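(* Let $\xi\in S^1\subset\mathbb{R}^2$ be a given unit vector. Let $a\in\mathcal{M}(\mathbb{R}^2)$ be such that $$\lim_{h\to0}\|a(\cdot+h\xi)-a\|_{\mathcal{M}}=0 .$$ Then there exists a sequence $(b_k)_k$ in $L^1\cap L^\infty(\mathbb{R}^2)$, converging towards $a$ in the vague topology, and such that the sequence of solutions $u_k(t):=S_tb_k$ of the two-dimensional Burgers equation converges boundedly almost everywhere on every compact subset of $(0,+\infty)\times\mathbb{R}^2$. The pointwise limit $u$ of $u_k$ is an entropy solution of the two-dimensional Burgers equation on $(0,+\infty)\times\mathbb{R}^2$, which satisfies the dispersion inequalities $$\|u(t)\|_1\le\|a\|_{\mathcal{M}},\qquad\|u(t)\|_\infty\le c_\infty t^{-1/2}\|a\|_{\mathcal{M}}^{1/4}\qquad(t>0).$$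
   Context: $\mathcal{M}(\mathbb{R}^2)$ is the space of bounded (signed, finite) Radon measures with total variation norm $\|\cdot\|_{\mathcal M}$; $a(\cdot+h\xi)$ is the translate of the measure $a$. Vague convergence is weak-star convergence tested against $C_c(\mathbb{R}^2)$. $\|\cdot\|_p$ is the norm of $L^p(\mathbb{R}^2)$. The two-dimensional Burgers equation is $$\partial_tu+\partial_1\frac{u^2}2+\partial_2\frac{u^3}3=0,\qquad t>0,\ x\in\mathbb{R}^2.$$ Write $f(u)=(u^2/2,u^3/3)$. For $b\in L^1\cap L^\infty(\mathbb{R}^2)$, $S_tb:=u(t)$ denotes Kruzhkov's semigroup, that is, $u\in L^\infty(\mathbb{R}_+\times\mathbb{R}^2)\cap C(\mathbb{R}_+;L^1(\mathbb{R}^2))$ is the unique admissible (Kruzhkov entropy) solution with initial data $b$. The constant $c_\infty<\infty$ is a fixed universal constant for which the known dispersive estimate (Serre–Silvestre) holds: $\|S_tb\|_\infty\le c_\infty t^{-1/2}\|b\|_1^{1/4}$ for all $t>0$ and all $b\in L^1\cap L^\infty(\mathbb{R}^2)$. An entropy solution on $(0,+\infty)\times\mathbb{R}^2$ is a function $u$, bounded on $(\tau,\infty)\times\mathbb{R}^2$ for every $\tau>0$, such that $$\int_0^\infty\int_{\mathbb{R}^2}(u\,\partial_t\phi+f(u)\cdot\nabla_x\phi)\,dx\,dt=0\quad\text{for all }\phi\in C_c^\infty((0,\infty)\times\mathbb{R}^2),$$ and $$\int_0^\infty\int_{\mathbb{R}^2}\big(|u-k|\,\partial_t\phi+\mathrm{sgn}(u-k)(f(u)-f(k))\cdot\nabla_x\phi\big)\,dx\,dt\ge0$$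 for all $k\in\mathbb{R}$ and all non-negative $\phi\in C_c^\infty((0,\infty)\times\mathbb{R}^2)$. (No initial condition is part of this notion.) "Boundedly almost everywhere" on a set means almost everywhere convergence with a uniform $L^\infty$ bound on that set. *)

theory Defs
  imports "HOL-Analysis.Analysis" "HOL-Probability.Essential_Supremum"
begin

section \<open>Finite signed measures on the plane\<close>

text \<open>A finite signed Borel measure is a countably additive real-valued set function on
  \<^term>\<open>sets borel\<close>; its values on other sets are irrelevant. On the plane every such measure is
  automatically a Radon measure, so no regularity condition is imposed.\<close>

type_synonym smeasure = "(real ^ 2) set \<Rightarrow> real"

definition signed_measure :: "smeasure \<Rightarrow> bool" where
  "signed_measure a \<longleftrightarrow>
     (\<forall>A :: nat \<Rightarrow> (real ^ 2) set. range A \<subseteq> sets borel \<longrightarrow> disjoint_family A \<longrightarrow>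
        (\<lambda>i. a (A i)) sums a (\<Union>i. A i))"

text \<open>The supremum below is over a bounded set of reals whenever \<^term>\<open>a\<close> is a signed measure.\<close>

definition variation :: "smeasure \<Rightarrow> smeasure" where
  "variation a E =
     (SUP P \<in> {P. finite P \<and> P \<subseteq> sets borel \<and> partition_on E P}. \<Sum>F\<in>P. \<bar>a F\<bar>)"

definition tv_norm :: "smeasure \<Rightarrow> real" where
  "tv_norm a = variation a UNIV"

text \<open>Jordan decomposition.\<close>

definition pos_part :: "smeasure \<Rightarrow> (real ^ 2) measure" where
  "pos_part a = measure_of UNIV (sets borel) (\<lambda>E. ennreal ((variation a E + a E) / 2))"

definition neg_part :: "smeasure \<Rightarrow> (real ^ 2) measure" where
  "neg_part a = measure_of UNIV (sets borel) (\<lambda>E. ennreal ((variation a E - a E) / 2))"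

definition sm_integral :: "smeasure \<Rightarrow> (real ^ 2 \<Rightarrow> real) \<Rightarrow> real" where
  "sm_integral a \<psi> = (LINT x|pos_part a. \<psi> x) - (LINT x|neg_part a. \<psi> x)"

text \<open>The measure \<open>a(\<cdot> + v)\<close>: if \<open>a\<close> has density \<open>g\<close>, then this one has density \<open>\<lambda>x. g (x + v)\<close>.\<close>

definition translate :: "real ^ 2 \<Rightarrow> smeasure \<Rightarrow> smeasure" where
  "translate v a E = a ((\<lambda>x. x + v) ` E)"

text \<open>Vague convergence of the measures \<open>b\<^sub>k dx\<close> towards \<open>a\<close>.\<close>

definition vague_limit :: "(nat \<Rightarrow> real ^ 2 \<Rightarrow> real) \<Rightarrow> smeasure \<Rightarrow> bool" where
  "vague_limit b a \<longleftrightarrow>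
     (\<forall>\<psi> :: real ^ 2 \<Rightarrow> real. continuous_on UNIV \<psi> \<longrightarrow> compact (closure {x. \<psi> x \<noteq> 0}) \<longrightarrow>
        (\<lambda>k. LINT x|lborel. \<psi> x * b k x) \<longlonglongrightarrow> sm_integral a \<psi>)"

section \<open>Lebesgue norms\<close>

text \<open>Elements of Lebesgue spaces are represented by Borel functions.\<close>

definition L1_norm :: "(real ^ 2 \<Rightarrow> real) \<Rightarrow> real" where
  "L1_norm b = (LINT x|lborel. \<bar>b x\<bar>)"

definition Linf_norm :: "(real ^ 2 \<Rightarrow> real) \<Rightarrow> ereal" where
  "Linf_norm b = esssup lborel (\<lambda>x. ereal \<bar>b x\<bar>)"

definition L1_Linf :: "(real ^ 2 \<Rightarrow> real) \<Rightarrow> bool" where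
  "L1_Linf b \<longleftrightarrow> integrable lborel b \<and> Linf_norm b < \<infinity>"

section \<open>Test functions\<close>

primrec C_k :: "nat \<Rightarrow> ('a::euclidean_space \<Rightarrow> real) \<Rightarrow> bool" where
  "C_k 0 \<phi> \<longleftrightarrow> continuous_on UNIV \<phi>"
| "C_k (Suc n) \<phi> \<longleftrightarrow> (\<forall>x. \<phi> differentiable (at x)) \<and>
     (\<forall>v. C_k n (\<lambda>x. frechet_derivative \<phi> (at x) v))"

text \<open>Test functions on an open set \<open>\<Omega>\<close>, extended by zero to the whole space.\<close>

definition test_function :: "'a::euclidean_space set \<Rightarrow> ('a \<Rightarrow> real) \<Rightarrow> bool" where
  "test_function \<Omega> \<phi> \<longleftrightarrow> (\<forall>n. C_k n \<phi>) \<and>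
     compact (closure {z. \<phi> z \<noteq> 0}) \<and> closure {z. \<phi> z \<noteq> 0} \<subseteq> \<Omega>"

definition dt :: "(real \<times> (real ^ 2) \<Rightarrow> real) \<Rightarrow> real \<times> (real ^ 2) \<Rightarrow> real" where
  "dt \<phi> z = frechet_derivative \<phi> (at z) (1, 0)"

definition grad_x :: "(real \<times> (real ^ 2) \<Rightarrow> real) \<Rightarrow> real \<times> (real ^ 2) \<Rightarrow> real ^ 2" where
  "grad_x \<phi> z = (\<chi> i. frechet_derivative \<phi> (at z) (0, axis i 1))"

section \<open>The Burgers equation\<close>

definition flux :: "real \<Rightarrow> real ^ 2" where
  "flux w = vector [w ^ 2 / 2, w ^ 3 / 3]"

abbreviation half_space :: "(real \<times> (real ^ 2)) set" where
  "half_space \<equiv> {0<..} \<times> UNIV"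

definition entropy_solution :: "(real \<Rightarrow> real ^ 2 \<Rightarrow> real) \<Rightarrow> bool" where
  "entropy_solution u \<longleftrightarrow>
     (\<lambda>(t, x). u t x) \<in> borel_measurable (restrict_space borel half_space) \<and>
     (\<forall>\<tau>>0. \<exists>C. AE (t, x) in lborel. t > \<tau> \<longrightarrow> \<bar>u t x\<bar> \<le> C) \<and>
     (\<forall>\<phi>. test_function half_space \<phi> \<longrightarrow>
        (LINT (t, x) : half_space | lborel.
           u t x * dt \<phi> (t, x) + flux (u t x) \<bullet> grad_x \<phi> (t, x)) = 0) \<and>
     (\<forall>k \<phi>. test_function half_space \<phi> \<longrightarrow> (\<forall>z. 0 \<le> \<phi> z) \<longrightarrow>
        (LINT (t, x) : half_space | lborel.
           \<bar>u t x - k\<bar> * dt \<phi> (t, x) +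
           sgn (u t x - k) * ((flux (u t x) - flux k) \<bullet> grad_x \<phi> (t, x))) \<ge> 0)"

text \<open>Admissible solutions with initial data \<open>b\<close>, in the class of essentially bounded functions that are
  continuous from \<open>[0, \<infinity>)\<close> to \<open>L\<^sup>1\<close>. The initial data are attained through this continuity.\<close>

definition kruzhkov_solution :: "(real ^ 2 \<Rightarrow> real) \<Rightarrow> (real \<Rightarrow> real ^ 2 \<Rightarrow> real) \<Rightarrow> bool" where
  "kruzhkov_solution b u \<longleftrightarrow>
     entropy_solution u \<and>
     (\<exists>C. AE (t, x) in lborel. t > 0 \<longrightarrow> \<bar>u t x\<bar> \<le> C) \<and>
     (\<forall>t\<ge>0. integrable lborel (u t)) \<and>
     (\<forall>t\<ge>0. ((\<lambda>s. L1_norm (\<lambda>x. u s x - u t x)) \<longlongrightarrow> 0) (at t within {0..})) \<and>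
     (AE x in lborel. u 0 x = b x)"

text \<open>\<open>S\<close> assigns to each \<open>b\<close> the unique admissible solution \<open>\<lambda>t. S t b\<close>; uniqueness is that of the
  \<open>L\<^sup>1\<close> class at every time.\<close>

definition kruzhkov_semigroup :: "(real \<Rightarrow> (real ^ 2 \<Rightarrow> real) \<Rightarrow> real ^ 2 \<Rightarrow> real) \<Rightarrow> bool" where
  "kruzhkov_semigroup S \<longleftrightarrow>
     (\<forall>b. L1_Linf b \<longrightarrow>
        kruzhkov_solution b (\<lambda>t. S t b) \<and>
        (\<forall>v. kruzhkov_solution b v \<longrightarrow> (\<forall>t\<ge>0. AE x in lborel. v t x = S t b x)))"

definition dispersive_constant ::
  "(real \<Rightarrow> (real ^ 2 \<Rightarrow> real) \<Rightarrow> real ^ 2 \<Rightarrow> real) \<Rightarrow> real \<Rightarrow> bool" where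
  "dispersive_constant S c \<longleftrightarrow>
     (\<forall>b t. L1_Linf b \<longrightarrow> t > 0 \<longrightarrow>
        Linf_norm (S t b) \<le> ereal (c * t powr (- 1 / 2) * L1_norm b powr (1 / 4)))"

definition boundedly_ae_on ::
  "(real \<times> (real ^ 2)) set \<Rightarrow> (nat \<Rightarrow> real \<Rightarrow> real ^ 2 \<Rightarrow> real) \<Rightarrow> (real \<Rightarrow> real ^ 2 \<Rightarrow> real) \<Rightarrow> bool" where
  "boundedly_ae_on K v u \<longleftrightarrow>
     (AE (t, x) in lborel. (t, x) \<in> K \<longrightarrow> (\<lambda>k. v k t x) \<longlonglongrightarrow> u t x) \<and>
     (\<exists>C. \<forall>k. AE (t, x) in lborel. (t, x) \<in> K \<longrightarrow> \<bar>v k t x\<bar> \<le> C)"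

end

theory Submission
  imports Defs "HOL-Computational_Algebra.Polynomial" "HOL-Library.Diagonal_Subsequence" "HOL-Complex_Analysis.Great_Picard"
begin

text \<open>The contraction of Kruzhkov's semigroup in \<open>L\<^sup>1\<close> commutes with translations, so the solutions with
  data \<open>b\<^sub>k\<close>, the averages of \<open>a\<close> over small balls, inherit the modulus of continuity of \<open>a\<close> in direction
  \<open>\<xi>\<close>, uniformly in \<open>k\<close> and \<open>t\<close>. For \<open>t > \<tau>\<close> they are also bounded uniformly, by dispersion. What remains is
  compactness in \<open>t\<close> and in the direction \<open>n\<close> orthogonal to \<open>\<xi>\<close>, where the equation behaves like a scalar law in
  one space variable. Let \<open>F = flux \<bullet> n\<close> and let \<open>q\<close> be a primitive of \<open>F'\<^sup>2\<close>. For the differences \<open>W\<close>, \<open>C\<close>, \<open>D\<close> of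
  \<open>u\<close>, \<open>F u\<close>, \<open>q u\<close> between two solutions one has \<open>W D - C\<^sup>2 \<ge> c \<bar>W\<bar>\<^sup>6\<close>, while the div-curl argument of Tartar
  bounds the integral of \<open>W D - C\<^sup>2\<close>: averaging along \<open>\<xi>\<close> over a length \<open>h\<close> makes the \<open>\<xi>\<close>-derivative harmless,
  averaging along \<open>t\<close> and \<open>n\<close> over a length \<open>d\<close> much smaller than \<open>h\<close> gives an approximate potential for the
  field \<open>(W, C)\<close> of size \<open>d\<close>, and the entropy production of \<open>F\<close> is a bounded measure. The error terms are averages
  of \<open>W\<close> and \<open>C\<close>, which are Lipschitz and hence precompact.\<close>

section \<open>Signed measures\<close>

text \<open>The data have a uniform modulus of continuity in one direction only, so no compactness
  criterion for translations applies to the solutions by itself; nonlinearity has to supply the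
  other direction. On the interval between two values, \<open>W D - C\<^sup>2\<close> is
  \<open>W\<^sup>2\<close> times the variance of \<open>F'\<close>. Since the two components of the
  flux have different degrees, \<open>F'\<close> is a nonconstant polynomial of degree at most two
  for every unit vector \<open>n\<close>; this rules out degenerate directions and explains the
  sixth power. Choosing \<open>F\<close> itself as the entropy makes its time component the normal
  flux of the equation, which is what produces the determinant. Two approximate solutions are
  compared with each other, rather than with a Young measure, so the estimate directly yields Cauchy
  sequences in the local mean. The bounds on the potential require both \<open>d\<close> and
  \<open>d / h\<close> to be small, whence \<open>d = h\<^sup>2\<close>; the scale is fixed before
  the indices of the sequence grow. A second obstacle is that the norms of the limit are to be
  bounded at every positive time, while convergence is obtained almost everywhere in
  space-time.\<close>

lemma signed_measure_sums:
  assumes "signed_measure a" "range A \<subseteq> sets borel" "disjoint_family A"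
  shows "(\<lambda>i::nat. a (A i)) sums a (\<Union>i. A i)"
  using assms unfolding signed_measure_def by blast

lemma signed_measure_empty:
  assumes "signed_measure a"
  shows "a {} = 0"
proof -
  have "(\<lambda>i::nat. a {}) sums a (\<Union>i::nat. {})"
    by (rule signed_measure_sums[OF assms]) (auto simp: disjoint_family_on_def)
  then have "(\<lambda>i::nat. a {}) \<longlonglongrightarrow> 0" using sums_summable summable_LIMSEQ_zero by blast
  then show ?thesis by (simp add: LIMSEQ_const_iff)
qed

lemma signed_measure_Un:
  assumes a: "signed_measure a" and [measurable]: "X \<in> sets borel" "Y \<in> sets borel"
    and "X \<inter> Y = {}"
  shows "a (X \<union> Y) = a X + a Y"
proof -
  define A :: "nat \<Rightarrow> (real ^ 2) set" where "A i = (if i = 0 then X else if i = 1 then Y else {})" for i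
  have "(\<lambda>i. a (A i)) sums a (\<Union>i. A i)"
    using assms(4)
    by (intro signed_measure_sums[OF a]) (auto simp: A_def disjoint_family_on_def)
  moreover have "(\<Union>i. A i) = X \<union> Y"
    unfolding A_def by (auto split: if_splits)
  moreover have "(\<lambda>i. a (A i)) sums (\<Sum>i\<in>{0,1}. a (A i))"
    by (rule sums_finite) (auto simp: A_def signed_measure_empty[OF a])
  ultimately have "a (X \<union> Y) = (\<Sum>i\<in>{0,1::nat}. a (A i))"
    by (metis sums_unique2)
  then show ?thesis by (simp add: A_def)
qed

lemma signed_measure_Diff:
  assumes a: "signed_measure a" and [measurable]: "X \<in> sets borel" "Y \<in> sets borel"
    and "Y \<subseteq> X"
  shows "a (X - Y) = a X - a Y"
proof -
  have "a ((X - Y) \<union> Y) = a (X - Y) + a Y"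
    by (rule signed_measure_Un[OF a]) auto
  moreover have "(X - Y) \<union> Y = X" using assms(4) by auto
  ultimately show ?thesis by simp
qed

section \<open>Hahn and Jordan decompositions\<close>

definition positive_set :: "smeasure \<Rightarrow> (real ^ 2) set \<Rightarrow> bool" where
  "positive_set a P \<longleftrightarrow> P \<in> sets borel \<and> (\<forall>B\<in>sets borel. B \<subseteq> P \<longrightarrow> 0 \<le> a B)"

text \<open>Greedy removal of almost maximally negative pieces from \<open>E\<close>.\<close>

lemma positive_subset:
  assumes a: "signed_measure a" and E: "E \<in> sets borel"
  obtains P where "positive_set a P" "P \<subseteq> E" "a E \<le> a P"
proof -
  \<comment> \<open>It is not known yet that \<open>a\<close> is bounded below on subsets of
    \<open>X\<close>. Either some piece has value at most -1 and is taken, or the infimum is finite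
    and a piece reaching half of it exists.\<close>
  have ex: "\<exists>B\<in>sets borel. B \<subseteq> X \<and> a B \<le> 0 \<and> (a B \<le> -1 \<or> (\<forall>C\<in>sets borel. C \<subseteq> X \<longrightarrow> 2 * a B \<le> a C))"
    for X :: "(real ^ 2) set"
  proof (cases "\<exists>B\<in>sets borel. B \<subseteq> X \<and> a B \<le> -1")
    case True
    then obtain B where B: "B \<in> sets borel" "B \<subseteq> X" "a B \<le> -1" by blast
    then show ?thesis by (intro bexI[of _ B]) auto
  next
    case False
    define V where "V = {a C |C. C \<in> sets borel \<and> C \<subseteq> X}"
    have V0: "0 \<in> V" unfolding V_def using signed_measure_empty[OF a] by force
    have bV: "bdd_below V"
    proof (rule bdd_belowI[of _ "-1"])
      fix v assume "v \<in> V"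
      then obtain C where "C \<in> sets borel" "C \<subseteq> X" "v = a C" unfolding V_def by blast
      then have "\<not> a C \<le> -1" using False by blast
      then show "-1 \<le> v" using \<open>v = a C\<close> by simp
    qed
    have InfV: "Inf V \<le> 0" using cInf_lower[OF V0 bV] .
    show ?thesis
    proof (cases "Inf V = 0")
      case True
      then have "0 \<le> a C" if "C \<in> sets borel" "C \<subseteq> X" for C
        using cInf_lower[of "a C" V] bV that by (auto simp: V_def)
      then show ?thesis using signed_measure_empty[OF a] by (intro bexI[of _ "{}"]) auto
    next
      case F: False
      then have "Inf V < Inf V / 2" using InfV by simp
      then obtain v where "v \<in> V" "v < Inf V / 2" using cInf_lessD[of V] V0 by blast
      then obtain B where B: "B \<in> sets borel" "B \<subseteq> X" "a B < Inf V / 2" by (auto simp: V_def)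
      have "2 * a B \<le> a C" if "C \<in> sets borel" "C \<subseteq> X" for C
      proof -
        have "Inf V \<le> a C" using cInf_lower[of "a C" V] bV that by (auto simp: V_def)
        then show ?thesis using B by simp
      qed
      then show ?thesis using B InfV by (intro bexI[of _ B]) auto
    qed
  qed
  define ch where "ch X = (SOME B. B \<in> sets borel \<and> B \<subseteq> X \<and> a B \<le> 0 \<and>
      (a B \<le> -1 \<or> (\<forall>C\<in>sets borel. C \<subseteq> X \<longrightarrow> 2 * a B \<le> a C)))" for X
  have ch: "ch X \<in> sets borel" "ch X \<subseteq> X" "a (ch X) \<le> 0"
      "a (ch X) \<le> -1 \<or> (\<forall>C\<in>sets borel. C \<subseteq> X \<longrightarrow> 2 * a (ch X) \<le> a C)" for X
    using someI_ex[of "\<lambda>B. B \<in> sets borel \<and> B \<subseteq> X \<and> a B \<le> 0 \<and>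
      (a B \<le> -1 \<or> (\<forall>C\<in>sets borel. C \<subseteq> X \<longrightarrow> 2 * a B \<le> a C))"] ex[of X]
    unfolding ch_def by blast+
  define X where "X = rec_nat E (\<lambda>_ Y. Y - ch Y)"
  have X0: "X 0 = E" and XS: "X (Suc n) = X n - ch (X n)" for n by (simp_all add: X_def)
  have Xdec: "X (n + m) \<subseteq> X n" for n m by (induction m) (auto simp: XS)
  have dis: "ch (X m) \<inter> ch (X n) = {}" if "m < n" for m n
  proof -
    have "ch (X n) \<subseteq> X (Suc m)" using ch(2)[of "X n"] Xdec[of "Suc m" "n - Suc m"] that by auto
    then show ?thesis by (auto simp: XS)
  qed
  have df: "disjoint_family (\<lambda>n. ch (X n))"
    unfolding disjoint_family_on_def
  proof (intro ballI impI)
    fix m n :: nat assume "m \<noteq> n"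
    then have "m < n \<or> n < m" by auto
    then show "ch (X m) \<inter> ch (X n) = {}" using dis[of m n] dis[of n m] by auto
  qed
  have su: "(\<lambda>n. a (ch (X n))) sums a (\<Union>n. ch (X n))"
    by (rule signed_measure_sums[OF a _ df]) (auto simp: ch)
  define P where "P = E - (\<Union>n. ch (X n))"
  have sub: "(\<Union>n. ch (X n)) \<subseteq> E"
    using ch(2) Xdec[of 0] X0 by (auto simp: subset_iff)
  have Un: "(\<Union>n. ch (X n)) \<in> sets borel" using ch(1) by auto
  have aP: "a P = a E - a (\<Union>n. ch (X n))"
    unfolding P_def by (rule signed_measure_Diff[OF a E Un sub])
  have "a (\<Union>n. ch (X n)) \<le> 0"
    using sums_le[OF _ su sums_zero] ch(3) by auto
  then have ge: "a E \<le> a P" using aP by simp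
  have PX: "P \<subseteq> X n" for n
    by (induction n) (auto simp: P_def X0 XS)
  have lim: "(\<lambda>n. a (ch (X n))) \<longlonglongrightarrow> 0" using su sums_summable summable_LIMSEQ_zero by blast
  \<comment> \<open>The removed values form a convergent series and hence tend to 0. From some index
    on they exceed -1, so the alternative with the factor 2 holds and bounds \<open>a B\<close>
    below by a null sequence.\<close>
  have "0 \<le> a B" if B: "B \<in> sets borel" "B \<subseteq> P" for B
  proof -
    have "eventually (\<lambda>n. a (ch (X n)) > -1) sequentially"
      using order_tendstoD(1)[OF lim, of "-1"] by simp
    then have "eventually (\<lambda>n. 2 * a (ch (X n)) \<le> a B) sequentially"
    proof eventually_elim
      case (elim n)
      then show ?case using ch(4)[of "X n"] B PX[of n] by force
    qed
    moreover have "(\<lambda>n. 2 * a (ch (X n))) \<longlonglongrightarrow> 2 * 0" by (intro tendsto_intros lim)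
    ultimately show ?thesis
      using tendsto_upperbound[of "\<lambda>n. 2 * a (ch (X n))" "2 * 0" sequentially "a B"] by simp
  qed
  moreover have "P \<in> sets borel" unfolding P_def using E Un by auto
  ultimately have "positive_set a P" by (auto simp: positive_set_def)
  then show ?thesis using that ge by (auto simp: P_def)
qed

lemma positive_set_mono:
  assumes a: "signed_measure a" and "positive_set a P" "Q \<subseteq> P" "Q \<in> sets borel"
  shows "positive_set a Q" "a Q \<le> a P"
proof -
  show "positive_set a Q" using assms by (auto simp: positive_set_def)
  have "a (P - Q) = a P - a Q"
    using signed_measure_Diff[OF a, of P Q] assms by (auto simp: positive_set_def)
  moreover have "0 \<le> a (P - Q)" using assms by (auto simp: positive_set_def)
  ultimately show "a Q \<le> a P" by simp
qed

text \<open>Cutting a subset of the union along the disjointed sets writes its value as a series of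
  nonnegative terms.\<close>

lemma positive_set_Un:
  fixes P :: "nat \<Rightarrow> (real ^ 2) set"
  assumes a: "signed_measure a" and P: "\<And>n. positive_set a (P n)"
  shows "positive_set a (\<Union>n. P n)"
proof -
  have Pb: "P n \<in> sets borel" for n using P by (auto simp: positive_set_def)
  have "0 \<le> a B" if B: "B \<in> sets borel" "B \<subseteq> (\<Union>n. P n)" for B
  proof -
    have "(\<lambda>n. a (B \<inter> disjointed P n)) sums a (\<Union>n. B \<inter> disjointed P n)"
    proof (rule signed_measure_sums[OF a])
      show "range (\<lambda>n. B \<inter> disjointed P n) \<subseteq> sets borel"
        using sets.range_disjointed_sets[of P borel] Pb B by (auto simp: image_subset_iff)
      show "disjoint_family (\<lambda>n. B \<inter> disjointed P n)"
        using disjoint_family_disjointed[of P] unfolding disjoint_family_on_def by blast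
    qed
    moreover have "(\<Union>n. B \<inter> disjointed P n) = B" using B UN_disjointed_eq[of P] by blast
    moreover have "0 \<le> a (B \<inter> disjointed P n)" for n
    proof -
      have "disjointed P n \<in> sets borel"
        using sets.range_disjointed_sets[of P borel] Pb by (auto simp: image_subset_iff)
      then show ?thesis
        using P[of n] B disjointed_subset[of P n] unfolding positive_set_def
        by (meson le_infI2 sets.Int)
    qed
    ultimately show ?thesis using sums_le[OF _ sums_zero] by metis
  qed
  then show ?thesis using Pb by (auto simp: positive_set_def)
qed

text \<open>A union of positive sets whose values approach the supremum is a positive set of maximal
  value. A set of positive value outside it would contain a positive set of positive value, and
  adding that set would exceed the maximum.\<close>

lemma Hahn_decomposition:
  assumes a: "signed_measure a"
  obtains P where "P \<in> sets borel" "\<And>B. B \<in> sets borel \<Longrightarrow> B \<subseteq> P \<Longrightarrow> 0 \<le> a B"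
    "\<And>B. B \<in> sets borel \<Longrightarrow> B \<inter> P = {} \<Longrightarrow> a B \<le> 0"
proof -
  define V where "V = {a P |P. positive_set a P}"
  have V0: "0 \<in> V" using signed_measure_empty[OF a] by (force simp: V_def positive_set_def)
  \<comment> \<open>If the values were unbounded, the union of positive sets with values above
    \<open>n\<close> would be a positive set whose real value exceeds every
    \<open>n\<close>.\<close>
  have bV: "bdd_above V"
  proof (rule ccontr)
    assume "\<not> bdd_above V"
    then have "\<forall>n::nat. \<exists>P. positive_set a P \<and> real n < a P"
      unfolding bdd_above_def V_def by (force simp: not_le)
    then obtain P where P: "\<And>n. positive_set a (P n)" "\<And>n::nat. real n < a (P n)" by metis
    have "real n < a (\<Union>n. P n)" for n
    proof -
      have "P n \<in> sets borel" using P(1) by (simp add: positive_set_def)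
      then have "a (P n) \<le> a (\<Union>n. P n)"
        by (intro positive_set_mono(2)[OF a positive_set_Un[OF a P(1)]]) auto
      then show ?thesis using P(2)[of n] by simp
    qed
    then show False using reals_Archimedean2 less_asym by metis
  qed
  have "\<exists>P. positive_set a P \<and> Sup V - 1 / real (Suc n) < a P" for n
    using less_cSupD[of V "Sup V - 1 / real (Suc n)"] V0 by (force simp: V_def)
  then obtain P where P: "\<And>n. positive_set a (P n)" "\<And>n. Sup V - 1 / real (Suc n) < a (P n)" by metis
  define Q where "Q = (\<Union>n. P n)"
  have Q: "positive_set a Q" unfolding Q_def by (rule positive_set_Un[OF a P(1)])
  have ge: "Sup V - 1 / real (Suc n) < a Q" for n
    using P(2)[of n] positive_set_mono(2)[OF a Q, of "P n"] P(1)[of n] unfolding Q_def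
    by (force simp: positive_set_def)
  have "Sup V \<le> a Q"
  proof (rule ccontr)
    assume "\<not> Sup V \<le> a Q"
    then obtain n where "1 / real (Suc n) < Sup V - a Q"
      using nat_approx_posE[of "Sup V - a Q"] by auto
    then show False using ge[of n] by simp
  qed
  have "a B \<le> 0" if B: "B \<in> sets borel" "B \<inter> Q = {}" for B
  proof (rule ccontr)
    assume n: "\<not> a B \<le> 0"
    obtain R where R: "positive_set a R" "R \<subseteq> B" "a B \<le> a R" using positive_subset[OF a B(1)] .
    have "positive_set a (\<Union>n::nat. if n = 0 then Q else R)"
      by (rule positive_set_Un[OF a]) (auto simp: Q R)
    moreover have "(\<Union>n::nat. if n = 0 then Q else R) = Q \<union> R"
      by (auto split: if_splits)
    ultimately have "positive_set a (Q \<union> R)" by simp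
    then have "a (Q \<union> R) \<in> V" by (auto simp: V_def)
    then have "a (Q \<union> R) \<le> Sup V" using bV by (rule cSup_upper)
    moreover have "a (Q \<union> R) = a Q + a R"
      using Q R B by (intro signed_measure_Un[OF a]) (auto simp: positive_set_def)
    ultimately show False using n R \<open>Sup V \<le> a Q\<close> by simp
  qed
  then show ?thesis using that Q by (auto simp: positive_set_def)
qed

text \<open>Nonnegativity on subsets of \<open>P\<close> is what makes the passage to
  \<open>ennreal\<close> additive, since negative values would be cut to 0.\<close>

lemma set_function_emeasure:
  assumes a: "signed_measure a" and P: "P \<in> sets borel" "\<And>B. B \<in> sets borel \<Longrightarrow> B \<subseteq> P \<Longrightarrow> 0 \<le> a B"
  defines "\<mu> \<equiv> measure_of UNIV (sets borel) (\<lambda>E. ennreal (a (E \<inter> P)))"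
  shows "sets \<mu> = sets borel" "E \<in> sets borel \<Longrightarrow> emeasure \<mu> E = ennreal (a (E \<inter> P))"
proof -
  show 1: "sets \<mu> = sets borel" unfolding \<mu>_def by (metis sets.sets_measure_of_eq space_borel)
  show "emeasure \<mu> E = ennreal (a (E \<inter> P))" if "E \<in> sets borel"
  proof (rule emeasure_measure_of[OF \<mu>_def[THEN meta_eq_to_obj_eq]])
    show "positive (sets \<mu>) (\<lambda>E. ennreal (a (E \<inter> P)))"
      using signed_measure_empty[OF a] by (simp add: positive_def)
    show "countably_additive (sets \<mu>) (\<lambda>E. ennreal (a (E \<inter> P)))"
      unfolding countably_additive_def 1
    proof (intro allI impI)
      fix A :: "nat \<Rightarrow> (real ^ 2) set"
      assume A: "range A \<subseteq> sets borel" "disjoint_family A"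
      have "(\<lambda>i. a (A i \<inter> P)) sums a (\<Union>i. A i \<inter> P)"
        using A P by (intro signed_measure_sums[OF a]) (auto simp: disjoint_family_on_def)
      moreover have "(\<Union>i. A i \<inter> P) = (\<Union>i. A i) \<inter> P" by auto
      ultimately have s: "(\<lambda>i. a (A i \<inter> P)) sums a ((\<Union>i. A i) \<inter> P)" by simp
      have nn: "0 \<le> a (A i \<inter> P)" for i using A P by auto
      then have "(\<Sum>i. ennreal (a (A i \<inter> P))) = ennreal (\<Sum>i. a (A i \<inter> P))"
        using sums_summable[OF s] by (intro suminf_ennreal2) auto
      then show "(\<Sum>i. ennreal (a (A i \<inter> P))) = ennreal (a ((\<Union>i. A i) \<inter> P))"
        using s by (simp add: sums_iff)
    qed
  qed (use that 1 in auto)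
qed

text \<open>The two measures are \<open>a\<close> on a Hahn set and \<open>- a\<close> on its
  complement. Splitting a set along the Hahn set attains the supremum that defines
  \<open>variation\<close>, and every other partition is dominated by additivity of the two
  measures.\<close>

lemma Jordan_decomposition:
  assumes a: "signed_measure a"
  obtains p n where "finite_measure p" "finite_measure n" "sets p = sets borel" "sets n = sets borel"
    "\<And>E. E \<in> sets borel \<Longrightarrow> a E = measure p E - measure n E"
    "\<And>E. E \<in> sets borel \<Longrightarrow> variation a E = measure p E + measure n E"
proof -
  obtain P where P: "P \<in> sets borel" "\<And>B. B \<in> sets borel \<Longrightarrow> B \<subseteq> P \<Longrightarrow> 0 \<le> a B"
    "\<And>B. B \<in> sets borel \<Longrightarrow> B \<inter> P = {} \<Longrightarrow> a B \<le> 0"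
    using Hahn_decomposition[OF a] by blast
  have a': "signed_measure (\<lambda>E. - a E)"
    using a unfolding signed_measure_def by (auto intro!: sums_minus)
  define p where "p = measure_of UNIV (sets borel) (\<lambda>E. ennreal (a (E \<inter> P)))"
  define n where "n = measure_of UNIV (sets borel) (\<lambda>E. ennreal (- a (E \<inter> - P)))"
  have p: "sets p = sets borel" "\<And>E. E \<in> sets borel \<Longrightarrow> emeasure p E = ennreal (a (E \<inter> P))"
    using set_function_emeasure[OF a P(1)] P(2) by (auto simp: p_def)
  have nP: "0 \<le> - a B" if "B \<in> sets borel" "B \<subseteq> - P" for B using P(3)[of B] that by auto
  have n: "sets n = sets borel" "\<And>E. E \<in> sets borel \<Longrightarrow> emeasure n E = ennreal (- a (E \<inter> - P))"
    using set_function_emeasure[OF a', of "- P"] P(1) nP by (auto simp: n_def)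
  have mp: "measure p E = a (E \<inter> P)" if "E \<in> sets borel" for E
    using p(2)[OF that] P(1) P(2)[of "E \<inter> P"] that by (simp add: measure_def)
  have mn: "measure n E = - a (E \<inter> - P)" if "E \<in> sets borel" for E
    using n(2)[OF that] P(1) nP[of "E \<inter> - P"] that by (simp add: measure_def)
  have fp: "finite_measure p"
    using p by (intro finite_measureI) (simp add: sets_eq_imp_space_eq[OF p(1)])
  have fn: "finite_measure n"
    using n by (intro finite_measureI) (simp add: sets_eq_imp_space_eq[OF n(1)])
  interpret p: finite_measure p by fact
  interpret n: finite_measure n by fact
  have aE: "a E = measure p E - measure n E" if E: "E \<in> sets borel" for E
  proof -
    have "a ((E \<inter> P) \<union> (E \<inter> - P)) = a (E \<inter> P) + a (E \<inter> - P)"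
      using E P by (intro signed_measure_Un[OF a]) auto
    moreover have "(E \<inter> P) \<union> (E \<inter> - P) = E" by auto
    ultimately show ?thesis using mp[OF E] mn[OF E] by simp
  qed
  have vE: "variation a E = measure p E + measure n E" if E: "E \<in> sets borel" for E
    unfolding variation_def
  proof (rule cSup_eq_maximum)
    let ?Q = "{E \<inter> P, E \<inter> - P} - {{}}"
    have "?Q \<in> {P. finite P \<and> P \<subseteq> sets borel \<and> partition_on E P}"
    proof -
      have "E \<inter> P \<in> sets borel" "E \<inter> - P \<in> sets borel" using E P(1) by auto
      then have "?Q \<subseteq> sets borel" by blast
      moreover have "partition_on E ?Q" unfolding partition_on_def disjoint_def by auto
      ultimately show ?thesis by simp
    qed
    moreover have "(\<Sum>F\<in>?Q. \<bar>a F\<bar>) = measure p E + measure n E"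
    proof -
      have "(\<Sum>F\<in>?Q. \<bar>a F\<bar>) = (\<Sum>F\<in>{E \<inter> P, E \<inter> - P}. \<bar>a F\<bar>)"
        by (rule sum.mono_neutral_left) (auto simp: signed_measure_empty[OF a])
      \<comment> \<open>The sum runs over a set of blocks, so equal blocks would be counted once;
        two disjoint blocks can only coincide when both are empty.\<close>
      also have "\<dots> = \<bar>a (E \<inter> P)\<bar> + \<bar>a (E \<inter> - P)\<bar>"
      proof (cases "E \<inter> P = E \<inter> - P")
        case True
        then have "E \<inter> P = {}" "E \<inter> - P = {}" by auto
        then show ?thesis by (simp add: signed_measure_empty[OF a])
      qed simp
      also have "\<dots> = measure p E + measure n E"
        using mp[OF E] mn[OF E] E P(1) P(2)[of "E \<inter> P"] nP[of "E \<inter> - P"] by simp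
      finally show ?thesis .
    qed
    ultimately show "measure p E + measure n E \<in> (\<lambda>P. \<Sum>F\<in>P. \<bar>a F\<bar>) ` {P. finite P \<and> P \<subseteq> sets borel \<and> partition_on E P}"
      by (metis (no_types, lifting) image_eqI)
  next
    fix v assume "v \<in> (\<lambda>P. \<Sum>F\<in>P. \<bar>a F\<bar>) ` {P. finite P \<and> P \<subseteq> sets borel \<and> partition_on E P}"
    then obtain R where R: "finite R" "R \<subseteq> sets borel" "partition_on E R" "v = (\<Sum>F\<in>R. \<bar>a F\<bar>)" by auto
    have dR: "disjoint_family_on (\<lambda>F. F) R"
      using R by (auto simp: partition_on_def disjoint_def disjoint_family_on_def)
    have UR: "\<Union>R = E" using R by (auto simp: partition_on_def)
    have "v \<le> (\<Sum>F\<in>R. measure p F + measure n F)"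
      unfolding R(4)
    proof (rule sum_mono)
      fix F assume "F \<in> R"
      then have "a F = measure p F - measure n F" using R(2) aE by blast
      then show "\<bar>a F\<bar> \<le> measure p F + measure n F"
        using measure_nonneg[of p F] measure_nonneg[of n F] by linarith
    qed
    also have "\<dots> = measure p (\<Union>F\<in>R. F) + measure n (\<Union>F\<in>R. F)"
      using R dR p(1) n(1)
      by (subst p.finite_measure_finite_Union, simp, simp, simp,
          subst n.finite_measure_finite_Union, simp, simp, simp, simp add: sum.distrib)
    also have "\<dots> = measure p E + measure n E" using UR by simp
    finally show "v \<le> measure p E + measure n E" .
  qed
  show ?thesis by (rule that[of p n]) (use fp fn p(1) n(1) aE vE in auto)
qed

text \<open>Half the sum and half the difference of \<open>variation a = p + n\<close> and
  \<open>a = p - n\<close> are \<open>p\<close> and \<open>n\<close>. This shows that the set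
  functions in the definitions are measures, so that \<open>measure_of\<close> returns them and not
  the default.\<close>

lemma pos_neg_part:
  assumes a: "signed_measure a"
  shows "finite_measure (pos_part a)" "finite_measure (neg_part a)"
    "sets (pos_part a) = sets borel" "sets (neg_part a) = sets borel"
    "\<And>E. E \<in> sets borel \<Longrightarrow> a E = measure (pos_part a) E - measure (neg_part a) E"
    "tv_norm a = measure (pos_part a) UNIV + measure (neg_part a) UNIV"
proof -
  obtain p n where pn: "finite_measure p" "finite_measure n" "sets p = sets borel" "sets n = sets borel"
    "\<And>E. E \<in> sets borel \<Longrightarrow> a E = measure p E - measure n E"
    "\<And>E. E \<in> sets borel \<Longrightarrow> variation a E = measure p E + measure n E"
    by (rule Jordan_decomposition[OF a]) (rule that)
  interpret p: finite_measure p by fact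
  interpret n: finite_measure n by fact
  have "pos_part a = measure_of UNIV (sets borel) (\<lambda>E. emeasure p E)"
    unfolding pos_part_def
    using pn by (intro measure_of_eq) (auto simp: p.emeasure_eq_measure sets.sigma_sets_eq[of borel, simplified])
  also have "\<dots> = p"
    using measure_of_of_measure[of p] pn(3) by (simp add: sets_eq_imp_space_eq)
  finally have P: "pos_part a = p" .
  have "neg_part a = measure_of UNIV (sets borel) (\<lambda>E. emeasure n E)"
    unfolding neg_part_def
    using pn by (intro measure_of_eq) (auto simp: n.emeasure_eq_measure sets.sigma_sets_eq[of borel, simplified])
  also have "\<dots> = n"
    using measure_of_of_measure[of n] pn(4) by (simp add: sets_eq_imp_space_eq)
  finally have N: "neg_part a = n" .
  show "finite_measure (pos_part a)" "finite_measure (neg_part a)"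
    "sets (pos_part a) = sets borel" "sets (neg_part a) = sets borel"
    "\<And>E. E \<in> sets borel \<Longrightarrow> a E = measure (pos_part a) E - measure (neg_part a) E"
    "tv_norm a = measure (pos_part a) UNIV + measure (neg_part a) UNIV"
    using pn by (auto simp: P N tv_norm_def)
qed

section \<open>Translations and averages of measures\<close>

lemma lborel_distr_shift:
  fixes c :: "'a::euclidean_space"
  shows "distr lborel borel (\<lambda>x. x + c) = lborel"
  using lborel_distr_plus[of c] by (simp add: add.commute[of _ c])

lemma lborel_distr_reflect:
  fixes c :: "'a::euclidean_space"
  shows "distr lborel borel (\<lambda>x. c - x) = lborel"
  using lborel_affine[of "-1" c] by (simp add: density_1)

lemma
  fixes f :: "'a::euclidean_space \<Rightarrow> 'b::{banach, second_countable_topology}"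
  assumes [measurable]: "f \<in> borel_measurable borel"
  shows lborel_integral_shift: "(LINT x|lborel. f (x + c)) = (LINT x|lborel. f x)"
    and lborel_integrable_shift: "integrable lborel (\<lambda>x. f (x + c)) \<longleftrightarrow> integrable lborel f"
    and lborel_integral_reflect: "(LINT x|lborel. f (c - x)) = (LINT x|lborel. f x)"
    and lborel_integrable_reflect: "integrable lborel (\<lambda>x. f (c - x)) \<longleftrightarrow> integrable lborel f"
proof -
  show "(LINT x|lborel. f (x + c)) = (LINT x|lborel. f x)"
    using integral_distr[of "\<lambda>x. x + c" lborel borel f] by (simp add: lborel_distr_shift)
  show "integrable lborel (\<lambda>x. f (x + c)) \<longleftrightarrow> integrable lborel f"
    using integrable_distr_eq[of "\<lambda>x. x + c" lborel borel f] by (simp add: lborel_distr_shift)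
  show "(LINT x|lborel. f (c - x)) = (LINT x|lborel. f x)"
    using integral_distr[of "\<lambda>x. c - x" lborel borel f] by (simp add: lborel_distr_reflect)
  show "integrable lborel (\<lambda>x. f (c - x)) \<longleftrightarrow> integrable lborel f"
    using integrable_distr_eq[of "\<lambda>x. c - x" lborel borel f] by (simp add: lborel_distr_reflect)
qed

lemma
  fixes c :: "'a::euclidean_space"
  assumes "AE x in lborel. P x"
  shows AE_lborel_shift: "AE x in lborel. P (x + c)"
    and AE_lborel_reflect: "AE x in lborel. P (c - x)"
proof -
  show "AE x in lborel. P (x + c)"
    by (rule AE_distrD[of "\<lambda>x. x + c" lborel borel P]) (simp, simp only: lborel_distr_shift assms)
  show "AE x in lborel. P (c - x)"
    by (rule AE_distrD[of "\<lambda>x. c - x" lborel borel P]) (simp, simp only: lborel_distr_reflect assms)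
qed

text \<open>At distance below 1, either both points lie in the ball of radius \<open>R + 1\<close>,
  where compactness applies, or both lie outside \<open>K\<close> and the values agree.\<close>

lemma uniformly_continuous_compact_support:
  fixes f :: "'a::heine_borel \<Rightarrow> 'b::metric_space"
  assumes c: "continuous_on UNIV f" and K: "compact K" and z: "\<And>x. x \<notin> K \<Longrightarrow> f x = z"
  shows "uniformly_continuous_on UNIV f"
proof -
  obtain x0 R where R: "K \<subseteq> cball x0 R" using compact_imp_bounded[OF K] unfolding bounded_def by (auto simp: subset_iff)
  have u: "uniformly_continuous_on (cball x0 (R + 1)) f"
    by (rule compact_uniformly_continuous[OF continuous_on_subset[OF c]]) auto
  show ?thesis
    unfolding uniformly_continuous_on_def
  proof (intro allI impI)
    fix e :: real assume "0 < e"
    then obtain d where d: "d > 0"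
      "\<And>x y. x \<in> cball x0 (R + 1) \<Longrightarrow> y \<in> cball x0 (R + 1) \<Longrightarrow> dist y x < d \<Longrightarrow> dist (f y) (f x) < e"
      using u unfolding uniformly_continuous_on_def by metis
    have "dist (f y) (f x) < e" if "dist y x < min d 1" for x y
    proof (cases "x \<in> cball x0 R \<or> y \<in> cball x0 R")
      case True
      have "dist x0 x \<le> dist x0 y + dist y x" "dist x0 y \<le> dist x0 x + dist y x"
        using dist_triangle[of x0 x y] dist_triangle[of x0 y x] by (simp_all add: dist_commute)
      then have "x \<in> cball x0 (R + 1)" "y \<in> cball x0 (R + 1)" using True that by auto
      then show ?thesis using d(2) that by auto
    next
      case False
      then have "x \<notin> K" "y \<notin> K" using R by auto
      then show ?thesis using z \<open>0 < e\<close> by simp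
    qed
    then show "\<exists>d>0. \<forall>x\<in>UNIV. \<forall>x'\<in>UNIV. dist x' x < d \<longrightarrow> dist (f x') (f x) < e"
      using d(1) by (intro exI[of _ "min d 1"]) auto
  qed
qed

lemma nn_integral_lborel_reflect:
  fixes f :: "'a::euclidean_space \<Rightarrow> ennreal"
  assumes [measurable]: "f \<in> borel_measurable borel"
  shows "(\<integral>\<^sup>+x. f (c - x) \<partial>lborel) = (\<integral>\<^sup>+x. f x \<partial>lborel)"
  using nn_integral_distr[of "\<lambda>x. c - x" lborel borel f] by (simp add: lborel_distr_reflect)

text \<open>For an open set the one-sided difference of the shifted indicators tends to zero pointwise,
  and both signs of the difference have the same integral.\<close>

lemma open_shift_tendsto:
  fixes U :: "'a::euclidean_space set"
  assumes U: "open U" "emeasure lborel U < \<infinity>" and c: "c \<longlonglongrightarrow> 0"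
  shows "(\<lambda>n. LINT x|lborel. \<bar>indicator U (x + c n) - indicator U x :: real\<bar>) \<longlonglongrightarrow> 0"
proof -
  have [measurable]: "U \<in> sets borel" using U by auto
  have i: "integrable lborel (indicator U :: 'a \<Rightarrow> real)" using U by (intro integrable_real_indicator) auto
  have ic: "integrable lborel (\<lambda>x. indicator U (x + d) :: real)" for d
    using i by (simp add: lborel_integrable_shift)
  have eq: "(LINT x|lborel. \<bar>indicator U (x + d) - indicator U x :: real\<bar>) =
      2 * (LINT x|lborel. indicator U x * (1 - indicator U (x + d)))" for d
  proof -
    have "(LINT x|lborel. \<bar>indicator U (x + d) - indicator U x :: real\<bar>) =
      (LINT x|lborel. (indicator U (x + d) - indicator U x) + 2 * (indicator U x * (1 - indicator U (x + d))))"
      by (rule Bochner_Integration.integral_cong) (auto simp: indicator_def)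
    also have "\<dots> = (LINT x|lborel. (indicator U (x + d) - indicator U x)) +
        (LINT x|lborel. 2 * (indicator U x * (1 - indicator U (x + d))))"
    proof (rule Bochner_Integration.integral_add)
      have "integrable lborel (\<lambda>x. indicator U x * (1 - indicator U (x + d)) :: real)"
        by (rule Bochner_Integration.integrable_bound[OF i]) (auto simp: indicator_def)
      then show "integrable lborel (\<lambda>x. 2 * (indicator U x * (1 - indicator U (x + d))) :: real)" by simp
    qed (use i ic in simp)
    also have "(LINT x|lborel. (indicator U (x + d) - indicator U x :: real)) = 0"
      using i ic lborel_integral_shift[of "indicator U :: 'a \<Rightarrow> real" d] by simp
    finally show ?thesis by simp
  qed
  have "(\<lambda>n. LINT x|lborel. indicator U x * (1 - indicator U (x + c n)) :: real) \<longlonglongrightarrow> (LINT x|(lborel :: 'a measure). (0::real))"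
  proof (rule integral_dominated_convergence[of "\<lambda>_. 0" lborel "\<lambda>n x. indicator U x * (1 - indicator U (x + c n))" "indicator U :: 'a \<Rightarrow> real"])
    show "AE x in lborel. (\<lambda>n. indicator U x * (1 - indicator U (x + c n)) :: real) \<longlonglongrightarrow> 0"
    proof (rule AE_I2)
      fix x :: 'a
      show "(\<lambda>n. indicator U x * (1 - indicator U (x + c n)) :: real) \<longlonglongrightarrow> 0"
      proof (cases "x \<in> U")
        case True
        have "(\<lambda>n. x + c n) \<longlonglongrightarrow> x + 0" by (intro tendsto_intros c)
        then have "eventually (\<lambda>n. x + c n \<in> U) sequentially"
          using topological_tendstoD[of "\<lambda>n. x + c n" x sequentially U] U True by simp
        then have "eventually (\<lambda>n. indicator U x * (1 - indicator U (x + c n)) = (0::real)) sequentially"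
          by eventually_elim auto
        then show ?thesis by (rule tendsto_eventually)
      qed auto
    qed
  qed (use i in \<open>auto simp: indicator_def\<close>)
  then have "(\<lambda>n. 2 * (LINT x|lborel. indicator U x * (1 - indicator U (x + c n)) :: real)) \<longlonglongrightarrow> 2 * 0"
    by (intro tendsto_intros) simp
  then show ?thesis by (simp add: eq)
qed

text \<open>Continuity of translations in the mean, by induction over integrable functions. An
  indicator is compared with that of an open superset, which outer regularity makes close to it in
  measure.\<close>

lemma L1_shift_tendsto:
  fixes f :: "'a::euclidean_space \<Rightarrow> real"
  assumes "integrable lborel f" and c: "c \<longlonglongrightarrow> 0"
  shows "(\<lambda>n. LINT x|lborel. \<bar>f (x + c n) - f x\<bar>) \<longlonglongrightarrow> 0"
  using assms(1)
proof (induction rule: integrable_induct)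
  case (base A r)
  show ?case
  proof (rule LIMSEQ_I)
    fix e :: real assume "0 < e"
    \<comment> \<open>Three errors of size \<open>e'\<close> occur; the factor 4 leaves room for a
      strict inequality and the summand 1 covers \<open>r = 0\<close>.\<close>
    define e' where "e' = e / (4 * (\<bar>r\<bar> + 1))"
    have e': "0 < e'" using \<open>0 < e\<close> by (simp add: e'_def)
    have [measurable]: "A \<in> sets borel" using base by simp
    obtain U where U: "open U" "A \<subseteq> U" "emeasure lborel (U - A) < e'"
      using outer_regular_lborel[of A e'] e' by auto
    have [measurable]: "U \<in> sets borel" using U by auto
    have "emeasure lborel U \<le> emeasure lborel (U - A) + emeasure lborel A"
      using emeasure_subadditive[of "U - A" lborel A] U(2) by (simp add: Un_absorb2)
    also have "\<dots> < \<infinity>"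
      using order.strict_trans[OF U(3) ennreal_less_top] base(2) by (simp add: less_top)
    finally have fU: "emeasure lborel U < \<infinity>" .
    have iU: "integrable lborel (indicator U :: 'a \<Rightarrow> real)" using fU by (intro integrable_real_indicator) auto
    have iA: "integrable lborel (indicator A :: 'a \<Rightarrow> real)" using base by (intro integrable_real_indicator) auto
    have iUA: "integrable lborel (indicator (U - A) :: 'a \<Rightarrow> real)"
    proof (rule integrable_real_indicator)
      show "emeasure lborel (U - A) < \<infinity>"
        using order.strict_trans[OF U(3) ennreal_less_top] by (simp add: infinity_ennreal_def)
    qed simp
    have mUA: "(LINT x|lborel. indicator (U - A) x :: real) < e'"
    proof -
      have "emeasure lborel (U - A) = ennreal (measure lborel (U - A))"
        using order.strict_trans[OF U(3) ennreal_less_top] by (intro emeasure_eq_ennreal_measure) auto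
      then show ?thesis using U(3) e' by (simp add: ennreal_less_iff)
    qed
    have *: "(LINT x|lborel. \<bar>indicator A (x + d) - indicator A x :: real\<bar>) \<le>
        2 * e' + (LINT x|lborel. \<bar>indicator U (x + d) - indicator U x\<bar>)" for d
    proof -
      have s: "integrable lborel (\<lambda>x. indicator B (x + d) :: real)"
        if "integrable lborel (indicator B :: 'a \<Rightarrow> real)" "B \<in> sets borel" for B
        using that by (simp add: lborel_integrable_shift)
      have "(LINT x|lborel. \<bar>indicator A (x + d) - indicator A x :: real\<bar>) \<le>
         (LINT x|lborel. (indicator (U - A) (x + d) + indicator (U - A) x) + \<bar>indicator U (x + d) - indicator U x\<bar>)"
        using U(2) s[OF iA] s[OF iU] s[OF iUA]
        by (intro integral_mono integrable_abs Bochner_Integration.integrable_add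
           Bochner_Integration.integrable_diff iA iU iUA) (auto simp: indicator_def)
      also have "\<dots> = (LINT x|lborel. indicator (U - A) (x + d)) + (LINT x|lborel. indicator (U - A) x)
          + (LINT x|lborel. \<bar>indicator U (x + d) - indicator U x\<bar>)"
        using s[OF iUA] s[OF iU] iU iUA
        by (subst Bochner_Integration.integral_add; simp)
      also have "(LINT x|lborel. indicator (U - A) (x + d) :: real) = (LINT x|lborel. indicator (U - A) x)"
        by (rule lborel_integral_shift) simp
      finally show ?thesis using mUA by simp
    qed
    obtain N where N: "\<And>n. n \<ge> N \<Longrightarrow> (LINT x|lborel. \<bar>indicator U (x + c n) - indicator U x :: real\<bar>) < e'"
      using LIMSEQ_D[OF open_shift_tendsto[OF U(1) fU c] e'] by (auto simp: abs_less_iff)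
    show "\<exists>no. \<forall>n\<ge>no. norm ((LINT x|lborel. \<bar>indicator A (x + c n) *\<^sub>R r - indicator A x *\<^sub>R r\<bar>) - 0) < e"
    proof (intro exI allI impI)
      fix n assume "N \<le> n"
      have "(LINT x|lborel. \<bar>indicator A (x + c n) *\<^sub>R r - indicator A x *\<^sub>R r\<bar>)
          = (LINT x|lborel. \<bar>r\<bar> * \<bar>indicator A (x + c n) - indicator A x\<bar>)"
        by (intro Bochner_Integration.integral_cong) (auto simp: indicator_def)
      also have "\<dots> = \<bar>r\<bar> * (LINT x|lborel. \<bar>indicator A (x + c n) - indicator A x\<bar>)" by simp
      also have "\<dots> \<le> \<bar>r\<bar> * (3 * e')" using *[of "c n"] N[OF \<open>N \<le> n\<close>] by (intro mult_left_mono) auto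
      also have "\<dots> < e" using \<open>0 < e\<close> unfolding e'_def by (simp add: field_simps add_nonneg_pos)
      finally show "norm ((LINT x|lborel. \<bar>indicator A (x + c n) *\<^sub>R r - indicator A x *\<^sub>R r\<bar>) - 0) < e"
        by (simp add: abs_of_nonneg)
    qed
  qed
next
  case (add f g)
  have [measurable]: "f \<in> borel_measurable borel" "g \<in> borel_measurable borel"
    using add(1,2)[THEN borel_measurable_integrable] by auto
  have i: "integrable lborel (\<lambda>x. f (x + d))" "integrable lborel (\<lambda>x. g (x + d))" for d
    using add(1,2) by (simp_all add: lborel_integrable_shift)
  show ?case
  proof (rule tendsto_sandwich[where f = "\<lambda>_. 0" and h =
      "\<lambda>n. (LINT x|lborel. \<bar>f (x + c n) - f x\<bar>) + (LINT x|lborel. \<bar>g (x + c n) - g x\<bar>)"])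
    show "\<forall>\<^sub>F n in sequentially. (LINT x|lborel. \<bar>f (x + c n) + g (x + c n) - (f x + g x)\<bar>)
       \<le> (LINT x|lborel. \<bar>f (x + c n) - f x\<bar>) + (LINT x|lborel. \<bar>g (x + c n) - g x\<bar>)"
    proof (intro always_eventually allI)
      fix n
      have "(LINT x|lborel. \<bar>f (x + c n) + g (x + c n) - (f x + g x)\<bar>)
          \<le> (LINT x|lborel. \<bar>f (x + c n) - f x\<bar> + \<bar>g (x + c n) - g x\<bar>)"
        using i add(1,2) by (intro integral_mono) auto
      then show "(LINT x|lborel. \<bar>f (x + c n) + g (x + c n) - (f x + g x)\<bar>)
          \<le> (LINT x|lborel. \<bar>f (x + c n) - f x\<bar>) + (LINT x|lborel. \<bar>g (x + c n) - g x\<bar>)"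
        using i add(1,2) by simp
    qed
    show "(\<lambda>n. (LINT x|lborel. \<bar>f (x + c n) - f x\<bar>) + (LINT x|lborel. \<bar>g (x + c n) - g x\<bar>)) \<longlonglongrightarrow> 0"
      using tendsto_add[OF add(3) add(4)] by simp
  qed auto
next
  case (lim f s)
  have [measurable]: "f \<in> borel_measurable borel" "\<And>i. s i \<in> borel_measurable borel"
    using lim(1,4)[THEN borel_measurable_integrable] by auto
  have sf: "(\<lambda>i. LINT x|lborel. \<bar>s i x - f x\<bar>) \<longlonglongrightarrow> (LINT x|(lborel :: 'a measure). (0::real))"
  proof (rule integral_dominated_convergence[where w = "\<lambda>x. 3 * \<bar>f x\<bar>"])
    show "AE x in lborel. (\<lambda>i. \<bar>s i x - f x\<bar>) \<longlonglongrightarrow> 0"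
      using lim(2) by (auto intro!: tendsto_rabs_zero simp: LIM_zero_iff)
    show "AE x in lborel. norm \<bar>s i x - f x\<bar> \<le> 3 * \<bar>f x\<bar>" for i
      using lim(3)[of _ i] by (auto intro!: AE_I2) (smt (verit) lim(3) real_norm_def space_lborel UNIV_I)
  qed (use lim(4) in auto)
  show ?case
  proof (rule LIMSEQ_I)
    fix e :: real assume "0 < e"
    obtain i where i: "(LINT x|lborel. \<bar>s i x - f x\<bar>) < e / 3"
      using LIMSEQ_D[OF sf, of "e / 3"] \<open>0 < e\<close> by (auto simp: abs_less_iff)
    obtain N where N: "\<And>n. n \<ge> N \<Longrightarrow> (LINT x|lborel. \<bar>s i (x + c n) - s i x\<bar>) < e / 3"
      using LIMSEQ_D[OF lim(5)[of i], of "e / 3"] \<open>0 < e\<close> by (auto simp: abs_less_iff)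
    show "\<exists>no. \<forall>n\<ge>no. norm ((LINT x|lborel. \<bar>f (x + c n) - f x\<bar>) - 0) < e"
    proof (intro exI allI impI)
      fix n assume n: "N \<le> n"
      have sh: "integrable lborel (\<lambda>x. f (x + c n))" "integrable lborel (\<lambda>x. s i (x + c n))"
        using lim(1,4) by (simp_all add: lborel_integrable_shift)
      have 1: "integrable lborel (\<lambda>x. \<bar>s i (x + c n) - f (x + c n)\<bar>)"
        "integrable lborel (\<lambda>x. \<bar>s i x - f x\<bar>)" "integrable lborel (\<lambda>x. \<bar>s i (x + c n) - s i x\<bar>)"
        using sh lim(1,4) by auto
      have "(LINT x|lborel. \<bar>f (x + c n) - f x\<bar>) \<le>
        (LINT x|lborel. \<bar>s i (x + c n) - f (x + c n)\<bar> + (\<bar>s i x - f x\<bar> + \<bar>s i (x + c n) - s i x\<bar>))"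
        using sh lim(1,4) by (intro integral_mono) auto
      also have "\<dots> = (LINT x|lborel. \<bar>s i (x + c n) - f (x + c n)\<bar>) + ((LINT x|lborel. \<bar>s i x - f x\<bar>)
         + (LINT x|lborel. \<bar>s i (x + c n) - s i x\<bar>))"
        using 1 by simp
      also have "(LINT x|lborel. \<bar>s i (x + c n) - f (x + c n)\<bar>) = (LINT x|lborel. \<bar>s i x - f x\<bar>)"
        using lborel_integral_shift[of "\<lambda>x. \<bar>s i x - f x\<bar>" "c n"] by simp
      finally have "(LINT x|lborel. \<bar>f (x + c n) - f x\<bar>) < e" using i N[OF n] by simp
      then show "norm ((LINT x|lborel. \<bar>f (x + c n) - f x\<bar>) - 0) < e" by (simp add: abs_of_nonneg)
    qed
  qed
qed

section \<open>Averages of a measure over translated sets\<close>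

text \<open>This is the convolution of \<open>a\<close> with the normalized indicator of the
  reflected set, written with values of \<open>a\<close> only.\<close>

definition set_average :: "smeasure \<Rightarrow> (real ^ 2) set \<Rightarrow> real ^ 2 \<Rightarrow> real" where
  "set_average a Q x = a ((\<lambda>y. y + x) ` Q) / measure lborel Q"

lemma shifted_set_borel:
  fixes Q :: "(real ^ 2) set"
  assumes "Q \<in> sets borel"
  shows "(\<lambda>y. y + x) ` Q \<in> sets borel"
proof -
  have "(\<lambda>y. y - x) -` Q \<inter> space borel \<in> sets borel"
    by (rule measurable_sets[OF _ assms]) simp
  moreover have "(\<lambda>y. y + x) ` Q = (\<lambda>y. y - x) -` Q \<inter> space borel"
    by (auto simp: image_iff) (metis diff_add_cancel)
  ultimately show ?thesis by simp
qed

text \<open>Everything is Fubini for \<open>indicator Q (y - x)\<close>, integrated in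
  \<open>y\<close> against \<open>p\<close> and in \<open>x\<close> against Lebesgue measure. The
  last formula moves the average from the measure to the test function.\<close>

lemma measure_shift_integral:
  fixes p :: "(real ^ 2) measure"
  assumes p: "finite_measure p" "sets p = sets borel"
    and Q: "Q \<in> sets borel" "emeasure lborel Q < \<infinity>"
  shows "(\<lambda>x. measure p ((\<lambda>y. y + x) ` Q)) \<in> borel_measurable borel"
    "integrable lborel (\<lambda>x. measure p ((\<lambda>y. y + x) ` Q))"
    "(LINT x|lborel. measure p ((\<lambda>y. y + x) ` Q)) = measure lborel Q * measure p UNIV"
    "\<And>\<psi>. \<psi> \<in> borel_measurable borel \<Longrightarrow> (\<And>x. \<bar>\<psi> x\<bar> \<le> C) \<Longrightarrow>
      (LINT x|lborel. \<psi> x * measure p ((\<lambda>y. y + x) ` Q)) = (LINT y|p. LINT x|lborel. \<psi> (y - x) * indicator Q x)"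
proof -
  interpret p: finite_measure p by fact
  interpret pair_sigma_finite lborel p ..
  have [measurable_cong]: "sets p = sets borel" by fact
  have [measurable]: "Q \<in> sets borel" by fact
  have sp: "space p = UNIV" using p(2) by (metis sets_eq_imp_space_eq space_borel)
  have ind: "indicator ((\<lambda>y. y + x) ` Q) y = (indicator Q (y - x) :: 'c::zero_neq_one)" for x y
    by (auto simp: indicator_def image_iff) (metis diff_add_cancel)
  have eq: "measure p ((\<lambda>y. y + x) ` Q) = (LINT y|p. indicator Q (y - x))" for x
  proof -
    have "(LINT y|p. indicator ((\<lambda>y. y + x) ` Q) y :: real) = measure p ((\<lambda>y. y + x) ` Q)"
      using shifted_set_borel[OF Q(1), of x] sp by simp
    then show ?thesis by (simp add: ind)
  qed
  show m: "(\<lambda>x. measure p ((\<lambda>y. y + x) ` Q)) \<in> borel_measurable borel"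
    unfolding eq by measurable
  have nn: "(\<integral>\<^sup>+x. indicator Q (y - x) \<partial>lborel) = emeasure lborel Q" for y
    using nn_integral_lborel_reflect[of "indicator Q" y] by simp
  have big: "integrable (lborel \<Otimes>\<^sub>M p) (\<lambda>(x, y). indicator Q (y - x) :: real)"
  proof (rule integrableI_bounded)
    have "(\<integral>\<^sup>+z. ennreal (norm (case z of (x, y) \<Rightarrow> (indicator Q (y - x) :: real))) \<partial>(lborel \<Otimes>\<^sub>M p))
      = (\<integral>\<^sup>+(x, y). indicator Q (y - x) \<partial>(lborel \<Otimes>\<^sub>M p))"
      by (intro nn_integral_cong) (auto simp: indicator_def)
    also have "\<dots> = (\<integral>\<^sup>+y. \<integral>\<^sup>+x. indicator Q (y - x) \<partial>lborel \<partial>p)"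
      by (subst nn_integral_snd[symmetric]) auto
    also have "\<dots> = emeasure lborel Q * emeasure p UNIV" using sp by (simp add: nn)
    also have "\<dots> < \<infinity>"
    proof -
      have "emeasure p UNIV < top" using p.emeasure_finite[of UNIV] unfolding infinity_ennreal_def top.not_eq_extremum .
      then show ?thesis using Q(2) by (simp add: ennreal_mult_less_top)
    qed
    finally show "(\<integral>\<^sup>+z. ennreal (norm (case z of (x, y) \<Rightarrow> (indicator Q (y - x) :: real))) \<partial>(lborel \<Otimes>\<^sub>M p)) < \<infinity>" .
  qed measurable
  show "integrable lborel (\<lambda>x. measure p ((\<lambda>y. y + x) ` Q))"
    unfolding eq using integrable_fst[of "\<lambda>x y. indicator Q (y - x) :: real"] big by simp
  have "(LINT x|lborel. LINT y|p. indicator Q (y - x)) = (LINT y|p. LINT x|lborel. indicator Q (y - x) :: real)"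
    using Fubini_integral[of "\<lambda>x y. indicator Q (y - x) :: real"] big by simp
  also have "\<dots> = measure lborel Q * measure p UNIV"
    using lborel_integral_reflect[of "indicator Q :: _ \<Rightarrow> real"] sp by simp
  finally show "(LINT x|lborel. measure p ((\<lambda>y. y + x) ` Q)) = measure lborel Q * measure p UNIV"
    by (simp add: eq)
  fix \<psi> :: "real ^ 2 \<Rightarrow> real" assume [measurable]: "\<psi> \<in> borel_measurable borel" and b: "\<And>x. \<bar>\<psi> x\<bar> \<le> C"
  have "C \<ge> 0" using b[of 0] by simp
  have big': "integrable (lborel \<Otimes>\<^sub>M p) (\<lambda>(x, y). \<psi> x * indicator Q (y - x))"
    by (rule Bochner_Integration.integrable_bound[where f = "\<lambda>z. C * (case z of (x, y) \<Rightarrow> (indicator Q (y - x) :: real))"])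
      (use big b \<open>C \<ge> 0\<close> in \<open>auto intro!: AE_I2 simp: indicator_def abs_mult\<close>)
  have "(LINT x|lborel. \<psi> x * measure p ((\<lambda>y. y + x) ` Q)) = (LINT x|lborel. LINT y|p. \<psi> x * indicator Q (y - x))"
    by (simp add: eq)
  also have "\<dots> = (LINT y|p. LINT x|lborel. \<psi> x * indicator Q (y - x))"
    using Fubini_integral[of "\<lambda>x y. \<psi> x * indicator Q (y - x)"] big' by simp
  also have "\<dots> = (LINT y|p. LINT x|lborel. \<psi> (y - x) * indicator Q x)"
  proof (rule Bochner_Integration.integral_cong[OF refl])
    fix y show "(LINT x|lborel. \<psi> x * indicator Q (y - x)) = (LINT x|lborel. \<psi> (y - x) * indicator Q x)"
      using lborel_integral_reflect[of "\<lambda>x. \<psi> x * indicator Q (y - x)" y] by simp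
  qed
  finally show "(LINT x|lborel. \<psi> x * measure p ((\<lambda>y. y + x) ` Q)) = (LINT y|p. LINT x|lborel. \<psi> (y - x) * indicator Q x)" .
qed

lemma set_average_L1:
  assumes a: "signed_measure a" and Q: "Q \<in> sets borel" "emeasure lborel Q < \<infinity>" "0 < measure lborel Q"
  shows "set_average a Q \<in> borel_measurable borel" "integrable lborel (set_average a Q)"
    "L1_norm (set_average a Q) \<le> tv_norm a" "\<bar>set_average a Q x\<bar> \<le> tv_norm a / measure lborel Q"
proof -
  let ?p = "pos_part a" and ?n = "neg_part a"
  note pn = pos_neg_part[OF a]
  interpret p: finite_measure ?p by (rule pn)
  interpret n: finite_measure ?n by (rule pn)
  have sp: "space ?p = UNIV" "space ?n = UNIV" using pn(3,4) by (metis sets_eq_imp_space_eq space_borel)+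
  have eq: "set_average a Q = (\<lambda>x. (measure ?p ((\<lambda>y. y + x) ` Q) - measure ?n ((\<lambda>y. y + x) ` Q)) / measure lborel Q)"
    using pn(5)[OF shifted_set_borel[OF Q(1)]] by (auto simp: set_average_def fun_eq_iff)
  note P = measure_shift_integral[OF pn(1,3) Q(1,2)] and N = measure_shift_integral[OF pn(2,4) Q(1,2)]
  show "set_average a Q \<in> borel_measurable borel" unfolding eq using P(1) N(1) by simp
  show i: "integrable lborel (set_average a Q)" unfolding eq using P(2) N(2) by simp
  have "L1_norm (set_average a Q) \<le> (LINT x|lborel.
      (measure ?p ((\<lambda>y. y + x) ` Q) + measure ?n ((\<lambda>y. y + x) ` Q)) / measure lborel Q)"
    unfolding L1_norm_def
  proof (rule integral_mono)
    fix x
    show "\<bar>set_average a Q x\<bar> \<le> (measure ?p ((\<lambda>y. y + x) ` Q) + measure ?n ((\<lambda>y. y + x) ` Q)) / measure lborel Q"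
      unfolding eq using Q(3) measure_nonneg[of ?p] measure_nonneg[of ?n]
      by (simp add: abs_divide) (intro divide_right_mono, auto simp: abs_le_iff)
  qed (use i P(2) N(2) in auto)
  also have "\<dots> = tv_norm a" using P(2,3) N(2,3) Q(3) pn(6) by (simp add: field_simps)
  finally show "L1_norm (set_average a Q) \<le> tv_norm a" .
  have "measure ?p B \<le> measure ?p UNIV" "measure ?n B \<le> measure ?n UNIV" for B
    using p.bounded_measure[of B] n.bounded_measure[of B] sp by simp_all
  then have "\<bar>measure ?p B - measure ?n B\<bar> \<le> tv_norm a" for B
    unfolding pn(6) using measure_nonneg[of ?p B] measure_nonneg[of ?n B] by (smt (verit))
  then show "\<bar>set_average a Q x\<bar> \<le> tv_norm a / measure lborel Q"
    unfolding eq using Q(3) by (simp add: abs_divide divide_right_mono)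
qed

lemma signed_measure_translate_diff:
  assumes a: "signed_measure a"
  shows "signed_measure (\<lambda>E. translate v a E - a E)"
  unfolding signed_measure_def
proof (intro allI impI)
  fix A :: "nat \<Rightarrow> (real ^ 2) set"
  assume A: "range A \<subseteq> sets borel" "disjoint_family A"
  have "(\<lambda>i. a ((\<lambda>x. x + v) ` A i)) sums a (\<Union>i. (\<lambda>x. x + v) ` A i)"
  proof (rule signed_measure_sums[OF a])
    show "range (\<lambda>i. (\<lambda>x. x + v) ` A i) \<subseteq> sets borel" using A(1) shifted_set_borel by auto
    show "disjoint_family (\<lambda>i. (\<lambda>x. x + v) ` A i)" using A(2) unfolding disjoint_family_on_def by fastforce
  qed
  then have "(\<lambda>i. translate v a (A i)) sums translate v a (\<Union>i. A i)"
    by (simp add: translate_def image_UN)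
  then show "(\<lambda>i. translate v a (A i) - a (A i)) sums (translate v a (\<Union>i. A i) - a (\<Union>i. A i))"
    by (rule sums_diff) (rule signed_measure_sums[OF a A])
qed

text \<open>Averaging commutes with translation, so the averages have the modulus of continuity of
  the measure with a bound that does not depend on \<open>Q\<close>. The hypothesis on
  \<open>a\<close> in the direction \<xi> reaches the approximating data through this
  inequality.\<close>

lemma set_average_shift_L1:
  assumes a: "signed_measure a" and Q: "Q \<in> sets borel" "emeasure lborel Q < \<infinity>" "0 < measure lborel Q"
  shows "L1_norm (\<lambda>x. set_average a Q (x + v) - set_average a Q x) \<le> tv_norm (\<lambda>E. translate v a E - a E)"
proof -
  have "(\<lambda>x. set_average a Q (x + v) - set_average a Q x) = set_average (\<lambda>E. translate v a E - a E) Q"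
    by (auto simp: fun_eq_iff set_average_def translate_def image_image add.assoc diff_divide_distrib)
  then show ?thesis
    using set_average_L1(3)[OF signed_measure_translate_diff[OF a] Q] by simp
qed

text \<open>After Fubini the measure is tested against averages of \<psi> over small sets, which
  converge uniformly because \<psi> is uniformly continuous. The argument is applied to the two
  parts of the Jordan decomposition.\<close>

lemma set_average_vague:
  assumes a: "signed_measure a"
    and Q: "\<And>k. Q k \<in> sets borel" "\<And>k. emeasure lborel (Q k) < \<infinity>" "\<And>k. 0 < measure lborel (Q k)"
    and small: "\<And>d. d > 0 \<Longrightarrow> eventually (\<lambda>k. Q k \<subseteq> ball 0 d) sequentially"
  shows "vague_limit (\<lambda>k. set_average a (Q k)) a"
  unfolding vague_limit_def
proof (intro allI impI)
  fix \<psi> :: "real ^ 2 \<Rightarrow> real"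
  assume c: "continuous_on UNIV \<psi>" and K: "compact (closure {x. \<psi> x \<noteq> 0})"
  let ?K = "closure {x. \<psi> x \<noteq> 0}"
  have z: "\<psi> x = 0" if "x \<notin> ?K" for x using that closure_subset[of "{x. \<psi> x \<noteq> 0}"] by auto
  have [measurable]: "\<psi> \<in> borel_measurable borel" using c by (rule borel_measurable_continuous_onI)
  have "compact (\<psi> ` ?K)" using K c by (intro compact_continuous_image) (auto intro: continuous_on_subset)
  then obtain C0 where "\<forall>y\<in>\<psi> ` ?K. norm y \<le> C0" using compact_imp_bounded bounded_iff by metis
  then have "\<bar>\<psi> x\<bar> \<le> max C0 0" for x using z[of x] by (cases "x \<in> ?K") (auto simp: le_max_iff_disj)
  then obtain C where C: "\<And>x. \<bar>\<psi> x\<bar> \<le> C" by blast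
  have unif: "\<exists>d>0. \<forall>x y. dist x y < d \<longrightarrow> \<bar>\<psi> x - \<psi> y\<bar> < e" if "e > 0" for e
  proof -
    have "uniformly_continuous_on UNIV \<psi>"
      by (rule uniformly_continuous_compact_support[OF c K z])
    then show ?thesis using that unfolding uniformly_continuous_on_def by (metis UNIV_I dist_real_def)
  qed
  have lim: "(\<lambda>k. (LINT x|lborel. \<psi> x * measure p ((\<lambda>y. y + x) ` Q k)) / measure lborel (Q k)) \<longlonglongrightarrow> (LINT y|p. \<psi> y)"
    if p: "finite_measure p" "sets p = sets borel" for p
  proof (rule LIMSEQ_I)
    interpret p: finite_measure p by fact
    have [measurable_cong]: "sets p = sets borel" by fact
    have ip: "integrable p \<psi>" using C by (intro p.integrable_const_bound[of _ C]) auto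
    fix e :: real assume "0 < e"
    define e' where "e' = e / (measure p (space p) + 1)"
    have e': "0 < e'" using \<open>0 < e\<close> by (simp add: e'_def add_nonneg_pos)
    obtain d where d: "d > 0" "\<And>x y. dist x y < d \<Longrightarrow> \<bar>\<psi> x - \<psi> y\<bar> < e'" using unif[OF e'] by blast
    obtain N where N: "\<And>k. k \<ge> N \<Longrightarrow> Q k \<subseteq> ball 0 d" using small[OF d(1)] by (auto simp: eventually_sequentially)
    show "\<exists>no. \<forall>k\<ge>no. norm ((LINT x|lborel. \<psi> x * measure p ((\<lambda>y. y + x) ` Q k)) / measure lborel (Q k) - (LINT y|p. \<psi> y)) < e"
    proof (intro exI allI impI)
      fix k assume k: "N \<le> k"
      let ?m = "measure lborel (Q k)"
      have [measurable]: "Q k \<in> sets borel" by (rule Q)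
      have iQ: "integrable lborel (indicator (Q k) :: _ \<Rightarrow> real)" using Q by (intro integrable_real_indicator) auto
      have iy: "integrable lborel (\<lambda>x. \<psi> (y - x) * indicator (Q k) x)" for y
        by (rule Bochner_Integration.integrable_bound[where f = "\<lambda>x. C * indicator (Q k) x"])
          (use iQ in simp, measurable, use C in \<open>auto simp: indicator_def intro!: AE_I2 order_trans[OF _ abs_ge_self]\<close>)
      define \<phi> where "\<phi> y = (LINT x|lborel. \<psi> (y - x) * indicator (Q k) x) / ?m" for y
      have near: "\<bar>\<phi> y - \<psi> y\<bar> \<le> e'" for y
      proof -
        have "\<phi> y - \<psi> y = (LINT x|lborel. (\<psi> (y - x) - \<psi> y) * indicator (Q k) x) / ?m"
          using iy[of y] iQ Q(3)[of k] Q(2)[of k] by (simp add: \<phi>_def left_diff_distrib field_simps)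
        also have "\<bar>\<dots>\<bar> \<le> (LINT x|lborel. e' * indicator (Q k) x) / ?m"
        proof -
          have "\<bar>LINT x|lborel. (\<psi> (y - x) - \<psi> y) * indicator (Q k) x\<bar> \<le> (LINT x|lborel. e' * indicator (Q k) x)"
          proof (rule integral_abs_bound_integral)
            show "integrable lborel (\<lambda>x. (\<psi> (y - x) - \<psi> y) * indicator (Q k) x)"
              using iy[of y] iQ by (simp add: left_diff_distrib)
            fix x
            have "\<bar>\<psi> (y - x) - \<psi> y\<bar> \<le> e'" if "x \<in> Q k"
              using d(2)[of "y - x" y] N[OF k] that by (force simp: dist_norm less_imp_le)
            then show "\<bar>(\<psi> (y - x) - \<psi> y) * indicator (Q k) x\<bar> \<le> e' * indicator (Q k) x"
              by (auto simp: indicator_def)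
          qed (use iQ in simp)
          then show ?thesis using Q(3)[of k] by (simp add: abs_divide divide_le_eq)
        qed
        also have "\<dots> = e'" using Q(3)[of k] by simp
        finally show ?thesis .
      qed
      have \<phi>m[measurable]: "\<phi> \<in> borel_measurable p" unfolding \<phi>_def by measurable
      have "\<bar>\<phi> y\<bar> \<le> C + e'" for y using near[of y] C[of y] by linarith
      then have i\<phi>: "integrable p \<phi>" by (intro p.integrable_const_bound[of _ "C + e'"]) auto
      have "(LINT x|lborel. \<psi> x * measure p ((\<lambda>y. y + x) ` Q k)) / ?m = (LINT y|p. \<phi> y)"
        using measure_shift_integral(4)[OF p Q(1,2)[of k] _ C] by (simp add: \<phi>_def)
      then have "norm ((LINT x|lborel. \<psi> x * measure p ((\<lambda>y. y + x) ` Q k)) / ?m - (LINT y|p. \<psi> y))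
          = norm (LINT y|p. \<phi> y - \<psi> y)" using i\<phi> ip by simp
      also have "\<dots> \<le> (LINT y|p. e')"
        unfolding real_norm_def by (rule integral_abs_bound_integral) (use near i\<phi> ip in auto)
      also have "\<dots> = e' * measure p (space p)" by simp
      also have "\<dots> < e' * (measure p (space p) + 1)" using e' by simp
      also have "\<dots> = e"
      proof -
        have "0 < measure p (space p) + 1" by (simp add: add_nonneg_pos)
        then show ?thesis unfolding e'_def by (metis less_numeral_extra(3) nonzero_eq_divide_eq)
      qed
      finally show "norm ((LINT x|lborel. \<psi> x * measure p ((\<lambda>y. y + x) ` Q k)) / ?m - (LINT y|p. \<psi> y)) < e" .
    qed
  qed
  let ?p = "pos_part a" and ?n = "neg_part a"
  note pn = pos_neg_part[OF a]
  have eq: "(LINT x|lborel. \<psi> x * set_average a (Q k) x) =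
      (LINT x|lborel. \<psi> x * measure ?p ((\<lambda>y. y + x) ` Q k)) / measure lborel (Q k)
    - (LINT x|lborel. \<psi> x * measure ?n ((\<lambda>y. y + x) ` Q k)) / measure lborel (Q k)" for k
  proof -
    have i: "integrable lborel (\<lambda>x. \<psi> x * measure p ((\<lambda>y. y + x) ` Q k))"
      if "finite_measure p" "sets p = sets borel" for p
      using measure_shift_integral(1,2)[OF that Q(1,2)[of k]] C
      by (intro Bochner_Integration.integrable_bound[where g = "\<lambda>x. \<psi> x * measure p ((\<lambda>y. y + x) ` Q k)"
            and f = "\<lambda>x. C * measure p ((\<lambda>y. y + x) ` Q k)"])
        (auto simp: abs_mult intro!: mult_right_mono AE_I2 order_trans[OF _ abs_ge_self])
    have "(LINT x|lborel. \<psi> x * set_average a (Q k) x) = (LINT x|lborel. \<psi> x * measure ?p ((\<lambda>y. y + x) ` Q k) / measure lborel (Q k)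
       - \<psi> x * measure ?n ((\<lambda>y. y + x) ` Q k) / measure lborel (Q k))"
      using pn(5)[OF shifted_set_borel[OF Q(1)]]
      by (intro Bochner_Integration.integral_cong) (auto simp: set_average_def diff_divide_distrib right_diff_distrib)
    also have "\<dots> = (LINT x|lborel. \<psi> x * measure ?p ((\<lambda>y. y + x) ` Q k)) / measure lborel (Q k)
    - (LINT x|lborel. \<psi> x * measure ?n ((\<lambda>y. y + x) ` Q k)) / measure lborel (Q k)"
      using i[OF pn(1,3)] i[OF pn(2,4)] by simp
    finally show ?thesis .
  qed
  show "(\<lambda>k. LINT x|lborel. \<psi> x * set_average a (Q k) x) \<longlonglongrightarrow> sm_integral a \<psi>"
    unfolding eq sm_integral_def by (intro tendsto_diff lim pn)
qed

section \<open>Test functions and mollification\<close>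

text \<open>A function that is not integrable has integral 0 by convention, so the bound holds for
  it as well and needs only integrability of the majorant.\<close>

lemma norm_integral_le:
  fixes f :: "'a \<Rightarrow> 'b::{banach, second_countable_topology}"
  assumes "integrable M g" "\<And>x. x \<in> space M \<Longrightarrow> norm (f x) \<le> g x"
  shows "norm (integral\<^sup>L M f) \<le> integral\<^sup>L M g"
proof (cases "integrable M f")
  case True
  have "norm (integral\<^sup>L M f) \<le> (LINT x|M. norm (f x))" by (rule integral_norm_bound)
  also have "\<dots> \<le> integral\<^sup>L M g" using assms True by (intro integral_mono) auto
  finally show ?thesis .
next
  case False
  have "0 \<le> integral\<^sup>L M g"
    using assms(2) by (intro integral_nonneg_AE AE_I2) (meson norm_ge_zero order_trans)
  then show ?thesis using False by (simp add: not_integrable_integral_eq)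
qed

lemma integrable_scaleR_bounded:
  fixes f :: "'a \<Rightarrow> 'b::{banach, second_countable_topology}"
  assumes w: "integrable M w" and [measurable]: "f \<in> borel_measurable M"
    and b: "\<And>x. x \<in> space M \<Longrightarrow> norm (f x) \<le> C"
  shows "integrable M (\<lambda>x. w x *\<^sub>R f x)"
proof (rule Bochner_Integration.integrable_bound[where f = "\<lambda>x. C * w x"])
  have [measurable]: "w \<in> borel_measurable M" using w by auto
  show "(\<lambda>x. w x *\<^sub>R f x) \<in> borel_measurable M" by measurable
  show "AE x in M. norm (w x *\<^sub>R f x) \<le> norm (C * w x)"
  proof (rule AE_I2)
    fix x assume x: "x \<in> space M"
    have "norm (w x *\<^sub>R f x) = \<bar>w x\<bar> * norm (f x)" by simp
    also have "\<dots> \<le> \<bar>w x\<bar> * \<bar>C\<bar>" using b[OF x] by (intro mult_left_mono) auto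
    finally show "norm (w x *\<^sub>R f x) \<le> norm (C * w x)" by (simp add: abs_mult mult.commute)
  qed
qed (use w in simp)

lemma integrable_mult_bounded:
  fixes f :: "'a \<Rightarrow> real"
  assumes "integrable M w" "f \<in> borel_measurable M" "\<And>x. x \<in> space M \<Longrightarrow> \<bar>f x\<bar> \<le> C"
  shows "integrable M (\<lambda>x. w x * f x)" "integrable M (\<lambda>x. f x * w x)"
  using integrable_scaleR_bounded[of M w f C] assms by (simp_all add: mult.commute)

section \<open>A smooth function supported on a half-line\<close>

lemma poly_div_exp_tendsto: "((\<lambda>y::real. poly p y / exp y) \<longlongrightarrow> 0) at_top"
proof -
  have "((\<lambda>y::real. \<Sum>i\<le>degree p. coeff p i * (y ^ i / exp y)) \<longlongrightarrow> (\<Sum>i\<le>degree p. coeff p i * 0)) at_top"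
    by (intro tendsto_intros tendsto_power_div_exp_0)
  moreover have "(\<lambda>y::real. \<Sum>i\<le>degree p. coeff p i * (y ^ i / exp y)) = (\<lambda>y. poly p y / exp y)"
    by (auto simp: poly_altdef sum_divide_distrib)
  ultimately show ?thesis by simp
qed

text \<open>The derivatives of \<open>exp (- (1 / x))\<close> are polynomials in
  \<open>1 / x\<close> times the same exponential; this family contains all of them.\<close>

definition flat_exp :: "real poly \<Rightarrow> real \<Rightarrow> real" where
  "flat_exp p x = (if 0 < x then poly p (1 / x) * exp (- (1 / x)) else 0)"

lemma flat_exp_tendsto_0: "(flat_exp p \<longlongrightarrow> 0) (at 0)"
proof -
  have "((\<lambda>x::real. poly p (inverse x) / exp (inverse x)) \<longlongrightarrow> 0) (at_right 0)"
    by (rule filterlim_compose[OF poly_div_exp_tendsto filterlim_inverse_at_top_right])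
  moreover have "eventually (\<lambda>x. poly p (inverse x) / exp (inverse x) = flat_exp p x) (at_right 0)"
    unfolding eventually_at_right_field
    by (intro exI[of _ 1]) (auto simp: flat_exp_def exp_minus field_simps)
  ultimately have r: "(flat_exp p \<longlongrightarrow> 0) (at_right 0)" by (rule Lim_transform_eventually)
  have "eventually (\<lambda>x. 0 = flat_exp p x) (at_left 0)"
    unfolding eventually_at_left_field by (intro exI[of _ "-1"]) (auto simp: flat_exp_def)
  then have "(flat_exp p \<longlongrightarrow> 0) (at_left 0)" by (rule Lim_transform_eventually[OF tendsto_const])
  with r show ?thesis by (simp add: filterlim_split_at)
qed

text \<open>In the variable \<open>y = 1 / x\<close> the derivative of
  \<open>poly p y * exp (- y)\<close> in \<open>x\<close> is \<open>y ^ 2\<close> times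
  \<open>p - pderiv p\<close>, times the exponential. At 0 the difference quotient is
  \<open>flat_exp ([:0, 1:] * p)\<close>, which belongs to the family again and tends to 0.\<close>

lemma flat_exp_deriv:
  "(flat_exp p has_real_derivative flat_exp ([:0, 0, 1:] * (p - pderiv p)) x) (at x)"
proof -
  consider "x > 0" | "x < 0" | "x = 0" by linarith
  then show ?thesis
  proof cases
    case 1
    have "((\<lambda>x. poly p (1 / x) * exp (- (1 / x))) has_real_derivative
        flat_exp ([:0, 0, 1:] * (p - pderiv p)) x) (at x)"
      using 1 by (auto intro!: derivative_eq_intros simp: flat_exp_def field_simps power2_eq_square)
    then show ?thesis
      by (rule DERIV_cong_ev[THEN iffD1, rotated -1, OF _ refl _ refl])
        (use 1 in \<open>auto simp: flat_exp_def eventually_nhds intro!: exI[of _ "{0<..}"]\<close>)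
  next
    case 2
    have "((\<lambda>x. 0) has_real_derivative 0) (at x)" by simp
    then show ?thesis
      using 2 by (subst DERIV_cong_ev[OF refl _ refl, of _ "\<lambda>_. 0"])
        (auto simp: flat_exp_def eventually_nhds intro!: exI[of _ "{..<0}"])
  next
    case 3
    have "(\<lambda>h. (flat_exp p (0 + h) - flat_exp p 0) / h) = flat_exp ([:0, 1:] * p)"
      by (auto simp: fun_eq_iff flat_exp_def)
    then show ?thesis
      using flat_exp_tendsto_0[of "[:0, 1:] * p"] 3 by (simp add: DERIV_def flat_exp_def)
  qed
qed

text \<open>A function listed with all its derivatives: smoothness can then be proved by raising the
  index instead of iterating a derivative operator.\<close>

definition smooth_chain :: "(nat \<Rightarrow> real \<Rightarrow> real) \<Rightarrow> bool" where
  "smooth_chain B \<longleftrightarrow> (\<forall>n x. (B n has_real_derivative B (Suc n) x) (at x))"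

lemma smooth_step_exists:
  obtains B where "smooth_chain B" "\<And>x. 0 \<le> B 0 x" "\<And>x. 0 < B 0 x \<longleftrightarrow> 0 < x"
proof -
  define P where "P = rec_nat 1 (\<lambda>_ p. [:0, 0, 1:] * (p - pderiv p) :: real poly)"
  have P: "P 0 = 1" "\<And>n. P (Suc n) = [:0, 0, 1:] * (P n - pderiv (P n))" by (simp_all add: P_def)
  show ?thesis
  proof (rule that[of "\<lambda>n. flat_exp (P n)"])
    show "smooth_chain (\<lambda>n. flat_exp (P n))"
      unfolding smooth_chain_def P(2) using flat_exp_deriv by blast
  qed (auto simp: P(1) flat_exp_def)
qed

lemma C_k_continuous: "C_k n \<phi> \<Longrightarrow> continuous_on UNIV \<phi>"
  by (cases n) (auto intro!: differentiable_imp_continuous_on simp: differentiable_on_def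
      intro: differentiable_at_withinI)

lemma C_k_Suc: "C_k (Suc n) \<phi> \<Longrightarrow> C_k n \<phi>"
proof (induction n arbitrary: \<phi>)
  case 0 then show ?case using C_k_continuous[of "Suc 0" \<phi>] by simp
next
  case (Suc n) then show ?case by (metis C_k.simps(2))
qed

lemma C_k_SucI:
  assumes "\<And>x. (\<phi> has_derivative D x) (at x)" "\<And>v. C_k n (\<lambda>x. D x v)"
  shows "C_k (Suc n) \<phi>"
proof -
  have "frechet_derivative \<phi> (at x) = D x" for x using frechet_derivative_at[OF assms(1)] by simp
  then show ?thesis using assms by (auto simp: differentiable_def)
qed

lemma C_k_SucD:
  assumes "C_k (Suc n) \<phi>"
  shows "(\<phi> has_derivative frechet_derivative \<phi> (at x)) (at x)" "C_k n (\<lambda>x. frechet_derivative \<phi> (at x) v)"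
  using assms by (auto simp: frechet_derivative_works[symmetric])

lemma C_k_const: "C_k n (\<lambda>_. c)"
proof (induction n arbitrary: c)
  case (Suc n) show ?case by (rule C_k_SucI[where D = "\<lambda>_ _. 0"]) (auto intro: Suc)
qed simp

lemma C_k_add: "C_k n f \<Longrightarrow> C_k n g \<Longrightarrow> C_k n (\<lambda>x. f x + g x)"
proof (induction n arbitrary: f g)
  case 0 then show ?case by (auto intro: continuous_on_add)
next
  case (Suc n)
  show ?case
  proof (rule C_k_SucI)
    show "((\<lambda>x. f x + g x) has_derivative
      (\<lambda>v. frechet_derivative f (at x) v + frechet_derivative g (at x) v)) (at x)" for x
      by (rule has_derivative_add[OF C_k_SucD(1)[OF Suc.prems(1)] C_k_SucD(1)[OF Suc.prems(2)]])
    show "C_k n (\<lambda>x. frechet_derivative f (at x) v + frechet_derivative g (at x) v)" for v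
      by (intro Suc.IH C_k_SucD(2)[OF Suc.prems(1)] C_k_SucD(2)[OF Suc.prems(2)])
  qed
qed

lemma C_k_mult: "C_k n f \<Longrightarrow> C_k n g \<Longrightarrow> C_k n (\<lambda>x. f x * g x)"
proof (induction n arbitrary: f g)
  case 0 then show ?case by (auto intro: continuous_on_mult)
next
  case (Suc n)
  show ?case
  proof (rule C_k_SucI)
    show "((\<lambda>x. f x * g x) has_derivative
      (\<lambda>v. f x * frechet_derivative g (at x) v + frechet_derivative f (at x) v * g x)) (at x)" for x
      by (rule has_derivative_mult[OF C_k_SucD(1)[OF Suc.prems(1)] C_k_SucD(1)[OF Suc.prems(2)]])
    show "C_k n (\<lambda>x. f x * frechet_derivative g (at x) v + frechet_derivative f (at x) v * g x)" for v
      by (rule C_k_add[OF Suc.IH Suc.IH])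
        (rule C_k_Suc[OF Suc.prems(1)] C_k_Suc[OF Suc.prems(2)]
          C_k_SucD(2)[OF Suc.prems(1)] C_k_SucD(2)[OF Suc.prems(2)])+
  qed
qed

lemma C_k_prod: "finite A \<Longrightarrow> (\<And>i. i \<in> A \<Longrightarrow> C_k n (f i)) \<Longrightarrow> C_k n (\<lambda>x. \<Prod>i\<in>A. f i x)"
proof (induction A rule: finite_induct)
  case empty then show ?case by (simp add: C_k_const)
next
  case (insert i A)
  have "C_k n (\<lambda>x. f i x * (\<Prod>i\<in>A. f i x))" by (intro C_k_mult insert) auto
  then show ?case using insert by simp
qed

text \<open>Each directional derivative is a constant times the same expression with
  \<open>j\<close> raised by one, so the induction runs over all \<open>j\<close> at once.\<close>

lemma C_k_chain:
  assumes B: "smooth_chain B"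
  shows "C_k n (\<lambda>x. B j (c + (x \<bullet> b) * s))"
proof (induction n arbitrary: j)
  case 0
  have "isCont (B j) x" for x using B DERIV_isCont unfolding smooth_chain_def by blast
  then have "continuous_on UNIV (B j)" by (simp add: continuous_on_eq_continuous_at)
  then show ?case by (auto intro!: continuous_on_compose2[of UNIV "B j"] continuous_intros)
next
  case (Suc n)
  show ?case
  proof (rule C_k_SucI)
    fix x
    have "(B j has_derivative (\<lambda>h. B (Suc j) (c + (x \<bullet> b) * s) * h)) (at (c + (x \<bullet> b) * s))"
      using B unfolding smooth_chain_def has_field_derivative_def by blast
    from has_derivative_compose[of "\<lambda>x. c + (x \<bullet> b) * s" "\<lambda>v. (v \<bullet> b) * s" x UNIV, OF _ this]
    show "((\<lambda>x. B j (c + (x \<bullet> b) * s)) has_derivative (\<lambda>v. B (Suc j) (c + (x \<bullet> b) * s) * ((v \<bullet> b) * s))) (at x)"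
      by (fastforce intro!: derivative_eq_intros)
  next
    fix v :: 'a
    show "C_k n (\<lambda>x. B (Suc j) (c + (x \<bullet> b) * s) * ((v \<bullet> b) * s))"
      by (intro C_k_mult C_k_const Suc)
  qed
qed

section \<open>Gradients, mollifiers and differentiation under the integral\<close>

definition is_grad :: "('a::euclidean_space \<Rightarrow> real) \<Rightarrow> ('a \<Rightarrow> 'a) \<Rightarrow> bool" where
  "is_grad \<phi> g \<longleftrightarrow> (\<forall>z. (\<phi> has_derivative (\<lambda>v. g z \<bullet> v)) (at z))"

lemma is_grad_continuous: "is_grad \<phi> g \<Longrightarrow> continuous_on UNIV \<phi>"
  unfolding is_grad_def by (auto simp: continuous_on_eq_continuous_at intro: has_derivative_continuous)

lemma has_derivative_inner_grad:
  assumes "(\<phi> has_derivative D) (at z)"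
  shows "(\<phi> has_derivative (\<lambda>v. (\<Sum>b\<in>Basis. D b *\<^sub>R b) \<bullet> v)) (at z)"
proof -
  interpret bounded_linear D using assms by (rule has_derivative_bounded_linear)
  have "D v = (\<Sum>b\<in>Basis. D b *\<^sub>R b) \<bullet> v" for v
  proof -
    have "D v = D (\<Sum>b\<in>Basis. (v \<bullet> b) *\<^sub>R b)" by (simp add: euclidean_representation)
    also have "\<dots> = (\<Sum>b\<in>Basis. (v \<bullet> b) * D b)" by (simp add: sum scaleR)
    finally show ?thesis by (simp add: inner_sum_left inner_commute[of v] mult.commute)
  qed
  then have "D = (\<lambda>v. (\<Sum>b\<in>Basis. D b *\<^sub>R b) \<bullet> v)" by (rule ext)
  with assms show ?thesis by (metis (no_types))
qed

lemma C_k_grad: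
  assumes "C_k (Suc 0) \<phi>"
  defines "g \<equiv> \<lambda>z. \<Sum>b\<in>Basis. frechet_derivative \<phi> (at z) b *\<^sub>R b"
  shows "is_grad \<phi> g" "continuous_on UNIV g"
proof -
  show "is_grad \<phi> g" unfolding is_grad_def g_def
    using has_derivative_inner_grad[OF C_k_SucD(1)[OF assms(1)]] by blast
  show "continuous_on UNIV g" unfolding g_def
    using C_k_SucD(2)[OF assms(1)] by (intro continuous_on_sum continuous_on_scaleR) auto
qed

lemma is_grad_unique:
  assumes "is_grad \<phi> g" "is_grad \<phi> h"
  shows "g = h"
proof
  fix z
  have "(\<lambda>v. g z \<bullet> v) = (\<lambda>v. h z \<bullet> v)"
    using assms unfolding is_grad_def by (meson has_derivative_unique)
  then show "g z = h z" by (metis inner_commute vector_eq_rdot)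
qed

lemma is_grad_zero:
  assumes "is_grad \<phi> g" "closed K" "\<And>z. z \<notin> K \<Longrightarrow> \<phi> z = 0" "z \<notin> K"
  shows "g z = 0"
proof -
  have "(\<phi> has_derivative (\<lambda>v. g z \<bullet> v)) (at z)" using assms by (simp add: is_grad_def)
  moreover have "(\<phi> has_derivative (\<lambda>v. 0)) (at z)"
    by (rule has_derivative_transform_within_open[of "\<lambda>_. 0" _ _ UNIV "- K"])
      (use assms in auto)
  ultimately have "(\<lambda>v. g z \<bullet> v) = (\<lambda>v. 0)" by (rule has_derivative_unique)
  then show ?thesis by (metis inner_eq_zero_iff)
qed

lemma is_grad_frechet: "is_grad \<phi> g \<Longrightarrow> frechet_derivative \<phi> (at z) v = g z \<bullet> v"
  unfolding is_grad_def by (metis frechet_derivative_at)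

text \<open>A product over the coordinates of smooth functions that are positive exactly on a
  symmetric interval, normalized to integral 1.\<close>

lemma mollifier_exists:
  assumes "0 < \<epsilon>"
  obtains J :: "'a::euclidean_space \<Rightarrow> real" and g where "\<And>n. C_k n J" "is_grad J g" "continuous_on UNIV g"
    "\<And>z. 0 \<le> J z" "\<And>z. \<epsilon> \<le> norm z \<Longrightarrow> J z = 0" "\<And>z. \<epsilon> < norm z \<Longrightarrow> g z = 0"
    "integrable lborel J" "(LINT z|lborel. J z) = 1"
proof -
  obtain B where B: "smooth_chain B" "\<And>x. 0 \<le> B 0 x" "\<And>x. 0 < B 0 x \<longleftrightarrow> 0 < x" by (rule smooth_step_exists) (rule that)
  \<comment> \<open>On the set where \<open>H\<close> is nonzero each coordinate is below
    \<open>1 / s\<close>, that is \<epsilon> divided by the dimension; the sum of the coordinates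
    then bounds the norm by \<epsilon>.\<close>
  define s where "s = DIM('a) / \<epsilon>"
  have s: "0 < s" using assms by (simp add: s_def)
  define H :: "'a \<Rightarrow> real" where "H z = (\<Prod>b\<in>Basis. B 0 (1 + (z \<bullet> b) * s) * B 0 (1 + (z \<bullet> b) * (- s)))" for z
  have Hk: "C_k n H" for n unfolding H_def by (intro C_k_prod C_k_mult C_k_chain B) auto
  have H0: "0 \<le> H z" for z unfolding H_def by (intro prod_nonneg mult_nonneg_nonneg B(2))
  have Hz: "H z = 0" if "\<epsilon> \<le> norm z" for z
  proof (rule ccontr)
    assume "H z \<noteq> 0"
    then have ne: "B 0 (1 + (z \<bullet> b) * s) \<noteq> 0" "B 0 (1 + (z \<bullet> b) * (- s)) \<noteq> 0" if "b \<in> Basis" for b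
      using that unfolding H_def by (auto simp: prod_zero_iff)
    have "\<bar>z \<bullet> b\<bar> < 1 / s" if b: "b \<in> Basis" for b
    proof -
      have "0 < B 0 (1 + (z \<bullet> b) * s)" "0 < B 0 (1 + (z \<bullet> b) * (- s))"
        using ne[OF b] B(2) by (simp_all add: order.strict_iff_order)
      then have "0 < 1 + (z \<bullet> b) * s" "0 < 1 + (z \<bullet> b) * (- s)" using B(3) by auto
      then show ?thesis using s by (simp add: abs_less_iff field_simps)
    qed
    then have "(\<Sum>b\<in>Basis. \<bar>z \<bullet> b\<bar>) < (\<Sum>b\<in>(Basis :: 'a set). 1 / s)"
      by (intro sum_strict_mono) auto
    also have "\<dots> = \<epsilon>" using assms by (simp add: s_def)
    finally show False using that norm_le_l1[of z] by simp
  qed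
  have cH: "continuous_on UNIV H" using Hk[of 0] by simp
  have cs: "\<And>z. z \<notin> cball 0 \<epsilon> \<Longrightarrow> H z = 0" using Hz by auto
  have iH: "integrable lborel H"
  proof -
    have "integrable lborel (\<lambda>z. indicator (cball 0 \<epsilon>) z *\<^sub>R H z)"
      by (rule borel_integrable_compact) (auto intro: continuous_on_subset[OF cH])
    moreover have "(\<lambda>z. indicator (cball 0 \<epsilon>) z *\<^sub>R H z) = H" using cs by (auto simp: indicator_def fun_eq_iff)
    ultimately show ?thesis by simp
  qed
  define c where "c = (LINT z|lborel. H z)"
  \<comment> \<open>A nonnegative function with integral 0 vanishes almost everywhere; the zero set
    is closed, so it would contain the origin, where every factor is positive.\<close>
  have "c \<noteq> 0"
  proof
    assume "c = 0"
    then have "AE z in lborel. H z = 0"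
      using integral_nonneg_eq_0_iff_AE[OF iH] H0 by (simp add: c_def)
    then have "AE z in lebesgue. z \<in> {z. H z = 0}" by (simp add: AE_completion)
    moreover have "closed {z. H z = 0}" using cH by (intro closed_Collect_eq) auto
    ultimately have "H 0 = 0" using mem_closed_if_AE_lebesgue[of "{z. H z = 0}" 0] by simp
    moreover have "0 < H 0" unfolding H_def using B(3)[of 1] by (intro prod_pos) auto
    ultimately show False by simp
  qed
  moreover have "0 \<le> c" unfolding c_def using H0 by (intro integral_nonneg_AE) auto
  ultimately have c: "0 < c" by simp
  define J where "J z = H z * (1 / c)" for z
  have Jk: "C_k n J" for n unfolding J_def by (intro C_k_mult Hk C_k_const)
  define g where "g = (\<lambda>z. \<Sum>b\<in>Basis. frechet_derivative J (at z) b *\<^sub>R b)"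
  have g: "is_grad J g" "continuous_on UNIV g" using C_k_grad[of J] Jk unfolding g_def by blast+
  show ?thesis
  proof (rule that[of J g])
    show "g z = 0" if "\<epsilon> < norm z" for z
      by (rule is_grad_zero[OF g(1), of "cball 0 \<epsilon>"]) (use that Hz in \<open>auto simp: J_def\<close>)
    show "integrable lborel J" "(LINT z|lborel. J z) = 1" using iH c by (auto simp: J_def[abs_def] c_def[symmetric])
  qed (use Jk g H0 Hz c in \<open>auto simp: J_def\<close>)
qed

lemma grad_mean_value:
  assumes "is_grad h g"
  shows "\<exists>t\<in>{0<..<1}. h (u + v) - h u = g (u + t *\<^sub>R v) \<bullet> v"
proof -
  have "((\<lambda>t. h (u + t *\<^sub>R v)) has_derivative (\<lambda>s. g (u + t *\<^sub>R v) \<bullet> (s *\<^sub>R v))) (at t within {0..1})" for t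
    by (rule has_derivative_compose[where g = h and f = "\<lambda>t. u + t *\<^sub>R v"])
      (use assms in \<open>auto intro!: derivative_eq_intros simp: is_grad_def\<close>)
  then show ?thesis
    using mvt_very_simple[of 0 1 "\<lambda>t. h (u + t *\<^sub>R v)" "\<lambda>t s. g (u + t *\<^sub>R v) \<bullet> (s *\<^sub>R v)"]
      mvt_simple[of 0 1 "\<lambda>t. h (u + t *\<^sub>R v)" "\<lambda>t s. g (u + t *\<^sub>R v) \<bullet> (s *\<^sub>R v)"] by auto
qed

text \<open>Weighted averages of translates; this covers mollification as well as averages along a line.\<close>

lemma is_grad_average:
  fixes h :: "'a::euclidean_space \<Rightarrow> real" and w :: "'b \<Rightarrow> real"
  assumes h: "is_grad h g" and g: "uniformly_continuous_on UNIV g" "\<And>z. norm (g z) \<le> G" "\<And>z. \<bar>h z\<bar> \<le> C"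
    and w: "integrable M w" and \<zeta>[measurable]: "\<zeta> \<in> borel_measurable M"
  shows "is_grad (\<lambda>z. LINT r|M. w r * h (z - \<zeta> r)) (\<lambda>z. LINT r|M. w r *\<^sub>R g (z - \<zeta> r))"
  unfolding is_grad_def has_derivative_at_alt
proof (intro allI conjI impI)
  have [measurable]: "h \<in> borel_measurable borel" "g \<in> borel_measurable borel" "w \<in> borel_measurable M"
    using is_grad_continuous[OF h] uniformly_continuous_imp_continuous[OF g(1)] w
    by (auto intro: borel_measurable_continuous_onI)
  have ih: "integrable M (\<lambda>r. w r * h (z - \<zeta> r))" for z
    using w g(3) by (intro integrable_mult_bounded[of _ _ _ C]) auto
  have ig: "integrable M (\<lambda>r. w r *\<^sub>R g (z - \<zeta> r))" for z
    using w g(2) by (intro integrable_scaleR_bounded[of _ _ _ G]) auto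
  fix z
  show "bounded_linear ((\<bullet>) (LINT r|M. w r *\<^sub>R g (z - \<zeta> r)))" by (rule bounded_linear_inner_right)
  fix e :: real assume "0 < e"
  define W where "W = (LINT r|M. \<bar>w r\<bar>) + 1"
  have W: "0 < W" unfolding W_def by (intro add_nonneg_pos integral_nonneg_AE) auto
  obtain d where d: "d > 0" "\<And>x y. dist x y < d \<Longrightarrow> dist (g x) (g y) < e / W"
    using g(1) \<open>0 < e\<close> W unfolding uniformly_continuous_on_def by (metis UNIV_I divide_pos_pos)
  \<comment> \<open>Uniform continuity of the gradient makes the first-order remainder uniform in
    the base point, so it can be integrated against the weight.\<close>
  have pw: "\<bar>h (u + v) - h u - g u \<bullet> v\<bar> \<le> e / W * norm v" if "norm v < d" for u v
  proof -
    obtain t where t: "t \<in> {0<..<1}" "h (u + v) - h u = g (u + t *\<^sub>R v) \<bullet> v" using grad_mean_value[OF h] by blast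
    have "h (u + v) - h u - g u \<bullet> v = (g (u + t *\<^sub>R v) - g u) \<bullet> v" by (simp add: t(2) inner_diff_left)
    also have "\<bar>\<dots>\<bar> \<le> norm (g (u + t *\<^sub>R v) - g u) * norm v" by (rule Cauchy_Schwarz_ineq2)
    also have "\<dots> \<le> e / W * norm v"
    proof (rule mult_right_mono)
      have "t * norm v \<le> 1 * norm v" using t(1) by (intro mult_right_mono) auto
      then have "dist (u + t *\<^sub>R v) u < d" using t(1) that by (simp add: dist_norm)
      then show "norm (g (u + t *\<^sub>R v) - g u) \<le> e / W" using d(2) by (metis dist_norm less_imp_le)
    qed simp
    finally show ?thesis .
  qed
  show "\<exists>d>0. \<forall>y. norm (y - z) < d \<longrightarrow> norm ((LINT r|M. w r * h (y - \<zeta> r)) - (LINT r|M. w r * h (z - \<zeta> r)) -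
      (LINT r|M. w r *\<^sub>R g (z - \<zeta> r)) \<bullet> (y - z)) \<le> e * norm (y - z)"
  proof (intro exI conjI allI impI, rule d(1))
    fix y assume y: "norm (y - z) < d"
    let ?v = "y - z"
    have e1: "(LINT r|M. w r *\<^sub>R g (z - \<zeta> r)) \<bullet> ?v = (LINT r|M. (w r *\<^sub>R g (z - \<zeta> r)) \<bullet> ?v)"
      using ig[of z] by (intro integral_inner_left[symmetric])
    have "integrable M (\<lambda>r. (w r *\<^sub>R g (z - \<zeta> r)) \<bullet> ?v)" using ig[of z] by (rule integrable_inner_left)
    then have "(LINT r|M. w r * h (y - \<zeta> r)) - (LINT r|M. w r * h (z - \<zeta> r)) - (LINT r|M. w r *\<^sub>R g (z - \<zeta> r)) \<bullet> ?v
      = (LINT r|M. w r * h (y - \<zeta> r) - w r * h (z - \<zeta> r) - (w r *\<^sub>R g (z - \<zeta> r)) \<bullet> ?v)"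
      using ih ig unfolding e1
      by (subst Bochner_Integration.integral_diff) (auto intro!: Bochner_Integration.integral_diff[symmetric])
    also have "norm \<dots> \<le> (LINT r|M. \<bar>w r\<bar> * (e / W * norm ?v))"
    proof (rule norm_integral_le)
      show "integrable M (\<lambda>r. \<bar>w r\<bar> * (e / W * norm ?v))" using w by simp
      fix r
      have "w r * h (y - \<zeta> r) - w r * h (z - \<zeta> r) - (w r *\<^sub>R g (z - \<zeta> r)) \<bullet> ?v
         = w r * (h ((z - \<zeta> r) + ?v) - h (z - \<zeta> r) - g (z - \<zeta> r) \<bullet> ?v)"
        by (simp add: algebra_simps)
      then show "norm (w r * h (y - \<zeta> r) - w r * h (z - \<zeta> r) - (w r *\<^sub>R g (z - \<zeta> r)) \<bullet> ?v)
          \<le> \<bar>w r\<bar> * (e / W * norm ?v)"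
        using mult_left_mono[OF pw[OF y, of "z - \<zeta> r"], of "\<bar>w r\<bar>"] by (simp add: abs_mult)
    qed
    also have "\<dots> = (LINT r|M. \<bar>w r\<bar>) * (e / W * norm ?v)" by simp
    also have "\<dots> \<le> W * (e / W * norm ?v)"
      using W \<open>0 < e\<close> by (intro mult_right_mono) (auto simp: W_def)
    also have "\<dots> = e * norm ?v" using W by simp
    finally show "norm ((LINT r|M. w r * h (y - \<zeta> r)) - (LINT r|M. w r * h (z - \<zeta> r)) -
      (LINT r|M. w r *\<^sub>R g (z - \<zeta> r)) \<bullet> (y - z)) \<le> e * norm (y - z)" .
  qed
qed


section \<open>Extension from smooth to continuously differentiable test functions\<close>

text \<open>The compensation argument tests with the product of a cut-off and a potential of which
  only continuity of the gradient is known. The gradient is carried along because the weak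
  formulations integrate against it.\<close>

definition c1_test :: "'a::euclidean_space set \<Rightarrow> ('a \<Rightarrow> real) \<Rightarrow> ('a \<Rightarrow> 'a) \<Rightarrow> bool" where
  "c1_test \<Omega> \<phi> g \<longleftrightarrow> is_grad \<phi> g \<and> continuous_on UNIV g \<and>
     (\<exists>K. compact K \<and> K \<subseteq> \<Omega> \<and> (\<forall>z. z \<notin> K \<longrightarrow> \<phi> z = 0))"

lemma bounded_compact_support:
  fixes f :: "'a::euclidean_space \<Rightarrow> 'b::real_normed_vector"
  assumes "continuous_on UNIV f" "compact K" "\<And>z. z \<notin> K \<Longrightarrow> f z = 0"
  obtains C where "0 < C" "\<And>z. norm (f z) \<le> C"
proof -
  have "compact (f ` K)" using assms by (intro compact_continuous_image) (auto intro: continuous_on_subset)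
  then obtain C where C: "0 < C" "\<forall>y\<in>f ` K. norm y \<le> C" using compact_imp_bounded bounded_pos by metis
  show ?thesis
  proof (rule that[of C])
    fix z show "norm (f z) \<le> C" using C assms(3)[of z] by (cases "z \<in> K") auto
  qed fact
qed

lemma c1_testE:
  assumes "c1_test \<Omega> \<phi> g"
  obtains K C where "compact K" "K \<subseteq> \<Omega>" "\<And>z. z \<notin> K \<Longrightarrow> \<phi> z = 0" "\<And>z. z \<notin> K \<Longrightarrow> g z = 0"
    "0 < C" "\<And>z. \<bar>\<phi> z\<bar> \<le> C" "\<And>z. norm (g z) \<le> C" "is_grad \<phi> g" "continuous_on UNIV g"
    "continuous_on UNIV \<phi>" "uniformly_continuous_on UNIV g" "uniformly_continuous_on UNIV \<phi>"
proof -
  obtain K where K: "compact K" "K \<subseteq> \<Omega>" "\<And>z. z \<notin> K \<Longrightarrow> \<phi> z = 0"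
    and g: "is_grad \<phi> g" "continuous_on UNIV g" using assms unfolding c1_test_def by blast
  have gz: "g z = 0" if "z \<notin> K" for z
    by (rule is_grad_zero[OF g(1) compact_imp_closed[OF K(1)] K(3) that])
  note c = is_grad_continuous[OF g(1)]
  obtain C1 where C1: "0 < C1" "\<And>z. norm (g z) \<le> C1" using bounded_compact_support[OF g(2) K(1) gz] by blast
  obtain C2 where C2: "0 < C2" "\<And>z. norm (\<phi> z) \<le> C2" using bounded_compact_support[OF c K(1,3)] by blast
  show ?thesis
  proof (rule that[OF K gz, of "max C1 C2"])
    show "\<bar>\<phi> z\<bar> \<le> max C1 C2" for z using C2(2)[of z] by (simp add: le_max_iff_disj)
    show "norm (g z) \<le> max C1 C2" for z using C1(2)[of z] by (simp add: le_max_iff_disj)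
  qed (use C1 g c K(1) in \<open>auto intro: uniformly_continuous_compact_support K gz\<close>)
qed

text \<open>A derivative of the average is the average of a derivative of \<open>h\<close>, and the
  latter is again smooth and supported in \<open>K\<close>; hence the induction over all such
  \<open>h\<close>.\<close>

lemma C_k_average:
  fixes h :: "'a::euclidean_space \<Rightarrow> real"
  assumes "\<And>m. C_k m h" "compact K" "\<And>z. z \<notin> K \<Longrightarrow> h z = 0"
    and w: "integrable M w" and \<zeta>: "\<zeta> \<in> borel_measurable M"
  shows "C_k n (\<lambda>z. LINT r|M. w r * h (z - \<zeta> r))"
  using assms(1,3)
proof (induction n arbitrary: h)
  case hyp: 0
  define g where "g = (\<lambda>z. \<Sum>b\<in>Basis. frechet_derivative h (at z) b *\<^sub>R b)"
  have g: "is_grad h g" "continuous_on UNIV g" using C_k_grad[of h] hyp(1) unfolding g_def by blast+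
  have "c1_test UNIV h g" using g assms(2) hyp(2) by (auto simp: c1_test_def)
  then obtain C where C: "\<And>z. \<bar>h z\<bar> \<le> C" "\<And>z. norm (g z) \<le> C" "uniformly_continuous_on UNIV g"
    by (rule c1_testE) blast
  show ?case using is_grad_continuous[OF is_grad_average[OF g(1) C(3,2,1) w \<zeta>]] by simp
next
  case hyp: (Suc n)
  define g where "g = (\<lambda>z. \<Sum>b\<in>Basis. frechet_derivative h (at z) b *\<^sub>R b)"
  have g: "is_grad h g" "continuous_on UNIV g" using C_k_grad[of h] hyp(2) unfolding g_def by blast+
  have c1: "c1_test UNIV h g" using g assms(2) hyp(3) by (auto simp: c1_test_def)
  then obtain C where C: "\<And>z. \<bar>h z\<bar> \<le> C" "\<And>z. norm (g z) \<le> C" "uniformly_continuous_on UNIV g"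
    by (rule c1_testE) blast
  have gz: "g z = 0" if "z \<notin> K" for z
    by (rule is_grad_zero[OF g(1) compact_imp_closed[OF assms(2)] hyp(3) that])
  have [measurable]: "g \<in> borel_measurable borel" "\<zeta> \<in> borel_measurable M"
    using g(2) \<zeta> by (auto intro: borel_measurable_continuous_onI)
  note av = is_grad_average[OF g(1) C(3,2,1) w \<zeta>]
  show ?case
  proof (rule C_k_SucI)
    show "((\<lambda>z. LINT r|M. w r * h (z - \<zeta> r)) has_derivative (\<lambda>v. (LINT r|M. w r *\<^sub>R g (z - \<zeta> r)) \<bullet> v)) (at z)" for z
      using av unfolding is_grad_def by blast
    fix v
    have "integrable M (\<lambda>r. w r *\<^sub>R g (z - \<zeta> r))" for z
      using w C(2) by (intro integrable_scaleR_bounded[of _ _ _ C]) auto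
    then have "(\<lambda>z. (LINT r|M. w r *\<^sub>R g (z - \<zeta> r)) \<bullet> v) = (\<lambda>z. LINT r|M. w r * (g (z - \<zeta> r) \<bullet> v))"
      by (simp add: integral_inner_left[symmetric])
    moreover have "C_k n (\<lambda>z. LINT r|M. w r * (g (z - \<zeta> r) \<bullet> v))"
    proof (rule hyp.IH)
      have "(\<lambda>z. g z \<bullet> v) = (\<lambda>z. frechet_derivative h (at z) v)"
        using is_grad_frechet[OF g(1)] by (simp add: fun_eq_iff)
      then show "C_k m (\<lambda>z. g z \<bullet> v)" for m using hyp(2)[of "Suc m"] by simp
    qed (simp add: gz)
    ultimately show "C_k n (\<lambda>z. (LINT r|M. w r *\<^sub>R g (z - \<zeta> r)) \<bullet> v)" by simp
  qed
qed

text \<open>Mollifying at a radius below \<open>d\<close> keeps the support in the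
  \<open>d\<close>-neighbourhood of \<open>K\<close> and preserves the sign; the gradient is
  mollified as well and is close to \<open>g\<close> by uniform continuity.\<close>

lemma c1_test_approx:
  fixes \<phi> :: "'a::euclidean_space \<Rightarrow> real"
  assumes \<Omega>: "open \<Omega>" and \<phi>: "c1_test \<Omega> \<phi> g" and "0 < e"
    and K: "compact K" "\<And>z. z \<notin> K \<Longrightarrow> \<phi> z = 0" and d: "0 < d" "{x. infdist x K \<le> d} \<subseteq> \<Omega>"
  obtains \<phi>' g' where "test_function \<Omega> \<phi>'" "is_grad \<phi>' g'" "\<And>z. norm (g' z - g z) \<le> e"
    "\<And>z. d < infdist z K \<Longrightarrow> g' z = 0" "(\<forall>z. 0 \<le> \<phi> z) \<Longrightarrow> (\<forall>z. 0 \<le> \<phi>' z)" "continuous_on UNIV g'"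
proof (cases "K = {}")
  case True
  then have "\<phi> = (\<lambda>_. 0)" using K by auto
  then have g0: "g = (\<lambda>_. 0)" using is_grad_unique[of \<phi> g "\<lambda>_. 0"] \<phi> by (auto simp: c1_test_def is_grad_def)
  show ?thesis
    by (rule that[of "\<lambda>_. 0" "\<lambda>_. 0"])
      (use \<open>0 < e\<close> in \<open>auto simp: g0 test_function_def C_k_const is_grad_def\<close>)
next
  case ne: False
  obtain C where C: "\<And>z. \<bar>\<phi> z\<bar> \<le> C" "\<And>z. norm (g z) \<le> C" "is_grad \<phi> g" "uniformly_continuous_on UNIV g"
    "continuous_on UNIV \<phi>" "continuous_on UNIV g"
    using \<phi> by (rule c1_testE) blast
  obtain d1 where d1: "d1 > 0" "\<And>x y. dist x y < d1 \<Longrightarrow> dist (g x) (g y) < e"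
    using C(4) \<open>0 < e\<close> unfolding uniformly_continuous_on_def by (metis UNIV_I)
  define \<epsilon> where "\<epsilon> = min d d1"
  have \<epsilon>: "0 < \<epsilon>" using d d1 by (simp add: \<epsilon>_def)
  obtain J :: "'a \<Rightarrow> real" and gJ where J: "\<And>n. C_k n J" "is_grad J gJ" "continuous_on UNIV gJ"
    "\<And>z. 0 \<le> J z" "\<And>z. \<epsilon> \<le> norm z \<Longrightarrow> J z = 0" "\<And>z. \<epsilon> < norm z \<Longrightarrow> gJ z = 0"
    "integrable lborel J" "(LINT z|lborel. J z) = 1" using mollifier_exists[OF \<epsilon>] by metis
  have [measurable]: "\<phi> \<in> borel_measurable borel" "g \<in> borel_measurable borel" "J \<in> borel_measurable borel"
    using C J C_k_continuous by (auto intro: borel_measurable_continuous_onI)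
  have i\<phi>: "integrable lborel \<phi>"
  proof -
    have "integrable lborel (\<lambda>z. indicator K z *\<^sub>R \<phi> z)"
      by (rule borel_integrable_compact[OF K(1)]) (auto intro: continuous_on_subset[OF C(5)])
    moreover have "(\<lambda>z. indicator K z *\<^sub>R \<phi> z) = \<phi>" using K(2) by (auto simp: indicator_def fun_eq_iff)
    ultimately show ?thesis by simp
  qed
  \<comment> \<open>The same convolution is read in two ways: as an average of translates of
    \<open>J\<close> it is smooth, and as an average of translates of \<phi> its gradient is the
    average of \<open>g\<close>.\<close>
  define \<phi>' where "\<phi>' z = (LINT \<zeta>|lborel. \<phi> \<zeta> * J (z - \<zeta>))" for z
  define g' where "g' z = (LINT \<zeta>|lborel. J \<zeta> *\<^sub>R g (z - \<zeta>))" for z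
  have \<phi>'2: "\<phi>' z = (LINT \<zeta>|lborel. J \<zeta> * \<phi> (z - \<zeta>))" for z
    unfolding \<phi>'_def using lborel_integral_reflect[of "\<lambda>\<zeta>. \<phi> \<zeta> * J (z - \<zeta>)" z] by (simp add: mult.commute)
  have gr: "is_grad \<phi>' g'"
    unfolding \<phi>'2[abs_def] g'_def[abs_def]
    using is_grad_average[OF C(3,4,2,1) J(7), of "\<lambda>\<zeta>. \<zeta>"] by simp
  have Ck: "C_k n \<phi>'" for n
    unfolding \<phi>'_def[abs_def]
    by (rule C_k_average[OF J(1), of "cball 0 \<epsilon>"]) (use J(5) i\<phi> in auto)
  have far: "\<phi>' z = 0" if "d \<le> infdist z K" for z
  proof -
    have "J \<zeta> * \<phi> (z - \<zeta>) = 0" for \<zeta>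
    proof (cases "norm \<zeta> < \<epsilon>")
      case True
      have "infdist z K \<le> norm \<zeta>" if "z - \<zeta> \<in> K"
        using infdist_le[OF that, of z] by (simp add: dist_norm)
      then have "z - \<zeta> \<notin> K" using \<open>d \<le> infdist z K\<close> True by (auto simp: \<epsilon>_def)
      then show ?thesis using K by simp
    qed (use J(5) in simp)
    then have "(\<lambda>\<zeta>. J \<zeta> * \<phi> (z - \<zeta>)) = (\<lambda>_. 0)" by blast
    then show ?thesis by (simp only: \<phi>'2) simp
  qed
  have sub: "closure {z. \<phi>' z \<noteq> 0} \<subseteq> {x. infdist x K \<le> d}"
  proof (rule closure_minimal)
    show "{z. \<phi>' z \<noteq> 0} \<subseteq> {x. infdist x K \<le> d}" using far by (auto simp: not_le[symmetric] intro: ccontr)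
    show "closed {x. infdist x K \<le> d}" by (intro closed_Collect_le continuous_intros)
  qed
  have cpt: "compact {x. infdist x K \<le> d}" by (rule compact_infdist_le[OF ne K(1) d(1)])
  show ?thesis
  proof (rule that[of \<phi>' g'])
    show "test_function \<Omega> \<phi>'"
    proof -
      have "closure {z. \<phi>' z \<noteq> 0} \<inter> {x. infdist x K \<le> d} = closure {z. \<phi>' z \<noteq> 0}" using sub by blast
      then have "compact (closure {z. \<phi>' z \<noteq> 0})" using closed_Int_compact[OF closed_closure cpt] by metis
      then show ?thesis unfolding test_function_def using Ck sub d(2) by blast
    qed
    show "is_grad \<phi>' g'" by (rule gr)
    show "norm (g' z - g z) \<le> e" for z
    proof -
      have i1: "integrable lborel (\<lambda>\<zeta>. J \<zeta> *\<^sub>R g (z - \<zeta>))"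
        using J(7) C(2) by (intro integrable_scaleR_bounded[of _ _ _ C]) auto
      have "g' z - g z = (LINT \<zeta>|lborel. J \<zeta> *\<^sub>R g (z - \<zeta>)) - (LINT \<zeta>|lborel. J \<zeta> *\<^sub>R g z)"
        using J(7,8) by (simp add: g'_def)
      also have "\<dots> = (LINT \<zeta>|lborel. J \<zeta> *\<^sub>R (g (z - \<zeta>) - g z))"
        using i1 J(7) by (simp add: scaleR_diff_right)
      also have "norm \<dots> \<le> (LINT \<zeta>|lborel. J \<zeta> * e)"
      proof (rule norm_integral_le)
        fix \<zeta>
        show "norm (J \<zeta> *\<^sub>R (g (z - \<zeta>) - g z)) \<le> J \<zeta> * e"
        proof (cases "norm \<zeta> < \<epsilon>")
          case True
          then have "dist (g (z - \<zeta>)) (g z) < e" by (intro d1(2)) (simp add: \<epsilon>_def dist_norm)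
          then show ?thesis using J(4)[of \<zeta>] by (simp add: dist_norm mult_left_mono)
        qed (use J(5) in simp)
      qed (use J(7) in simp)
      finally show ?thesis using J(8) by simp
    qed
    show "g' z = 0" if "d < infdist z K" for z
      by (rule is_grad_zero[OF gr, of "{x. infdist x K \<le> d}"])
        (use far that in \<open>auto intro!: closed_Collect_le continuous_intros\<close>)
    show "\<forall>z. 0 \<le> \<phi>' z" if "\<forall>z. 0 \<le> \<phi> z"
      unfolding \<phi>'2 using that J(4) by (auto intro!: integral_nonneg_AE)
    show "continuous_on UNIV g'"
      using C_k_grad(2)[of \<phi>', OF Ck] is_grad_unique[OF gr C_k_grad(1)[OF Ck]] by simp
  qed
qed

text \<open>The flag \<open>pos\<close> restricts the hypothesis to nonnegative test functions; in this way one statement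
  serves the weak formulation and the entropy inequality.\<close>

lemma test_function_extend:
  fixes V :: "'a::euclidean_space \<Rightarrow> 'a"
  assumes \<Omega>: "open \<Omega>" and [measurable]: "V \<in> borel_measurable borel"
    and V: "\<And>K. compact K \<Longrightarrow> K \<subseteq> \<Omega> \<Longrightarrow> \<exists>C. AE z in lborel. z \<in> K \<longrightarrow> norm (V z) \<le> C"
    and ent: "\<And>\<phi> g. test_function \<Omega> \<phi> \<Longrightarrow> is_grad \<phi> g \<Longrightarrow> (pos \<longrightarrow> (\<forall>z. 0 \<le> \<phi> z)) \<Longrightarrow> 0 \<le> (LINT z|lborel. V z \<bullet> g z)"
    and \<phi>: "c1_test \<Omega> \<phi> g" "pos \<longrightarrow> (\<forall>z. 0 \<le> \<phi> z)"
  shows "0 \<le> (LINT z|lborel. V z \<bullet> g z)"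
proof -
  obtain K where K: "compact K" "K \<subseteq> \<Omega>" "\<And>z. z \<notin> K \<Longrightarrow> \<phi> z = 0" "\<And>z. z \<notin> K \<Longrightarrow> g z = 0"
    and cg: "continuous_on UNIV g"
    using \<phi>(1) by (rule c1_testE) blast
  show ?thesis
  proof (cases "K = {}")
    case True then show ?thesis using K by simp
  next
    case ne: False
    obtain d where d: "0 < d" "{x. infdist x K \<le> d} \<subseteq> \<Omega>"
      using compact_in_open_separated[OF ne K(1) \<Omega> K(2)] by blast
    define K' where "K' = {x. infdist x K \<le> d}"
    have K': "compact K'" "K' \<subseteq> \<Omega>" "K \<subseteq> K'"
      using compact_infdist_le[OF ne K(1) d(1)] d by (auto simp: K'_def)
    have [measurable]: "K' \<in> sets borel" using K'(1) by (simp add: compact_imp_closed)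
    obtain C where C: "AE z in lborel. z \<in> K' \<longrightarrow> norm (V z) \<le> C" using V[OF K'(1,2)] by blast
    define I where "I = (LINT z|lborel. \<bar>C\<bar> * indicator K' z)"
    have iK: "integrable lborel (indicator K' :: 'a \<Rightarrow> real)"
      using emeasure_bounded_finite[OF compact_imp_bounded[OF K'(1)]] by (intro integrable_real_indicator) auto
    have I: "0 \<le> I" unfolding I_def by (intro integral_nonneg_AE) auto
    have iV: "integrable lborel (\<lambda>z. V z \<bullet> h z)"
      if h: "continuous_on UNIV h" "\<And>z. z \<notin> K' \<Longrightarrow> h z = 0" for h :: "'a \<Rightarrow> 'a"
    proof -
      obtain B where B: "0 < B" "\<And>z. norm (h z) \<le> B" using bounded_compact_support[OF h(1) K'(1) h(2)] by blast
      have [measurable]: "h \<in> borel_measurable borel" using h(1) by (rule borel_measurable_continuous_onI)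
      show ?thesis
      proof (rule Bochner_Integration.integrable_bound[where f = "\<lambda>z. (\<bar>C\<bar> * B) * indicator K' z"])
        show "AE z in lborel. norm (V z \<bullet> h z) \<le> norm (\<bar>C\<bar> * B * indicator K' z)"
          using C
        proof eventually_elim
          case (elim z)
          show ?case
          proof (cases "z \<in> K'")
            case True
            have "\<bar>V z \<bullet> h z\<bar> \<le> norm (V z) * norm (h z)" by (rule Cauchy_Schwarz_ineq2)
            also have "\<dots> \<le> \<bar>C\<bar> * B" using elim True B by (intro mult_mono) auto
            finally show ?thesis using True B(1) by simp
          qed (simp add: h(2))
        qed
      qed (use iK in simp_all)
    qed
    show ?thesis
    proof (rule field_le_epsilon)
      fix e :: real assume "0 < e"
      define e' where "e' = e / (I + 1)"
      have e': "0 < e'" using \<open>0 < e\<close> I by (simp add: e'_def)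
      obtain \<phi>' g' where a: "test_function \<Omega> \<phi>'" "is_grad \<phi>' g'" "\<And>z. norm (g' z - g z) \<le> e'"
        "\<And>z. d < infdist z K \<Longrightarrow> g' z = 0" "(\<forall>z. 0 \<le> \<phi> z) \<Longrightarrow> (\<forall>z. 0 \<le> \<phi>' z)" "continuous_on UNIV g'"
        using c1_test_approx[OF \<Omega> \<phi>(1) e' K(1,3) d] by blast
      have z: "g' z = 0" "g z = 0" if "z \<notin> K'" for z using that a(4)[of z] K(4) K'(3) by (auto simp: K'_def)
      have 0: "0 \<le> (LINT z|lborel. V z \<bullet> g' z)" using ent[OF a(1,2)] a(5) \<phi>(2) by blast
      have i1: "integrable lborel (\<lambda>z. V z \<bullet> g' z)" "integrable lborel (\<lambda>z. V z \<bullet> g z)"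
        using iV[OF a(6)] iV[OF cg] z by auto
      have "(LINT z|lborel. V z \<bullet> g' z) - (LINT z|lborel. V z \<bullet> g z) = (LINT z|lborel. V z \<bullet> g' z - V z \<bullet> g z)"
        using i1 by simp
      also have "\<dots> \<le> (LINT z|lborel. e' * (\<bar>C\<bar> * indicator K' z))"
      proof (rule integral_mono_AE)
        show "AE z in lborel. V z \<bullet> g' z - V z \<bullet> g z \<le> e' * (\<bar>C\<bar> * indicator K' z)"
          using C
        proof eventually_elim
          case (elim z)
          show ?case
          proof (cases "z \<in> K'")
            case True
            have "V z \<bullet> g' z - V z \<bullet> g z \<le> norm (V z) * norm (g' z - g z)"
              using norm_cauchy_schwarz[of "V z" "g' z - g z"] by (simp add: inner_diff_right)
            also have "\<dots> \<le> \<bar>C\<bar> * e'" using elim True a(3) by (intro mult_mono) auto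
            finally show ?thesis using True by (simp add: mult.commute)
          qed (simp add: z)
        qed
      qed (use i1 iK in auto)
      also have "\<dots> = e' * I" by (simp add: I_def)
      also have "\<dots> \<le> e" using \<open>0 < e\<close> I by (simp add: e'_def divide_le_eq mult_left_mono)
      finally show "0 \<le> (LINT z|lborel. V z \<bullet> g z) + e" using 0 by linarith
    qed
  qed
qed

section \<open>Doubling of variables and the contraction in \<open>L\<^sup>1\<close>\<close>

lemma L1_shift_small:
  fixes f :: "'a::euclidean_space \<Rightarrow> real"
  assumes f: "integrable lborel f" and "0 < e"
  obtains d where "0 < d" "\<And>c. norm c < d \<Longrightarrow> (LINT x|lborel. \<bar>f (x + c) - f x\<bar>) < e"
proof (rule ccontr)
  assume n: "\<not> thesis"
  have "\<forall>n::nat. \<exists>c. norm c < 1 / real (Suc n) \<and> \<not> (LINT x|lborel. \<bar>f (x + c) - f x\<bar>) < e"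
  proof
    fix n :: nat
    show "\<exists>c. norm c < 1 / real (Suc n) \<and> \<not> (LINT x|lborel. \<bar>f (x + c) - f x\<bar>) < e"
      using that[of "1 / real (Suc n)"] n by auto
  qed
  then obtain c where c: "\<And>n. norm (c n) < 1 / real (Suc n)" "\<And>n. \<not> (LINT x|lborel. \<bar>f (x + c n) - f x\<bar>) < e"
    by metis
  have "(\<lambda>n. 1 / real (Suc n)) \<longlonglongrightarrow> 0" using LIMSEQ_inverse_real_of_nat by (simp add: inverse_eq_divide)
  then have "(\<lambda>n. norm (c n)) \<longlonglongrightarrow> 0"
    by (rule tendsto_sandwich[of "\<lambda>_. 0", rotated 3])
      (use c(1) in \<open>auto intro!: always_eventually less_imp_le\<close>)
  then have "c \<longlonglongrightarrow> 0" by (rule tendsto_norm_zero_cancel)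
  from L1_shift_tendsto[OF f this] have "eventually (\<lambda>n. (LINT x|lborel. \<bar>f (x + c n) - f x\<bar>) < e) sequentially"
    using \<open>0 < e\<close> by (rule order_tendstoD)
  then show False using c(2) by simp
qed

lemma is_grad_mult:
  assumes "is_grad f g" "is_grad h k"
  shows "is_grad (\<lambda>z. f z * h z) (\<lambda>z. h z *\<^sub>R g z + f z *\<^sub>R k z)"
  unfolding is_grad_def
proof
  fix z
  have "((\<lambda>z. f z * h z) has_derivative (\<lambda>v. f z * (k z \<bullet> v) + (g z \<bullet> v) * h z)) (at z)"
    using assms unfolding is_grad_def by (intro has_derivative_mult) auto
  then show "((\<lambda>z. f z * h z) has_derivative (\<bullet>) (h z *\<^sub>R g z + f z *\<^sub>R k z)) (at z)"
    by (rule has_derivative_eq_rhs) (auto simp: algebra_simps)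
qed

lemma is_grad_cmult: "is_grad f g \<Longrightarrow> is_grad (\<lambda>z. c * f z) (\<lambda>z. c *\<^sub>R g z)"
  using is_grad_mult[of "\<lambda>_. c" "\<lambda>_. 0" f g] by (simp add: is_grad_def)

lemma is_grad_add: "is_grad f g \<Longrightarrow> is_grad h k \<Longrightarrow> is_grad (\<lambda>z. f z + h z) (\<lambda>z. g z + k z)"
  unfolding is_grad_def
  by (auto intro!: has_derivative_eq_rhs[OF has_derivative_add] simp: inner_add_left)

lemma is_grad_shift: "is_grad f g \<Longrightarrow> is_grad (\<lambda>z. f (z - c)) (\<lambda>z. g (z - c))"
  unfolding is_grad_def
proof
  fix z assume "\<forall>z. (f has_derivative (\<bullet>) (g z)) (at z)"
  then have "(f has_derivative (\<bullet>) (g (z - c))) (at (z - c))" by blast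
  moreover have "((\<lambda>z. z - c) has_derivative (\<lambda>v. v)) (at z)" by (auto intro!: derivative_eq_intros)
  ultimately show "((\<lambda>z. f (z - c)) has_derivative (\<bullet>) (g (z - c))) (at z)"
    using has_derivative_compose[of "\<lambda>z. z - c" "\<lambda>v. v" z UNIV f] by blast
qed

lemma is_grad_reflect: "is_grad f g \<Longrightarrow> is_grad (\<lambda>z. f (c - z)) (\<lambda>z. - g (c - z))"
  unfolding is_grad_def
proof
  fix z assume "\<forall>z. (f has_derivative (\<bullet>) (g z)) (at z)"
  then have "(f has_derivative (\<bullet>) (g (c - z))) (at (c - z))" by blast
  moreover have "((\<lambda>z. c - z) has_derivative (\<lambda>v. - v)) (at z)" by (auto intro!: derivative_eq_intros)
  ultimately have "((\<lambda>z. f (c - z)) has_derivative (\<lambda>v. g (c - z) \<bullet> (- v))) (at z)"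
    using has_derivative_compose[of "\<lambda>z. c - z" "\<lambda>v. - v" z UNIV f] by blast
  then show "((\<lambda>z. f (c - z)) has_derivative (\<bullet>) (- g (c - z))) (at z)"
    by (rule has_derivative_eq_rhs) (simp add: fun_eq_iff)
qed

section \<open>Kruzhkov entropy fluxes for a general flux\<close>

text \<open>Time is treated as one of the coordinates of \<open>X\<close>. For the space-time flux
  the first component is the Kruzhkov entropy and the rest is its flux.\<close>

definition kflux :: "(real \<Rightarrow> 'a::euclidean_space) \<Rightarrow> real \<Rightarrow> real \<Rightarrow> 'a" where
  "kflux X w c = sgn (w - c) *\<^sub>R (X w - X c)"

text \<open>This symmetry lets either solution play the role of the constant when the variables are
  doubled.\<close>

lemma kflux_commute: "kflux X w c = kflux X c w"
  unfolding kflux_def by (cases w c rule: linorder_cases) auto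

lemma kflux_measurable [measurable]:
  assumes [measurable]: "X \<in> borel_measurable borel" "f \<in> borel_measurable M" "g \<in> borel_measurable M"
  shows "(\<lambda>z. kflux X (f z) (g z)) \<in> borel_measurable M"
  unfolding kflux_def by measurable

text \<open>The jump of \<open>sgn\<close> occurs where the other factor vanishes. When
  \<open>w\<close> lies between \<open>c\<close> and \<open>d\<close>, the two fluxes are bounded
  separately and the two distances add up to the distance of \<open>c\<close> and
  \<open>d\<close>.\<close>

lemma kflux_lipschitz:
  assumes X: "\<And>v w. \<bar>v\<bar> \<le> M \<Longrightarrow> \<bar>w\<bar> \<le> M \<Longrightarrow> norm (X v - X w) \<le> L * \<bar>v - w\<bar>"
    and b: "\<bar>w\<bar> \<le> M" "\<bar>c\<bar> \<le> M" "\<bar>d\<bar> \<le> M"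
  shows "norm (kflux X w c) \<le> L * \<bar>w - c\<bar>" "norm (kflux X w c - kflux X w d) \<le> L * \<bar>c - d\<bar>"
proof -
  show 1: "norm (kflux X w c) \<le> L * \<bar>w - c\<bar>"
    using X[OF b(1,2)] by (cases w c rule: linorder_cases) (auto simp: kflux_def norm_minus_commute)
  have split: "norm (kflux X w c - kflux X w d) \<le> L * \<bar>c - d\<bar>"
    if "c \<le> w" "w \<le> d" "\<bar>c\<bar> \<le> M" "\<bar>d\<bar> \<le> M" for c d
  proof -
    have "norm (kflux X w c - kflux X w d) \<le> norm (kflux X w c) + norm (kflux X w d)" by (rule norm_triangle_ineq4)
    also have "\<dots> \<le> norm (X w - X c) + norm (X w - X d)"
      by (intro add_mono) (auto simp: kflux_def sgn_if norm_minus_commute)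
    also have "\<dots> \<le> L * (w - c) + L * (d - w)"
      using X[OF b(1) that(3)] X[OF b(1) that(4)] that(1,2) by (intro add_mono) auto
    also have "\<dots> = L * \<bar>c - d\<bar>" using that by (simp add: algebra_simps)
    finally show ?thesis .
  qed
  consider "c < w" "d < w" | "w < c" "w < d" | "c \<le> w" "w \<le> d" | "d \<le> w" "w \<le> c" by linarith
  then show "norm (kflux X w c - kflux X w d) \<le> L * \<bar>c - d\<bar>"
  proof cases
    case 1 then show ?thesis using X[OF b(3,2)] by (simp add: kflux_def abs_minus_commute)
  next
    case 2 then show ?thesis using X[OF b(2,3)] by (simp add: kflux_def)
  next
    case 3 then show ?thesis using split b by blast
  next
    case 4 then show ?thesis using split[of d c] b by (simp add: norm_minus_commute abs_minus_commute)
  qed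
qed

definition entropy_ineq :: "(real \<Rightarrow> 'a::euclidean_space) \<Rightarrow> 'a set \<Rightarrow> ('a \<Rightarrow> real) \<Rightarrow> bool" where
  "entropy_ineq X \<Omega> U \<longleftrightarrow> (\<forall>c \<phi> g. c1_test \<Omega> \<phi> g \<longrightarrow> (\<forall>z. 0 \<le> \<phi> z) \<longrightarrow> 0 \<le> (LINT z|lborel. kflux X (U z) c \<bullet> g z))"

lemma integrable_convolution_kernel:
  fixes h k :: "'a::euclidean_space \<Rightarrow> real"
  assumes h: "integrable lborel h" and k: "integrable lborel k"
  shows "integrable (lborel \<Otimes>\<^sub>M lborel) (\<lambda>(z, z'). h z * k (z - z'))"
proof (rule lborel_pair.Fubini_integrable)
  have [measurable]: "h \<in> borel_measurable borel" "k \<in> borel_measurable borel" using h k by auto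
  show "(\<lambda>(z, z'). h z * k (z - z')) \<in> borel_measurable (lborel \<Otimes>\<^sub>M lborel)" by measurable
  have "(LINT z'|lborel. norm (case (z, z') of (z, z') \<Rightarrow> h z * k (z - z'))) = \<bar>h z\<bar> * (LINT z|lborel. \<bar>k z\<bar>)" for z
    using lborel_integral_reflect[of "\<lambda>z. \<bar>k z\<bar>" z] by (simp add: abs_mult)
  then show "integrable lborel (\<lambda>z. LINT z'|lborel. norm (case (z, z') of (z, z') \<Rightarrow> h z * k (z - z')))"
    using h by simp
  show "AE z in lborel. integrable lborel (\<lambda>z'. case (z, z') of (z, z') \<Rightarrow> h z * k (z - z'))"
    using k by (auto simp: lborel_integrable_reflect)
qed

lemma integrable_compact_support:
  fixes f :: "'a::euclidean_space \<Rightarrow> 'b::{banach, second_countable_topology}"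
  assumes f: "continuous_on UNIV f" and K: "compact K" "\<And>z. z \<notin> K \<Longrightarrow> f z = 0"
  shows "integrable lborel f"
proof -
  have "integrable lborel (\<lambda>z. indicator K z *\<^sub>R f z)"
    by (rule borel_integrable_compact[OF K(1)]) (auto intro: continuous_on_subset[OF f])
  moreover have "(\<lambda>z. indicator K z *\<^sub>R f z) = f" using K(2) by (auto simp: indicator_def fun_eq_iff)
  ultimately show ?thesis by simp
qed

text \<open>Doubling of variables with the test function \<open>\<psi> z * J (z - z')\<close>: the terms containing the
  gradient of \<open>J\<close> cancel.\<close>

theorem kato_inequality:
  fixes X :: "real \<Rightarrow> 'a::euclidean_space"
  assumes \<Omega>: "open \<Omega>" and [measurable]: "X \<in> borel_measurable borel"
    and X: "\<And>v w. \<bar>v\<bar> \<le> M \<Longrightarrow> \<bar>w\<bar> \<le> M \<Longrightarrow> norm (X v - X w) \<le> L * \<bar>v - w\<bar>"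
    and [measurable]: "U \<in> borel_measurable borel" "V \<in> borel_measurable borel"
    and b: "\<And>z. \<bar>U z\<bar> \<le> M" "\<And>z. \<bar>V z\<bar> \<le> M"
    and U: "entropy_ineq X \<Omega> U" and V: "entropy_ineq X \<Omega> V"
    and \<psi>: "c1_test \<Omega> \<psi> g" "\<And>z. 0 \<le> \<psi> z"
  shows "0 \<le> (LINT z|lborel. kflux X (U z) (V z) \<bullet> g z)"
proof -
  obtain K C where K: "compact K" "K \<subseteq> \<Omega>" "\<And>z. z \<notin> K \<Longrightarrow> \<psi> z = 0" "\<And>z. z \<notin> K \<Longrightarrow> g z = 0"
    and C: "0 < C" "\<And>z. \<bar>\<psi> z\<bar> \<le> C" "\<And>z. norm (g z) \<le> C"
    and g: "is_grad \<psi> g" "continuous_on UNIV g" "continuous_on UNIV \<psi>"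
    using \<psi>(1) by (rule c1_testE) blast
  show ?thesis
  proof (cases "K = {}")
    case True then show ?thesis using K by simp
  next
    case ne: False
    have [measurable]: "\<psi> \<in> borel_measurable borel" "g \<in> borel_measurable borel" "K \<in> sets borel"
      using g(2,3) K(1) by (auto intro: borel_measurable_continuous_onI simp: compact_imp_closed)
    obtain d where d: "0 < d" "{x. infdist x K \<le> d} \<subseteq> \<Omega>"
      using compact_in_open_separated[OF ne K(1) \<Omega> K(2)] by blast
    define Q where "Q = kflux X"
    have [measurable]: "(\<lambda>z. Q (f z) (h z)) \<in> borel_measurable N"
      if [measurable]: "f \<in> borel_measurable N" "h \<in> borel_measurable N" for f h and N :: "'c measure"
      unfolding Q_def by measurable
    have M: "0 \<le> M" using b(1)[of 0] by linarith
    \<comment> \<open>For \<open>M = 0\<close> the Lipschitz hypothesis leaves the sign of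
      \<open>L\<close> open, so only the product is controlled.\<close>
    have L: "0 \<le> L * M"
    proof -
      have "0 \<le> norm (X M - X 0)" by simp
      also have "\<dots> \<le> L * \<bar>M - 0\<bar>" using M by (intro X) auto
      finally show ?thesis using M by simp
    qed
    define Qb where "Qb = 2 * (L * M)"
    have Qb: "norm (Q (U z) (V z')) \<le> Qb" for z z'
    proof -
      have "norm (Q (U z) (V z')) \<le> L * \<bar>U z - V z'\<bar>" unfolding Q_def by (rule kflux_lipschitz(1)[OF X b(1) b(2) b(2)])
      also have "\<dots> \<le> Qb"
      proof (cases "M = 0")
        case True then show ?thesis using b(1)[of z] b(2)[of z'] by (simp add: Qb_def)
      next
        case False
        then have "0 \<le> L" using L M by (simp add: zero_le_mult_iff)
        moreover have "\<bar>U z - V z'\<bar> \<le> 2 * M" using b(1)[of z] b(2)[of z'] by linarith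
        ultimately have "L * \<bar>U z - V z'\<bar> \<le> L * (2 * M)" by (intro mult_left_mono)
        then show ?thesis by (simp add: Qb_def)
      qed
      finally show ?thesis .
    qed
    have iK: "integrable lborel (indicator K :: 'a \<Rightarrow> real)"
      using emeasure_bounded_finite[OF compact_imp_bounded[OF K(1)]] by (intro integrable_real_indicator) auto
    show ?thesis
    proof (rule field_le_epsilon)
      fix e :: real assume "0 < e"
      \<comment> \<open>\<open>V\<close> is bounded but perhaps not integrable. Cut off to a
        neighbourhood of \<open>K\<close> it is, and continuity of translations in the mean
        applies.\<close>
      define V1 where "V1 z = indicator {x. infdist x K \<le> d} z * V z" for z
      have cK: "compact {x. infdist x K \<le> d}" by (rule compact_infdist_le[OF ne K(1) d(1)])
      have [measurable]: "{x. infdist x K \<le> d} \<in> sets borel" using cK by (simp add: compact_imp_closed)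
      have iV1: "integrable lborel V1"
      proof -
        have "integrable lborel (indicator {x. infdist x K \<le> d} :: 'a \<Rightarrow> real)"
          using emeasure_bounded_finite[OF compact_imp_bounded[OF cK]] by (intro integrable_real_indicator) auto
        then show ?thesis unfolding V1_def[abs_def] by (rule integrable_mult_bounded(1)[of _ _ _ M]) (use b in auto)
      qed
      define LC where "LC = \<bar>L\<bar> * C + 1"
      have LC: "0 < LC" unfolding LC_def using C(1) by (intro add_nonneg_pos) auto
      obtain d1 where d1: "0 < d1" "\<And>c. norm c < d1 \<Longrightarrow> (LINT x|lborel. \<bar>V1 (x + c) - V1 x\<bar>) < e / LC"
        using L1_shift_small[OF iV1, of "e / LC"] \<open>0 < e\<close> LC by auto
      define \<epsilon> where "\<epsilon> = min d d1"
      have \<epsilon>: "0 < \<epsilon>" "\<epsilon> \<le> d" "\<epsilon> \<le> d1" using d d1 by (auto simp: \<epsilon>_def)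
      obtain J :: "'a \<Rightarrow> real" and gJ where J: "\<And>n. C_k n J" "is_grad J gJ" "continuous_on UNIV gJ"
        "\<And>z. 0 \<le> J z" "\<And>z. \<epsilon> \<le> norm z \<Longrightarrow> J z = 0" "\<And>z. \<epsilon> < norm z \<Longrightarrow> gJ z = 0"
        "integrable lborel J" "(LINT z|lborel. J z) = 1" using mollifier_exists[OF \<epsilon>(1)] by metis
      have [measurable]: "J \<in> borel_measurable borel" "gJ \<in> borel_measurable borel"
        using J C_k_continuous by (auto intro: borel_measurable_continuous_onI)
      have igJ: "integrable lborel (\<lambda>z. norm (gJ z))"
        by (rule integrable_compact_support[of _ "cball 0 \<epsilon>"]) (use J(3,6) in \<open>auto intro!: continuous_intros\<close>)
      \<comment> \<open>The gradient of the doubled test function falls on \<psi> in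
        \<open>F1\<close> and on \<open>J\<close> in \<open>F2\<close>.\<close>
      define F1 where "F1 z z' = (Q (U z) (V z') \<bullet> g z) * J (z - z')" for z z'
      define F2 where "F2 z z' = \<psi> z * (Q (U z) (V z') \<bullet> gJ (z - z'))" for z z'
      have iF1: "integrable (lborel \<Otimes>\<^sub>M lborel) (case_prod F1)"
      proof (rule Bochner_Integration.integrable_bound)
        show "integrable (lborel \<Otimes>\<^sub>M lborel) (\<lambda>p. (Qb * C) * (case p of (z, z') \<Rightarrow> indicator K z * J (z - z')))"
          using integrable_convolution_kernel[OF iK J(7)] by (rule Bochner_Integration.integrable_mult_right)
        show "case_prod F1 \<in> borel_measurable (lborel \<Otimes>\<^sub>M lborel)" unfolding F1_def by measurable
        have "\<bar>F1 z z'\<bar> \<le> Qb * C * (indicator K z * J (z - z'))" for z z'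
        proof (cases "z \<in> K")
          case True
          have "\<bar>Q (U z) (V z') \<bullet> g z\<bar> \<le> norm (Q (U z) (V z')) * norm (g z)" by (rule Cauchy_Schwarz_ineq2)
          also have "\<dots> \<le> Qb * C" using Qb[of z z'] C(3)[of z] norm_ge_zero order_trans by (intro mult_mono) blast+
          finally show ?thesis using True J(4)[of "z - z'"] by (simp add: F1_def abs_mult mult_right_mono)
        qed (simp add: F1_def K(4))
        then show "AE p in lborel \<Otimes>\<^sub>M lborel. norm (case_prod F1 p)
            \<le> norm ((Qb * C) * (case p of (z, z') \<Rightarrow> indicator K z * J (z - z')))"
          by (intro AE_I2) (auto intro: order_trans[OF _ abs_ge_self])
      qed
      have iF2: "integrable (lborel \<Otimes>\<^sub>M lborel) (case_prod F2)"
      proof (rule Bochner_Integration.integrable_bound)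
        show "integrable (lborel \<Otimes>\<^sub>M lborel) (\<lambda>p. (C * Qb) * (case p of (z, z') \<Rightarrow> indicator K z * norm (gJ (z - z'))))"
          using integrable_convolution_kernel[OF iK igJ] by (rule Bochner_Integration.integrable_mult_right)
        show "case_prod F2 \<in> borel_measurable (lborel \<Otimes>\<^sub>M lborel)" unfolding F2_def by measurable
        have "\<bar>F2 z z'\<bar> \<le> C * Qb * (indicator K z * norm (gJ (z - z')))" for z z'
        proof (cases "z \<in> K")
          case True
          have "\<bar>F2 z z'\<bar> = \<bar>\<psi> z\<bar> * \<bar>Q (U z) (V z') \<bullet> gJ (z - z')\<bar>" by (simp add: F2_def abs_mult)
          also have "\<dots> \<le> C * (Qb * norm (gJ (z - z')))"
            using C(1,2) Qb[of z z']
            by (intro mult_mono order_trans[OF Cauchy_Schwarz_ineq2] mult_right_mono) auto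
          finally show ?thesis using True by (simp add: mult.assoc)
        qed (simp add: F2_def K(3))
        then show "AE p in lborel \<Otimes>\<^sub>M lborel. norm (case_prod F2 p)
            \<le> norm ((C * Qb) * (case p of (z, z') \<Rightarrow> indicator K z * norm (gJ (z - z'))))"
          by (intro AE_I2) (auto intro: order_trans[OF _ abs_ge_self])
      qed
      \<comment> \<open>For fixed \<open>z'\<close> the number \<open>V z'\<close> is the Kruzhkov
        constant in the inequality for \<open>U\<close>.\<close>
      have T1: "0 \<le> (LINT z|lborel. F1 z z' + F2 z z')" for z'
      proof -
        have "c1_test \<Omega> (\<lambda>z. \<psi> z * J (z - z')) (\<lambda>z. J (z - z') *\<^sub>R g z + \<psi> z *\<^sub>R gJ (z - z'))"
          unfolding c1_test_def
        proof (intro conjI exI[of _ K] allI impI)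
          show "is_grad (\<lambda>z. \<psi> z * J (z - z')) (\<lambda>z. J (z - z') *\<^sub>R g z + \<psi> z *\<^sub>R gJ (z - z'))"
            by (rule is_grad_mult[OF g(1) is_grad_shift[OF J(2)]])
          have "continuous_on UNIV (\<lambda>z. J (z - z'))" "continuous_on UNIV (\<lambda>z. gJ (z - z'))"
            using C_k_continuous[OF J(1)] J(3)
            by (auto intro!: continuous_on_compose2[of UNIV J] continuous_on_compose2[of UNIV gJ] continuous_intros)
          then show "continuous_on UNIV (\<lambda>z. J (z - z') *\<^sub>R g z + \<psi> z *\<^sub>R gJ (z - z'))"
            using g(2,3) by (intro continuous_intros)
        qed (use K in auto)
        then have "0 \<le> (LINT z|lborel. Q (U z) (V z') \<bullet> (J (z - z') *\<^sub>R g z + \<psi> z *\<^sub>R gJ (z - z')))"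
          using U \<psi>(2) J(4) unfolding entropy_ineq_def Q_def by simp
        then show ?thesis by (simp add: F1_def F2_def inner_add_right mult.commute)
      qed
      \<comment> \<open>For fixed \<open>z\<close> the number \<open>U z\<close> is the constant in
        the inequality for \<open>V\<close>. The gradient in \<open>z'\<close> of
        \<open>J (z - z')\<close> has the opposite sign, which makes the sum with the previous
        inequality lose \<open>F2\<close>.\<close>
      have T2: "0 \<le> (LINT z'|lborel. - F2 z z')" for z
      proof (cases "z \<in> K")
        case True
        have "c1_test \<Omega> (\<lambda>z'. \<psi> z * J (z - z')) (\<lambda>z'. \<psi> z *\<^sub>R (- gJ (z - z')))"
          unfolding c1_test_def
        proof (intro conjI exI[of _ "cball z \<epsilon>"] allI impI)
          show "is_grad (\<lambda>z'. \<psi> z * J (z - z')) (\<lambda>z'. \<psi> z *\<^sub>R (- gJ (z - z')))"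
            by (rule is_grad_cmult[OF is_grad_reflect[OF J(2)]])
          have "continuous_on UNIV (\<lambda>z'. gJ (z - z'))"
            using J(3) by (auto intro!: continuous_on_compose2[of UNIV gJ] continuous_intros)
          then show "continuous_on UNIV (\<lambda>z'. \<psi> z *\<^sub>R (- gJ (z - z')))" by (intro continuous_intros)
          show "cball z \<epsilon> \<subseteq> \<Omega>"
          proof
            fix x assume "x \<in> cball z \<epsilon>"
            then have "infdist x K \<le> d" using infdist_le[OF True, of x] \<epsilon> by (simp add: dist_commute)
            then show "x \<in> \<Omega>" using d(2) by auto
          qed
        qed (use J(5) in \<open>auto simp: dist_norm\<close>)
        moreover have "\<forall>z'. 0 \<le> \<psi> z * J (z - z')" using \<psi>(2) J(4) by simp
        ultimately have "0 \<le> (LINT z'|lborel. Q (V z') (U z) \<bullet> (\<psi> z *\<^sub>R (- gJ (z - z'))))"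
          using V unfolding entropy_ineq_def Q_def by blast
        then show ?thesis by (simp add: F2_def Q_def kflux_commute[of X "V _"])
      qed (simp add: F2_def K(3))
      have "0 \<le> (LINT z'|lborel. LINT z|lborel. F1 z z' + F2 z z')"
        using T1 by (intro integral_nonneg_AE) auto
      also have "\<dots> = (LINT z|lborel. LINT z'|lborel. F1 z z' + F2 z z')"
      proof (rule lborel_pair.Fubini_integral)
        show "integrable (lborel \<Otimes>\<^sub>M lborel) (\<lambda>(z, z'). F1 z z' + F2 z z')"
          using Bochner_Integration.integrable_add[OF iF1 iF2] by (simp add: split_beta')
      qed
      also have "\<dots> = (LINT p|(lborel \<Otimes>\<^sub>M lborel). case_prod F1 p + case_prod F2 p)"
        using lborel_pair.integral_fst[of "\<lambda>z z'. F1 z z' + F2 z z'"] Bochner_Integration.integrable_add[OF iF1 iF2]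
        by (simp add: split_beta')
      also have "\<dots> = (LINT p|(lborel \<Otimes>\<^sub>M lborel). case_prod F1 p) + (LINT p|(lborel \<Otimes>\<^sub>M lborel). case_prod F2 p)"
        by (rule Bochner_Integration.integral_add[OF iF1 iF2])
      finally have 1: "0 \<le> (LINT p|(lborel \<Otimes>\<^sub>M lborel). case_prod F1 p) + (LINT p|(lborel \<Otimes>\<^sub>M lborel). case_prod F2 p)" .
      have "0 \<le> (LINT z|lborel. LINT z'|lborel. - F2 z z')"
        using T2 by (intro integral_nonneg_AE) auto
      also have "\<dots> = - (LINT p|(lborel \<Otimes>\<^sub>M lborel). case_prod F2 p)"
        using lborel_pair.integral_fst[OF iF2] by (simp add: split_beta')
      finally have 2: "0 \<le> (LINT p|(lborel \<Otimes>\<^sub>M lborel). case_prod F1 p)" using 1 by simp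
      \<comment> \<open>This is \<open>F1\<close> in the variable \<open>\<zeta> = z - z'\<close>.
        The weight \<open>J\<close> has mass 1 near 0, so replacing \<open>V (z - \<zeta>)\<close>
        by \<open>V z\<close> costs at most \<open>e\<close>.\<close>
      define G where "G z \<zeta> = J \<zeta> * (Q (U z) (V (z - \<zeta>)) \<bullet> g z)" for z \<zeta>
      have iG: "integrable (lborel \<Otimes>\<^sub>M lborel) (case_prod G)"
      proof (rule lborel_pair.Fubini_integrable)
        show "case_prod G \<in> borel_measurable (lborel \<Otimes>\<^sub>M lborel)" unfolding G_def by measurable
        have bG: "\<bar>Q (U z) (V z') \<bullet> g z\<bar> \<le> Qb * C * indicator K z" for z z'
        proof (cases "z \<in> K")
          case True
          have "\<bar>Q (U z) (V z') \<bullet> g z\<bar> \<le> norm (Q (U z) (V z')) * norm (g z)" by (rule Cauchy_Schwarz_ineq2)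
          also have "\<dots> \<le> Qb * C" using Qb[of z z'] C(3)[of z] norm_ge_zero order_trans by (intro mult_mono) blast+
          finally show ?thesis using True by simp
        qed (simp add: K(4))
        have ii: "integrable lborel (\<lambda>\<zeta>. J \<zeta> * (Q (U z) (V (z - \<zeta>)) \<bullet> g z))" for z
          by (rule integrable_mult_bounded(1)[of _ _ _ "Qb * C * indicator K z"]) (use J(7) bG in auto)
        then show "AE z in lborel. integrable lborel (\<lambda>\<zeta>. case (z, \<zeta>) of (z, \<zeta>) \<Rightarrow> G z \<zeta>)" by (simp add: G_def)
        show "integrable lborel (\<lambda>z. LINT \<zeta>|lborel. norm (case (z, \<zeta>) of (z, \<zeta>) \<Rightarrow> G z \<zeta>))"
        proof (rule Bochner_Integration.integrable_bound)
          show "integrable lborel (\<lambda>z. Qb * C * indicator K z)" using iK by simp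
          show "(\<lambda>z. LINT \<zeta>|lborel. norm (case (z, \<zeta>) of (z, \<zeta>) \<Rightarrow> G z \<zeta>)) \<in> borel_measurable lborel"
            unfolding G_def by measurable
          have "norm (LINT \<zeta>|lborel. norm (G z \<zeta>)) \<le> (LINT \<zeta>|lborel. J \<zeta> * (Qb * C * indicator K z))" for z
            by (rule norm_integral_le) (use J(4,7) bG in \<open>auto simp: G_def abs_mult intro!: mult_left_mono\<close>)
          then show "AE z in lborel. norm (LINT \<zeta>|lborel. norm (case (z, \<zeta>) of (z, \<zeta>) \<Rightarrow> G z \<zeta>)) \<le> norm (Qb * C * indicator K z)"
            using J(8) by (auto intro: order_trans[OF _ abs_ge_self])
        qed
      qed
      have "(LINT p|(lborel \<Otimes>\<^sub>M lborel). case_prod F1 p) = (LINT z|lborel. LINT z'|lborel. F1 z z')"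
        using lborel_pair.integral_fst[OF iF1] by simp
      also have "\<dots> = (LINT z|lborel. LINT \<zeta>|lborel. G z \<zeta>)"
      proof (rule Bochner_Integration.integral_cong[OF refl])
        fix z
        show "(LINT z'|lborel. F1 z z') = (LINT \<zeta>|lborel. G z \<zeta>)"
          using lborel_integral_reflect[of "\<lambda>z'. F1 z z'" z] by (simp add: F1_def G_def mult.commute)
      qed
      also have "\<dots> = (LINT \<zeta>|lborel. LINT z|lborel. G z \<zeta>)"
        by (rule lborel_pair.Fubini_integral[OF iG, symmetric])
      finally have 3: "0 \<le> (LINT \<zeta>|lborel. LINT z|lborel. G z \<zeta>)" using 2 by simp
      define A where "A = (LINT z|lborel. kflux X (U z) (V z) \<bullet> g z)"
      have iQ: "integrable lborel (\<lambda>z. Q (U z) (V (z - \<zeta>)) \<bullet> g z)" for \<zeta>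
      proof (rule Bochner_Integration.integrable_bound[where f = "\<lambda>z. Qb * norm (g z)"])
        show "integrable lborel (\<lambda>z. Qb * norm (g z))"
          by (intro Bochner_Integration.integrable_mult_right integrable_norm integrable_compact_support[OF g(2) K(1,4)])
        show "AE z in lborel. norm (Q (U z) (V (z - \<zeta>)) \<bullet> g z) \<le> norm (Qb * norm (g z))"
        proof (rule AE_I2)
          fix z
          have "norm (Q (U z) (V (z - \<zeta>)) \<bullet> g z) \<le> norm (Q (U z) (V (z - \<zeta>))) * norm (g z)"
            unfolding real_norm_def by (rule Cauchy_Schwarz_ineq2)
          also have "\<dots> \<le> Qb * norm (g z)" by (intro mult_right_mono Qb) auto
          finally show "norm (Q (U z) (V (z - \<zeta>)) \<bullet> g z) \<le> norm (Qb * norm (g z))" by (rule order_trans) simp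
        qed
      qed measurable
      have near: "(LINT z|lborel. Q (U z) (V (z - \<zeta>)) \<bullet> g z) \<le> A + e" if \<zeta>: "norm \<zeta> < \<epsilon>" for \<zeta>
      proof -
        have "(LINT z|lborel. Q (U z) (V (z - \<zeta>)) \<bullet> g z) - A =
            (LINT z|lborel. Q (U z) (V (z - \<zeta>)) \<bullet> g z - Q (U z) (V z) \<bullet> g z)"
          using iQ[of \<zeta>] iQ[of 0] by (simp add: A_def Q_def)
        also have "\<dots> \<le> (LINT z|lborel. (\<bar>L\<bar> * C) * \<bar>V1 (z + (- \<zeta>)) - V1 z\<bar>)"
        proof (rule integral_mono)
          fix z
          show "Q (U z) (V (z - \<zeta>)) \<bullet> g z - Q (U z) (V z) \<bullet> g z \<le> (\<bar>L\<bar> * C) * \<bar>V1 (z + (- \<zeta>)) - V1 z\<bar>"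
          proof (cases "z \<in> K")
            case True
            have "infdist (z - \<zeta>) K \<le> d" using infdist_le[OF True, of "z - \<zeta>"] \<zeta> \<epsilon> by (simp add: dist_norm)
            moreover have "infdist z K \<le> d" using True d by simp
            ultimately have V1: "V1 (z + (- \<zeta>)) = V (z - \<zeta>)" "V1 z = V z" by (simp_all add: V1_def)
            have "Q (U z) (V (z - \<zeta>)) \<bullet> g z - Q (U z) (V z) \<bullet> g z \<le>
                norm (Q (U z) (V (z - \<zeta>)) - Q (U z) (V z)) * norm (g z)"
              using norm_cauchy_schwarz[of "Q (U z) (V (z - \<zeta>)) - Q (U z) (V z)" "g z"] by (simp add: inner_diff_left)
            also have "\<dots> \<le> (L * \<bar>V (z - \<zeta>) - V z\<bar>) * norm (g z)"
              unfolding Q_def by (intro mult_right_mono kflux_lipschitz(2)[OF X b(1) b(2) b(2)]) auto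
            also have "\<dots> \<le> (\<bar>L\<bar> * \<bar>V (z - \<zeta>) - V z\<bar>) * C"
              using C(1,3) by (intro mult_mono) (auto intro: mult_right_mono)
            finally show ?thesis unfolding V1 by (simp add: mult_ac)
          qed (use K(4) C(1) in auto)
        next
          have "integrable lborel (\<lambda>z. V1 (z + (- \<zeta>)))" using iV1 lborel_integrable_shift[of V1 "- \<zeta>"] by auto
          then show "integrable lborel (\<lambda>z. (\<bar>L\<bar> * C) * \<bar>V1 (z + (- \<zeta>)) - V1 z\<bar>)" using iV1 by auto
        qed (use iQ[of \<zeta>] iQ[of 0] in simp)
        also have "\<dots> = (\<bar>L\<bar> * C) * (LINT z|lborel. \<bar>V1 (z + (- \<zeta>)) - V1 z\<bar>)" by simp
        also have "\<dots> \<le> (\<bar>L\<bar> * C) * (e / LC)"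
          using d1(2)[of "- \<zeta>"] \<zeta> \<epsilon> C(1) by (intro mult_left_mono) auto
        also have "\<dots> \<le> LC * (e / LC)" using \<open>0 < e\<close> LC by (intro mult_right_mono) (auto simp: LC_def)
        also have "\<dots> = e" using LC by simp
        finally show ?thesis by simp
      qed
      have "(LINT \<zeta>|lborel. LINT z|lborel. G z \<zeta>) \<le> (LINT \<zeta>|lborel. J \<zeta> * (A + e))"
      proof (rule integral_mono)
        show "integrable lborel (\<lambda>\<zeta>. LINT z|lborel. G z \<zeta>)" using lborel_pair.integrable_snd[OF iG] .
        fix \<zeta> :: 'a
        have "(LINT z|lborel. G z \<zeta>) = J \<zeta> * (LINT z|lborel. Q (U z) (V (z - \<zeta>)) \<bullet> g z)" by (simp add: G_def)
        also have "\<dots> \<le> J \<zeta> * (A + e)"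
          using near[of \<zeta>] J(4)[of \<zeta>] J(5)[of \<zeta>] by (cases "norm \<zeta> < \<epsilon>") (auto intro: mult_left_mono)
        finally show "(LINT z|lborel. G z \<zeta>) \<le> J \<zeta> * (A + e)" .
      qed (use J(7) in simp)
      then show "0 \<le> (LINT z|lborel. kflux X (U z) (V z) \<bullet> g z) + e" using 3 J(8) by (simp add: A_def)
    qed
  qed
qed

section \<open>The Burgers flux in space-time and bounded representatives\<close>

lemma borel_fst [measurable]: "fst \<in> (borel :: ('a::euclidean_space \<times> 'b::euclidean_space) measure) \<rightarrow>\<^sub>M borel"
  and borel_snd [measurable]: "snd \<in> (borel :: ('a \<times> 'b) measure) \<rightarrow>\<^sub>M borel"
  by (intro borel_measurable_continuous_onI continuous_intros)+

definition spacetime_flux :: "real \<Rightarrow> real \<times> (real ^ 2)" where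
  "spacetime_flux w = (w, flux w)"

lemma flux_eq: "flux w = (w ^ 2 / 2) *\<^sub>R axis 1 1 + (w ^ 3 / 3) *\<^sub>R axis 2 1"
  by (simp add: flux_def vec_eq_iff forall_2 axis_def)

lemma continuous_spacetime_flux: "continuous_on A spacetime_flux"
  unfolding spacetime_flux_def flux_eq by (intro continuous_intros) auto

lemma spacetime_flux_measurable [measurable]: "spacetime_flux \<in> borel_measurable borel"
  by (rule borel_measurable_continuous_onI[OF continuous_spacetime_flux])

lemma spacetime_flux_lipschitz:
  assumes "\<bar>v\<bar> \<le> M" "\<bar>w\<bar> \<le> M"
  shows "norm (spacetime_flux v - spacetime_flux w) \<le> (1 + M + M ^ 2) * \<bar>v - w\<bar>"
proof -
  have M: "0 \<le> M" using assms by linarith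
  have "norm (spacetime_flux v - spacetime_flux w) \<le> norm (v - w) + norm (flux v - flux w)"
    using norm_Pair_le[of "v - w" "flux v - flux w"] by (simp add: spacetime_flux_def)
  also have "flux v - flux w = (v ^ 2 / 2 - w ^ 2 / 2) *\<^sub>R axis 1 1 + (v ^ 3 / 3 - w ^ 3 / 3) *\<^sub>R axis 2 1"
    by (simp add: flux_eq scaleR_diff_left)
  also have "norm \<dots> \<le> \<bar>v ^ 2 / 2 - w ^ 2 / 2\<bar> + \<bar>v ^ 3 / 3 - w ^ 3 / 3\<bar>"
    by (rule order_trans[OF norm_triangle_ineq]) (simp add: norm_axis_1)
  also have "\<bar>v ^ 2 / 2 - w ^ 2 / 2\<bar> = \<bar>v + w\<bar> / 2 * \<bar>v - w\<bar>"
  proof -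
    have "v ^ 2 / 2 - w ^ 2 / 2 = (v + w) / 2 * (v - w)" by (simp add: field_simps power2_eq_square)
    then show ?thesis by (simp only: abs_mult abs_divide abs_numeral)
  qed
  also have "\<bar>v ^ 3 / 3 - w ^ 3 / 3\<bar> = \<bar>v ^ 2 + v * w + w ^ 2\<bar> / 3 * \<bar>v - w\<bar>"
  proof -
    have "v ^ 3 / 3 - w ^ 3 / 3 = (v ^ 2 + v * w + w ^ 2) / 3 * (v - w)"
      by (simp add: field_simps power2_eq_square power3_eq_cube)
    then show ?thesis by (simp only: abs_mult abs_divide abs_numeral)
  qed
  also have "norm (v - w) + (\<bar>v + w\<bar> / 2 * \<bar>v - w\<bar> + \<bar>v ^ 2 + v * w + w ^ 2\<bar> / 3 * \<bar>v - w\<bar>)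
      = (1 + \<bar>v + w\<bar> / 2 + \<bar>v ^ 2 + v * w + w ^ 2\<bar> / 3) * \<bar>v - w\<bar>"
    by (simp add: algebra_simps)
  also have "\<dots> \<le> (1 + M + M ^ 2) * \<bar>v - w\<bar>"
  proof (intro mult_right_mono add_mono)
    show "\<bar>v + w\<bar> / 2 \<le> M" using assms abs_triangle_ineq[of v w] by simp
    have "\<bar>v ^ 2\<bar> \<le> M ^ 2" "\<bar>w ^ 2\<bar> \<le> M ^ 2" using assms by (auto simp: abs_le_square_iff[symmetric] power2_abs)
    moreover have "\<bar>v * w\<bar> \<le> M ^ 2" using assms M unfolding abs_mult power2_eq_square by (intro mult_mono) auto
    ultimately have "\<bar>v ^ 2 + v * w + w ^ 2\<bar> \<le> (M ^ 2 + M ^ 2) + M ^ 2"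
      by (intro order_trans[OF abs_triangle_ineq add_mono[OF order_trans[OF abs_triangle_ineq add_mono]]])
    then show "\<bar>v ^ 2 + v * w + w ^ 2\<bar> / 3 \<le> M ^ 2" by simp
  qed auto
  finally show ?thesis by simp
qed

lemma kflux_spacetime:
  "kflux spacetime_flux w c \<bullet> (p, q) = \<bar>w - c\<bar> * p + sgn (w - c) * ((flux w - flux c) \<bullet> q)"
proof -
  have "sgn (w - c) * (w - c) = \<bar>w - c\<bar>" by (simp add: sgn_mult_self_eq abs_sgn mult.commute)
  then show ?thesis by (simp add: kflux_def spacetime_flux_def inner_prod_def)
qed

lemma half_space_borel [measurable]: "half_space \<in> sets borel"
  by (intro borel_open open_Times) auto

lemma entropy_solution_measurable:
  assumes "entropy_solution u"
  shows "(\<lambda>z. indicator half_space z * u (fst z) (snd z)) \<in> borel_measurable borel"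
proof -
  have "(\<lambda>z. indicator half_space z *\<^sub>R (\<lambda>(t, x). u t x) z) \<in> borel_measurable borel"
    using borel_measurable_restrict_space_iff[of half_space borel "\<lambda>(t, x). u t x"] assms half_space_borel
    unfolding entropy_solution_def by simp
  then show ?thesis by (simp add: split_beta')
qed

text \<open>A representative that is Borel and bounded at every point, as doubling requires. Where
  the solution is essentially bounded by \<open>M\<close> on \<open>S\<close>, clamping changes it
  on a null set only.\<close>

definition clamp_ext :: "real \<Rightarrow> (real \<times> (real ^ 2)) set \<Rightarrow> (real \<Rightarrow> real ^ 2 \<Rightarrow> real) \<Rightarrow> real \<times> (real ^ 2) \<Rightarrow> real" where
  "clamp_ext M S u z = (if z \<in> S then max (- M) (min M (u (fst z) (snd z))) else 0)"

lemma clamp_ext_bound: "0 \<le> M \<Longrightarrow> \<bar>clamp_ext M S u z\<bar> \<le> M"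
  by (auto simp: clamp_ext_def max_def min_def)

lemma clamp_ext_measurable:
  assumes u: "entropy_solution u" and S: "S \<in> sets borel" "S \<subseteq> half_space"
  shows "clamp_ext M S u \<in> borel_measurable borel"
proof -
  note [measurable] = S(1) entropy_solution_measurable[OF u]
  have "clamp_ext M S u = (\<lambda>z. if z \<in> S then max (- M) (min M (indicator half_space z * u (fst z) (snd z))) else 0)"
    using S(2) by (auto simp: clamp_ext_def fun_eq_iff indicator_def)
  then show ?thesis by (simp only:) measurable
qed

definition weak_solution :: "(real \<Rightarrow> 'a::euclidean_space) \<Rightarrow> 'a set \<Rightarrow> ('a \<Rightarrow> real) \<Rightarrow> bool" where
  "weak_solution X \<Omega> U \<longleftrightarrow> (\<forall>\<phi> g. c1_test \<Omega> \<phi> g \<longrightarrow> (LINT z|lborel. X (U z) \<bullet> g z) = 0)"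

lemma test_function_grad:
  assumes "test_function \<Omega> \<phi>" "is_grad \<phi> g"
  shows "z \<notin> \<Omega> \<Longrightarrow> g z = 0"
proof (rule is_grad_zero[OF assms(2), of "closure {z. \<phi> z \<noteq> 0}"])
  show "\<phi> z = 0" if "z \<notin> closure {z. \<phi> z \<noteq> 0}" for z
    using that closure_subset[of "{z. \<phi> z \<noteq> 0}"] by auto
qed (use assms(1) in \<open>auto simp: test_function_def\<close>)

lemma grad_components:
  assumes "is_grad \<phi> g"
  shows "dt \<phi> z = fst (g z)" "grad_x \<phi> z = snd (g z)"
  by (simp_all add: dt_def grad_x_def is_grad_frechet[OF assms] inner_prod_def vec_eq_iff inner_axis)

lemma half_space_flux_integral:
  fixes u :: "real \<Rightarrow> real ^ 2 \<Rightarrow> real"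
  assumes t: "test_function half_space \<phi>" and g: "is_grad \<phi> g"
  defines "W \<equiv> \<lambda>z. indicator half_space z * u (fst z) (snd z)"
  shows "(LINT (t, x) : half_space | lborel. u t x * dt \<phi> (t, x) + flux (u t x) \<bullet> grad_x \<phi> (t, x)) =
      (LINT z|lborel. spacetime_flux (W z) \<bullet> g z)"
    "(LINT (t, x) : half_space | lborel. \<bar>u t x - k\<bar> * dt \<phi> (t, x) + sgn (u t x - k) * ((flux (u t x) - flux k) \<bullet> grad_x \<phi> (t, x))) =
      (LINT z|lborel. kflux spacetime_flux (W z) k \<bullet> g z)"
proof -
  have g0: "z \<notin> half_space \<Longrightarrow> g z = 0" for z using test_function_grad[OF t g] .
  show "(LINT (t, x) : half_space | lborel. u t x * dt \<phi> (t, x) + flux (u t x) \<bullet> grad_x \<phi> (t, x)) =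
      (LINT z|lborel. spacetime_flux (W z) \<bullet> g z)"
    unfolding set_lebesgue_integral_def
  proof (rule Bochner_Integration.integral_cong[OF refl])
    fix z :: "real \<times> (real ^ 2)"
    obtain p q where pq: "g z = (p, q)" by (cases "g z")
    show "indicator half_space z *\<^sub>R (case z of (t, x) \<Rightarrow> u t x * dt \<phi> (t, x) + flux (u t x) \<bullet> grad_x \<phi> (t, x)) = spacetime_flux (W z) \<bullet> g z"
      using pq g0[of z] by (cases "z \<in> half_space") (auto simp: W_def grad_components[OF g] spacetime_flux_def split_beta)
  qed
  show "(LINT (t, x) : half_space | lborel. \<bar>u t x - k\<bar> * dt \<phi> (t, x) + sgn (u t x - k) * ((flux (u t x) - flux k) \<bullet> grad_x \<phi> (t, x))) =
      (LINT z|lborel. kflux spacetime_flux (W z) k \<bullet> g z)"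
    unfolding set_lebesgue_integral_def
  proof (rule Bochner_Integration.integral_cong[OF refl])
    fix z :: "real \<times> (real ^ 2)"
    obtain p q where pq: "g z = (p, q)" by (cases "g z")
    show "indicator half_space z *\<^sub>R (case z of (t, x) \<Rightarrow> \<bar>u t x - k\<bar> * dt \<phi> (t, x) +
        sgn (u t x - k) * ((flux (u t x) - flux k) \<bullet> grad_x \<phi> (t, x))) = kflux spacetime_flux (W z) k \<bullet> g z"
      using pq g0[of z] by (cases "z \<in> half_space") (auto simp: W_def grad_components[OF g] kflux_spacetime split_beta)
  qed
qed

text \<open>The clamped function agrees with the solution almost everywhere on \<open>S\<close>, and
  gradients of test functions on \<open>S\<close> vanish elsewhere. The inequalities then extend to
  continuously differentiable tests; the weak equation is obtained as two inequalities, for the flux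
  and for its negative.\<close>

lemma entropy_solution_clamp:
  assumes u: "entropy_solution u" and S: "open S" "S \<subseteq> half_space" and M: "0 \<le> M"
    and b: "AE z in lborel. z \<in> S \<longrightarrow> \<bar>u (fst z) (snd z)\<bar> \<le> M"
  shows "entropy_ineq spacetime_flux S (clamp_ext M S u)" "weak_solution spacetime_flux S (clamp_ext M S u)"
proof -
  define U where "U = clamp_ext M S u"
  have Um[measurable]: "U \<in> borel_measurable borel"
    unfolding U_def using S by (intro clamp_ext_measurable[OF u]) auto
  have Ub: "\<bar>U z\<bar> \<le> M" for z unfolding U_def by (rule clamp_ext_bound[OF M])
  have sub: "test_function half_space \<phi>" if "test_function S \<phi>" for \<phi>
    using that S by (auto simp: test_function_def)
  have bX: "\<exists>B. \<forall>z. norm (spacetime_flux (U z)) \<le> B"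
  proof -
    have "compact (spacetime_flux ` {-M..M})" by (intro compact_continuous_image continuous_spacetime_flux) auto
    then obtain B where "\<forall>y\<in>spacetime_flux ` {-M..M}. norm y \<le> B" using compact_imp_bounded bounded_iff by metis
    moreover have "U z \<in> {-M..M}" for z using Ub[of z] by (simp add: abs_le_iff minus_le_iff)
    ultimately show ?thesis by blast
  qed
  then obtain B where B: "\<And>z. norm (spacetime_flux (U z)) \<le> B" by blast
  have eq: "AE z in lborel. z \<in> S \<longrightarrow> U z = u (fst z) (snd z)"
    using b by eventually_elim (auto simp: U_def clamp_ext_def abs_le_iff)
  define W where "W z = indicator half_space z * u (fst z) (snd z)" for z
  have [measurable]: "W \<in> borel_measurable borel"
    unfolding W_def[abs_def] by (rule entropy_solution_measurable[OF u])
  have eqW: "AE z in lborel. z \<in> S \<longrightarrow> U z = W z"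
    using eq by eventually_elim (use S(2) in \<open>auto simp: W_def\<close>)
  have gm: "g \<in> borel_measurable borel" if "test_function S \<phi>" "is_grad \<phi> g" for \<phi> g
  proof -
    have "C_k (Suc 0) \<phi>" using that(1) unfolding test_function_def by blast
    then have "g = (\<lambda>z. \<Sum>b\<in>Basis. frechet_derivative \<phi> (at z) b *\<^sub>R b)"
      by (intro is_grad_unique[OF that(2) C_k_grad(1)])
    then have "continuous_on UNIV g" using C_k_grad(2)[OF \<open>C_k (Suc 0) \<phi>\<close>] by (simp only:)
    then show ?thesis by (rule borel_measurable_continuous_onI)
  qed
  show "entropy_ineq spacetime_flux S (clamp_ext M S u)"
    unfolding entropy_ineq_def U_def[symmetric]
  proof (intro allI impI)
    fix c \<phi> g assume \<phi>: "c1_test S \<phi> g" "\<forall>z. 0 \<le> \<phi> z"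
    show "0 \<le> (LINT z|lborel. kflux spacetime_flux (U z) c \<bullet> g z)"
    proof (rule test_function_extend[OF S(1) _ _ _ \<phi>(1), where pos = True])
      show "\<exists>C. AE z in lborel. z \<in> K \<longrightarrow> norm (kflux spacetime_flux (U z) c) \<le> C" for K
      proof (intro exI[of _ "B + norm (spacetime_flux c)"] AE_I2 impI)
        fix z
        have "norm (kflux spacetime_flux (U z) c) \<le> 1 * norm (spacetime_flux (U z) - spacetime_flux c)"
          unfolding kflux_def norm_scaleR by (intro mult_right_mono) (auto simp: sgn_if)
        also have "\<dots> \<le> B + norm (spacetime_flux c)" using norm_triangle_ineq4[of "spacetime_flux (U z)" "spacetime_flux c"] B[of z] by simp
        finally show "norm (kflux spacetime_flux (U z) c) \<le> B + norm (spacetime_flux c)" .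
      qed
      fix \<phi> g assume t: "test_function S \<phi>" and g: "is_grad \<phi> g" and p: "True \<longrightarrow> (\<forall>z. 0 \<le> \<phi> z)"
      have "0 \<le> (LINT (t, x) : half_space | lborel.
           \<bar>u t x - c\<bar> * dt \<phi> (t, x) + sgn (u t x - c) * ((flux (u t x) - flux c) \<bullet> grad_x \<phi> (t, x)))"
        using u sub[OF t] p unfolding entropy_solution_def by blast
      also have "\<dots> = (LINT z|lborel. kflux spacetime_flux (U z) c \<bullet> g z)"
        unfolding half_space_flux_integral(2)[OF sub[OF t] g] W_def[symmetric]
      proof (rule integral_cong_AE)
        have [measurable]: "g \<in> borel_measurable borel" by (rule gm[OF t g])
        show "(\<lambda>z. kflux spacetime_flux (W z) c \<bullet> g z) \<in> borel_measurable lborel"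
          "(\<lambda>z. kflux spacetime_flux (U z) c \<bullet> g z) \<in> borel_measurable lborel" by measurable
        show "AE z in lborel. kflux spacetime_flux (W z) c \<bullet> g z = kflux spacetime_flux (U z) c \<bullet> g z"
          using eqW by eventually_elim (metis test_function_grad[OF t g] inner_zero_right)
      qed
      finally show "0 \<le> (LINT z|lborel. kflux spacetime_flux (U z) c \<bullet> g z)" .
    qed (use \<phi> in auto)
  qed
  have zero: "(LINT z|lborel. spacetime_flux (U z) \<bullet> g z) = 0" if t: "test_function S \<phi>" and g: "is_grad \<phi> g" for \<phi> g
  proof -
    have [measurable]: "g \<in> borel_measurable borel" by (rule gm[OF t g])
    have "0 = (LINT (t, x) : half_space | lborel. u t x * dt \<phi> (t, x) + flux (u t x) \<bullet> grad_x \<phi> (t, x))"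
      using u sub[OF t] unfolding entropy_solution_def by simp
    also have "\<dots> = (LINT z|lborel. spacetime_flux (U z) \<bullet> g z)"
      unfolding half_space_flux_integral(1)[OF sub[OF t] g] W_def[symmetric]
    proof (rule integral_cong_AE)
      show "AE z in lborel. spacetime_flux (W z) \<bullet> g z = spacetime_flux (U z) \<bullet> g z"
        using eqW by eventually_elim (metis test_function_grad[OF t g] inner_zero_right)
    qed measurable
    finally show ?thesis by simp
  qed
  show "weak_solution spacetime_flux S (clamp_ext M S u)"
    unfolding weak_solution_def U_def[symmetric]
  proof (intro allI impI antisym)
    fix \<phi> g assume \<phi>: "c1_test S \<phi> g"
    show "0 \<le> (LINT z|lborel. spacetime_flux (U z) \<bullet> g z)"
      by (rule test_function_extend[OF S(1) _ _ _ \<phi>, where pos = False])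
        (use zero B in \<open>auto intro!: exI[of _ B]\<close>)
    have "0 \<le> (LINT z|lborel. (- spacetime_flux (U z)) \<bullet> g z)"
      by (rule test_function_extend[OF S(1) _ _ _ \<phi>, where pos = False])
        (use zero B in \<open>auto intro!: exI[of _ B]\<close>)
    then show "(LINT z|lborel. spacetime_flux (U z) \<bullet> g z) \<le> 0" by simp
  qed
qed

section \<open>From space-time inequalities to the norm at a fixed time\<close>

text \<open>Testing with a translate of a mollifier says that the mollified function has a
  nonpositive derivative; the mollification is close to \<open>m\<close> at the two times by
  continuity.\<close>

lemma nonincreasing_of_weak:
  fixes m :: "real \<Rightarrow> real"
  assumes m: "continuous_on {0<..} m"
    and weak: "\<And>\<theta> \<theta>'. c1_test {0<..} \<theta> \<theta>' \<Longrightarrow> (\<And>t. 0 \<le> \<theta> t) \<Longrightarrow> 0 \<le> (LINT t|lborel. m t * \<theta>' t)"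
    and st: "0 < s" "s \<le> t"
  shows "m t \<le> m s"
proof (rule field_le_epsilon)
  fix e :: real assume "0 < e"
  have "\<exists>d>0. \<forall>r. \<bar>r - \<tau>\<bar> < d \<longrightarrow> \<bar>m r - m \<tau>\<bar> < e / 2" if "0 < \<tau>" for \<tau>
  proof -
    have "isCont m \<tau>" using m that by (simp add: continuous_on_eq_continuous_at)
    then show ?thesis using \<open>0 < e\<close> unfolding continuous_at_eps_delta by (metis dist_real_def half_gt_zero)
  qed
  from this[of s] this[of t] st obtain ds dt where ds: "ds > 0" "\<And>r. \<bar>r - s\<bar> < ds \<Longrightarrow> \<bar>m r - m s\<bar> < e / 2"
    and dt: "dt > 0" "\<And>r. \<bar>r - t\<bar> < dt \<Longrightarrow> \<bar>m r - m t\<bar> < e / 2" by auto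
  \<comment> \<open>The bound \<open>s / 2\<close> keeps the supports of the translated mollifiers
    inside the positive times.\<close>
  define \<epsilon> where "\<epsilon> = min (s / 2) (min ds dt)"
  have \<epsilon>: "0 < \<epsilon>" "\<epsilon> \<le> s / 2" "\<epsilon> \<le> ds" "\<epsilon> \<le> dt" using st ds dt by (auto simp: \<epsilon>_def)
  obtain J :: "real \<Rightarrow> real" and gJ where J: "\<And>n. C_k n J" "is_grad J gJ" "continuous_on UNIV gJ"
    "\<And>z. 0 \<le> J z" "\<And>z. \<epsilon> \<le> norm z \<Longrightarrow> J z = 0" "\<And>z. \<epsilon> < norm z \<Longrightarrow> gJ z = 0"
    "integrable lborel J" "(LINT z|lborel. J z) = 1" using mollifier_exists[OF \<epsilon>(1)] by metis
  have [measurable]: "J \<in> borel_measurable borel" "gJ \<in> borel_measurable borel"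
    using J C_k_continuous by (auto intro: borel_measurable_continuous_onI)
  define w where "w r = indicator {s - \<epsilon>..t + \<epsilon>} r *\<^sub>R m r" for r
  have w: "integrable lborel w"
    unfolding w_def[abs_def] by (rule borel_integrable_compact) (use \<epsilon> st in \<open>auto intro: continuous_on_subset[OF m]\<close>)
  have gh: "is_grad (\<lambda>x. J (0 - x)) (\<lambda>x. - gJ (0 - x))" by (rule is_grad_reflect[OF J(2)])
  have c1: "c1_test UNIV (\<lambda>x. J (0 - x)) (\<lambda>x. - gJ (0 - x))"
    unfolding c1_test_def
  proof (intro conjI exI[of _ "cball 0 \<epsilon>"] allI impI gh)
    show "continuous_on UNIV (\<lambda>x. - gJ (0 - x))"
      by (intro continuous_intros continuous_on_compose2[OF J(3)]) auto
  qed (use J(5) in auto)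
  obtain C where C: "\<And>z. \<bar>J (0 - z)\<bar> \<le> C" "\<And>z. norm (- gJ (0 - z)) \<le> C" "uniformly_continuous_on UNIV (\<lambda>x. - gJ (0 - x))"
    using c1 by (rule c1_testE) blast
  \<comment> \<open>The reflected kernel evaluates to \<open>J (r - \<tau>)\<close>, which is the
    test function in the variable \<open>r\<close>; the derivative in \<tau> then carries the minus
    sign that reverses the weak inequality.\<close>
  define f where "f \<tau> = (LINT r|lborel. w r * J (0 - (\<tau> - r)))" for \<tau>
  define f' where "f' \<tau> = (LINT r|lborel. w r *\<^sub>R (- gJ (0 - (\<tau> - r))))" for \<tau>
  have ff': "is_grad f f'"
    unfolding f_def[abs_def] f'_def[abs_def]
    by (rule is_grad_average[OF gh C(3,2,1) w, of "\<lambda>r. r"]) simp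
  have f'le: "f' \<tau> \<le> 0" if \<tau>: "s \<le> \<tau>" "\<tau> \<le> t" for \<tau>
  proof -
    have "c1_test {0<..} (\<lambda>r. J (r - \<tau>)) (\<lambda>r. gJ (r - \<tau>))"
      unfolding c1_test_def
    proof (intro conjI exI[of _ "cball \<tau> \<epsilon>"] allI impI is_grad_shift J(2))
      show "continuous_on UNIV (\<lambda>r. gJ (r - \<tau>))" by (intro continuous_on_compose2[OF J(3)] continuous_intros) auto
      show "cball \<tau> \<epsilon> \<subseteq> {0<..}" using \<tau> \<epsilon> st by (auto simp: cball_def dist_real_def)
    qed (use J(5) in \<open>auto simp: dist_real_def\<close>)
    then have "0 \<le> (LINT r|lborel. m r * gJ (r - \<tau>))" using weak J(4) by blast
    also have "(\<lambda>r. m r * gJ (r - \<tau>)) = (\<lambda>r. w r * gJ (r - \<tau>))"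
    proof
      fix r show "m r * gJ (r - \<tau>) = w r * gJ (r - \<tau>)"
      proof (cases "\<bar>r - \<tau>\<bar> \<le> \<epsilon>")
        case True then show ?thesis using \<tau> by (simp add: w_def abs_le_iff)
      qed (use J(6) in simp)
    qed
    finally show ?thesis by (simp add: f'_def)
  qed
  have "f t \<le> f s"
  proof (rule DERIV_nonpos_imp_nonincreasing[OF st(2)])
    fix \<tau> assume \<tau>: "s \<le> \<tau>" "\<tau> \<le> t"
    have "(f has_derivative (\<lambda>v. f' \<tau> \<bullet> v)) (at \<tau>)" using ff' by (simp add: is_grad_def)
    then have "(f has_real_derivative f' \<tau>) (at \<tau>)" by (simp add: has_field_derivative_def)
    then show "\<exists>y. (f has_real_derivative y) (at \<tau>) \<and> y \<le> 0" using f'le[OF \<tau>] by blast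
  qed
  have close: "\<bar>f \<tau> - m \<tau>\<bar> \<le> e / 2"
    if \<tau>: "s \<le> \<tau>" "\<tau> \<le> t" and d: "\<And>r. \<bar>r - \<tau>\<bar> < \<epsilon> \<Longrightarrow> \<bar>m r - m \<tau>\<bar> < e / 2" for \<tau>
  proof -
    have iJ: "integrable lborel (\<lambda>r. J (r - \<tau>))" using J(7) lborel_integrable_shift[of J "- \<tau>"] by simp
    have 1: "(LINT r|lborel. J (r - \<tau>)) = 1" using J(8) lborel_integral_shift[of J "- \<tau>"] by simp
    have iw: "integrable lborel (\<lambda>r. w r * J (r - \<tau>))"
      by (rule integrable_mult_bounded(1)[OF w, of _ C]) (use C(1)[of "- _"] in \<open>auto simp: minus_diff_eq\<close>)
    have "f \<tau> - m \<tau> = (LINT r|lborel. w r * J (r - \<tau>)) - (LINT r|lborel. m \<tau> * J (r - \<tau>))"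
      using 1 by (simp add: f_def)
    also have "\<dots> = (LINT r|lborel. w r * J (r - \<tau>) - m \<tau> * J (r - \<tau>))" using iw iJ by simp
    also have "norm \<dots> \<le> (LINT r|lborel. e / 2 * J (r - \<tau>))"
    proof (rule norm_integral_le)
      fix r
      show "norm (w r * J (r - \<tau>) - m \<tau> * J (r - \<tau>)) \<le> e / 2 * J (r - \<tau>)"
      proof (cases "\<bar>r - \<tau>\<bar> < \<epsilon>")
        case True
        then have "w r = m r" using \<tau> by (simp add: w_def abs_less_iff)
        then have "norm (w r * J (r - \<tau>) - m \<tau> * J (r - \<tau>)) = \<bar>m r - m \<tau>\<bar> * J (r - \<tau>)"
          using J(4)[of "r - \<tau>"] by (simp add: left_diff_distrib[symmetric] abs_mult)
        also have "\<dots> \<le> e / 2 * J (r - \<tau>)" using d[OF True] J(4) by (intro mult_right_mono) auto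
        finally show ?thesis .
      qed (use J(5) in simp)
    qed (use iJ in simp)
    finally show ?thesis using 1 by simp
  qed
  have "\<bar>f s - m s\<bar> \<le> e / 2" by (rule close) (use st ds \<epsilon> in auto)
  moreover have "\<bar>f t - m t\<bar> \<le> e / 2" by (rule close) (use st dt \<epsilon> in auto)
  ultimately show "m t \<le> m s + e" using \<open>f t \<le> f s\<close> by linarith
qed

definition L1_continuous :: "(real \<Rightarrow> real ^ 2 \<Rightarrow> real) \<Rightarrow> bool" where
  "L1_continuous u \<longleftrightarrow> (\<forall>t\<ge>0. integrable lborel (u t)) \<and>
     (\<forall>t\<ge>0. ((\<lambda>s. L1_norm (\<lambda>x. u s x - u t x)) \<longlongrightarrow> 0) (at t within {0..}))"

lemma L1_continuous_diff_norm:
  assumes u: "L1_continuous u" and v: "L1_continuous v"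
  shows "continuous_on {0..} (\<lambda>t. L1_norm (\<lambda>x. u t x - v t x))"
  unfolding continuous_on_def
proof
  fix t :: real assume t: "t \<in> {0..}"
  have i: "integrable lborel (u s)" "integrable lborel (v s)" if "0 \<le> s" for s
    using u v that by (auto simp: L1_continuous_def)
  have e1: "((\<lambda>s. L1_norm (\<lambda>x. u s x - u t x) + L1_norm (\<lambda>x. v s x - v t x)) \<longlongrightarrow> 0 + 0) (at t within {0..})"
    using u v t by (intro tendsto_add) (auto simp: L1_continuous_def)
  have e2: "eventually (\<lambda>s. norm (L1_norm (\<lambda>x. u s x - v s x) - L1_norm (\<lambda>x. u t x - v t x))
      \<le> L1_norm (\<lambda>x. u s x - u t x) + L1_norm (\<lambda>x. v s x - v t x)) (at t within {0..})"
    unfolding eventually_at_filter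
  proof (intro always_eventually allI impI)
    fix s assume "s \<noteq> t" and s: "s \<in> {0..}"
    have "L1_norm (\<lambda>x. u s x - v s x) - L1_norm (\<lambda>x. u t x - v t x) = (LINT x|lborel. \<bar>u s x - v s x\<bar> - \<bar>u t x - v t x\<bar>)"
      unfolding L1_norm_def using i[of s] i[of t] s t by simp
    also have "norm \<dots> \<le> (LINT x|lborel. \<bar>u s x - u t x\<bar> + \<bar>v s x - v t x\<bar>)"
      by (rule norm_integral_le) (use i[of s] i[of t] s t in auto)
    also have "\<dots> = L1_norm (\<lambda>x. u s x - u t x) + L1_norm (\<lambda>x. v s x - v t x)"
      unfolding L1_norm_def using i[of s] i[of t] s t by simp
    finally show "norm (L1_norm (\<lambda>x. u s x - v s x) - L1_norm (\<lambda>x. u t x - v t x))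
      \<le> L1_norm (\<lambda>x. u s x - u t x) + L1_norm (\<lambda>x. v s x - v t x)" .
  qed
  have "((\<lambda>s. L1_norm (\<lambda>x. u s x - v s x) - L1_norm (\<lambda>x. u t x - v t x)) \<longlongrightarrow> 0) (at t within {0..})"
    by (rule Lim_null_comparison[OF e2]) (use e1 in simp)
  then show "((\<lambda>t. L1_norm (\<lambda>x. u t x - v t x)) \<longlongrightarrow> L1_norm (\<lambda>x. u t x - v t x)) (at t within {0..})"
    by (rule Lim_null[THEN iffD2])
qed

lemma AE_lborel_pair:
  fixes P :: "'a::euclidean_space \<Rightarrow> 'b::euclidean_space \<Rightarrow> bool"
  assumes "AE z in lborel. P (fst z) (snd z)"
  shows "AE t in lborel. AE x in lborel. P t x"
proof -
  have "AE z in (lborel \<Otimes>\<^sub>M lborel). P (fst z) (snd z)" unfolding lborel_prod by (rule assms)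
  then show ?thesis using lborel_pair.AE_pair[of "\<lambda>z. P (fst z) (snd z)"] by simp
qed

text \<open>The functions \<open>U\<close> and \<open>V\<close> are fixed only up to null sets of
  space-time, while \<open>u\<close> and \<open>v\<close> are curves of integrable functions. Fubini
  identifies almost every slice; the compact support of \<open>w\<close> in positive times and
  continuity of the distance give integrability.\<close>

lemma slice_integral:
  fixes U V :: "real \<times> (real ^ 2) \<Rightarrow> real"
  assumes [measurable]: "U \<in> borel_measurable borel" "V \<in> borel_measurable borel"
    and U: "AE z in lborel. z \<in> half_space \<longrightarrow> U z = u (fst z) (snd z)"
    and V: "AE z in lborel. z \<in> half_space \<longrightarrow> V z = v (fst z) (snd z)"
    and u: "L1_continuous u" and v: "L1_continuous v"
    and w: "continuous_on UNIV w" "compact K" "K \<subseteq> {0<..}" "\<And>t. t \<notin> K \<Longrightarrow> w t = 0"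
  shows "integrable lborel (\<lambda>z. \<bar>U z - V z\<bar> * w (fst z))"
    "(LINT z|lborel. \<bar>U z - V z\<bar> * w (fst z)) = (LINT t|lborel. L1_norm (\<lambda>x. u t x - v t x) * w t)"
proof -
  have [measurable]: "w \<in> borel_measurable borel" using w(1) by (rule borel_measurable_continuous_onI)
  have ae: "AE t in lborel. AE x in lborel. 0 < t \<longrightarrow> U (t, x) = u t x \<and> V (t, x) = v t x"
  proof (rule AE_lborel_pair)
    show "AE z in lborel. 0 < fst z \<longrightarrow> U (fst z, snd z) = u (fst z) (snd z) \<and> V (fst z, snd z) = v (fst z) (snd z)"
      using U V by eventually_elim (auto simp: mem_Times_iff)
  qed
  have i: "integrable lborel (u s)" "integrable lborel (v s)" if "0 < s" for s
    using u v that by (auto simp: L1_continuous_def)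
  have sl: "AE t in lborel. integrable lborel (\<lambda>x. \<bar>U (t, x) - V (t, x)\<bar> * w t) \<and>
      (LINT x|lborel. \<bar>U (t, x) - V (t, x)\<bar> * w t) = L1_norm (\<lambda>x. u t x - v t x) * w t \<and>
      (LINT x|lborel. norm (\<bar>U (t, x) - V (t, x)\<bar> * w t)) = L1_norm (\<lambda>x. u t x - v t x) * \<bar>w t\<bar>"
    using ae
  proof eventually_elim
    case (elim t)
    show ?case
    proof (cases "0 < t")
      case True
      have [measurable]: "u t \<in> borel_measurable lborel" "v t \<in> borel_measurable lborel" using i[OF True] by auto
      have e: "AE x in lborel. \<bar>U (t, x) - V (t, x)\<bar> = \<bar>u t x - v t x\<bar>" using elim by eventually_elim (use True in auto)
      have ii: "integrable lborel (\<lambda>x. \<bar>u t x - v t x\<bar>)" using i[OF True] by auto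
      have 1: "integrable lborel (\<lambda>x. \<bar>U (t, x) - V (t, x)\<bar>)"
        using ii by (rule integrable_cong_AE_imp) (use e in \<open>auto elim: eventually_mono\<close>)
      have 2: "(LINT x|lborel. \<bar>U (t, x) - V (t, x)\<bar>) = L1_norm (\<lambda>x. u t x - v t x)"
        unfolding L1_norm_def by (rule integral_cong_AE) (use e in auto)
      show ?thesis using 1 2 by (simp add: abs_mult)
    next
      case False
      then have "w t = 0" using w(3,4) by force
      then show ?thesis by simp
    qed
  qed
  define m where "m t = L1_norm (\<lambda>x. u t x - v t x)" for t
  have mc: "continuous_on {0<..} m"
    unfolding m_def by (rule continuous_on_subset[OF L1_continuous_diff_norm[OF u v]]) auto
  have im: "integrable lborel (\<lambda>t. m t * \<bar>w t\<bar>)"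
  proof -
    have "integrable lborel (\<lambda>t. indicator K t *\<^sub>R (m t * \<bar>w t\<bar>))"
      by (rule borel_integrable_compact[OF w(2)])
        (intro continuous_intros continuous_on_subset[OF mc] continuous_on_subset[OF w(1)] w(3), auto)
    moreover have "(\<lambda>t. indicator K t *\<^sub>R (m t * \<bar>w t\<bar>)) = (\<lambda>t. m t * \<bar>w t\<bar>)"
      using w(4) by (auto simp: indicator_def fun_eq_iff)
    ultimately show ?thesis by simp
  qed
  have big: "integrable (lborel \<Otimes>\<^sub>M lborel) (\<lambda>z. \<bar>U z - V z\<bar> * w (fst z))"
  proof (rule lborel_pair.Fubini_integrable)
    show "(\<lambda>z. \<bar>U z - V z\<bar> * w (fst z)) \<in> borel_measurable (lborel \<Otimes>\<^sub>M lborel)" by (simp add: lborel_prod)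
    show "AE t in lborel. integrable lborel (\<lambda>x. \<bar>U (t, x) - V (t, x)\<bar> * w (fst (t, x)))"
      using sl by eventually_elim simp
    show "integrable lborel (\<lambda>t. LINT x|lborel. norm (\<bar>U (t, x) - V (t, x)\<bar> * w (fst (t, x))))"
      using im
    proof (rule integrable_cong_AE_imp)
      show "AE t in lborel. m t * \<bar>w t\<bar> = (LINT x|lborel. norm (\<bar>U (t, x) - V (t, x)\<bar> * w (fst (t, x))))"
        using sl by eventually_elim (simp add: m_def)
    qed simp
  qed
  then show "integrable lborel (\<lambda>z. \<bar>U z - V z\<bar> * w (fst z))" by (simp add: lborel_prod)
  have "(LINT z|lborel. \<bar>U z - V z\<bar> * w (fst z)) = (LINT t|lborel. LINT x|lborel. \<bar>U (t, x) - V (t, x)\<bar> * w t)"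
    using lborel_pair.integral_fst'[OF big] by (simp add: lborel_prod)
  also have "\<dots> = (LINT t|lborel. m t * w t)"
  proof (rule integral_cong_AE)
    show "AE t in lborel. (LINT x|lborel. \<bar>U (t, x) - V (t, x)\<bar> * w t) = m t * w t"
      using sl by eventually_elim (simp add: m_def)
    have "(\<lambda>t. indicator {0<..} t * m t) \<in> borel_measurable borel"
      using borel_measurable_continuous_on_indicator[of "{0<..}" m] mc by simp
    then have "(\<lambda>t. (indicator {0<..} t * m t) * w t) \<in> borel_measurable borel" by measurable
    moreover have "(\<lambda>t. (indicator {0<..} t * m t) * w t) = (\<lambda>t. m t * w t)"
      using w(3,4) by (fastforce simp: indicator_def fun_eq_iff)
    ultimately show "(\<lambda>t. m t * w t) \<in> borel_measurable lborel" by simp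
  qed measurable
  finally show "(LINT z|lborel. \<bar>U z - V z\<bar> * w (fst z)) = (LINT t|lborel. L1_norm (\<lambda>x. u t x - v t x) * w t)"
    by (simp add: m_def)
qed

text \<open>Indicators of growing balls are convolved with one fixed mollifier of radius 1. The
  gradients are bounded by the integral of the norm of its gradient, whatever the radius of the
  ball, and the mollifier accounts for the shift by 1.\<close>

lemma cutoff_sequence:
  obtains \<eta> :: "nat \<Rightarrow> 'a::euclidean_space \<Rightarrow> real" and g C where "\<And>n. c1_test UNIV (\<eta> n) (g n)" "0 < C"
    "\<And>n x. 0 \<le> \<eta> n x" "\<And>n x. \<eta> n x \<le> 1" "\<And>n x. norm (g n x) \<le> C"
    "\<And>n x. norm x < real n - 1 \<Longrightarrow> \<eta> n x = 1" "\<And>n x. norm x < real n - 1 \<Longrightarrow> g n x = 0"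
proof -
  obtain J :: "'a \<Rightarrow> real" and gJ where J: "\<And>n. C_k n J" "is_grad J gJ" "continuous_on UNIV gJ"
    "\<And>z. 0 \<le> J z" "\<And>z. 1 \<le> norm z \<Longrightarrow> J z = 0" "\<And>z. 1 < norm z \<Longrightarrow> gJ z = 0"
    "integrable lborel J" "(LINT z|lborel. J z) = 1" using mollifier_exists[of 1] by (metis zero_less_one)
  have [measurable]: "J \<in> borel_measurable borel" "gJ \<in> borel_measurable borel"
    using J C_k_continuous by (auto intro: borel_measurable_continuous_onI)
  have c1: "c1_test UNIV J gJ" using J(2,3,5) unfolding c1_test_def by (intro conjI exI[of _ "cball 0 1"]) auto
  obtain CJ where CJ: "\<And>z. \<bar>J z\<bar> \<le> CJ" "\<And>z. norm (gJ z) \<le> CJ" "uniformly_continuous_on UNIV gJ"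
    using c1 by (rule c1_testE) blast
  have igJ: "integrable lborel (\<lambda>z. norm (gJ z))"
    by (rule integrable_compact_support[of _ "cball 0 1"]) (use J(3,6) in \<open>auto intro!: continuous_intros\<close>)
  define \<eta> :: "nat \<Rightarrow> 'a \<Rightarrow> real" where "\<eta> n x = (LINT y|lborel. indicator (ball 0 (real n)) y * J (x - y))" for n x
  define g where "g n x = (LINT y|lborel. indicator (ball 0 (real n)) y *\<^sub>R gJ (x - y))" for n x
  have iB: "integrable lborel (indicator (ball 0 (real n)) :: 'a \<Rightarrow> real)" for n
    using emeasure_bounded_finite[OF bounded_ball, of "0 :: 'a" "real n"] by (intro integrable_real_indicator) auto
  have gr: "is_grad (\<eta> n) (g n)" for n
    unfolding \<eta>_def[abs_def] g_def[abs_def]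
    by (rule is_grad_average[OF J(2) CJ(3,2,1) iB, of "\<lambda>y. y"]) simp
  have iJ: "integrable lborel (\<lambda>y. J (x - y))" for x using J(7) lborel_integrable_reflect[of J x] by simp
  have igJr: "integrable lborel (\<lambda>y. norm (gJ (x - y)))" for x
    using igJ lborel_integrable_reflect[of "\<lambda>z. norm (gJ z)" x] by simp
  have 1: "(LINT y|lborel. J (x - y)) = 1" for x using J(8) lborel_integral_reflect[of J x] by simp
  have iBJ: "integrable lborel (\<lambda>y. indicator (ball 0 (real n)) y * J (x - y))" for n x
    by (rule integrable_mult_bounded(1)[OF iB]) (use CJ(1) in auto)
  have inside: "\<eta> n x = 1" if "norm x < real n - 1" for n x
  proof -
    have "(\<lambda>y. indicator (ball 0 (real n)) y * J (x - y)) = (\<lambda>y. J (x - y))"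
    proof
      fix y
      show "indicator (ball 0 (real n)) y * J (x - y) = J (x - y)"
      proof (cases "norm (x - y) < 1")
        case True
        then have "norm y < real n" using that norm_triangle_ineq4[of x "x - y"] by simp
        then show ?thesis by simp
      qed (use J(5) in simp)
    qed
    then show ?thesis by (simp only: \<eta>_def 1)
  qed
  show ?thesis
  proof (rule that[of \<eta> g "(LINT z|lborel. norm (gJ z)) + 1"])
    show "c1_test UNIV (\<eta> n) (g n)" for n
      unfolding c1_test_def
    proof (intro conjI exI[of _ "cball 0 (real n + 1)"] allI impI)
      have "C_k m (\<eta> n)" for m
        unfolding \<eta>_def[abs_def] by (rule C_k_average[OF J(1), of "cball 0 1"]) (use J(5) iB in auto)
      note Ck = this
      have "g n = (\<lambda>z. \<Sum>b\<in>Basis. frechet_derivative (\<eta> n) (at z) b *\<^sub>R b)"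
        by (rule is_grad_unique[OF gr C_k_grad(1)[OF Ck]])
      then show "continuous_on UNIV (g n)" using C_k_grad(2)[OF Ck] by (simp only:)
      fix x :: 'a assume x: "x \<notin> cball 0 (real n + 1)"
      have "(\<lambda>y. indicator (ball 0 (real n)) y * J (x - y)) = (\<lambda>y. 0)"
      proof
        fix y
        show "indicator (ball 0 (real n)) y * J (x - y) = 0"
        proof (cases "norm y < real n")
          case True
          then have "1 \<le> norm (x - y)" using x norm_triangle_ineq2[of x y] by simp
          then show ?thesis using J(5) by simp
        qed simp
      qed
      then show "\<eta> n x = 0" by (simp only: \<eta>_def) simp
    qed (auto intro: gr)
    show "0 < (LINT z|lborel. norm (gJ z)) + 1" by (intro add_nonneg_pos integral_nonneg_AE) auto
    show "0 \<le> \<eta> n x" for n x unfolding \<eta>_def by (intro integral_nonneg_AE) (use J(4) in auto)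
    show "\<eta> n x \<le> 1" for n x
      unfolding \<eta>_def 1[of x, symmetric]
      by (rule integral_mono[OF iBJ iJ]) (use J(4) in \<open>auto simp: indicator_def\<close>)
    show "norm (g n x) \<le> (LINT z|lborel. norm (gJ z)) + 1" for n x
    proof -
      have "norm (g n x) \<le> (LINT y|lborel. norm (gJ (x - y)))"
        unfolding g_def by (rule norm_integral_le[OF igJr]) (auto simp: indicator_def)
      also have "\<dots> = (LINT z|lborel. norm (gJ z))" using lborel_integral_reflect[of "\<lambda>z. norm (gJ z)" x] by simp
      finally show ?thesis by simp
    qed
    show "norm x < real n - 1 \<Longrightarrow> g n x = 0" for n x
    proof -
      assume x: "norm x < real n - 1"
      have "is_grad (\<lambda>x. \<eta> n x + (- 1)) (\<lambda>x. g n x + 0)"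
        by (rule is_grad_add[OF gr]) (simp add: is_grad_def)
      then show "g n x = 0"
        using is_grad_zero[of "\<lambda>x. \<eta> n x + (- 1)" "\<lambda>x. g n x + 0" "- ball 0 (real n - 1)" x] x inside by auto
    qed
  qed (use inside in auto)
qed

lemma is_grad_fst: "is_grad f g \<Longrightarrow> is_grad (\<lambda>z. f (fst z)) (\<lambda>z. (g (fst z), 0))"
  unfolding is_grad_def
proof
  fix z :: "'a \<times> 'b" assume "\<forall>z. (f has_derivative (\<bullet>) (g z)) (at z)"
  then have "(f has_derivative (\<bullet>) (g (fst z))) (at (fst z))" by blast
  from has_derivative_compose[of fst fst z UNIV f, OF has_derivative_fst[OF has_derivative_ident] this]
  show "((\<lambda>z. f (fst z)) has_derivative (\<bullet>) (g (fst z), 0)) (at z)"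
    by (rule has_derivative_eq_rhs) (simp add: fun_eq_iff inner_prod_def)
qed

lemma is_grad_snd: "is_grad f g \<Longrightarrow> is_grad (\<lambda>z. f (snd z)) (\<lambda>z. (0, g (snd z)))"
  unfolding is_grad_def
proof
  fix z :: "'b \<times> 'a" assume "\<forall>z. (f has_derivative (\<bullet>) (g z)) (at z)"
  then have "(f has_derivative (\<bullet>) (g (snd z))) (at (snd z))" by blast
  from has_derivative_compose[of snd snd z UNIV f, OF has_derivative_snd[OF has_derivative_ident] this]
  show "((\<lambda>z. f (snd z)) has_derivative (\<bullet>) (0, g (snd z))) (at z)"
    by (rule has_derivative_eq_rhs) (simp add: fun_eq_iff inner_prod_def)
qed

lemma c1_test_prod:
  assumes \<theta>: "c1_test S \<theta> \<theta>'" and \<eta>: "c1_test T \<eta> g"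
  shows "c1_test (S \<times> T) (\<lambda>z. \<theta> (fst z) * \<eta> (snd z)) (\<lambda>z. (\<eta> (snd z) *\<^sub>R \<theta>' (fst z), \<theta> (fst z) *\<^sub>R g (snd z)))"
proof -
  obtain K where K: "compact K" "K \<subseteq> S" "\<And>z. z \<notin> K \<Longrightarrow> \<theta> z = 0" "is_grad \<theta> \<theta>'" "continuous_on UNIV \<theta>'" "continuous_on UNIV \<theta>"
    using \<theta> by (rule c1_testE) blast
  obtain K2 where K2: "compact K2" "K2 \<subseteq> T" "\<And>z. z \<notin> K2 \<Longrightarrow> \<eta> z = 0" "is_grad \<eta> g" "continuous_on UNIV g" "continuous_on UNIV \<eta>"
    using \<eta> by (rule c1_testE) blast
  show ?thesis
    unfolding c1_test_def
  proof (intro conjI exI[of _ "K \<times> K2"] allI impI)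
    show "is_grad (\<lambda>z. \<theta> (fst z) * \<eta> (snd z)) (\<lambda>z. (\<eta> (snd z) *\<^sub>R \<theta>' (fst z), \<theta> (fst z) *\<^sub>R g (snd z)))"
      using is_grad_mult[OF is_grad_fst[OF K(4)] is_grad_snd[OF K2(4)]] by simp
    show "continuous_on UNIV (\<lambda>z. (\<eta> (snd z) *\<^sub>R \<theta>' (fst z), \<theta> (fst z) *\<^sub>R g (snd z)))"
      by (intro continuous_intros continuous_on_compose2[OF K(5)] continuous_on_compose2[OF K(6)]
        continuous_on_compose2[OF K2(5)] continuous_on_compose2[OF K2(6)]) auto
  qed (use K K2 in \<open>auto simp: mem_Times_iff intro: compact_Times\<close>)
qed

text \<open>Testing Kato's inequality with a product of a function of time and a cut-off in space,
  and removing the cut-off, leaves the weak form of monotonicity of the distance in time. Continuity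
  in the mean carries this from positive times down to time 0.\<close>

lemma L1_decay:
  fixes U V :: "real \<times> (real ^ 2) \<Rightarrow> real"
  assumes Um[measurable]: "U \<in> borel_measurable borel" "V \<in> borel_measurable borel"
    and b: "\<And>z. \<bar>U z\<bar> \<le> M" "\<And>z. \<bar>V z\<bar> \<le> M"
    and U: "AE z in lborel. z \<in> half_space \<longrightarrow> U z = u (fst z) (snd z)"
    and V: "AE z in lborel. z \<in> half_space \<longrightarrow> V z = v (fst z) (snd z)"
    and u: "L1_continuous u" and v: "L1_continuous v"
    and kato: "\<And>\<psi> g. c1_test half_space \<psi> g \<Longrightarrow> (\<And>z. 0 \<le> \<psi> z) \<Longrightarrow> 0 \<le> (LINT z|lborel. kflux spacetime_flux (U z) (V z) \<bullet> g z)"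
    and t: "0 \<le> t"
  shows "L1_norm (\<lambda>x. u t x - v t x) \<le> L1_norm (\<lambda>x. u 0 x - v 0 x)"
proof -
  define m where "m t = L1_norm (\<lambda>x. u t x - v t x)" for t
  have mc: "continuous_on {0..} m" unfolding m_def by (rule L1_continuous_diff_norm[OF u v])
  have M: "0 \<le> M" using b(1)[of 0] by linarith
  have weak: "0 \<le> (LINT t|lborel. m t * \<theta>' t)" if \<theta>: "c1_test {0<..} \<theta> \<theta>'" "\<And>t. 0 \<le> \<theta> t" for \<theta> \<theta>'
  proof -
    obtain K where K: "compact K" "K \<subseteq> {0<..}" "\<And>z. z \<notin> K \<Longrightarrow> \<theta> z = 0" "\<And>z. z \<notin> K \<Longrightarrow> \<theta>' z = 0"
      "continuous_on UNIV \<theta>'" "continuous_on UNIV \<theta>"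
      using \<theta>(1) by (rule c1_testE) blast
    obtain \<eta> :: "nat \<Rightarrow> real ^ 2 \<Rightarrow> real" and g C where \<eta>: "\<And>n. c1_test UNIV (\<eta> n) (g n)" "0 < C"
      "\<And>n x. 0 \<le> \<eta> n x" "\<And>n x. \<eta> n x \<le> 1" "\<And>n x. norm (g n x) \<le> C"
      "\<And>n x. norm x < real n - 1 \<Longrightarrow> \<eta> n x = 1" "\<And>n x. norm x < real n - 1 \<Longrightarrow> g n x = 0"
      by (rule cutoff_sequence) (rule that)
    define G where "G n z = (\<eta> n (snd z) *\<^sub>R \<theta>' (fst z), \<theta> (fst z) *\<^sub>R g n (snd z))" for n z
    have c1: "c1_test half_space (\<lambda>z. \<theta> (fst z) * \<eta> n (snd z)) (G n)" for n
      unfolding G_def[abs_def] by (rule c1_test_prod[OF \<theta>(1) \<eta>(1)])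
    have Gm[measurable]: "G n \<in> borel_measurable borel" for n
      using c1[of n] unfolding c1_test_def by (auto intro: borel_measurable_continuous_onI)
    define L where "L = 1 + M + M ^ 2"
    have L: "0 \<le> L" using M by (simp add: L_def)
    \<comment> \<open>The majorant is supported in a compact set of positive times and is integrable
      in space thanks to the factor \<open>\<bar>U z - V z\<bar>\<close>. At each point the cut-off
      is constant for large \<open>n\<close>, so the flux at infinity disappears.\<close>
    have lim: "(\<lambda>n. LINT z|lborel. kflux spacetime_flux (U z) (V z) \<bullet> G n z) \<longlonglongrightarrow> (LINT z|lborel. \<bar>U z - V z\<bar> * \<theta>' (fst z))"
    proof (rule integral_dominated_convergence[where w = "\<lambda>z. \<bar>U z - V z\<bar> * (L * (\<bar>\<theta>' (fst z)\<bar> + C * \<bar>\<theta> (fst z)\<bar>))"])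
      show "integrable lborel (\<lambda>z. \<bar>U z - V z\<bar> * (L * (\<bar>\<theta>' (fst z)\<bar> + C * \<bar>\<theta> (fst z)\<bar>)))"
        by (rule slice_integral(1)[OF Um U V u v, of "\<lambda>t. L * (\<bar>\<theta>' t\<bar> + C * \<bar>\<theta> t\<bar>)" K])
          (use K in \<open>auto intro!: continuous_intros\<close>)
      show "(\<lambda>z. \<bar>U z - V z\<bar> * \<theta>' (fst z)) \<in> borel_measurable lborel"
        using slice_integral(1)[OF Um U V u v K(5,1,2,4)] by simp
      show "AE z in lborel. (\<lambda>n. kflux spacetime_flux (U z) (V z) \<bullet> G n z) \<longlonglongrightarrow> \<bar>U z - V z\<bar> * \<theta>' (fst z)"
      proof (rule AE_I2)
        fix z :: "real \<times> (real ^ 2)"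
        obtain N :: nat where N: "norm (snd z) + 1 < real N" using reals_Archimedean2 by blast
        have "eventually (\<lambda>n. kflux spacetime_flux (U z) (V z) \<bullet> G n z = \<bar>U z - V z\<bar> * \<theta>' (fst z)) sequentially"
          unfolding eventually_sequentially
        proof (intro exI[of _ N] allI impI)
          fix n assume "N \<le> n"
          then have "norm (snd z) < real n - 1" using N by linarith
          then show "kflux spacetime_flux (U z) (V z) \<bullet> G n z = \<bar>U z - V z\<bar> * \<theta>' (fst z)"
            by (simp add: G_def \<eta>(6,7) kflux_spacetime)
        qed
        then show "(\<lambda>n. kflux spacetime_flux (U z) (V z) \<bullet> G n z) \<longlonglongrightarrow> \<bar>U z - V z\<bar> * \<theta>' (fst z)"
          by (rule tendsto_eventually)
      qed
      show "AE z in lborel. norm (kflux spacetime_flux (U z) (V z) \<bullet> G n z)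
          \<le> \<bar>U z - V z\<bar> * (L * (\<bar>\<theta>' (fst z)\<bar> + C * \<bar>\<theta> (fst z)\<bar>))" for n
      proof (rule AE_I2)
        fix z :: "real \<times> (real ^ 2)"
        have "norm (kflux spacetime_flux (U z) (V z) \<bullet> G n z) \<le> norm (kflux spacetime_flux (U z) (V z)) * norm (G n z)"
          unfolding real_norm_def by (rule Cauchy_Schwarz_ineq2)
        also have "\<dots> \<le> (L * \<bar>U z - V z\<bar>) * (\<bar>\<theta>' (fst z)\<bar> + C * \<bar>\<theta> (fst z)\<bar>)"
        proof (rule mult_mono)
          show "norm (kflux spacetime_flux (U z) (V z)) \<le> L * \<bar>U z - V z\<bar>"
            unfolding L_def by (rule kflux_lipschitz(1)[OF spacetime_flux_lipschitz b(1) b(2) b(2)])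
          have "norm (G n z) \<le> norm (\<eta> n (snd z) *\<^sub>R \<theta>' (fst z)) + norm (\<theta> (fst z) *\<^sub>R g n (snd z))"
            unfolding G_def by (rule norm_Pair_le)
          also have "\<dots> \<le> 1 * \<bar>\<theta>' (fst z)\<bar> + C * \<bar>\<theta> (fst z)\<bar>"
          proof (rule add_mono)
            have "\<bar>\<eta> n (snd z)\<bar> * \<bar>\<theta>' (fst z)\<bar> \<le> 1 * \<bar>\<theta>' (fst z)\<bar>"
              using \<eta>(3,4)[of n "snd z"] by (intro mult_right_mono) auto
            then show "norm (\<eta> n (snd z) *\<^sub>R \<theta>' (fst z)) \<le> 1 * \<bar>\<theta>' (fst z)\<bar>" by (simp add: abs_mult)
            have "norm (g n (snd z)) * \<bar>\<theta> (fst z)\<bar> \<le> C * \<bar>\<theta> (fst z)\<bar>"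
              using \<eta>(5)[of n "snd z"] by (intro mult_right_mono) auto
            then show "norm (\<theta> (fst z) *\<^sub>R g n (snd z)) \<le> C * \<bar>\<theta> (fst z)\<bar>" by (simp add: mult.commute)
          qed
          finally show "norm (G n z) \<le> \<bar>\<theta>' (fst z)\<bar> + C * \<bar>\<theta> (fst z)\<bar>" by simp
        qed (use L in auto)
        finally show "norm (kflux spacetime_flux (U z) (V z) \<bullet> G n z)
          \<le> \<bar>U z - V z\<bar> * (L * (\<bar>\<theta>' (fst z)\<bar> + C * \<bar>\<theta> (fst z)\<bar>))" by (simp add: mult_ac)
      qed
    qed measurable
    have "0 \<le> (LINT z|lborel. kflux spacetime_flux (U z) (V z) \<bullet> G n z)" for n
      using kato[OF c1[of n]] \<theta>(2) \<eta>(3) by simp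
    then have "0 \<le> (LINT z|lborel. \<bar>U z - V z\<bar> * \<theta>' (fst z))"
      by (intro tendsto_lowerbound[OF lim]) auto
    then show ?thesis using slice_integral(2)[OF Um U V u v K(5,1,2,4)] by (simp add: m_def)
  qed
  have mono: "m t \<le> m s" if "0 < s" "s \<le> t" for s t
    by (rule nonincreasing_of_weak[OF _ weak that]) (auto intro: continuous_on_subset[OF mc])
  show ?thesis
  proof (cases "t = 0")
    case False
    then have t: "0 < t" using t by simp
    have "(m \<longlongrightarrow> m 0) (at 0 within {0..})" using mc unfolding continuous_on_def by auto
    then have "(m \<longlongrightarrow> m 0) (at_right 0)" by (rule tendsto_within_subset) auto
    moreover have "eventually (\<lambda>s. m t \<le> m s) (at_right 0)"
      unfolding eventually_at_right_field using t mono by (intro exI[of _ t]) auto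
    ultimately have "m t \<le> m 0" by (rule tendsto_lowerbound) simp
    then show ?thesis by (simp add: m_def)
  qed simp
qed

lemma spacetime_L1_contraction:
  assumes Um: "U \<in> borel_measurable borel" "V \<in> borel_measurable borel"
    and b: "\<And>z. \<bar>U z\<bar> \<le> M" "\<And>z. \<bar>V z\<bar> \<le> M"
    and ent: "entropy_ineq spacetime_flux half_space U" "entropy_ineq spacetime_flux half_space V"
    and U: "AE z in lborel. z \<in> half_space \<longrightarrow> U z = u (fst z) (snd z)"
    and V: "AE z in lborel. z \<in> half_space \<longrightarrow> V z = v (fst z) (snd z)"
    and u: "L1_continuous u" and v: "L1_continuous v" and t: "0 \<le> t"
  shows "L1_norm (\<lambda>x. u t x - v t x) \<le> L1_norm (\<lambda>x. u 0 x - v 0 x)"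
proof (rule L1_decay[OF Um b U V u v _ t])
  have "open (half_space :: (real \<times> (real ^ 2)) set)" by (intro open_Times) auto
  then show "0 \<le> (LINT z|lborel. kflux spacetime_flux (U z) (V z) \<bullet> g z)"
    if "c1_test half_space \<psi> g" "\<And>z. 0 \<le> \<psi> z" for \<psi> g
    using that by (intro kato_inequality[OF _ spacetime_flux_measurable spacetime_flux_lipschitz Um b ent])
qed

text \<open>The definition bounds the solution almost everywhere in space-time; clamping at that
  bound gives the function to which the doubling argument is applied, while the slices remain those
  of \<open>u\<close>.\<close>

lemma kruzhkov_representative:
  assumes "kruzhkov_solution b u"
  obtains M U where "U \<in> borel_measurable borel" "0 \<le> M" "\<And>z. \<bar>U z\<bar> \<le> M" "entropy_ineq spacetime_flux half_space U"
    "AE z in lborel. z \<in> half_space \<longrightarrow> U z = u (fst z) (snd z)" "L1_continuous u"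
proof -
  have e: "entropy_solution u" using assms by (simp add: kruzhkov_solution_def)
  obtain C where "AE (t, x) in lborel. t > 0 \<longrightarrow> \<bar>u t x\<bar> \<le> C" using assms unfolding kruzhkov_solution_def by blast
  then have C: "AE z in lborel. z \<in> half_space \<longrightarrow> \<bar>u (fst z) (snd z)\<bar> \<le> max C 0"
    by eventually_elim (auto simp: split_beta)
  have op: "open (half_space :: (real \<times> (real ^ 2)) set)" by (intro open_Times) auto
  show ?thesis
  proof (rule that[of "clamp_ext (max C 0) half_space u" "max C 0"])
    show "clamp_ext (max C 0) half_space u \<in> borel_measurable borel" by (rule clamp_ext_measurable[OF e]) auto
    show "\<bar>clamp_ext (max C 0) half_space u z\<bar> \<le> max C 0" for z by (rule clamp_ext_bound) simp
    show "entropy_ineq spacetime_flux half_space (clamp_ext (max C 0) half_space u)"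
      by (rule entropy_solution_clamp(1)[OF e op _ _ C]) auto
    show "AE z in lborel. z \<in> half_space \<longrightarrow> clamp_ext (max C 0) half_space u z = u (fst z) (snd z)"
      using C by eventually_elim (auto simp: clamp_ext_def abs_le_iff)
    show "L1_continuous u" using assms by (auto simp: kruzhkov_solution_def L1_continuous_def)
  qed simp
qed

section \<open>Translation estimate and bound by the mass of the data\<close>

lemma c1_test_shift:
  assumes "c1_test \<Omega> \<phi> g" "\<And>z. z \<in> \<Omega> \<Longrightarrow> z + c \<in> \<Omega>"
  shows "c1_test \<Omega> (\<lambda>z. \<phi> (z - c)) (\<lambda>z. g (z - c))"
proof -
  obtain K where K: "compact K" "K \<subseteq> \<Omega>" "\<And>z. z \<notin> K \<Longrightarrow> \<phi> z = 0" and g: "is_grad \<phi> g" "continuous_on UNIV g"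
    using assms(1) unfolding c1_test_def by blast
  show ?thesis
    unfolding c1_test_def
  proof (intro conjI exI[of _ "(\<lambda>z. z + c) ` K"] allI impI is_grad_shift g(1))
    show "continuous_on UNIV (\<lambda>z. g (z - c))" by (intro continuous_on_compose2[OF g(2)] continuous_intros) auto
    show "compact ((\<lambda>z. z + c) ` K)" using K(1) by (intro compact_continuous_image continuous_intros)
    show "(\<lambda>z. z + c) ` K \<subseteq> \<Omega>" using K(2) assms(2) by blast
    fix z assume "z \<notin> (\<lambda>z. z + c) ` K"
    then have "z - c \<notin> K" by (metis diff_add_cancel imageI)
    then show "\<phi> (z - c) = 0" by (rule K(3))
  qed
qed

lemma entropy_ineq_shift:
  assumes U: "entropy_ineq X \<Omega> U" and [measurable]: "U \<in> borel_measurable borel" "X \<in> borel_measurable borel"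
    and c: "\<And>z. z \<in> \<Omega> \<Longrightarrow> z + c \<in> \<Omega>"
  shows "entropy_ineq X \<Omega> (\<lambda>z. U (z + c))"
  unfolding entropy_ineq_def
proof (intro allI impI)
  fix k \<phi> g assume \<phi>: "c1_test \<Omega> \<phi> g" "\<forall>z. 0 \<le> \<phi> z"
  have [measurable]: "g \<in> borel_measurable borel"
    using \<phi>(1) unfolding c1_test_def by (auto intro: borel_measurable_continuous_onI)
  have "0 \<le> (LINT z|lborel. kflux X (U z) k \<bullet> g (z - c))"
    using U c1_test_shift[OF \<phi>(1) c] \<phi>(2) unfolding entropy_ineq_def by blast
  also have "\<dots> = (LINT z|lborel. kflux X (U (z + c)) k \<bullet> g z)"
    using lborel_integral_shift[of "\<lambda>z. kflux X (U z) k \<bullet> g (z - c)" c] by simp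
  finally show "0 \<le> (LINT z|lborel. kflux X (U (z + c)) k \<bullet> g z)" .
qed

lemma L1_continuous_shift:
  assumes "L1_continuous u"
  shows "L1_continuous (\<lambda>t x. u t (x + c))"
proof -
  have i: "integrable lborel (u t)" if "0 \<le> t" for t using assms that by (simp add: L1_continuous_def)
  have m: "u t \<in> borel_measurable borel" if "0 \<le> t" for t using i[OF that] by auto
  have eq: "L1_norm (\<lambda>x. u s (x + c) - u t (x + c)) = L1_norm (\<lambda>x. u s x - u t x)" if "0 \<le> s" "0 \<le> t" for s t
    unfolding L1_norm_def using lborel_integral_shift[of "\<lambda>x. \<bar>u s x - u t x\<bar>" c] m that by simp
  have "((\<lambda>s. L1_norm (\<lambda>x. u s (x + c) - u t (x + c))) \<longlongrightarrow> 0) (at t within {0..})" if t: "0 \<le> t" for t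
  proof (rule Lim_transform_eventually)
    show "((\<lambda>s. L1_norm (\<lambda>x. u s x - u t x)) \<longlongrightarrow> 0) (at t within {0..})" using assms t by (simp add: L1_continuous_def)
    show "eventually (\<lambda>s. L1_norm (\<lambda>x. u s x - u t x) = L1_norm (\<lambda>x. u s (x + c) - u t (x + c))) (at t within {0..})"
      unfolding eventually_at_filter using eq t by (intro always_eventually) auto
  qed
  then show ?thesis using i m by (simp add: L1_continuous_def lborel_integrable_shift)
qed

theorem kruzhkov_translation_estimate:
  assumes u: "kruzhkov_solution b u" and [measurable]: "b \<in> borel_measurable borel" and t: "0 \<le> t"
  shows "L1_norm (\<lambda>x. u t (x + c) - u t x) \<le> L1_norm (\<lambda>x. b (x + c) - b x)"
proof -
  obtain M U where U: "U \<in> borel_measurable borel" "0 \<le> M" "\<And>z. \<bar>U z\<bar> \<le> M" "entropy_ineq spacetime_flux half_space U"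
    "AE z in lborel. z \<in> half_space \<longrightarrow> U z = u (fst z) (snd z)" "L1_continuous u"
    by (rule kruzhkov_representative[OF u]) (rule that)
  have [measurable]: "U \<in> borel_measurable borel" by (rule U)
  have "L1_norm (\<lambda>x. u t (x + c) - u t x) \<le> L1_norm (\<lambda>x. u 0 (x + c) - u 0 x)"
  proof (rule spacetime_L1_contraction[where U = "\<lambda>z. U (z + (0, c))" and V = U and M = M])
    show "entropy_ineq spacetime_flux half_space (\<lambda>z. U (z + (0, c)))"
      by (rule entropy_ineq_shift[OF U(4,1)]) auto
    have "AE z in lborel. z + (0, c) \<in> half_space \<longrightarrow> U (z + (0, c)) = u (fst (z + (0, c))) (snd (z + (0, c)))"
      by (rule AE_lborel_shift[OF U(5)])
    then show "AE z in lborel. z \<in> half_space \<longrightarrow> U (z + (0, c)) = u (fst z) (snd z + c)"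
      by eventually_elim (auto simp: mem_Times_iff)
  qed (use U t in \<open>auto intro: L1_continuous_shift\<close>)
  also have "\<dots> = L1_norm (\<lambda>x. b (x + c) - b x)"
    unfolding L1_norm_def
  proof (rule integral_cong_AE)
    have [measurable]: "u 0 \<in> borel_measurable borel" using U(6) unfolding L1_continuous_def by auto
    show "(\<lambda>x. \<bar>u 0 (x + c) - u 0 x\<bar>) \<in> borel_measurable lborel" by measurable
    have ae: "AE x in lborel. u 0 x = b x" using u by (simp add: kruzhkov_solution_def)
    show "AE x in lborel. \<bar>u 0 (x + c) - u 0 x\<bar> = \<bar>b (x + c) - b x\<bar>"
      using ae AE_lborel_shift[OF ae, of c] by eventually_elim simp
  qed measurable
  finally show ?thesis .
qed

text \<open>This is the decay of the distance to the zero solution, for which Kato's inequality is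
  the entropy inequality with constant 0.\<close>

theorem kruzhkov_L1_bound:
  assumes u: "kruzhkov_solution b u" and [measurable]: "b \<in> borel_measurable borel" and t: "0 \<le> t"
  shows "L1_norm (u t) \<le> L1_norm b"
proof -
  obtain M U where U: "U \<in> borel_measurable borel" "0 \<le> M" "\<And>z. \<bar>U z\<bar> \<le> M" "entropy_ineq spacetime_flux half_space U"
    "AE z in lborel. z \<in> half_space \<longrightarrow> U z = u (fst z) (snd z)" "L1_continuous u"
    by (rule kruzhkov_representative[OF u]) (rule that)
  have "L1_norm (\<lambda>x. u t x - 0) \<le> L1_norm (\<lambda>x. u 0 x - 0)"
    by (rule L1_decay[where U = U and V = "\<lambda>_. 0" and M = M and u = u and v = "\<lambda>_ _. 0"])
      (use U t in \<open>auto simp: L1_continuous_def L1_norm_def entropy_ineq_def\<close>)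
  also have "\<dots> = L1_norm b"
    unfolding L1_norm_def
  proof (rule integral_cong_AE)
    have [measurable]: "u 0 \<in> borel_measurable borel" using U(6) unfolding L1_continuous_def by auto
    show "(\<lambda>x. \<bar>u 0 x - 0\<bar>) \<in> borel_measurable lborel" by measurable
    show "AE x in lborel. \<bar>u 0 x - 0\<bar> = \<bar>b x\<bar>" using u by (auto simp: kruzhkov_solution_def)
  qed measurable
  finally show ?thesis by simp
qed

section \<open>Compensated compactness\<close>

text \<open>A class that is stable under averaging with any integrable weight, which compact support
  is not.\<close>

definition nice :: "('a::euclidean_space \<Rightarrow> real) \<Rightarrow> ('a \<Rightarrow> 'a) \<Rightarrow> bool" where
  "nice h g \<longleftrightarrow> is_grad h g \<and> uniformly_continuous_on UNIV g \<and> (\<exists>G. \<forall>z. norm (g z) \<le> G) \<and> (\<exists>C. \<forall>z. \<bar>h z\<bar> \<le> C)"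

lemma nice_measurable:
  assumes "nice h g"
  shows "h \<in> borel_measurable borel" "g \<in> borel_measurable borel"
  using assms unfolding nice_def
  by (auto intro: borel_measurable_continuous_onI is_grad_continuous uniformly_continuous_imp_continuous)

lemma nice_average:
  fixes h :: "'a::euclidean_space \<Rightarrow> real" and w :: "'b \<Rightarrow> real"
  assumes h: "nice h g" and w: "integrable M w" and \<zeta>[measurable]: "\<zeta> \<in> borel_measurable M"
  shows "nice (\<lambda>z. LINT r|M. w r * h (z - \<zeta> r)) (\<lambda>z. LINT r|M. w r *\<^sub>R g (z - \<zeta> r))"
proof -
  note [measurable] = nice_measurable[OF h]
  obtain G C where g: "is_grad h g" "uniformly_continuous_on UNIV g" "\<And>z. norm (g z) \<le> G" "\<And>z. \<bar>h z\<bar> \<le> C"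
    using h unfolding nice_def by blast
  have iw: "integrable M (\<lambda>r. \<bar>w r\<bar>)" using w by simp
  have ig: "integrable M (\<lambda>r. w r *\<^sub>R g (z - \<zeta> r))" for z
    using w g(3) by (intro integrable_scaleR_bounded[of _ _ _ G]) auto
  define W where "W = (LINT r|M. \<bar>w r\<bar>) + 1"
  have W: "0 < W" unfolding W_def by (intro add_nonneg_pos integral_nonneg_AE) auto
  have uc: "uniformly_continuous_on UNIV (\<lambda>z. LINT r|M. w r *\<^sub>R g (z - \<zeta> r))"
    unfolding uniformly_continuous_on_def
  proof (intro allI impI)
    fix e :: real assume "0 < e"
    then obtain d where d: "d > 0" "\<And>x y. dist x y < d \<Longrightarrow> dist (g x) (g y) < e / W"
      using g(2) W unfolding uniformly_continuous_on_def by (metis UNIV_I divide_pos_pos)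
    have "dist (LINT r|M. w r *\<^sub>R g (y - \<zeta> r)) (LINT r|M. w r *\<^sub>R g (x - \<zeta> r)) < e" if "dist y x < d" for x y
    proof -
      have "dist (LINT r|M. w r *\<^sub>R g (y - \<zeta> r)) (LINT r|M. w r *\<^sub>R g (x - \<zeta> r))
        = norm (LINT r|M. w r *\<^sub>R (g (y - \<zeta> r) - g (x - \<zeta> r)))"
        using ig by (simp add: dist_norm scaleR_diff_right)
      also have "\<dots> \<le> (LINT r|M. \<bar>w r\<bar> * (e / W))"
      proof (rule norm_integral_le)
        fix r
        have "dist (g (y - \<zeta> r)) (g (x - \<zeta> r)) < e / W" using that by (intro d(2)) (simp add: dist_norm)
        then show "norm (w r *\<^sub>R (g (y - \<zeta> r) - g (x - \<zeta> r))) \<le> \<bar>w r\<bar> * (e / W)"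
          unfolding norm_scaleR dist_norm by (intro mult_left_mono) auto
      qed (use iw in simp)
      also have "\<dots> = (LINT r|M. \<bar>w r\<bar>) * (e / W)" by simp
      also have "\<dots> < W * (e / W)" using \<open>0 < e\<close> W by (intro mult_strict_right_mono) (auto simp: W_def)
      also have "\<dots> = e" using W by simp
      finally show ?thesis .
    qed
    then show "\<exists>d>0. \<forall>x\<in>UNIV. \<forall>x'\<in>UNIV. dist x' x < d \<longrightarrow>
        dist (LINT r|M. w r *\<^sub>R g (x' - \<zeta> r)) (LINT r|M. w r *\<^sub>R g (x - \<zeta> r)) < e"
      using d(1) by blast
  qed
  have "norm (LINT r|M. w r *\<^sub>R g (z - \<zeta> r)) \<le> (LINT r|M. \<bar>w r\<bar> * G)" for z
    by (rule norm_integral_le) (use iw g(3) in \<open>auto intro: mult_left_mono\<close>)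
  moreover have "\<bar>LINT r|M. w r * h (z - \<zeta> r)\<bar> \<le> (LINT r|M. \<bar>w r\<bar> * C)" for z
    unfolding real_norm_def[symmetric]
    by (rule norm_integral_le) (use iw g(4) in \<open>auto simp: abs_mult intro: mult_left_mono\<close>)
  ultimately show ?thesis
    unfolding nice_def using is_grad_average[OF g w \<zeta>] uc by blast
qed

definition av :: "(real \<Rightarrow> real) \<Rightarrow> 'a \<Rightarrow> ('a::euclidean_space \<Rightarrow> 'b::{banach, second_countable_topology}) \<Rightarrow> 'a \<Rightarrow> 'b" where
  "av w e h z = (LINT r|lborel. w r *\<^sub>R h (z - r *\<^sub>R e))"

lemma nice_av:
  assumes "nice h g" "integrable lborel w"
  shows "nice (av w e h) (av w e g)"
  using nice_average[OF assms, of "\<lambda>r. r *\<^sub>R e"] by (simp add: av_def[abs_def])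

lemma av_measurable [measurable]:
  assumes [measurable]: "h \<in> borel_measurable borel" "w \<in> borel_measurable borel"
  shows "av w e h \<in> borel_measurable borel"
  unfolding av_def[abs_def] by measurable

lemma av_integrable:
  fixes h :: "'a::euclidean_space \<Rightarrow> 'b::{banach, second_countable_topology}"
  assumes "integrable lborel w" and [measurable]: "h \<in> borel_measurable borel" and "\<And>z. norm (h z) \<le> C"
  shows "integrable lborel (\<lambda>r. w r *\<^sub>R h (z - r *\<^sub>R e))"
  by (rule integrable_scaleR_bounded[OF assms(1), of _ C]) (use assms(3) in auto)

lemma av_inner:
  assumes "integrable lborel w" "g \<in> borel_measurable borel" "\<And>z. norm (g z) \<le> C"
  shows "av w e g z \<bullet> v = av w e (\<lambda>z. g z \<bullet> v) z"
  unfolding av_def using integral_inner_left[of v lborel "\<lambda>r. w r *\<^sub>R g (z - r *\<^sub>R e)"] av_integrable[OF assms] by simp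

lemma av_bound:
  assumes w: "integrable lborel w" and h: "\<And>r. w r \<noteq> 0 \<Longrightarrow> norm (h (z - r *\<^sub>R e)) \<le> C"
  shows "norm (av w e h z) \<le> (LINT r|lborel. \<bar>w r\<bar>) * C"
proof -
  have "norm (av w e h z) \<le> (LINT r|lborel. \<bar>w r\<bar> * C)"
    unfolding av_def
  proof (rule norm_integral_le)
    fix r show "norm (w r *\<^sub>R h (z - r *\<^sub>R e)) \<le> \<bar>w r\<bar> * C"
      using h[of r] by (cases "w r = 0") (auto intro: mult_left_mono)
  qed (use w in simp)
  then show ?thesis by simp
qed

lemma av_cong:
  assumes "\<And>r. w r \<noteq> 0 \<Longrightarrow> h (z - r *\<^sub>R e) = k (z - r *\<^sub>R e)"
  shows "av w e h z = av w e k z"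
  unfolding av_def
proof (rule Bochner_Integration.integral_cong[OF refl])
  fix r show "w r *\<^sub>R h (z - r *\<^sub>R e) = w r *\<^sub>R k (z - r *\<^sub>R e)"
    using assms[of r] by (cases "w r = 0") auto
qed

lemma av_linear:
  fixes h k :: "'a::euclidean_space \<Rightarrow> real"
  assumes "integrable lborel w" "h \<in> borel_measurable borel" "\<And>z. \<bar>h z\<bar> \<le> C"
    "k \<in> borel_measurable borel" "\<And>z. \<bar>k z\<bar> \<le> D"
  shows "av w e (\<lambda>z. h z + k z) z = av w e h z + av w e k z" "av w e (\<lambda>z. h z - k z) z = av w e h z - av w e k z"
    "av w e (\<lambda>z. - h z) z = - av w e h z"
  using av_integrable[OF assms(1,2), of C] av_integrable[OF assms(1,4), of D] assms(3,5)
  unfolding av_def by (simp_all add: distrib_left right_diff_distrib)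

definition box_weight :: "real \<Rightarrow> real \<Rightarrow> real" where
  "box_weight d r = indicator {0..d} r * (1 / d)"

text \<open>On the interval the ramp has slope \<open>- (1 / d)\<close>, the negative of the box
  weight, and it starts at 1 and ends at 0.\<close>

definition ramp_weight :: "real \<Rightarrow> real \<Rightarrow> real" where
  "ramp_weight d r = indicator {0..d} r * (1 - r / d)"

lemma box_weight:
  assumes "0 < d"
  shows "integrable lborel (box_weight d)" "(LINT r|lborel. \<bar>box_weight d r\<bar>) = 1" "(LINT r|lborel. box_weight d r) = 1"
    "0 \<le> box_weight d r" "box_weight d r \<noteq> 0 \<Longrightarrow> 0 \<le> r \<and> r \<le> d"
proof -
  have i: "integrable lborel (indicator {0..d} :: real \<Rightarrow> real)" by (intro integrable_real_indicator) (auto simp: emeasure_lborel_Icc_eq)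
  show "integrable lborel (box_weight d)" unfolding box_weight_def[abs_def] using i by simp
  show 1: "(LINT r|lborel. box_weight d r) = 1" unfolding box_weight_def using assms by simp
  have "\<bar>box_weight d r\<bar> = box_weight d r" for r using assms by (auto simp: box_weight_def)
  then show "(LINT r|lborel. \<bar>box_weight d r\<bar>) = 1" using 1 by simp
  show "0 \<le> box_weight d r" using assms by (simp add: box_weight_def)
  show "box_weight d r \<noteq> 0 \<Longrightarrow> 0 \<le> r \<and> r \<le> d" by (auto simp: box_weight_def indicator_def split: if_splits)
qed

lemma ramp_weight:
  assumes "0 < d"
  shows "integrable lborel (ramp_weight d)" "(LINT r|lborel. \<bar>ramp_weight d r\<bar>) \<le> d"
    "ramp_weight d r \<noteq> 0 \<Longrightarrow> 0 \<le> r \<and> r \<le> d"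
proof -
  have i: "integrable lborel (indicator {0..d} :: real \<Rightarrow> real)" by (intro integrable_real_indicator) (auto simp: emeasure_lborel_Icc_eq)
  have b: "\<bar>ramp_weight d r\<bar> \<le> indicator {0..d} r" for r using assms by (auto simp: ramp_weight_def indicator_def field_simps)
  show 1: "integrable lborel (ramp_weight d)"
    by (rule Bochner_Integration.integrable_bound[OF i])
      (use b in \<open>auto simp: ramp_weight_def[abs_def] intro!: AE_I2\<close>)
  have "(LINT r|lborel. \<bar>ramp_weight d r\<bar>) \<le> (LINT r|lborel. indicator {0..d} r)"
    by (rule integral_mono) (use 1 i b in auto)
  then show "(LINT r|lborel. \<bar>ramp_weight d r\<bar>) \<le> d" using assms by simp
  show "ramp_weight d r \<noteq> 0 \<Longrightarrow> 0 \<le> r \<and> r \<le> d" by (auto simp: ramp_weight_def indicator_def split: if_splits)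
qed

lemma line_derivative:
  assumes "nice h g"
  shows "((\<lambda>r. h (z - r *\<^sub>R e)) has_vector_derivative - (g (z - r *\<^sub>R e) \<bullet> e)) (at r within S)"
proof -
  have "(h has_derivative (\<bullet>) (g (z - r *\<^sub>R e))) (at (z - r *\<^sub>R e))" using assms by (auto simp: nice_def is_grad_def)
  moreover have "((\<lambda>r. z - r *\<^sub>R e) has_derivative (\<lambda>s. - (s *\<^sub>R e))) (at r within S)" by (auto intro!: derivative_eq_intros)
  ultimately have "((\<lambda>r. h (z - r *\<^sub>R e)) has_derivative (\<lambda>s. g (z - r *\<^sub>R e) \<bullet> (- (s *\<^sub>R e)))) (at r within S)"
    using has_derivative_compose[of "\<lambda>r. z - r *\<^sub>R e" "\<lambda>s. - (s *\<^sub>R e)" r S h] by blast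
  then show ?thesis unfolding has_vector_derivative_def by (rule has_derivative_eq_rhs) (auto simp: fun_eq_iff)
qed

lemma nice_continuous:
  assumes "nice h g"
  shows "continuous_on A (\<lambda>r. h (z - r *\<^sub>R e))" "continuous_on A (\<lambda>r. g (z - r *\<^sub>R e))"
proof -
  have "continuous_on UNIV h" "continuous_on UNIV g"
    using assms by (auto simp: nice_def intro: is_grad_continuous uniformly_continuous_imp_continuous)
  then show "continuous_on A (\<lambda>r. h (z - r *\<^sub>R e))" "continuous_on A (\<lambda>r. g (z - r *\<^sub>R e))"
    by (auto intro!: continuous_on_compose2[of UNIV h] continuous_on_compose2[of UNIV g] continuous_intros)
qed

lemma av_box_derivative:
  assumes h: "nice h g" and d: "0 < d"
  shows "av (box_weight d) e (\<lambda>z. g z \<bullet> e) z = (h z - h (z - d *\<^sub>R e)) / d"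
proof -
  have "(LINT r|lborel. indicator {0..d} r *\<^sub>R (g (z - r *\<^sub>R e) \<bullet> e)) = - h (z - d *\<^sub>R e) - (- h (z - 0 *\<^sub>R e))"
  proof (rule integral_FTC_Icc)
    show "((\<lambda>r. - h (z - r *\<^sub>R e)) has_vector_derivative g (z - r *\<^sub>R e) \<bullet> e) (at r within {0..d})" for r
      using has_vector_derivative_minus[OF line_derivative[OF h, of z e r "{0..d}"]] by simp
    show "continuous_on {0..d} (\<lambda>r. g (z - r *\<^sub>R e) \<bullet> e)" by (intro continuous_intros nice_continuous(2)[OF h])
  qed (use d in auto)
  moreover have "av (box_weight d) e (\<lambda>z. g z \<bullet> e) z = (LINT r|lborel. indicator {0..d} r *\<^sub>R (g (z - r *\<^sub>R e) \<bullet> e)) / d"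
    unfolding av_def box_weight_def by (subst integral_divide_zero[symmetric]) (simp add: mult.commute)
  ultimately show ?thesis by simp
qed

text \<open>Integration by parts against the ramp. It acts as an approximate inverse of the
  derivative along \<open>e\<close>: the function is recovered up to its mean over a segment of
  length \<open>d\<close>.\<close>

lemma av_ramp_derivative:
  assumes h: "nice h g" and d: "0 < d"
  shows "av (ramp_weight d) e (\<lambda>z. g z \<bullet> e) z = h z - av (box_weight d) e h z"
proof -
  obtain G C where g: "\<And>z. norm (g z) \<le> G" "\<And>z. \<bar>h z\<bar> \<le> C" using h unfolding nice_def by blast
  note [measurable] = nice_measurable[OF h]
  have "(LINT r|lborel. indicator {0..d} r *\<^sub>R ((1 - r / d) * (g (z - r *\<^sub>R e) \<bullet> e) + 1 / d * h (z - r *\<^sub>R e)))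
    = - ((1 - d / d) * h (z - d *\<^sub>R e)) - (- ((1 - 0 / d) * h (z - 0 *\<^sub>R e)))"
  proof (rule integral_FTC_Icc)
    fix r
    have "((\<lambda>r. 1 - r / d) has_vector_derivative - (1 / d)) (at r within {0..d})"
      using d by (auto intro!: derivative_eq_intros simp: has_real_derivative_iff_has_vector_derivative[symmetric])
    from has_vector_derivative_minus[OF has_vector_derivative_mult[OF this line_derivative[OF h, of z e r "{0..d}"]]]
    show "((\<lambda>r. - ((1 - r / d) * h (z - r *\<^sub>R e))) has_vector_derivative
        (1 - r / d) * (g (z - r *\<^sub>R e) \<bullet> e) + 1 / d * h (z - r *\<^sub>R e)) (at r within {0..d})"
      by (simp add: algebra_simps)
    show "continuous_on {0..d} (\<lambda>r. (1 - r / d) * (g (z - r *\<^sub>R e) \<bullet> e) + 1 / d * h (z - r *\<^sub>R e))"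
      by (intro continuous_intros nice_continuous[OF h]) (use d in auto)
  qed (use d in auto)
  moreover have "(\<lambda>r. indicator {0..d} r *\<^sub>R ((1 - r / d) * (g (z - r *\<^sub>R e) \<bullet> e) + 1 / d * h (z - r *\<^sub>R e)))
    = (\<lambda>r. ramp_weight d r *\<^sub>R (g (z - r *\<^sub>R e) \<bullet> e) + box_weight d r *\<^sub>R h (z - r *\<^sub>R e))"
    by (auto simp: ramp_weight_def box_weight_def fun_eq_iff algebra_simps)
  moreover have "integrable lborel (\<lambda>r. ramp_weight d r *\<^sub>R (g (z - r *\<^sub>R e) \<bullet> e))"
  proof (rule av_integrable[OF ramp_weight(1)[OF d], of _ "G * norm e"])
    show "norm (g z \<bullet> e) \<le> G * norm e" for z
      using g(1)[of z] Cauchy_Schwarz_ineq2[of "g z" e] mult_right_mono[of "norm (g z)" G "norm e"] by simp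
  qed measurable
  moreover have "integrable lborel (\<lambda>r. box_weight d r *\<^sub>R h (z - r *\<^sub>R e))"
    by (rule av_integrable[OF box_weight(1)[OF d], of _ C]) (use g in auto)
  ultimately show ?thesis using d by (simp add: av_def)
qed

lemma nice_diff:
  assumes "nice h g" "nice k l"
  shows "nice (\<lambda>z. h z - k z) (\<lambda>z. g z - l z)"
proof -
  have "is_grad (\<lambda>z. h z - k z) (\<lambda>z. g z - l z)"
    using assms unfolding nice_def is_grad_def
    by (auto intro!: has_derivative_eq_rhs[OF has_derivative_diff] simp: inner_diff_left)
  moreover have "uniformly_continuous_on UNIV (\<lambda>z. g z - l z)"
    using assms unfolding nice_def by (intro uniformly_continuous_on_diff) auto
  moreover obtain G L where "\<And>z. norm (g z) \<le> G" "\<And>z. norm (l z) \<le> L" using assms unfolding nice_def by blast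
  then have "norm (g z - l z) \<le> G + L" for z by (meson add_mono norm_triangle_ineq4 order_trans)
  moreover obtain C D where "\<And>z. \<bar>h z\<bar> \<le> C" "\<And>z. \<bar>k z\<bar> \<le> D" using assms unfolding nice_def by blast
  then have "\<bar>h z - k z\<bar> \<le> C + D" for z by (meson add_mono abs_triangle_ineq4 order_trans)
  ultimately show ?thesis unfolding nice_def by blast
qed

text \<open>A field that is divergence free up to the \<open>es\<close>-component has an approximate potential: after
  averaging in direction \<open>es\<close> the \<open>es\<close>-derivative is of size \<open>1 / h\<close> and so negligible at scale \<open>d\<close>.\<close>

lemma approximate_potential:
  fixes a1 a2 a3 :: "'a::euclidean_space \<Rightarrow> real"
  assumes a: "nice a1 g1" "nice a2 g2" "nice a3 g3" and d: "0 < d" and h: "0 < h"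
    and N: "\<And>z. \<bar>a1 z\<bar> \<le> N" "\<And>z. \<bar>a2 z\<bar> \<le> N" "\<And>z. \<bar>a3 z\<bar> \<le> N"
    and div: "\<And>z. z \<in> D \<Longrightarrow> g1 z \<bullet> et + g2 z \<bullet> ey + g3 z \<bullet> es = 0"
    and R: "\<And>z r p q. z \<in> R \<Longrightarrow> 0 \<le> r \<Longrightarrow> r \<le> d \<Longrightarrow> z - r *\<^sub>R et - p *\<^sub>R ey - q *\<^sub>R es \<in> D"
  defines "A \<equiv> av (box_weight h) es a1" and "B \<equiv> av (box_weight h) es a2"
  defines "bar \<equiv> \<lambda>f. av (box_weight d) et (av (box_weight d) ey f)"
  obtains \<Phi> g\<Phi> where "nice \<Phi> g\<Phi>" "\<And>z. \<bar>\<Phi> z\<bar> \<le> 2 * d * N" "\<And>z. \<bar>g\<Phi> z \<bullet> es\<bar> \<le> 4 * d * N / h"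
    "\<And>z. z \<in> R \<Longrightarrow> \<bar>g\<Phi> z \<bullet> ey - (A z - bar A z)\<bar> \<le> 2 * d * N / h"
    "\<And>z. z \<in> R \<Longrightarrow> \<bar>g\<Phi> z \<bullet> et + (B z - bar B z)\<bar> \<le> 2 * d * N / h"
proof -
  define gA where "gA = av (box_weight h) es g1"
  define gB where "gB = av (box_weight h) es g2"
  have nA: "nice A gA" and nB: "nice B gB"
    unfolding A_def B_def gA_def gB_def by (rule nice_av[OF a(1) box_weight(1)[OF h]] nice_av[OF a(2) box_weight(1)[OF h]])+
  define A2 where "A2 = av (box_weight d) ey A"
  define B2 where "B2 = av (box_weight d) ey B"
  define gA2 where "gA2 = av (box_weight d) ey gA"
  define gB2 where "gB2 = av (box_weight d) ey gB"
  have nA2: "nice A2 gA2" and nB2: "nice B2 gB2"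
    unfolding A2_def B2_def gA2_def gB2_def by (rule nice_av[OF nA box_weight(1)[OF d]] nice_av[OF nB box_weight(1)[OF d]])+
  \<comment> \<open>The first term is a primitive of \<open>A\<close> along \<open>ey\<close> up to
    the mean \<open>A2\<close>. The second uses the divergence condition: its
    \<open>ey\<close>-derivative turns the missing \<open>A2\<close> into the double mean, and its
    \<open>et\<close>-derivative does the same for \<open>B\<close>.\<close>
  define \<Phi> where "\<Phi> z = av (ramp_weight d) ey A z - av (ramp_weight d) et B2 z" for z
  define g\<Phi> where "g\<Phi> z = av (ramp_weight d) ey gA z - av (ramp_weight d) et gB2 z" for z
  have n\<Phi>: "nice \<Phi> g\<Phi>"
    unfolding \<Phi>_def[abs_def] g\<Phi>_def[abs_def]
    by (rule nice_diff[OF nice_av[OF nA ramp_weight(1)[OF d]] nice_av[OF nB2 ramp_weight(1)[OF d]]])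
  \<comment> \<open>The \<open>es\<close>-derivative of the averaged third component is a difference
    quotient over the length \<open>h\<close>, hence of size \<open>2 * N / h\<close>. It is the
    only defect of the divergence in the plane of \<open>et\<close> and \<open>ey\<close>.\<close>
  define \<gamma> where "\<gamma> z = (a3 z - a3 (z - h *\<^sub>R es)) / h" for z
  have N0: "0 \<le> N" using N(1)[of 0] by linarith
  have \<gamma>b: "\<bar>\<gamma> z\<bar> \<le> 2 * N / h" for z
  proof -
    have "\<bar>a3 z - a3 (z - h *\<^sub>R es)\<bar> \<le> 2 * N" using N(3)[of z] N(3)[of "z - h *\<^sub>R es"] by linarith
    then show ?thesis using h by (simp add: \<gamma>_def abs_divide divide_right_mono)
  qed
  note [measurable] = nice_measurable[OF a(1)] nice_measurable[OF a(2)] nice_measurable[OF a(3)]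
    nice_measurable[OF nA] nice_measurable[OF nB] nice_measurable[OF nA2] nice_measurable[OF nB2]
  have \<gamma>m[measurable]: "\<gamma> \<in> borel_measurable borel" unfolding \<gamma>_def[abs_def] by measurable
  have Ab: "\<bar>A z\<bar> \<le> N" and Bb: "\<bar>B z\<bar> \<le> N" for z
    using av_bound[OF box_weight(1)[OF h], of a1 z es N] av_bound[OF box_weight(1)[OF h], of a2 z es N] N box_weight(2)[OF h]
    unfolding A_def B_def by auto
  have A2b: "\<bar>A2 z\<bar> \<le> N" and B2b: "\<bar>B2 z\<bar> \<le> N" for z
    using av_bound[OF box_weight(1)[OF d], of A z ey N] av_bound[OF box_weight(1)[OF d], of B z ey N] Ab Bb box_weight(2)[OF d]
    unfolding A2_def B2_def by auto
  have ramp: "\<bar>av (ramp_weight d) e k z\<bar> \<le> d * c" if "\<And>r. 0 \<le> r \<Longrightarrow> r \<le> d \<Longrightarrow> \<bar>k (z - r *\<^sub>R e)\<bar> \<le> c" "0 \<le> c" for k :: "'a \<Rightarrow> real" and e z c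
  proof -
    have "norm (av (ramp_weight d) e k z) \<le> (LINT r|lborel. \<bar>ramp_weight d r\<bar>) * c"
      by (rule av_bound[OF ramp_weight(1)[OF d]]) (use that ramp_weight(3)[OF d] in auto)
    also have "\<dots> \<le> d * c" using ramp_weight(2)[OF d] that(2) by (rule mult_right_mono)
    finally show ?thesis by simp
  qed
  have box: "\<bar>av (box_weight d) e k z\<bar> \<le> c" if "\<And>r. \<bar>k (z - r *\<^sub>R e)\<bar> \<le> c" for k :: "'a \<Rightarrow> real" and e z c
    using av_bound[OF box_weight(1)[OF d], of k z e c] that box_weight(2)[OF d] by simp
  obtain G1 G2 where G: "\<And>z. norm (gA z) \<le> G1" "\<And>z. norm (gB z) \<le> G2" using nA nB unfolding nice_def by blast
  obtain G3 G4 where G': "\<And>z. norm (gA2 z) \<le> G3" "\<And>z. norm (gB2 z) \<le> G4" using nA2 nB2 unfolding nice_def by blast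
  obtain H1 H2 H3 where H: "\<And>z. norm (g1 z) \<le> H1" "\<And>z. norm (g2 z) \<le> H2" "\<And>z. norm (g3 z) \<le> H3"
    using a unfolding nice_def by blast
  have inn: "\<bar>v \<bullet> e\<bar> \<le> c * norm e" if "norm v \<le> c" for v e :: 'a and c
    using that Cauchy_Schwarz_ineq2[of v e] mult_right_mono[of "norm v" c "norm e"] by simp
  have divAB: "gB z \<bullet> ey = - (gA z \<bullet> et) - \<gamma> z" if z: "\<And>q. z - q *\<^sub>R es \<in> D" for z
  proof -
    have "gA z \<bullet> et + gB z \<bullet> ey + \<gamma> z = av (box_weight h) es (\<lambda>z. g1 z \<bullet> et) z + av (box_weight h) es (\<lambda>z. g2 z \<bullet> ey) z
       + av (box_weight h) es (\<lambda>z. g3 z \<bullet> es) z"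
      unfolding gA_def gB_def \<gamma>_def av_box_derivative[OF a(3) h]
      using av_inner[OF box_weight(1)[OF h], of g1 H1] av_inner[OF box_weight(1)[OF h], of g2 H2] H by simp
    also have "\<dots> = av (box_weight h) es (\<lambda>z. g1 z \<bullet> et + g2 z \<bullet> ey + g3 z \<bullet> es) z"
    proof -
      have b12: "\<bar>g1 z \<bullet> et + g2 z \<bullet> ey\<bar> \<le> H1 * norm et + H2 * norm ey" for z
        using inn[OF H(1), of z et] inn[OF H(2), of z ey] by linarith
      show ?thesis
        by (subst av_linear(1)[OF box_weight(1)[OF h] _ b12 _ inn[OF H(3)]], simp, simp,
            subst av_linear(1)[OF box_weight(1)[OF h] _ inn[OF H(1)] _ inn[OF H(2)]]) simp_all
    qed
    also have "\<dots> = av (box_weight h) es (\<lambda>z. 0) z" by (rule av_cong) (use div z in auto)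
    finally show ?thesis by (simp add: av_def)
  qed
  have gBm: "gA z \<bullet> et = - (gB z \<bullet> ey) - \<gamma> z" if "\<And>q. z - q *\<^sub>R es \<in> D" for z
    using divAB[OF that] by simp
  show ?thesis
  proof (rule that[OF n\<Phi>])
    show "\<bar>\<Phi> z\<bar> \<le> 2 * d * N" for z
    proof -
      have "\<bar>av (ramp_weight d) ey A z\<bar> \<le> d * N" "\<bar>av (ramp_weight d) et B2 z\<bar> \<le> d * N"
        by (rule ramp, use Ab B2b N0 in auto)+
      then show ?thesis unfolding \<Phi>_def by linarith
    qed
    have es: "gA z \<bullet> es = (a1 z - a1 (z - h *\<^sub>R es)) / h" "gB z \<bullet> es = (a2 z - a2 (z - h *\<^sub>R es)) / h" for z
      unfolding gA_def gB_def av_box_derivative[OF a(1) h, symmetric] av_box_derivative[OF a(2) h, symmetric]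
      using av_inner[OF box_weight(1)[OF h], of g1 H1] av_inner[OF box_weight(1)[OF h], of g2 H2] H by auto
    have esb: "\<bar>gA z \<bullet> es\<bar> \<le> 2 * N / h" "\<bar>gB z \<bullet> es\<bar> \<le> 2 * N / h" for z
    proof -
      have "\<bar>a1 z - a1 (z - h *\<^sub>R es)\<bar> \<le> 2 * N" "\<bar>a2 z - a2 (z - h *\<^sub>R es)\<bar> \<le> 2 * N"
        using N(1)[of z] N(1)[of "z - h *\<^sub>R es"] N(2)[of z] N(2)[of "z - h *\<^sub>R es"] by linarith+
      then show "\<bar>gA z \<bullet> es\<bar> \<le> 2 * N / h" "\<bar>gB z \<bullet> es\<bar> \<le> 2 * N / h"
        using h by (simp_all add: es abs_divide divide_right_mono)
    qed
    have gB2: "gB2 z \<bullet> v = av (box_weight d) ey (\<lambda>z. gB z \<bullet> v) z" "gA2 z \<bullet> v = av (box_weight d) ey (\<lambda>z. gA z \<bullet> v) z" for z v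
      unfolding gB2_def gA2_def using av_inner[OF box_weight(1)[OF d], of gB G2] av_inner[OF box_weight(1)[OF d], of gA G1] G by auto
    have g\<Phi>v: "g\<Phi> z \<bullet> v = av (ramp_weight d) ey (\<lambda>z. gA z \<bullet> v) z - av (ramp_weight d) et (\<lambda>z. gB2 z \<bullet> v) z" for z v
      unfolding g\<Phi>_def inner_diff_left
      using av_inner[OF ramp_weight(1)[OF d], of gA G1] av_inner[OF ramp_weight(1)[OF d], of gB2 G4] G G' by simp
    show "\<bar>g\<Phi> z \<bullet> es\<bar> \<le> 4 * d * N / h" for z
    proof -
      have "\<bar>av (ramp_weight d) ey (\<lambda>z. gA z \<bullet> es) z\<bar> \<le> d * (2 * N / h)"
        by (rule ramp) (use esb(1) N0 h in auto)
      moreover have "\<bar>gB2 z \<bullet> es\<bar> \<le> 2 * N / h" for z unfolding gB2 by (rule box) (rule esb)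
      then have "\<bar>av (ramp_weight d) et (\<lambda>z. gB2 z \<bullet> es) z\<bar> \<le> d * (2 * N / h)"
        by (intro ramp) (use N0 h in auto)
      ultimately have "\<bar>g\<Phi> z \<bullet> es\<bar> \<le> d * (2 * N / h) + d * (2 * N / h)"
        unfolding g\<Phi>v by (rule order_trans[OF abs_triangle_ineq4 add_mono])
      then show ?thesis by (simp add: algebra_simps)
    qed
    fix z assume z: "z \<in> R"
    show "\<bar>g\<Phi> z \<bullet> ey - (A z - bar A z)\<bar> \<le> 2 * d * N / h"
    proof -
      \<comment> \<open>The divergence condition is used at points displaced backwards along
        \<open>et\<close> by at most \<open>d\<close>, and arbitrarily far along the other
        directions; these are the displacements that the set \<open>R\<close> allows for.\<close>
      have 1: "gB2 (z - r *\<^sub>R et) \<bullet> ey = - (gA2 (z - r *\<^sub>R et) \<bullet> et) - av (box_weight d) ey \<gamma> (z - r *\<^sub>R et)"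
        if r: "0 \<le> r" "r \<le> d" for r
      proof -
        have "gB2 (z - r *\<^sub>R et) \<bullet> ey = av (box_weight d) ey (\<lambda>z. - (gA z \<bullet> et) - \<gamma> z) (z - r *\<^sub>R et)"
          unfolding gB2
        proof (rule av_cong)
          fix p assume "box_weight d p \<noteq> 0"
          show "gB (z - r *\<^sub>R et - p *\<^sub>R ey) \<bullet> ey = - (gA (z - r *\<^sub>R et - p *\<^sub>R ey) \<bullet> et) - \<gamma> (z - r *\<^sub>R et - p *\<^sub>R ey)"
            by (rule divAB) (rule R[OF z r])
        qed
        also have "\<dots> = av (box_weight d) ey (\<lambda>z. - (gA z \<bullet> et)) (z - r *\<^sub>R et) - av (box_weight d) ey \<gamma> (z - r *\<^sub>R et)"
        proof (rule av_linear(2)[OF box_weight(1)[OF d] _ _ _ \<gamma>b])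
          show "\<bar>- (gA z \<bullet> et)\<bar> \<le> G1 * norm et" for z using inn[OF G(1)] by simp
        qed measurable
        also have "av (box_weight d) ey (\<lambda>z. - (gA z \<bullet> et)) (z - r *\<^sub>R et) = - av (box_weight d) ey (\<lambda>z. gA z \<bullet> et) (z - r *\<^sub>R et)"
          by (rule av_linear(3)[OF box_weight(1)[OF d] _ inn[OF G(1)] \<gamma>m \<gamma>b]) auto
        finally show ?thesis by (simp add: gB2)
      qed
      have \<gamma>2m[measurable]: "av (box_weight d) ey \<gamma> \<in> borel_measurable borel" unfolding box_weight_def[abs_def] by measurable
      have \<gamma>2b: "\<bar>av (box_weight d) ey \<gamma> z\<bar> \<le> 2 * N / h" for z by (rule box) (rule \<gamma>b)
      have "av (ramp_weight d) et (\<lambda>z. gB2 z \<bullet> ey) z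
        = av (ramp_weight d) et (\<lambda>z. - (gA2 z \<bullet> et) - av (box_weight d) ey \<gamma> z) z"
        by (rule av_cong) (use 1 ramp_weight(3)[OF d] in auto)
      also have "\<dots> = av (ramp_weight d) et (\<lambda>z. - (gA2 z \<bullet> et)) z - av (ramp_weight d) et (av (box_weight d) ey \<gamma>) z"
      proof (rule av_linear(2)[OF ramp_weight(1)[OF d] _ _ \<gamma>2m \<gamma>2b])
        show "\<bar>- (gA2 z \<bullet> et)\<bar> \<le> G3 * norm et" for z using inn[OF G'(1)] by simp
      qed measurable
      also have "av (ramp_weight d) et (\<lambda>z. - (gA2 z \<bullet> et)) z = - av (ramp_weight d) et (\<lambda>z. gA2 z \<bullet> et) z"
        by (rule av_linear(3)[OF ramp_weight(1)[OF d] _ inn[OF G'(1)] \<gamma>m \<gamma>b]) auto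
      also have "av (ramp_weight d) et (\<lambda>z. gA2 z \<bullet> et) z = A2 z - av (box_weight d) et A2 z"
        by (rule av_ramp_derivative[OF nA2 d])
      finally have "g\<Phi> z \<bullet> ey - (A z - bar A z) = av (ramp_weight d) et (av (box_weight d) ey \<gamma>) z"
        unfolding g\<Phi>v av_ramp_derivative[OF nA d] by (simp add: bar_def A2_def)
      moreover have "\<bar>av (ramp_weight d) et (av (box_weight d) ey \<gamma>) z\<bar> \<le> d * (2 * N / h)"
        by (rule ramp) (use \<gamma>2b N0 h in auto)
      ultimately show ?thesis by (simp add: mult_ac)
    qed
    show "\<bar>g\<Phi> z \<bullet> et + (B z - bar B z)\<bar> \<le> 2 * d * N / h"
    proof -
      have "av (ramp_weight d) ey (\<lambda>z. gA z \<bullet> et) z = av (ramp_weight d) ey (\<lambda>z. - (gB z \<bullet> ey) - \<gamma> z) z"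
      proof (rule av_cong)
        fix p
        have "z - p *\<^sub>R ey - q *\<^sub>R es \<in> D" for q using R[OF z, of 0 p q] d by simp
        then show "gA (z - p *\<^sub>R ey) \<bullet> et = - (gB (z - p *\<^sub>R ey) \<bullet> ey) - \<gamma> (z - p *\<^sub>R ey)" by (rule gBm)
      qed
      also have "\<dots> = av (ramp_weight d) ey (\<lambda>z. - (gB z \<bullet> ey)) z - av (ramp_weight d) ey \<gamma> z"
      proof (rule av_linear(2)[OF ramp_weight(1)[OF d] _ _ \<gamma>m \<gamma>b])
        show "\<bar>- (gB z \<bullet> ey)\<bar> \<le> G2 * norm ey" for z using inn[OF G(2)] by simp
      qed measurable
      also have "av (ramp_weight d) ey (\<lambda>z. - (gB z \<bullet> ey)) z = - av (ramp_weight d) ey (\<lambda>z. gB z \<bullet> ey) z"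
        by (rule av_linear(3)[OF ramp_weight(1)[OF d] _ inn[OF G(2)] \<gamma>m \<gamma>b]) auto
      also have "av (ramp_weight d) ey (\<lambda>z. gB z \<bullet> ey) z = B z - B2 z"
        unfolding B2_def by (rule av_ramp_derivative[OF nB d])
      finally have "g\<Phi> z \<bullet> et + (B z - bar B z) = - av (ramp_weight d) ey \<gamma> z"
        unfolding g\<Phi>v av_ramp_derivative[OF nB2 d] by (simp add: bar_def B2_def)
      moreover have "\<bar>av (ramp_weight d) ey \<gamma> z\<bar> \<le> d * (2 * N / h)"
        by (rule ramp) (use \<gamma>b N0 h in auto)
      ultimately show ?thesis by (simp add: mult_ac)
    qed
  qed
qed

section \<open>Entropy production as a bounded measure\<close>

text \<open>By translation invariance the integral of \<phi> over translates of a large ball is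
  constant near the origin. Its gradient there is 0, and it is also the integral of
  \<open>g\<close>.\<close>

lemma integral_grad_zero:
  assumes "c1_test UNIV \<phi> g"
  shows "(LINT z|lborel. g z) = 0"
proof -
  obtain K C where K: "compact K" "\<And>z. z \<notin> K \<Longrightarrow> \<phi> z = 0" "\<And>z. z \<notin> K \<Longrightarrow> g z = 0"
    and C: "\<And>z. \<bar>\<phi> z\<bar> \<le> C" "\<And>z. norm (g z) \<le> C" "is_grad \<phi> g" "uniformly_continuous_on UNIV g"
      "continuous_on UNIV \<phi>" "continuous_on UNIV g"
    using assms by (rule c1_testE) blast
  have [measurable]: "\<phi> \<in> borel_measurable borel" "g \<in> borel_measurable borel"
    using C(5,6) by (auto intro: borel_measurable_continuous_onI)
  obtain B where B: "K \<subseteq> ball 0 B" using compact_imp_bounded[OF K(1)] bounded_subset_ballD by blast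
  define w :: "'a \<Rightarrow> real" where "w = indicator (ball 0 (B + 1))"
  have w: "integrable lborel w"
    using emeasure_bounded_finite[OF bounded_ball, of "0 :: 'a" "B + 1"] unfolding w_def by (intro integrable_real_indicator) auto
  have ws: "w r * f (z - r) = f (z - r)" if "norm z < 1" "\<And>z. z \<notin> K \<Longrightarrow> f z = 0" for f :: "'a \<Rightarrow> real" and z r
  proof (cases "z - r \<in> K")
    case True
    then have "norm (z - r) < B" using B by auto
    then have "norm r < B + 1" using that(1) norm_triangle_ineq4[of z "z - r"] by simp
    then show ?thesis by (simp add: w_def)
  qed (use that(2) in simp)
  define S where "S z = (LINT r|lborel. w r * \<phi> (z - r))" for z
  define gS where "gS z = (LINT r|lborel. w r *\<^sub>R g (z - r))" for z
  have gr: "is_grad S gS" unfolding S_def[abs_def] gS_def[abs_def]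
    by (rule is_grad_average[OF C(3,4,2,1) w, of "\<lambda>r. r"]) simp
  have const: "S z = (LINT r|lborel. \<phi> r)" if "norm z < 1" for z
  proof -
    have "(\<lambda>r. w r * \<phi> (z - r)) = (\<lambda>r. \<phi> (z - r))" using ws[OF that, of \<phi>] K(2) by blast
    then show ?thesis using lborel_integral_reflect[of \<phi> z] by (simp add: S_def)
  qed
  have "is_grad (\<lambda>z. S z + (- (LINT r|lborel. \<phi> r))) (\<lambda>z. gS z + 0)"
    by (rule is_grad_add[OF gr]) (simp add: is_grad_def)
  then have "gS 0 = 0"
    using is_grad_zero[of "\<lambda>z. S z + (- (LINT r|lborel. \<phi> r))" "\<lambda>z. gS z + 0" "- ball 0 1" 0] const by auto
  moreover have "w r *\<^sub>R g (0 - r) = g (0 - r)" for r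
  proof (cases "- r \<in> K")
    case True then show ?thesis using B by (auto simp: w_def)
  qed (use K(3) in simp)
  ultimately show ?thesis using lborel_integral_reflect[of g 0] by (simp add: gS_def)
qed

lemma c1_test_mono: "c1_test \<Omega> \<phi> g \<Longrightarrow> \<Omega> \<subseteq> \<Omega>' \<Longrightarrow> c1_test \<Omega>' \<phi> g"
  unfolding c1_test_def by blast

lemma c1_test_lincomb:
  assumes "c1_test \<Omega> \<phi> g" "c1_test \<Omega> \<psi> k"
  shows "c1_test \<Omega> (\<lambda>z. a * \<phi> z + b * \<psi> z) (\<lambda>z. a *\<^sub>R g z + b *\<^sub>R k z)"
proof -
  obtain K where K: "compact K" "K \<subseteq> \<Omega>" "\<And>z. z \<notin> K \<Longrightarrow> \<phi> z = 0" "is_grad \<phi> g" "continuous_on UNIV g"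
    using assms(1) unfolding c1_test_def by blast
  obtain L where L: "compact L" "L \<subseteq> \<Omega>" "\<And>z. z \<notin> L \<Longrightarrow> \<psi> z = 0" "is_grad \<psi> k" "continuous_on UNIV k"
    using assms(2) unfolding c1_test_def by blast
  show ?thesis
    unfolding c1_test_def using K L
    by (intro conjI exI[of _ "K \<union> L"] is_grad_add is_grad_cmult continuous_intros) auto
qed

lemma integrable_inner_test:
  fixes V :: "'a::euclidean_space \<Rightarrow> 'a"
  assumes \<phi>: "c1_test \<Omega> \<phi> g" and [measurable]: "V \<in> borel_measurable borel" and V: "\<And>z. norm (V z) \<le> B"
  shows "integrable lborel (\<lambda>z. V z \<bullet> g z)" "\<bar>LINT z|lborel. V z \<bullet> g z\<bar> \<le> B * (LINT z|lborel. norm (g z))"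
    "integrable lborel (\<lambda>z. norm (g z))"
proof -
  obtain K where K: "compact K" "\<And>z. z \<notin> K \<Longrightarrow> g z = 0" "continuous_on UNIV g" using \<phi> by (rule c1_testE) blast
  have [measurable]: "g \<in> borel_measurable borel" using K(3) by (rule borel_measurable_continuous_onI)
  show i: "integrable lborel (\<lambda>z. norm (g z))" by (rule integrable_norm[OF integrable_compact_support[OF K(3,1,2)]])
  have b: "norm (V z \<bullet> g z) \<le> B * norm (g z)" for z
    unfolding real_norm_def by (rule order_trans[OF Cauchy_Schwarz_ineq2]) (intro mult_right_mono V norm_ge_zero)
  show "integrable lborel (\<lambda>z. V z \<bullet> g z)"
    by (rule Bochner_Integration.integrable_bound[where f = "\<lambda>z. B * norm (g z)"])
      (use i in simp, measurable, use b in \<open>auto intro!: AE_I2 intro: order_trans[OF _ abs_ge_self]\<close>)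
  have "norm (LINT z|lborel. V z \<bullet> g z) \<le> (LINT z|lborel. B * norm (g z))"
    by (rule norm_integral_le) (use i b in auto)
  then show "\<bar>LINT z|lborel. V z \<bullet> g z\<bar> \<le> B * (LINT z|lborel. norm (g z))" by simp
qed

text \<open>Superposing Kruzhkov fluxes with the density \<open>f'\<close>, the second derivative of
  an entropy, gives twice the flux \<open>Y\<close> of that entropy up to a multiple of
  \<open>X\<close> and a constant. The density may have any sign.\<close>

lemma kruzhkov_superposition:
  fixes X X' Y :: "real \<Rightarrow> 'a::euclidean_space"
  assumes X: "\<And>w. (X has_vector_derivative X' w) (at w)"
    and f: "\<And>w. (f has_real_derivative f' w) (at w)" "continuous_on UNIV f'"
    and Y: "\<And>w. (Y has_vector_derivative f w *\<^sub>R X' w) (at w)"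
    and w: "\<bar>w\<bar> \<le> M"
  shows "(LINT c|lborel. indicator {-M..M} c *\<^sub>R (f' c *\<^sub>R kflux X w c)) =
    2 *\<^sub>R Y w - (f M + f (- M)) *\<^sub>R X w + (f M *\<^sub>R X M + f (- M) *\<^sub>R X (- M) - Y M - Y (- M))"
proof -
  \<comment> \<open>A primitive in \<open>c\<close> of \<open>f' c *\<^sub>R (X w - X c)\<close>:
    the two terms with \<open>X' c\<close> cancel because \<open>f c *\<^sub>R X' c\<close> is the
    derivative of \<open>Y\<close>. The integral is split at \<open>c = w\<close>, where
    \<open>sgn\<close> changes.\<close>
  define P where "P c = f c *\<^sub>R (X w - X c) + Y c" for c
  have cX: "continuous_on UNIV X"
    using X by (auto intro!: continuous_at_imp_continuous_on has_vector_derivative_continuous)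
  have P: "(P has_vector_derivative f' c *\<^sub>R (X w - X c)) (at c within S)" for c S
  proof -
    have "((\<lambda>c. f c *\<^sub>R (X w - X c)) has_vector_derivative (f c *\<^sub>R (0 - X' c) + f' c *\<^sub>R (X w - X c))) (at c)"
      by (intro has_vector_derivative_scaleR f(1) has_vector_derivative_diff has_vector_derivative_const X)
    note D = has_vector_derivative_add[OF this Y[of c]]
    have e: "f c *\<^sub>R (0 - X' c) + f' c *\<^sub>R (X w - X c) + f c *\<^sub>R X' c = f' c *\<^sub>R (X w - X c)" by simp
    show ?thesis unfolding P_def by (rule has_vector_derivative_at_within[OF D[unfolded e]])
  qed
  have cont: "continuous_on A (\<lambda>c. f' c *\<^sub>R (X w - X c))" for A
    by (intro continuous_on_scaleR continuous_on_diff continuous_on_const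
      continuous_on_subset[OF f(2) subset_UNIV] continuous_on_subset[OF cX subset_UNIV])
  have I: "(LINT c|lborel. indicator {a..b} c *\<^sub>R (f' c *\<^sub>R (X w - X c))) = P b - P a"
    "integrable lborel (\<lambda>c. indicator {a..b} c *\<^sub>R (f' c *\<^sub>R (X w - X c)))" if "a \<le> b" for a b
    by (rule integral_FTC_Icc[OF that P cont]) (rule borel_integrable_compact[OF compact_Icc cont])
  have "(\<lambda>c. indicator {-M..M} c *\<^sub>R (f' c *\<^sub>R kflux X w c)) =
    (\<lambda>c. indicator {-M..w} c *\<^sub>R (f' c *\<^sub>R (X w - X c)) - indicator {w..M} c *\<^sub>R (f' c *\<^sub>R (X w - X c)))"
  proof
    fix c
    show "indicator {-M..M} c *\<^sub>R (f' c *\<^sub>R kflux X w c) =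
      indicator {-M..w} c *\<^sub>R (f' c *\<^sub>R (X w - X c)) - indicator {w..M} c *\<^sub>R (f' c *\<^sub>R (X w - X c))"
      using w by (cases c w rule: linorder_cases) (auto simp: kflux_def indicator_def abs_le_iff scaleR_diff_right)
  qed
  then have "(LINT c|lborel. indicator {-M..M} c *\<^sub>R (f' c *\<^sub>R kflux X w c)) = (P w - P (- M)) - (P M - P w)"
    using I[of "- M" w] I[of w M] w by (simp add: abs_le_iff)
  also have "\<dots> = 2 *\<^sub>R Y w - (f M + f (- M)) *\<^sub>R X w + (f M *\<^sub>R X M + f (- M) *\<^sub>R X (- M) - Y M - Y (- M))"
    by (simp add: P_def algebra_simps scaleR_2)
  finally show ?thesis .
qed

text \<open>Kruzhkov entropies have a production of one sign, so its action on \<psi> is dominated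
  by \<open>m\<close> times its action on the cut-off, and that is bounded in terms of the flux on
  [-M, M]. Superposition carries the bound to the given entropy. The constant depends on \<eta> and
  \<open>M\<close> but not on the solution.\<close>

lemma entropy_dissipation_bound:
  fixes X X' Y :: "real \<Rightarrow> 'a::euclidean_space"
  assumes X: "\<And>w. (X has_vector_derivative X' w) (at w)"
    and f: "\<And>w. (f has_real_derivative f' w) (at w)" "continuous_on UNIV f'"
    and Y: "\<And>w. (Y has_vector_derivative f w *\<^sub>R X' w) (at w)"
    and \<eta>: "c1_test \<Omega> \<eta> g\<eta>" and M: "0 \<le> M"
  obtains C where "0 \<le> C" "\<And>U \<psi> g m. U \<in> borel_measurable borel \<Longrightarrow> (\<And>z. \<bar>U z\<bar> \<le> M) \<Longrightarrow> entropy_ineq X \<Omega> U \<Longrightarrow>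
    weak_solution X \<Omega> U \<Longrightarrow> c1_test \<Omega> \<psi> g \<Longrightarrow> (\<And>z. \<bar>\<psi> z\<bar> \<le> m * \<eta> z) \<Longrightarrow> 0 \<le> m \<Longrightarrow>
    \<bar>LINT z|lborel. Y (U z) \<bullet> g z\<bar> \<le> m * C"
proof -
  have cX: "continuous_on UNIV X"
    using X by (auto intro!: continuous_at_imp_continuous_on has_vector_derivative_continuous)
  have cY: "continuous_on UNIV Y"
    using Y by (auto intro!: continuous_at_imp_continuous_on has_vector_derivative_continuous)
  have [measurable]: "X \<in> borel_measurable borel" "Y \<in> borel_measurable borel" "f' \<in> borel_measurable borel"
    using cX cY f(2) by (auto intro: borel_measurable_continuous_onI)
  have bd: "\<exists>B. \<forall>w. \<bar>w\<bar> \<le> M \<longrightarrow> norm (Z w) \<le> B" if "continuous_on UNIV Z" for Z :: "real \<Rightarrow> 'a"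
  proof -
    have "compact (Z ` {-M..M})" by (intro compact_continuous_image continuous_on_subset[OF that]) auto
    then obtain B where "\<forall>y\<in>Z ` {-M..M}. norm y \<le> B" using compact_imp_bounded bounded_iff by metis
    then have "norm (Z w) \<le> B" if "\<bar>w\<bar> \<le> M" for w using that by (simp add: abs_le_iff minus_le_iff)
    then show ?thesis by blast
  qed
  obtain B where B: "\<And>w. \<bar>w\<bar> \<le> M \<Longrightarrow> norm (X w) \<le> B" using bd[OF cX] by blast
  obtain BY where BY: "\<And>w. \<bar>w\<bar> \<le> M \<Longrightarrow> norm (Y w) \<le> BY" using bd[OF cY] by blast
  have B0: "0 \<le> B" using B[of 0] M norm_ge_zero[of "X 0"] by linarith
  have kb: "norm (kflux X w c) \<le> 2 * B" if "\<bar>w\<bar> \<le> M" "\<bar>c\<bar> \<le> M" for w c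
  proof -
    have "norm (kflux X w c) \<le> 1 * norm (X w - X c)"
      unfolding kflux_def norm_scaleR by (intro mult_right_mono) (auto simp: sgn_if)
    also have "\<dots> \<le> B + B" using norm_triangle_ineq4[of "X w" "X c"] B[OF that(1)] B[OF that(2)] by simp
    finally show ?thesis by simp
  qed
  define I where "I = (LINT z|lborel. norm (g\<eta> z))"
  define fI where "fI = (LINT c|lborel. indicator {-M..M} c * \<bar>f' c\<bar>)"
  have if': "integrable lborel (\<lambda>c. indicator {-M..M} c * \<bar>f' c\<bar>)"
    using borel_integrable_compact[of "{-M..M}" "\<lambda>c. \<bar>f' c\<bar>"] continuous_on_subset[OF f(2)]
    by (simp add: continuous_on_rabs)
  have if'': "integrable lborel (\<lambda>c. indicator {-M..M} c * f' c)"
    using borel_integrable_compact[of "{-M..M}" f'] continuous_on_subset[OF f(2)] by simp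
  show ?thesis
  proof (rule that[of "fI * (2 * B * I)"])
    have "0 \<le> fI" unfolding fI_def by (intro integral_nonneg_AE) auto
    moreover have "0 \<le> I" unfolding I_def by (intro integral_nonneg_AE) auto
    ultimately show "0 \<le> fI * (2 * B * I)" using B0 by simp
    fix U \<psi> g m
    assume Um[measurable]: "U \<in> borel_measurable borel" and Ub: "\<And>z. \<bar>U z\<bar> \<le> M" and ent: "entropy_ineq X \<Omega> U"
      and weak: "weak_solution X \<Omega> U" and \<psi>: "c1_test \<Omega> \<psi> g" "\<And>z. \<bar>\<psi> z\<bar> \<le> m * \<eta> z" and m: "0 \<le> m"
    have [measurable]: "g \<in> borel_measurable borel"
      using \<psi>(1) unfolding c1_test_def by (auto intro: borel_measurable_continuous_onI)
    define q where "q c k = (LINT z|lborel. kflux X (U z) c \<bullet> k z)" for c and k :: "'a \<Rightarrow> 'a"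
    have ik: "integrable lborel (\<lambda>z. kflux X (U z) c \<bullet> k z)" "\<bar>q c k\<bar> \<le> 2 * B * (LINT z|lborel. norm (k z))"
      if "c1_test \<Omega> \<phi> k" "\<bar>c\<bar> \<le> M" for \<phi> k c
    proof -
      have m: "(\<lambda>z. kflux X (U z) c) \<in> borel_measurable borel" by measurable
      have b: "norm (kflux X (U z) c) \<le> 2 * B" for z by (rule kb[OF Ub that(2)])
      show "integrable lborel (\<lambda>z. kflux X (U z) c \<bullet> k z)" "\<bar>q c k\<bar> \<le> 2 * B * (LINT z|lborel. norm (k z))"
        unfolding q_def by (rule integrable_inner_test(1)[OF that(1) m b] integrable_inner_test(2)[OF that(1) m b])+
    qed
    \<comment> \<open>Both \<open>m * \<eta> z + \<psi> z\<close> and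
      \<open>m * \<eta> z - \<psi> z\<close> are nonnegative test functions.\<close>
    have qb: "\<bar>q c g\<bar> \<le> m * (2 * B * I)" if c: "\<bar>c\<bar> \<le> M" for c
    proof -
      have "0 \<le> q c (\<lambda>z. m *\<^sub>R g\<eta> z + s *\<^sub>R g z)" if "s = 1 \<or> s = -1" for s
      proof -
        have "0 \<le> m * \<eta> z + s * \<psi> z" for z using \<psi>(2)[of z] that by (auto simp: abs_le_iff)
        then show ?thesis
          using ent c1_test_lincomb[OF \<eta> \<psi>(1), of m s] unfolding entropy_ineq_def q_def by blast
      qed
      moreover have "q c (\<lambda>z. m *\<^sub>R g\<eta> z + s *\<^sub>R g z) = m * q c g\<eta> + s * q c g" for s
        unfolding q_def using ik(1)[OF \<eta> c] ik(1)[OF \<psi>(1) c] by (simp add: inner_add_right)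
      ultimately have "0 \<le> m * q c g\<eta> + 1 * q c g" "0 \<le> m * q c g\<eta> + (- 1) * q c g" by metis+
      then have "\<bar>q c g\<bar> \<le> m * q c g\<eta>" by linarith
      also have "\<dots> \<le> m * (2 * B * I)" using ik(2)[OF \<eta> c] m by (intro mult_left_mono) (auto simp: I_def)
      finally show ?thesis .
    qed
    have ig: "integrable lborel (\<lambda>z. norm (g z))" by (rule integrable_inner_test(3)[OF \<psi>(1), of "\<lambda>_. 0" 0]) auto
    have "integrable (lborel \<Otimes>\<^sub>M lborel) (\<lambda>(c, z). indicator {-M..M} c * f' c * (kflux X (U z) c \<bullet> g z))"
    proof (rule Bochner_Integration.integrable_bound)
      show "integrable (lborel \<Otimes>\<^sub>M lborel) (\<lambda>(c, z). (2 * B) * (indicator {-M..M} c * \<bar>f' c\<bar> * norm (g z)))"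
      proof (rule lborel_pair.Fubini_integrable)
        show "AE c in lborel. integrable lborel (\<lambda>z. case (c, z) of (c, z) \<Rightarrow> 2 * B * (indicator {-M..M} c * \<bar>f' c\<bar> * norm (g z)))"
          using ig by simp
        show "integrable lborel (\<lambda>c. LINT z|lborel. norm (case (c, z) of (c, z) \<Rightarrow> 2 * B * (indicator {-M..M} c * \<bar>f' c\<bar> * norm (g z))))"
          using if' by (simp add: abs_mult)
      qed measurable
      have "\<bar>indicator {-M..M} c * f' c * (kflux X (U z) c \<bullet> g z)\<bar> \<le> (2 * B) * (indicator {-M..M} c * \<bar>f' c\<bar> * norm (g z))" for c z
      proof (cases "\<bar>c\<bar> \<le> M")
        case True
        have "\<bar>kflux X (U z) c \<bullet> g z\<bar> \<le> 2 * B * norm (g z)"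
          by (rule order_trans[OF Cauchy_Schwarz_ineq2]) (intro mult_right_mono kb Ub True norm_ge_zero)
        then have "\<bar>f' c\<bar> * \<bar>kflux X (U z) c \<bullet> g z\<bar> \<le> \<bar>f' c\<bar> * (2 * B * norm (g z))" by (rule mult_left_mono) simp
        then show ?thesis using True by (simp add: abs_mult abs_le_iff mult_ac minus_le_iff)
      next
        case False
        then have "c \<notin> {-M..M}" by auto
        then show ?thesis by simp
      qed
      then show "AE p in lborel \<Otimes>\<^sub>M lborel. norm (case p of (c, z) \<Rightarrow> indicator {-M..M} c * f' c * (kflux X (U z) c \<bullet> g z))
        \<le> norm (case p of (c, z) \<Rightarrow> (2 * B) * (indicator {-M..M} c * \<bar>f' c\<bar> * norm (g z)))"
        by (intro AE_I2) (auto intro: order_trans[OF _ abs_ge_self])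
    qed measurable
    then have fub: "(LINT z|lborel. LINT c|lborel. indicator {-M..M} c * f' c * (kflux X (U z) c \<bullet> g z))
      = (LINT c|lborel. LINT z|lborel. indicator {-M..M} c * f' c * (kflux X (U z) c \<bullet> g z))"
      by (rule lborel_pair.Fubini_integral)
    \<comment> \<open>The multiple \<open>s\<close> of \<open>X\<close> drops out because
      \<open>U\<close> is a weak solution, and the constant \<open>k\<close> because gradients of
      test functions have integral 0.\<close>
    define s where "s = f M + f (- M)"
    define k where "k = f M *\<^sub>R X M + f (- M) *\<^sub>R X (- M) - Y M - Y (- M)"
    have inner: "(LINT c|lborel. indicator {-M..M} c * f' c * (kflux X (U z) c \<bullet> g z))
      = 2 * (Y (U z) \<bullet> g z) - s * (X (U z) \<bullet> g z) + k \<bullet> g z" for z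
    proof -
      have "integrable lborel (\<lambda>c. (indicator {-M..M} c * f' c) *\<^sub>R (indicator {-M..M} c *\<^sub>R kflux X (U z) c))"
        by (rule integrable_scaleR_bounded[OF if'', of _ "2 * B"])
          (use kb[OF Ub[of z]] B0 in \<open>auto simp: indicator_def abs_le_iff\<close>)
      moreover have "(\<lambda>c. (indicator {-M..M} c * f' c) *\<^sub>R (indicator {-M..M} c *\<^sub>R kflux X (U z) c))
          = (\<lambda>c. indicator {-M..M} c *\<^sub>R (f' c *\<^sub>R kflux X (U z) c))" by (auto simp: fun_eq_iff indicator_def)
      ultimately have i: "integrable lborel (\<lambda>c. indicator {-M..M} c *\<^sub>R (f' c *\<^sub>R kflux X (U z) c))" by simp
      have "(LINT c|lborel. indicator {-M..M} c * f' c * (kflux X (U z) c \<bullet> g z))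
        = (LINT c|lborel. (indicator {-M..M} c *\<^sub>R (f' c *\<^sub>R kflux X (U z) c)) \<bullet> g z)" by (simp add: mult.assoc)
      also have "\<dots> = (LINT c|lborel. indicator {-M..M} c *\<^sub>R (f' c *\<^sub>R kflux X (U z) c)) \<bullet> g z"
        by (rule integral_inner_left) (rule i)
      also have "\<dots> = 2 * (Y (U z) \<bullet> g z) - s * (X (U z) \<bullet> g z) + k \<bullet> g z"
        unfolding kruzhkov_superposition[OF X f Y Ub] s_def k_def by (simp add: inner_add_left inner_diff_left)
      finally show ?thesis .
    qed
    have iY: "integrable lborel (\<lambda>z. Y (U z) \<bullet> g z)" "integrable lborel (\<lambda>z. X (U z) \<bullet> g z)" "integrable lborel (\<lambda>z. k \<bullet> g z)"
      using integrable_inner_test(1)[OF \<psi>(1), of "\<lambda>z. Y (U z)" BY] integrable_inner_test(1)[OF \<psi>(1), of "\<lambda>z. X (U z)" B]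
        integrable_inner_test(1)[OF \<psi>(1), of "\<lambda>z. k" "norm k"] BY[OF Ub] B[OF Ub] by auto
    have i0: "(LINT z|lborel. k \<bullet> g z) = 0"
    proof -
      have "integrable lborel g"
      proof -
        obtain K where K: "compact K" "\<And>z. z \<notin> K \<Longrightarrow> g z = 0" "continuous_on UNIV g" using \<psi>(1) by (rule c1_testE) blast
        show ?thesis by (rule integrable_compact_support[OF K(3,1,2)])
      qed
      then have "(LINT z|lborel. k \<bullet> g z) = k \<bullet> (LINT z|lborel. g z)" by (intro integral_inner_right)
      then show ?thesis using integral_grad_zero[OF c1_test_mono[OF \<psi>(1)]] by simp
    qed
    have "2 * (LINT z|lborel. Y (U z) \<bullet> g z) = (LINT z|lborel. 2 * (Y (U z) \<bullet> g z) - s * (X (U z) \<bullet> g z) + k \<bullet> g z)"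
      using iY i0 weak \<psi>(1) by (simp add: weak_solution_def)
    also have "\<dots> = (LINT c|lborel. indicator {-M..M} c * f' c * q c g)"
      unfolding inner[symmetric] fub q_def by simp
    finally have "2 * \<bar>LINT z|lborel. Y (U z) \<bullet> g z\<bar> = norm (LINT c|lborel. indicator {-M..M} c * f' c * q c g)"
      by (metis abs_mult abs_numeral real_norm_def)
    also have "\<dots> \<le> (LINT c|lborel. indicator {-M..M} c * \<bar>f' c\<bar> * (m * (2 * B * I)))"
    proof (rule norm_integral_le)
      show "integrable lborel (\<lambda>c. indicator {-M..M} c * \<bar>f' c\<bar> * (m * (2 * B * I)))" using if' by simp
      fix c
      show "norm (indicator {-M..M} c * f' c * q c g) \<le> indicator {-M..M} c * \<bar>f' c\<bar> * (m * (2 * B * I))"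
      proof (cases "c \<in> {-M..M}")
        case True
        then have "\<bar>q c g\<bar> \<le> m * (2 * B * I)" by (intro qb) auto
        then have "\<bar>f' c\<bar> * \<bar>q c g\<bar> \<le> \<bar>f' c\<bar> * (m * (2 * B * I))" by (rule mult_left_mono) simp
        then show ?thesis using True by (simp add: abs_mult)
      qed simp
    qed
    also have "\<dots> = m * (fI * (2 * B * I))" by (simp add: fI_def)
    finally have "2 * \<bar>LINT z|lborel. Y (U z) \<bullet> g z\<bar> \<le> m * (fI * (2 * B * I))" .
    then show "\<bar>LINT z|lborel. Y (U z) \<bullet> g z\<bar> \<le> m * (fI * (2 * B * I))"
      using abs_ge_zero[of "LINT z|lborel. Y (U z) \<bullet> g z"] by linarith
  qed
qed

section \<open>Box means and the compensated estimate\<close>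

text \<open>Minkowski's inequality for averages of translates, proved by exchanging the integrals; a
  uniform modulus over the support of the weight bounds the distance of the average to
  \<open>f\<close>.\<close>

lemma average_L1:
  fixes f :: "'a::euclidean_space \<Rightarrow> real" and w :: "'b::euclidean_space \<Rightarrow> real"
  assumes f: "integrable lborel f" and w: "integrable lborel w" "\<And>r. 0 \<le> w r" "(LINT r|lborel. w r) = 1"
    and \<zeta>[measurable]: "\<zeta> \<in> borel_measurable borel"
  shows "integrable lborel (\<lambda>z. LINT r|lborel. w r * f (z - \<zeta> r))"
    "(LINT z|lborel. \<bar>LINT r|lborel. w r * f (z - \<zeta> r)\<bar>) \<le> (LINT z|lborel. \<bar>f z\<bar>)"
    "(\<And>r. w r \<noteq> 0 \<Longrightarrow> (LINT z|lborel. \<bar>f (z - \<zeta> r) - f z\<bar>) \<le> D) \<Longrightarrow>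
      (LINT z|lborel. \<bar>(LINT r|lborel. w r * f (z - \<zeta> r)) - f z\<bar>) \<le> D"
proof -
  have [measurable]: "f \<in> borel_measurable borel" "w \<in> borel_measurable borel" using f w by auto
  have sh: "integrable lborel (\<lambda>z. f (z - c))" for c using f lborel_integrable_shift[of f "- c"] by simp
  have shn: "(LINT z|lborel. \<bar>f (z - c)\<bar>) = (LINT z|lborel. \<bar>f z\<bar>)" for c
    using lborel_integral_shift[of "\<lambda>z. \<bar>f z\<bar>" "- c"] by simp
  \<comment> \<open>With \<open>c = 0\<close> this concerns the average itself, with
    \<open>c = 1\<close> its deviation from \<open>f\<close>.\<close>
  have gen: "integrable (lborel \<Otimes>\<^sub>M lborel) (\<lambda>(r, z). w r * (f (z - \<zeta> r) - c * f z))" for c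
  proof (rule lborel_pair.Fubini_integrable)
    show "AE r in lborel. integrable lborel (\<lambda>z. case (r, z) of (r, z) \<Rightarrow> w r * (f (z - \<zeta> r) - c * f z))"
      using sh f by simp
    show "integrable lborel (\<lambda>r. LINT z|lborel. norm (case (r, z) of (r, z) \<Rightarrow> w r * (f (z - \<zeta> r) - c * f z)))"
    proof (rule Bochner_Integration.integrable_bound)
      show "integrable lborel (\<lambda>r. w r * ((1 + \<bar>c\<bar>) * (LINT z|lborel. \<bar>f z\<bar>)))" using w by simp
      have "\<bar>LINT z|lborel. \<bar>w r * (f (z - \<zeta> r) - c * f z)\<bar>\<bar> \<le> w r * ((1 + \<bar>c\<bar>) * (LINT z|lborel. \<bar>f z\<bar>))" for r
      proof -
        have "norm (LINT z|lborel. \<bar>w r * (f (z - \<zeta> r) - c * f z)\<bar>) \<le> (LINT z|lborel. w r * (\<bar>f (z - \<zeta> r)\<bar> + \<bar>c\<bar> * \<bar>f z\<bar>))"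
        proof (rule norm_integral_le)
          fix z
          have "\<bar>f (z - \<zeta> r) - c * f z\<bar> \<le> \<bar>f (z - \<zeta> r)\<bar> + \<bar>c\<bar> * \<bar>f z\<bar>"
            using abs_triangle_ineq4[of "f (z - \<zeta> r)" "c * f z"] by (simp add: abs_mult)
          then show "norm \<bar>w r * (f (z - \<zeta> r) - c * f z)\<bar> \<le> w r * (\<bar>f (z - \<zeta> r)\<bar> + \<bar>c\<bar> * \<bar>f z\<bar>)"
            using w(2)[of r] by (simp add: abs_mult mult_left_mono)
        qed (use sh f in simp)
        also have "\<dots> = w r * ((1 + \<bar>c\<bar>) * (LINT z|lborel. \<bar>f z\<bar>))" using sh f shn by (simp add: algebra_simps)
        finally show ?thesis by simp
      qed
      then show "AE r in lborel. norm (LINT z|lborel. norm (case (r, z) of (r, z) \<Rightarrow> w r * (f (z - \<zeta> r) - c * f z)))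
          \<le> norm (w r * ((1 + \<bar>c\<bar>) * (LINT z|lborel. \<bar>f z\<bar>)))"
        by (intro AE_I2) (auto intro: order_trans[OF _ abs_ge_self])
    qed measurable
  qed measurable
  show i1: "integrable lborel (\<lambda>z. LINT r|lborel. w r * f (z - \<zeta> r))"
    using lborel_pair.integrable_snd[of "\<lambda>r z. w r * f (z - \<zeta> r)"] gen[of 0] by simp
  have main: "(LINT z|lborel. \<bar>LINT r|lborel. w r * (f (z - \<zeta> r) - c * f z)\<bar>)
      \<le> (LINT r|lborel. w r * (LINT z|lborel. \<bar>f (z - \<zeta> r) - c * f z\<bar>))" for c
  proof -
    have n: "integrable (lborel \<Otimes>\<^sub>M lborel) (\<lambda>(r, z). \<bar>w r * (f (z - \<zeta> r) - c * f z)\<bar>)"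
      using integrable_norm[OF gen[of c]] by (simp add: split_beta')
    have "(LINT z|lborel. \<bar>LINT r|lborel. w r * (f (z - \<zeta> r) - c * f z)\<bar>)
        \<le> (LINT z|lborel. LINT r|lborel. \<bar>w r * (f (z - \<zeta> r) - c * f z)\<bar>)"
    proof (rule integral_mono)
      show "integrable lborel (\<lambda>z. \<bar>LINT r|lborel. w r * (f (z - \<zeta> r) - c * f z)\<bar>)"
        using lborel_pair.integrable_snd[OF gen[of c]] by simp
      show "integrable lborel (\<lambda>z. LINT r|lborel. \<bar>w r * (f (z - \<zeta> r) - c * f z)\<bar>)"
        by (rule lborel_pair.integrable_snd[OF n])
      show "\<bar>LINT r|lborel. w r * (f (z - \<zeta> r) - c * f z)\<bar> \<le> (LINT r|lborel. \<bar>w r * (f (z - \<zeta> r) - c * f z)\<bar>)" for z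
        by (rule integral_abs_bound)
    qed
    also have "\<dots> = (LINT r|lborel. LINT z|lborel. \<bar>w r * (f (z - \<zeta> r) - c * f z)\<bar>)"
      by (rule lborel_pair.Fubini_integral[OF n])
    also have "\<dots> = (LINT r|lborel. w r * (LINT z|lborel. \<bar>f (z - \<zeta> r) - c * f z\<bar>))"
      using w(2) by (simp add: abs_mult)
    finally show ?thesis .
  qed
  show "(LINT z|lborel. \<bar>LINT r|lborel. w r * f (z - \<zeta> r)\<bar>) \<le> (LINT z|lborel. \<bar>f z\<bar>)"
    using main[of 0] w(3) by (simp add: shn)
  assume D: "\<And>r. w r \<noteq> 0 \<Longrightarrow> (LINT z|lborel. \<bar>f (z - \<zeta> r) - f z\<bar>) \<le> D"
  have "AE z in lborel. integrable lborel (\<lambda>r. w r * f (z - \<zeta> r))"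
    using lborel_pair.AE_integrable_snd[OF gen[of 0]] by simp
  then have "AE z in lborel. (LINT r|lborel. w r * f (z - \<zeta> r)) - f z = (LINT r|lborel. w r * (f (z - \<zeta> r) - 1 * f z))"
  proof eventually_elim
    case (elim z)
    then show ?case using w(1,3) by (simp add: right_diff_distrib)
  qed
  then have "(LINT z|lborel. \<bar>(LINT r|lborel. w r * f (z - \<zeta> r)) - f z\<bar>)
      = (LINT z|lborel. \<bar>LINT r|lborel. w r * (f (z - \<zeta> r) - 1 * f z)\<bar>)"
    by (intro integral_cong_AE) (auto elim: eventually_mono)
  also have "\<dots> \<le> (LINT r|lborel. w r * (LINT z|lborel. \<bar>f (z - \<zeta> r) - 1 * f z\<bar>))" by (rule main)
  also have "\<dots> \<le> (LINT r|lborel. w r * D)"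
  proof (rule integral_mono)
    have "integrable (lborel \<Otimes>\<^sub>M lborel) (\<lambda>(r, z). \<bar>w r * (f (z - \<zeta> r) - 1 * f z)\<bar>)"
      using integrable_norm[OF gen[of 1]] by (simp add: split_beta')
    from lborel_pair.integrable_fst[OF this]
    show "integrable lborel (\<lambda>r. w r * (LINT z|lborel. \<bar>f (z - \<zeta> r) - 1 * f z\<bar>))" using w(2) by (simp add: abs_mult)
    show "w r * (LINT z|lborel. \<bar>f (z - \<zeta> r) - 1 * f z\<bar>) \<le> w r * D" for r
      using D[of r] w(2)[of r] by (cases "w r = 0") (auto intro: mult_left_mono)
  qed (use w in simp)
  also have "\<dots> = D" using w(3) by simp
  finally show "(LINT z|lborel. \<bar>(LINT r|lborel. w r * f (z - \<zeta> r)) - f z\<bar>) \<le> D" .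
qed

definition bounded_sol :: "(real \<Rightarrow> 'a::euclidean_space) \<Rightarrow> 'a set \<Rightarrow> real \<Rightarrow> ('a \<Rightarrow> real) \<Rightarrow> bool" where
  "bounded_sol X \<Omega> M U \<longleftrightarrow> U \<in> borel_measurable borel \<and> (\<forall>z. \<bar>U z\<bar> \<le> M) \<and> integrable lborel U \<and>
     weak_solution X \<Omega> U \<and> entropy_ineq X \<Omega> U"

text \<open>For the \<open>es\<close>-average of \<open>f\<close> this is the double mean that the
  approximate potential fails to reproduce. It is the only error of the estimate that is removed by
  compactness rather than by smallness.\<close>

definition box_mean :: "real \<Rightarrow> real \<Rightarrow> 'a \<Rightarrow> 'a \<Rightarrow> 'a \<Rightarrow> ('a::euclidean_space \<Rightarrow> real) \<Rightarrow> 'a \<Rightarrow> real" where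
  "box_mean d h et ey es f = av (box_weight d) et (av (box_weight d) ey (av (box_weight h) es f))"

lemma av_box_L1:
  fixes f :: "'a::euclidean_space \<Rightarrow> real"
  assumes f: "integrable lborel f" and d: "0 < d"
  shows "integrable lborel (av (box_weight d) e f)" "(LINT z|lborel. \<bar>av (box_weight d) e f z\<bar>) \<le> (LINT z|lborel. \<bar>f z\<bar>)"
    "(\<And>r. 0 \<le> r \<Longrightarrow> r \<le> d \<Longrightarrow> (LINT z|lborel. \<bar>f (z - r *\<^sub>R e) - f z\<bar>) \<le> D) \<Longrightarrow>
      (LINT z|lborel. \<bar>av (box_weight d) e f z - f z\<bar>) \<le> D"
proof -
  note w = box_weight(1,4,3)[OF d]
  have \<zeta>: "(\<lambda>r. r *\<^sub>R e) \<in> borel_measurable borel" by simp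
  show "integrable lborel (av (box_weight d) e f)"
    using average_L1(1)[OF f w \<zeta>] by (simp add: av_def[abs_def])
  show "(LINT z|lborel. \<bar>av (box_weight d) e f z\<bar>) \<le> (LINT z|lborel. \<bar>f z\<bar>)"
    using average_L1(2)[OF f w \<zeta>] by (simp add: av_def)
  assume "\<And>r. 0 \<le> r \<Longrightarrow> r \<le> d \<Longrightarrow> (LINT z|lborel. \<bar>f (z - r *\<^sub>R e) - f z\<bar>) \<le> D"
  then show "(LINT z|lborel. \<bar>av (box_weight d) e f z - f z\<bar>) \<le> D"
    using average_L1(3)[OF f w \<zeta>, of D] box_weight(5)[OF d] by (simp add: av_def)
qed

lemma av_box_bounded:
  fixes f :: "'a::euclidean_space \<Rightarrow> real"
  assumes "0 < d" "\<And>z. \<bar>f z\<bar> \<le> C"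
  shows "\<bar>av (box_weight d) e f z\<bar> \<le> C"
  using av_bound[OF box_weight(1)[OF assms(1)], of f z e C] assms box_weight(2)[OF assms(1)] by simp

lemma box_weight_measurable [measurable]: "box_weight d \<in> borel_measurable borel"
  unfolding box_weight_def[abs_def] by measurable

lemma box_mean_measurable [measurable]:
  "f \<in> borel_measurable borel \<Longrightarrow> box_mean d h et ey es f \<in> borel_measurable borel"
  unfolding box_mean_def by (intro av_measurable box_weight_measurable)

lemma box_mean_L1:
  assumes f: "integrable lborel f" and d: "0 < d" "0 < h"
  shows "integrable lborel (box_mean d h et ey es f)" "(LINT z|lborel. \<bar>box_mean d h et ey es f z\<bar>) \<le> (LINT z|lborel. \<bar>f z\<bar>)"
proof -
  note 1 = av_box_L1(1,2)[OF f d(2), of es]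
  note 2 = av_box_L1(1,2)[OF 1(1) d(1), of ey]
  note 3 = av_box_L1(1,2)[OF 2(1) d(1), of et]
  show "integrable lborel (box_mean d h et ey es f)" using 3(1) by (simp add: box_mean_def)
  show "(LINT z|lborel. \<bar>box_mean d h et ey es f z\<bar>) \<le> (LINT z|lborel. \<bar>f z\<bar>)"
    unfolding box_mean_def by (rule order_trans[OF 3(2) order_trans[OF 2(2) 1(2)]])
qed

lemma box_mean_diff:
  assumes d: "0 < d" "0 < h" and f: "f \<in> borel_measurable borel" "\<And>z. \<bar>f z\<bar> \<le> C" "k \<in> borel_measurable borel" "\<And>z. \<bar>k z\<bar> \<le> D"
  shows "box_mean d h et ey es (\<lambda>z. f z - k z) = (\<lambda>z. box_mean d h et ey es f z - box_mean d h et ey es k z)"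
proof -
  note bw = box_weight_measurable
  note l1 = av_linear(2)[OF box_weight(1)[OF d(2)] f]
  note f1 = av_measurable[OF f(1) bw[of h], of es] av_box_bounded[OF d(2) f(2), of es]
    av_measurable[OF f(3) bw[of h], of es] av_box_bounded[OF d(2) f(4), of es]
  note l2 = av_linear(2)[OF box_weight(1)[OF d(1)] f1]
  note f2 = av_measurable[OF f1(1) bw[of d], of ey] av_box_bounded[OF d(1) f1(2), of ey]
    av_measurable[OF f1(3) bw[of d], of ey] av_box_bounded[OF d(1) f1(4), of ey]
  note l3 = av_linear(2)[OF box_weight(1)[OF d(1)] f2]
  show ?thesis unfolding box_mean_def l1[abs_def] l2[abs_def] l3[abs_def] ..
qed

text \<open>The fields built from solutions are merely bounded and measurable, whereas the potential
  requires gradients. One mollifier serves both functions, and its error is sent to 0 while the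
  other parameters stay fixed.\<close>

lemma mollifier_close:
  fixes f k :: "'a::euclidean_space \<Rightarrow> real"
  assumes f: "integrable lborel f" and k: "integrable lborel k" and \<rho>: "0 < \<rho>" and e: "0 < e"
  obtains J gJ where "nice J gJ" "integrable lborel J" "\<And>z. 0 \<le> J z" "(LINT z|lborel. J z) = 1" "\<And>z. \<rho> \<le> norm z \<Longrightarrow> J z = 0"
    "(LINT z|lborel. \<bar>(LINT \<zeta>|lborel. J \<zeta> * f (z - \<zeta>)) - f z\<bar>) \<le> e"
    "(LINT z|lborel. \<bar>(LINT \<zeta>|lborel. J \<zeta> * k (z - \<zeta>)) - k z\<bar>) \<le> e"
proof -
  obtain d1 where d1: "0 < d1" "\<And>c. norm c < d1 \<Longrightarrow> (LINT x|lborel. \<bar>f (x + c) - f x\<bar>) < e"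
    using L1_shift_small[OF f e] by blast
  obtain d2 where d2: "0 < d2" "\<And>c. norm c < d2 \<Longrightarrow> (LINT x|lborel. \<bar>k (x + c) - k x\<bar>) < e"
    using L1_shift_small[OF k e] by blast
  define \<epsilon> where "\<epsilon> = min \<rho> (min d1 d2)"
  have \<epsilon>: "0 < \<epsilon>" "\<epsilon> \<le> \<rho>" "\<epsilon> \<le> d1" "\<epsilon> \<le> d2" using d1 d2 \<rho> by (auto simp: \<epsilon>_def)
  obtain J :: "'a \<Rightarrow> real" and gJ where J: "\<And>n. C_k n J" "is_grad J gJ" "continuous_on UNIV gJ"
    "\<And>z. 0 \<le> J z" "\<And>z. \<epsilon> \<le> norm z \<Longrightarrow> J z = 0" "\<And>z. \<epsilon> < norm z \<Longrightarrow> gJ z = 0"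
    "integrable lborel J" "(LINT z|lborel. J z) = 1" using mollifier_exists[OF \<epsilon>(1)] by metis
  have "c1_test UNIV J gJ" using J(2,3,5) unfolding c1_test_def by (intro conjI exI[of _ "cball 0 \<epsilon>"]) auto
  then obtain C where C: "\<And>z. \<bar>J z\<bar> \<le> C" "\<And>z. norm (gJ z) \<le> C" "uniformly_continuous_on UNIV gJ"
    by (rule c1_testE) blast
  have small: "norm \<zeta> < \<epsilon>" if "J \<zeta> \<noteq> 0" for \<zeta> using J(5)[of \<zeta>] that by force
  show ?thesis
  proof (rule that[of J gJ])
    show "nice J gJ" using J(2) C by (auto simp: nice_def)
    show "(LINT z|lborel. \<bar>(LINT \<zeta>|lborel. J \<zeta> * f (z - \<zeta>)) - f z\<bar>) \<le> e"
      by (rule average_L1(3)[OF f J(7,4,8), of "\<lambda>\<zeta>. \<zeta>"]) (use d1(2)[of "- _"] small \<epsilon> in \<open>force intro: less_imp_le\<close>)+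
    show "(LINT z|lborel. \<bar>(LINT \<zeta>|lborel. J \<zeta> * k (z - \<zeta>)) - k z\<bar>) \<le> e"
      by (rule average_L1(3)[OF k J(7,4,8), of "\<lambda>\<zeta>. \<zeta>"]) (use d2(2)[of "- _"] small \<epsilon> in \<open>force intro: less_imp_le\<close>)+
    show "\<rho> \<le> norm z \<Longrightarrow> J z = 0" for z using J(5) \<epsilon>(2) by auto
  qed (use J in auto)
qed

lemma mollified_bound:
  fixes w J :: "'a::euclidean_space \<Rightarrow> real"
  assumes J: "integrable lborel J" "\<And>z. 0 \<le> J z" "(LINT z|lborel. J z) = 1"
    and [measurable]: "w \<in> borel_measurable borel" and w: "\<And>z. \<bar>w z\<bar> \<le> N"
  shows "(LINT \<zeta>|lborel. w \<zeta> * J (z - \<zeta>)) = (LINT \<zeta>|lborel. J \<zeta> * w (z - \<zeta>))" "\<bar>LINT \<zeta>|lborel. w \<zeta> * J (z - \<zeta>)\<bar> \<le> N"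
proof -
  have [measurable]: "J \<in> borel_measurable borel" using J by auto
  show 1: "(LINT \<zeta>|lborel. w \<zeta> * J (z - \<zeta>)) = (LINT \<zeta>|lborel. J \<zeta> * w (z - \<zeta>))"
    using lborel_integral_reflect[of "\<lambda>\<zeta>. w \<zeta> * J (z - \<zeta>)" z] by (simp add: mult.commute)
  have "norm (LINT \<zeta>|lborel. J \<zeta> * w (z - \<zeta>)) \<le> (LINT \<zeta>|lborel. J \<zeta> * N)"
    by (rule norm_integral_le) (use J(1,2) w in \<open>auto simp: abs_mult intro: mult_left_mono\<close>)
  then show "\<bar>LINT \<zeta>|lborel. w \<zeta> * J (z - \<zeta>)\<bar> \<le> N" unfolding 1 using J(3) by simp
qed

text \<open>Let \<Phi> be the potential of the averaged differences \<open>A\<close> and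
  \<open>B\<close> of \<open>U\<close> and of \<open>F\<close>. Testing the difference of the two
  entropy balances with \<phi> times \<Phi> produces \<open>A * Q - B * w2\<close>, since the
  gradient of \<Phi> is nearly \<open>- B\<close> along \<open>et\<close> and \<open>A\<close> along
  \<open>ey\<close>. The production is of order \<open>d\<close> because \<Phi> is; the defects of
  the potential cost \<open>d / h\<close>, its means give the last integral, and undoing the average
  along \<open>es\<close> costs \<omega>.\<close>

lemma compensated_estimate:
  fixes X X' Y :: "real \<Rightarrow> 'a::euclidean_space" and F f f' G q R :: "real \<Rightarrow> real"
  assumes X: "\<And>w. X w = w *\<^sub>R et + F w *\<^sub>R ey + G w *\<^sub>R es"
    and Y: "\<And>w. Y w = F w *\<^sub>R et + q w *\<^sub>R ey + R w *\<^sub>R es"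
    and dX: "\<And>w. (X has_vector_derivative X' w) (at w)"
    and df: "\<And>w. (f has_real_derivative f' w) (at w)" "continuous_on UNIV f'"
    and dY: "\<And>w. (Y has_vector_derivative f w *\<^sub>R X' w) (at w)"
    and [measurable]: "F \<in> borel_measurable borel" "G \<in> borel_measurable borel" "q \<in> borel_measurable borel" "R \<in> borel_measurable borel"
    and N: "\<And>w. \<bar>w\<bar> \<le> M \<Longrightarrow> 2 * \<bar>w\<bar> \<le> N \<and> 2 * \<bar>F w\<bar> \<le> N \<and> 2 * \<bar>G w\<bar> \<le> N \<and> 2 * \<bar>q w\<bar> \<le> N \<and> 2 * \<bar>R w\<bar> \<le> N"
    and L: "\<And>w. \<bar>w\<bar> \<le> M \<Longrightarrow> \<bar>F w\<bar> \<le> L * \<bar>w\<bar> \<and> \<bar>G w\<bar> \<le> L * \<bar>w\<bar>"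
    and M: "0 \<le> M" and \<phi>: "c1_test \<Omega> \<phi> g\<phi>" "\<And>z. 0 \<le> \<phi> z"
    and \<rho>: "0 < \<rho>" "\<And>z r p p'. \<phi> z \<noteq> 0 \<Longrightarrow> 0 \<le> r \<Longrightarrow> r \<le> \<rho> \<Longrightarrow> cball (z - r *\<^sub>R et - p *\<^sub>R ey - p' *\<^sub>R es) \<rho> \<subseteq> \<Omega>"
  obtains C where "0 \<le> C" "\<And>U V d h \<omega>. bounded_sol X \<Omega> M U \<Longrightarrow> bounded_sol X \<Omega> M V \<Longrightarrow> 0 < d \<Longrightarrow> d \<le> \<rho> \<Longrightarrow> 0 < h \<Longrightarrow>
    (\<And>r. 0 \<le> r \<Longrightarrow> r \<le> h \<Longrightarrow> (LINT z|lborel. \<bar>(U (z - r *\<^sub>R es) - V (z - r *\<^sub>R es)) - (U z - V z)\<bar>) \<le> \<omega>) \<Longrightarrow>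
    (\<And>r. 0 \<le> r \<Longrightarrow> r \<le> h \<Longrightarrow> (LINT z|lborel. \<bar>(F (U (z - r *\<^sub>R es)) - F (V (z - r *\<^sub>R es))) - (F (U z) - F (V z))\<bar>) \<le> \<omega>) \<Longrightarrow>
    (LINT z|lborel. \<phi> z * ((U z - V z) * (q (U z) - q (V z)) - (F (U z) - F (V z))\<^sup>2)) \<le>
      C * (d + d / h + \<omega>) + C * (LINT z|lborel. \<phi> z * (\<bar>box_mean d h et ey es (\<lambda>z. U z - V z) z\<bar> +
        \<bar>box_mean d h et ey es (\<lambda>z. F (U z) - F (V z)) z\<bar>))"
proof -
  obtain CT where CT: "0 \<le> CT" "\<And>U \<psi> g m. U \<in> borel_measurable borel \<Longrightarrow> (\<And>z. \<bar>U z\<bar> \<le> M) \<Longrightarrow> entropy_ineq X \<Omega> U \<Longrightarrow>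
    weak_solution X \<Omega> U \<Longrightarrow> c1_test \<Omega> \<psi> g \<Longrightarrow> (\<And>z. \<bar>\<psi> z\<bar> \<le> m * \<phi> z) \<Longrightarrow> 0 \<le> m \<Longrightarrow>
    \<bar>LINT z|lborel. Y (U z) \<bullet> g z\<bar> \<le> m * CT"
    using entropy_dissipation_bound[OF dX df dY \<phi>(1) M] by blast
  obtain K c where K: "compact K" "K \<subseteq> \<Omega>" "\<And>z. z \<notin> K \<Longrightarrow> \<phi> z = 0" "\<And>z. z \<notin> K \<Longrightarrow> g\<phi> z = 0"
    and c: "0 < c" "\<And>z. \<bar>\<phi> z\<bar> \<le> c" "\<And>z. norm (g\<phi> z) \<le> c" and g\<phi>: "is_grad \<phi> g\<phi>" "continuous_on UNIV g\<phi>" "continuous_on UNIV \<phi>"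
    using \<phi>(1) by (rule c1_testE) blast
  have [measurable]: "\<phi> \<in> borel_measurable borel" "g\<phi> \<in> borel_measurable borel"
    using g\<phi>(2,3) by (auto intro: borel_measurable_continuous_onI)
  have i\<phi>: "integrable lborel \<phi>" by (rule integrable_compact_support[OF g\<phi>(3) K(1,3)])
  have ig\<phi>: "integrable lborel (\<lambda>z. norm (g\<phi> z))" by (rule integrable_norm[OF integrable_compact_support[OF g\<phi>(2) K(1,4)]])
  define P where "P = (LINT z|lborel. \<phi> z)"
  define Pg where "Pg = (LINT z|lborel. norm (g\<phi> z))"
  have P: "0 \<le> P" "0 \<le> Pg" unfolding P_def Pg_def using \<phi>(2) by (auto intro!: integral_nonneg_AE)
  have N0: "0 \<le> N" using N[of 0] M by (auto intro: order_trans[rotated])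
  define NY where "NY = N * (norm et + norm ey + norm es)"
  have NY: "0 \<le> NY" using N0 by (simp add: NY_def)
  \<comment> \<open>The coefficients of \<open>d\<close>, \<open>d / h\<close>, \<omega> and the
    mean term in the final chain are all dominated by this sum, which involves neither the solutions
    nor the lengths.\<close>
  define C where "C = 4 * N * CT + 2 * N * NY * Pg + 12 * N * N * P + 2 * N * c + N"
  have C0: "0 \<le> C" unfolding C_def using N0 CT(1) NY P c(1) by simp
  show ?thesis
  proof (rule that[OF C0])
    fix U V d h \<omega>
    assume U: "bounded_sol X \<Omega> M U" and V: "bounded_sol X \<Omega> M V" and d: "0 < d" "d \<le> \<rho>" and h: "0 < h"
      and \<omega>1: "\<And>r. 0 \<le> r \<Longrightarrow> r \<le> h \<Longrightarrow> (LINT z|lborel. \<bar>(U (z - r *\<^sub>R es) - V (z - r *\<^sub>R es)) - (U z - V z)\<bar>) \<le> \<omega>"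
      and \<omega>2: "\<And>r. 0 \<le> r \<Longrightarrow> r \<le> h \<Longrightarrow> (LINT z|lborel. \<bar>(F (U (z - r *\<^sub>R es)) - F (V (z - r *\<^sub>R es))) - (F (U z) - F (V z))\<bar>) \<le> \<omega>"
    have Um[measurable]: "U \<in> borel_measurable borel" "V \<in> borel_measurable borel" and Ub: "\<And>z. \<bar>U z\<bar> \<le> M" "\<And>z. \<bar>V z\<bar> \<le> M"
      and iU: "integrable lborel U" "integrable lborel V" using U V by (auto simp: bounded_sol_def)
    define w1 where "w1 z = U z - V z" for z
    define w2 where "w2 z = F (U z) - F (V z)" for z
    define w3 where "w3 z = G (U z) - G (V z)" for z
    define Q where "Q z = q (U z) - q (V z)" for z
    define R' where "R' z = R (U z) - R (V z)" for z
    have wm[measurable]: "w1 \<in> borel_measurable borel" "w2 \<in> borel_measurable borel" "w3 \<in> borel_measurable borel"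
      "Q \<in> borel_measurable borel" "R' \<in> borel_measurable borel"
      unfolding w1_def[abs_def] w2_def[abs_def] w3_def[abs_def] Q_def[abs_def] R'_def[abs_def] by measurable
    have wb: "\<bar>w1 z\<bar> \<le> N" "\<bar>w2 z\<bar> \<le> N" "\<bar>w3 z\<bar> \<le> N" "\<bar>Q z\<bar> \<le> N" "\<bar>R' z\<bar> \<le> N" for z
    proof -
      have tri: "\<bar>x - y\<bar> \<le> N" if "2 * \<bar>x\<bar> \<le> N" "2 * \<bar>y\<bar> \<le> N" for x y :: real
        using that abs_triangle_ineq4[of x y] by linarith
      show "\<bar>w1 z\<bar> \<le> N" "\<bar>w2 z\<bar> \<le> N" "\<bar>w3 z\<bar> \<le> N" "\<bar>Q z\<bar> \<le> N" "\<bar>R' z\<bar> \<le> N"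
        unfolding w1_def w2_def w3_def Q_def R'_def using N[OF Ub(1), of z] N[OF Ub(2), of z] by (auto intro!: tri)
    qed
    have comp: "integrable lborel (\<lambda>z. E (W z))"
      if "integrable lborel W" "\<And>z. \<bar>W z\<bar> \<le> M" "\<And>w. \<bar>w\<bar> \<le> M \<Longrightarrow> \<bar>E w\<bar> \<le> L * \<bar>w\<bar>" "E \<in> borel_measurable borel" for W :: "'a \<Rightarrow> real" and E :: "real \<Rightarrow> real"
    proof -
      note [measurable] = that(4) borel_measurable_integrable[OF that(1)]
      show ?thesis
        by (rule Bochner_Integration.integrable_bound[where f = "\<lambda>z. L * \<bar>W z\<bar>"])
          (use that(1) in simp, measurable, use that(2,3) in \<open>auto intro!: AE_I2 intro: order_trans[OF _ abs_ge_self]\<close>)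
    qed
    have iw: "integrable lborel w1" "integrable lborel w2" "integrable lborel w3"
      unfolding w1_def[abs_def] w2_def[abs_def] w3_def[abs_def]
      using iU comp[OF iU(1) Ub(1)] comp[OF iU(2) Ub(2)] L by auto
    define S where "S = (LINT z|lborel. \<phi> z * (\<bar>box_mean d h et ey es w1 z\<bar> + \<bar>box_mean d h et ey es w2 z\<bar>))"
    have "(LINT z|lborel. \<phi> z * (w1 z * Q z - (w2 z)\<^sup>2)) \<le> C * (d + d / h + \<omega>) + C * S"
    proof (rule field_le_epsilon)
      fix e0 :: real assume "0 < e0"
      \<comment> \<open>The mollification error enters with the total factor
        \<open>4 * N * c\<close>: twice \<open>N * c\<close> from the means, twice from the passage
        between the fields and their averages.\<close>
      define e where "e = e0 / (4 * N * c + 1)"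
      have e: "0 < e" using \<open>0 < e0\<close> N0 c(1) by (simp add: e_def add_nonneg_pos)
      obtain J gJ where J: "nice J gJ" "integrable lborel J" "\<And>z. 0 \<le> J z" "(LINT z|lborel. J z) = 1" "\<And>z. \<rho> \<le> norm z \<Longrightarrow> J z = 0"
        "(LINT z|lborel. \<bar>(LINT \<zeta>|lborel. J \<zeta> * w1 (z - \<zeta>)) - w1 z\<bar>) \<le> e"
        "(LINT z|lborel. \<bar>(LINT \<zeta>|lborel. J \<zeta> * w2 (z - \<zeta>)) - w2 z\<bar>) \<le> e"
        by (rule mollifier_close[OF iw(1,2) \<rho>(1) e]) (rule that)
      note [measurable] = nice_measurable[OF J(1)]
      define m where "m w z = (LINT \<zeta>|lborel. w \<zeta> * J (z - \<zeta>))" for w :: "'a \<Rightarrow> real" and z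
      define gm where "gm w z = (LINT \<zeta>|lborel. w \<zeta> *\<^sub>R gJ (z - \<zeta>))" for w :: "'a \<Rightarrow> real" and z
      have nm: "nice (m w) (gm w)" if "integrable lborel w" for w :: "'a \<Rightarrow> real"
        unfolding m_def[abs_def] gm_def[abs_def] using nice_average[OF J(1) that, of "\<lambda>\<zeta>. \<zeta>"] by simp
      have mb: "\<bar>m w z\<bar> \<le> N" if "w \<in> borel_measurable borel" "\<And>z. \<bar>w z\<bar> \<le> N" for w :: "'a \<Rightarrow> real" and z
        unfolding m_def by (rule mollified_bound(2)[OF J(2-4) that])
      have mclose: "(LINT z|lborel. \<bar>m w1 z - w1 z\<bar>) \<le> e" "(LINT z|lborel. \<bar>m w2 z - w2 z\<bar>) \<le> e"
        unfolding m_def mollified_bound(1)[OF J(2-4) wm(1) wb(1)] mollified_bound(1)[OF J(2-4) wm(2) wb(2)] by (rule J(6) J(7))+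
      have im: "integrable lborel (m w)" if "integrable lborel w" "w \<in> borel_measurable borel" "\<And>z. \<bar>w z\<bar> \<le> N" for w :: "'a \<Rightarrow> real"
        unfolding m_def[abs_def] mollified_bound(1)[OF J(2-4) that(2,3)]
        by (rule average_L1(1)[OF that(1) J(2-4), of "\<lambda>\<zeta>. \<zeta>"]) simp
      \<comment> \<open>At these points the mollifier centred at \<open>z\<close> is an admissible
        test function, so the mollified differences satisfy the linear conservation law
        exactly.\<close>
      define D where "D = {z. cball z \<rho> \<subseteq> \<Omega>}"
      have div: "gm w1 z \<bullet> et + gm w2 z \<bullet> ey + gm w3 z \<bullet> es = 0" if z: "z \<in> D" for z
      proof -
        obtain GJ where GJ: "\<And>z. norm (gJ z) \<le> GJ" using J(1) unfolding nice_def by blast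
        have c1: "c1_test \<Omega> (\<lambda>\<zeta>. J (z - \<zeta>)) (\<lambda>\<zeta>. - gJ (z - \<zeta>))"
          unfolding c1_test_def
        proof (intro conjI exI[of _ "cball z \<rho>"] allI impI)
          show "is_grad (\<lambda>\<zeta>. J (z - \<zeta>)) (\<lambda>\<zeta>. - gJ (z - \<zeta>))" by (rule is_grad_reflect) (use J(1) in \<open>simp add: nice_def\<close>)
          have "continuous_on UNIV gJ" using J(1) unfolding nice_def by (auto intro: uniformly_continuous_imp_continuous)
          then show "continuous_on UNIV (\<lambda>\<zeta>. - gJ (z - \<zeta>))"
            by (intro continuous_on_minus continuous_on_compose2[of UNIV gJ UNIV "\<lambda>\<zeta>. z - \<zeta>"]
              continuous_on_diff continuous_on_const continuous_on_id) auto
          show "cball z \<rho> \<subseteq> \<Omega>" using z by (simp add: D_def)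
        qed (use J(5) in \<open>auto simp: dist_norm\<close>)
        have ii: "integrable lborel (\<lambda>\<zeta>. w \<zeta> * (gJ (z - \<zeta>) \<bullet> v))" if "integrable lborel w" for w :: "'a \<Rightarrow> real" and v
        proof (rule integrable_mult_bounded(1)[OF that])
          show "\<bar>gJ (z - \<zeta>) \<bullet> v\<bar> \<le> GJ * norm v" for \<zeta>
            by (rule order_trans[OF Cauchy_Schwarz_ineq2]) (intro mult_right_mono GJ norm_ge_zero)
        qed measurable
        have gv: "gm w z \<bullet> v = (LINT \<zeta>|lborel. w \<zeta> * (gJ (z - \<zeta>) \<bullet> v))" if "integrable lborel w" for w :: "'a \<Rightarrow> real" and v
        proof -
          have "integrable lborel (\<lambda>\<zeta>. w \<zeta> *\<^sub>R gJ (z - \<zeta>))"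
            by (rule integrable_scaleR_bounded[OF that, of _ GJ]) (use GJ in auto)
          then show ?thesis unfolding gm_def by (subst integral_inner_left[symmetric]) auto
        qed
        have wk: "(LINT \<zeta>|lborel. W \<zeta> * (gJ (z - \<zeta>) \<bullet> et)) + (LINT \<zeta>|lborel. F (W \<zeta>) * (gJ (z - \<zeta>) \<bullet> ey)) + (LINT \<zeta>|lborel. G (W \<zeta>) * (gJ (z - \<zeta>) \<bullet> es)) = 0"
          if W: "bounded_sol X \<Omega> M W" for W
        proof -
          have i: "integrable lborel W" "integrable lborel (\<lambda>z. F (W z))" "integrable lborel (\<lambda>z. G (W z))"
            using W comp[of W F] comp[of W G] L by (auto simp: bounded_sol_def)
          have "(LINT \<zeta>|lborel. X (W \<zeta>) \<bullet> (- gJ (z - \<zeta>))) = 0"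
            using W c1 unfolding bounded_sol_def weak_solution_def by blast
          then have "0 = (LINT \<zeta>|lborel. X (W \<zeta>) \<bullet> (- gJ (z - \<zeta>)))" by (rule sym)
          also have "\<dots> = - (LINT \<zeta>|lborel. W \<zeta> * (gJ (z - \<zeta>) \<bullet> et) + F (W \<zeta>) * (gJ (z - \<zeta>) \<bullet> ey) + G (W \<zeta>) * (gJ (z - \<zeta>) \<bullet> es))"
            by (subst Bochner_Integration.integral_minus[symmetric])
              (simp add: X inner_add_left inner_commute[of et] inner_commute[of ey] inner_commute[of es])
          finally show ?thesis using ii[OF i(1)] ii[OF i(2)] ii[OF i(3)] by simp
        qed
        have iF: "integrable lborel (\<lambda>z. F (U z))" "integrable lborel (\<lambda>z. F (V z))" "integrable lborel (\<lambda>z. G (U z))" "integrable lborel (\<lambda>z. G (V z))"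
          using comp[OF iU(1) Ub(1)] comp[OF iU(2) Ub(2)] L by auto
        have "gm w1 z \<bullet> et = (LINT \<zeta>|lborel. U \<zeta> * (gJ (z - \<zeta>) \<bullet> et)) - (LINT \<zeta>|lborel. V \<zeta> * (gJ (z - \<zeta>) \<bullet> et))"
          unfolding gv[OF iw(1)] using ii[OF iU(1)] ii[OF iU(2)] by (simp add: w1_def left_diff_distrib)
        moreover have "gm w2 z \<bullet> ey = (LINT \<zeta>|lborel. F (U \<zeta>) * (gJ (z - \<zeta>) \<bullet> ey)) - (LINT \<zeta>|lborel. F (V \<zeta>) * (gJ (z - \<zeta>) \<bullet> ey))"
          unfolding gv[OF iw(2)] using ii[OF iF(1)] ii[OF iF(2)] by (simp add: w2_def left_diff_distrib)
        moreover have "gm w3 z \<bullet> es = (LINT \<zeta>|lborel. G (U \<zeta>) * (gJ (z - \<zeta>) \<bullet> es)) - (LINT \<zeta>|lborel. G (V \<zeta>) * (gJ (z - \<zeta>) \<bullet> es))"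
          unfolding gv[OF iw(3)] using ii[OF iF(3)] ii[OF iF(4)] by (simp add: w3_def left_diff_distrib)
        ultimately show ?thesis using wk[OF U] wk[OF V] by simp
      qed
      define A where "A = av (box_weight h) es (m w1)"
      define B where "B = av (box_weight h) es (m w2)"
      define Ab where "Ab = box_mean d h et ey es (m w1)"
      define Bb where "Bb = box_mean d h et ey es (m w2)"
      obtain \<Phi> g\<Phi> where \<Phi>: "nice \<Phi> g\<Phi>" "\<And>z. \<bar>\<Phi> z\<bar> \<le> 2 * d * N" "\<And>z. \<bar>g\<Phi> z \<bullet> es\<bar> \<le> 4 * d * N / h"
        "\<And>z. z \<in> {z. \<phi> z \<noteq> 0} \<Longrightarrow> \<bar>g\<Phi> z \<bullet> ey - (A z - Ab z)\<bar> \<le> 2 * d * N / h"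
        "\<And>z. z \<in> {z. \<phi> z \<noteq> 0} \<Longrightarrow> \<bar>g\<Phi> z \<bullet> et + (B z - Bb z)\<bar> \<le> 2 * d * N / h"
        unfolding A_def B_def Ab_def Bb_def box_mean_def
      proof (rule approximate_potential[OF nm[OF iw(1)] nm[OF iw(2)] nm[OF iw(3)] d(1) h, of N D et ey es "{z. \<phi> z \<noteq> 0}"])
        show "z - r *\<^sub>R et - p *\<^sub>R ey - p' *\<^sub>R es \<in> D" if "z \<in> {z. \<phi> z \<noteq> 0}" "0 \<le> r" "r \<le> d" for z r p p'
          using \<rho>(2)[of z r p p'] that d(2) by (simp add: D_def)
      qed (use mb[OF wm(1) wb(1)] mb[OF wm(2) wb(2)] mb[OF wm(3) wb(3)] div that in auto)
      define \<psi> where "\<psi> z = \<phi> z * \<Phi> z" for z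
      define g\<psi> where "g\<psi> z = \<Phi> z *\<^sub>R g\<phi> z + \<phi> z *\<^sub>R g\<Phi> z" for z
      have c\<Phi>: "continuous_on UNIV g\<Phi>" "continuous_on UNIV \<Phi>" "is_grad \<Phi> g\<Phi>"
        using \<Phi>(1) unfolding nice_def by (auto intro: uniformly_continuous_imp_continuous is_grad_continuous)
      have \<psi>: "c1_test \<Omega> \<psi> g\<psi>"
        unfolding c1_test_def
      proof (intro conjI exI[of _ K] allI impI)
        show "is_grad \<psi> g\<psi>" unfolding \<psi>_def[abs_def] g\<psi>_def[abs_def] by (rule is_grad_mult[OF g\<phi>(1) c\<Phi>(3)])
        show "continuous_on UNIV g\<psi>" unfolding g\<psi>_def[abs_def] by (intro continuous_intros g\<phi>(2,3) c\<Phi>(1,2))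
      qed (use K in \<open>auto simp: \<psi>_def\<close>)
      have \<psi>b: "\<bar>\<psi> z\<bar> \<le> (2 * d * N) * \<phi> z" for z
        using mult_right_mono[OF \<Phi>(2)[of z] \<phi>(2)[of z]] \<phi>(2)[of z] by (simp add: \<psi>_def abs_mult mult.commute)
      have T: "\<bar>LINT z|lborel. Y (W z) \<bullet> g\<psi> z\<bar> \<le> 2 * d * N * CT" if "bounded_sol X \<Omega> M W" for W
        by (rule CT(2)[OF _ _ _ _ \<psi> \<psi>b]) (use that d N0 in \<open>auto simp: bounded_sol_def\<close>)
      \<comment> \<open>The difference of the two entropy fields; its \<open>et\<close>-component
        \<open>w2\<close> is at the same time the \<open>ey\<close>-component of the difference of
        the two flux fields.\<close>
      define Z where "Z z = w2 z *\<^sub>R et + Q z *\<^sub>R ey + R' z *\<^sub>R es" for z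
      have ZY: "Z z = Y (U z) - Y (V z)" for z by (simp add: Z_def Y w2_def Q_def R'_def scaleR_diff_left)
      have Zm[measurable]: "Z \<in> borel_measurable borel" unfolding Z_def[abs_def] by measurable
      have Zb: "norm (Z z) \<le> NY" for z
      proof -
        have "norm (Z z) \<le> norm (w2 z *\<^sub>R et) + norm (Q z *\<^sub>R ey) + norm (R' z *\<^sub>R es)"
          unfolding Z_def by (rule order_trans[OF norm_triangle_ineq add_right_mono[OF norm_triangle_ineq]])
        also have "\<dots> \<le> N * norm et + N * norm ey + N * norm es"
          unfolding norm_scaleR by (intro add_mono mult_right_mono wb norm_ge_zero)
        finally show ?thesis by (simp add: NY_def algebra_simps)
      qed
      have iZ: "integrable lborel (\<lambda>z. Z z \<bullet> g\<psi> z)" by (rule integrable_inner_test(1)[OF \<psi> Zm Zb])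
      have Ym: "(\<lambda>z. Y (W z)) \<in> borel_measurable borel" if [measurable]: "W \<in> borel_measurable borel" for W :: "'a \<Rightarrow> real"
        unfolding Y by measurable
      have Yb: "norm (Y (W z)) \<le> NY" if "\<And>z. \<bar>W z\<bar> \<le> M" for W :: "'a \<Rightarrow> real" and z
      proof -
        have "norm (Y (W z)) \<le> norm (F (W z) *\<^sub>R et) + norm (q (W z) *\<^sub>R ey) + norm (R (W z) *\<^sub>R es)"
          unfolding Y by (rule order_trans[OF norm_triangle_ineq add_right_mono[OF norm_triangle_ineq]])
        also have "\<dots> \<le> N * norm et + N * norm ey + N * norm es"
          unfolding norm_scaleR using N[OF that, of z] by (intro add_mono mult_right_mono norm_ge_zero) auto
        finally show ?thesis by (simp add: NY_def algebra_simps)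
      qed
      have IZ: "\<bar>LINT z|lborel. Z z \<bullet> g\<psi> z\<bar> \<le> 4 * d * N * CT"
      proof -
        have "(LINT z|lborel. Z z \<bullet> g\<psi> z) = (LINT z|lborel. Y (U z) \<bullet> g\<psi> z) - (LINT z|lborel. Y (V z) \<bullet> g\<psi> z)"
          using integrable_inner_test(1)[OF \<psi> Ym[OF Um(1)], of NY] integrable_inner_test(1)[OF \<psi> Ym[OF Um(2)], of NY]
            Yb[of U] Yb[of V] Ub
          by (simp add: ZY inner_diff_left)
        then show ?thesis using T[OF U] T[OF V] by linarith
      qed
      note [measurable] = nice_measurable[OF \<Phi>(1)] nice_measurable[OF nm[OF iw(1)]] nice_measurable[OF nm[OF iw(2)]]
      have ABm[measurable]: "A \<in> borel_measurable borel" "B \<in> borel_measurable borel" "Ab \<in> borel_measurable borel" "Bb \<in> borel_measurable borel"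
        unfolding A_def B_def Ab_def Bb_def by measurable
      \<comment> \<open>Expanding the product of \<open>Z z\<close> with \<open>g\<psi> z\<close>,
        the coefficient 8 collects 4 from the \<open>es\<close>-derivative of \<Phi> and 2 from each
        of the other two components. Where \<phi> vanishes only the term with its gradient is
        left.\<close>
      have pw: "\<phi> z * (A z * Q z - B z * w2 z) \<le> Z z \<bullet> g\<psi> z + (2 * d * N) * (NY * norm (g\<phi> z)) +
          \<phi> z * (8 * N * N * (d / h)) + N * (\<phi> z * (\<bar>Ab z\<bar> + \<bar>Bb z\<bar>))" for z
      proof (cases "\<phi> z = 0")
        case True
        have "- (Z z \<bullet> g\<psi> z) \<le> (2 * d * N) * (NY * norm (g\<phi> z))"
        proof -
          have "- (Z z \<bullet> g\<psi> z) \<le> \<bar>\<Phi> z\<bar> * \<bar>Z z \<bullet> g\<phi> z\<bar>" using True by (simp add: g\<psi>_def abs_mult[symmetric])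
          also have "\<dots> \<le> (2 * d * N) * (NY * norm (g\<phi> z))"
            using d N0 NY by (intro mult_mono \<Phi> order_trans[OF Cauchy_Schwarz_ineq2] mult_right_mono Zb) auto
          finally show ?thesis .
        qed
        then show ?thesis using True by simp
      next
        case False
        define k where "k = d / h"
        define e1 where "e1 = g\<Phi> z \<bullet> ey - (A z - Ab z)"
        define e2 where "e2 = g\<Phi> z \<bullet> et + (B z - Bb z)"
        have e12: "\<bar>e1\<bar> \<le> 2 * N * (d / h)" "\<bar>e2\<bar> \<le> 2 * N * (d / h)"
          using \<Phi>(4,5)[of z] False unfolding e1_def e2_def by (simp_all add: mult_ac)
        have Zeq: "Z z \<bullet> g\<psi> z = \<Phi> z * (Z z \<bullet> g\<phi> z) + \<phi> z * (w2 z * (g\<Phi> z \<bullet> et) + Q z * (g\<Phi> z \<bullet> ey) + R' z * (g\<Phi> z \<bullet> es))"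
          unfolding g\<psi>_def inner_add_right inner_scaleR_right by (simp add: Z_def inner_add_left inner_commute[of et] inner_commute[of ey] inner_commute[of es])
        have ABeq: "A z * Q z - B z * w2 z = Q z * (g\<Phi> z \<bullet> ey) + w2 z * (g\<Phi> z \<bullet> et) + Q z * (Ab z - e1) - w2 z * (Bb z + e2)"
          unfolding e1_def e2_def by (simp add: algebra_simps)
        have eq: "\<phi> z * (A z * Q z - B z * w2 z) = Z z \<bullet> g\<psi> z - \<Phi> z * (Z z \<bullet> g\<phi> z) +
           \<phi> z * (- (R' z * (g\<Phi> z \<bullet> es)) + Q z * (Ab z - e1) - w2 z * (Bb z + e2))"
          unfolding ABeq Zeq by (simp add: algebra_simps)
        have "- (\<Phi> z * (Z z \<bullet> g\<phi> z)) \<le> \<bar>\<Phi> z\<bar> * \<bar>Z z \<bullet> g\<phi> z\<bar>" by (simp add: abs_mult[symmetric])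
        also have "\<dots> \<le> (2 * d * N) * (NY * norm (g\<phi> z))"
          using d N0 NY by (intro mult_mono \<Phi> order_trans[OF Cauchy_Schwarz_ineq2] mult_right_mono Zb) auto
        finally have t1: "- (\<Phi> z * (Z z \<bullet> g\<phi> z)) \<le> (2 * d * N) * (NY * norm (g\<phi> z))" .
        have a: "x * y \<le> N * b" if "\<bar>x\<bar> \<le> N" "\<bar>y\<bar> \<le> b" for x y b :: real
        proof -
          have "x * y \<le> \<bar>x\<bar> * \<bar>y\<bar>" by (simp add: abs_mult[symmetric])
          also have "\<dots> \<le> N * b" using that N0 by (intro mult_mono) auto
          finally show ?thesis .
        qed
        have r1: "- R' z * (g\<Phi> z \<bullet> es) \<le> N * (4 * N * (d / h))"
          using wb(5)[of z] \<Phi>(3)[of z] by (intro a) (simp_all add: mult_ac)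
        have r2: "Q z * (Ab z - e1) \<le> N * (\<bar>Ab z\<bar> + 2 * N * (d / h))"
          using wb(4)[of z] e12 by (intro a) (auto intro: order_trans[OF abs_triangle_ineq4])
        have r3: "- w2 z * (Bb z + e2) \<le> N * (\<bar>Bb z\<bar> + 2 * N * (d / h))"
          using wb(2)[of z] e12 by (intro a) (auto intro: order_trans[OF abs_triangle_ineq])
        have "- (R' z * (g\<Phi> z \<bullet> es)) + Q z * (Ab z - e1) - w2 z * (Bb z + e2) \<le> 8 * N * N * (d / h) + N * (\<bar>Ab z\<bar> + \<bar>Bb z\<bar>)"
          using r1 r2 r3 unfolding k_def[symmetric] by (simp add: algebra_simps)
        from mult_left_mono[OF this \<phi>(2)[of z]]
        show ?thesis unfolding eq using t1 unfolding k_def[symmetric] by (simp add: algebra_simps)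
      qed
      have mean_b: "\<bar>box_mean d h et ey es f z\<bar> \<le> N" if "\<And>z. \<bar>f z\<bar> \<le> N" for f :: "'a \<Rightarrow> real" and z
        unfolding box_mean_def by (intro av_box_bounded d(1) h that)
      have ABb: "\<bar>A z\<bar> \<le> N" "\<bar>B z\<bar> \<le> N" "\<bar>Ab z\<bar> \<le> N" "\<bar>Bb z\<bar> \<le> N" for z
        unfolding A_def B_def Ab_def Bb_def
        using mb[OF wm(1) wb(1)] mb[OF wm(2) wb(2)] by (auto intro!: av_box_bounded[OF h] mean_b)
      have i\<phi>b: "integrable lborel (\<lambda>z. \<phi> z * f z)" if "f \<in> borel_measurable borel" "\<And>z. \<bar>f z\<bar> \<le> b" for f :: "'a \<Rightarrow> real" and b
        by (rule integrable_mult_bounded(1)[OF i\<phi>, of _ b]) (use that in auto)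
      have prodb: "\<bar>x * y\<bar> \<le> N * N" if "\<bar>x\<bar> \<le> N" "\<bar>y\<bar> \<le> N" for x y :: real
        unfolding abs_mult using that N0 by (intro mult_mono) auto
      have iAB: "integrable lborel (\<lambda>z. \<phi> z * (A z * Q z - B z * w2 z))"
        by (rule i\<phi>b[of _ "N * N + N * N"])
          (measurable, intro order_trans[OF abs_triangle_ineq4] add_mono prodb ABb wb)
      have iabs: "integrable lborel (\<lambda>z. \<phi> z * (\<bar>Ab z\<bar> + \<bar>Bb z\<bar>))"
      proof (rule i\<phi>b[of _ "N + N"])
        show "\<bar>\<bar>Ab z\<bar> + \<bar>Bb z\<bar>\<bar> \<le> N + N" for z using add_mono[OF ABb(3)[of z] ABb(4)[of z]] by simp
      qed measurable
      have "(LINT z|lborel. \<phi> z * (A z * Q z - B z * w2 z)) \<le> (LINT z|lborel. Z z \<bullet> g\<psi> z + (2 * d * N) * (NY * norm (g\<phi> z)) +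
          \<phi> z * (8 * N * N * (d / h)) + N * (\<phi> z * (\<bar>Ab z\<bar> + \<bar>Bb z\<bar>)))"
        by (rule integral_mono[OF iAB _ pw]) (use iZ ig\<phi> i\<phi> iabs in auto)
      also have "\<dots> = (LINT z|lborel. Z z \<bullet> g\<psi> z) + (2 * d * N) * (NY * Pg) + P * (8 * N * N * (d / h)) + N * (LINT z|lborel. \<phi> z * (\<bar>Ab z\<bar> + \<bar>Bb z\<bar>))"
        using iZ ig\<phi> i\<phi> iabs by (simp add: P_def Pg_def)
      finally have E1: "(LINT z|lborel. \<phi> z * (A z * Q z - B z * w2 z)) \<le> 4 * d * N * CT + (2 * d * N) * (NY * Pg) + P * (8 * N * N * (d / h))
          + N * (LINT z|lborel. \<phi> z * (\<bar>Ab z\<bar> + \<bar>Bb z\<bar>))" using IZ by linarith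
      have c\<phi>: "(LINT z|lborel. \<phi> z * \<bar>f z\<bar>) \<le> c * (LINT z|lborel. \<bar>f z\<bar>)" if "integrable lborel f" for f :: "'a \<Rightarrow> real"
      proof -
        have "(LINT z|lborel. \<phi> z * \<bar>f z\<bar>) \<le> (LINT z|lborel. c * \<bar>f z\<bar>)"
          by (rule integral_mono) (use that c(2) \<phi>(2) in \<open>auto intro!: integrable_mult_bounded(2)[of _ _ _ c] mult_right_mono simp: abs_le_iff\<close>)
        then show ?thesis by simp
      qed
      have mean_close: "(LINT z|lborel. \<phi> z * \<bar>box_mean d h et ey es (m w) z\<bar>) \<le> (LINT z|lborel. \<phi> z * \<bar>box_mean d h et ey es w z\<bar>) + c * e"
        if w: "integrable lborel w" "w \<in> borel_measurable borel" "\<And>z. \<bar>w z\<bar> \<le> N" "(LINT z|lborel. \<bar>m w z - w z\<bar>) \<le> e" for w :: "'a \<Rightarrow> real"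
      proof -
        note [measurable] = w(2) nice_measurable[OF nm[OF w(1)]]
        note mw = im[OF w(1-3)]
        note bd = box_mean_diff[OF d(1) h, of "m w" N w N et ey es, OF _ mb[OF w(2,3)] w(2,3)]
        have id: "integrable lborel (\<lambda>z. m w z - w z)" using mw w(1) by simp
        have "(LINT z|lborel. \<phi> z * \<bar>box_mean d h et ey es (m w) z\<bar>) \<le>
          (LINT z|lborel. \<phi> z * \<bar>box_mean d h et ey es w z\<bar> + \<phi> z * \<bar>box_mean d h et ey es (\<lambda>z. m w z - w z) z\<bar>)"
        proof (rule integral_mono)
          show "integrable lborel (\<lambda>z. \<phi> z * \<bar>box_mean d h et ey es (m w) z\<bar>)"
            by (rule i\<phi>b[of _ N]) (use mean_b[OF mb[OF w(2,3)]] in auto)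
          show "integrable lborel (\<lambda>z. \<phi> z * \<bar>box_mean d h et ey es w z\<bar> + \<phi> z * \<bar>box_mean d h et ey es (\<lambda>z. m w z - w z) z\<bar>)"
          proof (rule Bochner_Integration.integrable_add)
            show "integrable lborel (\<lambda>z. \<phi> z * \<bar>box_mean d h et ey es w z\<bar>)"
              by (rule i\<phi>b[of _ N]) (use mean_b[OF w(3)] in auto)
            show "integrable lborel (\<lambda>z. \<phi> z * \<bar>box_mean d h et ey es (\<lambda>z. m w z - w z) z\<bar>)"
              by (rule integrable_mult_bounded(2)[of _ _ _ c]) (use box_mean_L1(1)[OF id d(1) h] c(2) in auto)
          qed
          fix z
          have "\<bar>box_mean d h et ey es (m w) z\<bar> \<le> \<bar>box_mean d h et ey es w z\<bar> + \<bar>box_mean d h et ey es (\<lambda>z. m w z - w z) z\<bar>"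
            using bd by simp
          from mult_left_mono[OF this \<phi>(2)[of z]]
          show "\<phi> z * \<bar>box_mean d h et ey es (m w) z\<bar> \<le> \<phi> z * \<bar>box_mean d h et ey es w z\<bar> + \<phi> z * \<bar>box_mean d h et ey es (\<lambda>z. m w z - w z) z\<bar>"
            by (simp add: distrib_left)
        qed
        also have "\<dots> = (LINT z|lborel. \<phi> z * \<bar>box_mean d h et ey es w z\<bar>) + (LINT z|lborel. \<phi> z * \<bar>box_mean d h et ey es (\<lambda>z. m w z - w z) z\<bar>)"
        proof (rule Bochner_Integration.integral_add)
            show "integrable lborel (\<lambda>z. \<phi> z * \<bar>box_mean d h et ey es w z\<bar>)"
              by (rule i\<phi>b[of _ N]) (use mean_b[OF w(3)] in auto)
            show "integrable lborel (\<lambda>z. \<phi> z * \<bar>box_mean d h et ey es (\<lambda>z. m w z - w z) z\<bar>)"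
              by (rule integrable_mult_bounded(2)[of _ _ _ c]) (use box_mean_L1(1)[OF id d(1) h] c(2) in auto)
        qed
        also have "(LINT z|lborel. \<phi> z * \<bar>box_mean d h et ey es (\<lambda>z. m w z - w z) z\<bar>) \<le> c * e"
          by (rule order_trans[OF c\<phi>[OF box_mean_L1(1)[OF id d(1) h]] mult_left_mono[OF order_trans[OF box_mean_L1(2)[OF id d(1) h] w(4)]]])
            (use c(1) in simp)
        finally show ?thesis by simp
      qed
      have E2: "(LINT z|lborel. \<phi> z * (\<bar>Ab z\<bar> + \<bar>Bb z\<bar>)) \<le> S + 2 * c * e"
      proof -
        have sp: "(LINT z|lborel. \<phi> z * (\<bar>f z\<bar> + \<bar>k z\<bar>)) = (LINT z|lborel. \<phi> z * \<bar>f z\<bar>) + (LINT z|lborel. \<phi> z * \<bar>k z\<bar>)"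
          if "f \<in> borel_measurable borel" "\<And>z. \<bar>f z\<bar> \<le> N" "k \<in> borel_measurable borel" "\<And>z. \<bar>k z\<bar> \<le> N" for f k :: "'a \<Rightarrow> real"
          using i\<phi>b[of "\<lambda>z. \<bar>f z\<bar>" N] i\<phi>b[of "\<lambda>z. \<bar>k z\<bar>" N] that by (simp add: distrib_left)
        have "(LINT z|lborel. \<phi> z * (\<bar>Ab z\<bar> + \<bar>Bb z\<bar>)) = (LINT z|lborel. \<phi> z * \<bar>Ab z\<bar>) + (LINT z|lborel. \<phi> z * \<bar>Bb z\<bar>)"
          by (rule sp[OF ABm(3) ABb(3) ABm(4) ABb(4)])
        also have "\<dots> \<le> ((LINT z|lborel. \<phi> z * \<bar>box_mean d h et ey es w1 z\<bar>) + c * e) + ((LINT z|lborel. \<phi> z * \<bar>box_mean d h et ey es w2 z\<bar>) + c * e)"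
          unfolding Ab_def Bb_def
          by (intro add_mono mean_close[OF iw(1) wm(1) wb(1) mclose(1)] mean_close[OF iw(2) wm(2) wb(2) mclose(2)])
        also have "\<dots> = S + 2 * c * e"
          unfolding S_def using sp[of "box_mean d h et ey es w1" "box_mean d h et ey es w2"] mean_b[OF wb(1)] mean_b[OF wb(2)] by simp
        finally show ?thesis .
      qed
      have av_close: "(LINT z|lborel. \<bar>av (box_weight h) es (m w) z - w z\<bar>) \<le> e + \<omega>" "integrable lborel (\<lambda>z. av (box_weight h) es (m w) z - w z)"
        if w: "integrable lborel w" "w \<in> borel_measurable borel" "\<And>z. \<bar>w z\<bar> \<le> N" "(LINT z|lborel. \<bar>m w z - w z\<bar>) \<le> e"
          "\<And>r. 0 \<le> r \<Longrightarrow> r \<le> h \<Longrightarrow> (LINT z|lborel. \<bar>w (z - r *\<^sub>R es) - w z\<bar>) \<le> \<omega>" for w :: "'a \<Rightarrow> real"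
      proof -
        note [measurable] = w(2) nice_measurable[OF nm[OF w(1)]]
        have id: "integrable lborel (\<lambda>z. m w z - w z)" using im[OF w(1-3)] w(1) by simp
        have split: "av (box_weight h) es (m w) z - w z = av (box_weight h) es (\<lambda>z. m w z - w z) z + (av (box_weight h) es w z - w z)" for z
          using av_linear(2)[OF box_weight(1)[OF h], of "m w" N w N es z] mb[OF w(2,3)] w(3) by simp
        note i1 = av_box_L1(1)[OF id h, of es] and i2 = av_box_L1(1)[OF w(1) h, of es]
        show "integrable lborel (\<lambda>z. av (box_weight h) es (m w) z - w z)" unfolding split using i1 i2 w(1) by simp
        have "(LINT z|lborel. \<bar>av (box_weight h) es (m w) z - w z\<bar>) \<le>
          (LINT z|lborel. \<bar>av (box_weight h) es (\<lambda>z. m w z - w z) z\<bar> + \<bar>av (box_weight h) es w z - w z\<bar>)"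
          unfolding split using i1 i2 w(1) by (intro integral_mono) auto
        also have "\<dots> = (LINT z|lborel. \<bar>av (box_weight h) es (\<lambda>z. m w z - w z) z\<bar>) + (LINT z|lborel. \<bar>av (box_weight h) es w z - w z\<bar>)"
          using i1 i2 w(1) by simp
        also have "\<dots> \<le> e + \<omega>"
          using order_trans[OF av_box_L1(2)[OF id h] w(4)] av_box_L1(3)[OF w(1) h w(5)] by (rule add_mono)
        finally show "(LINT z|lborel. \<bar>av (box_weight h) es (m w) z - w z\<bar>) \<le> e + \<omega>" .
      qed
      have close1: "(LINT z|lborel. \<bar>A z - w1 z\<bar>) \<le> e + \<omega>" "integrable lborel (\<lambda>z. A z - w1 z)"
        unfolding A_def by (rule av_close[OF iw(1) wm(1) wb(1) mclose(1)], use \<omega>1 in \<open>simp add: w1_def\<close>)+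
      have close2: "(LINT z|lborel. \<bar>B z - w2 z\<bar>) \<le> e + \<omega>" "integrable lborel (\<lambda>z. B z - w2 z)"
        unfolding B_def by (rule av_close[OF iw(2) wm(2) wb(2) mclose(2)], use \<omega>2 in \<open>simp add: w2_def\<close>)+
      have i3: "integrable lborel (\<lambda>z. \<phi> z * \<bar>A z - w1 z\<bar>)" "integrable lborel (\<lambda>z. \<phi> z * \<bar>B z - w2 z\<bar>)"
        using close1(2) close2(2) c(2) by (auto intro!: integrable_mult_bounded(2)[of _ _ _ c])
      have "(LINT z|lborel. \<phi> z * (w1 z * Q z - (w2 z)\<^sup>2)) \<le> (LINT z|lborel. \<phi> z * (A z * Q z - B z * w2 z) +
          (N * (\<phi> z * \<bar>A z - w1 z\<bar>) + N * (\<phi> z * \<bar>B z - w2 z\<bar>)))"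
      proof (rule integral_mono)
        show "integrable lborel (\<lambda>z. \<phi> z * (w1 z * Q z - (w2 z)\<^sup>2))"
          unfolding power2_eq_square
          by (rule i\<phi>b[of _ "N * N + N * N"]) (measurable, intro order_trans[OF abs_triangle_ineq4] add_mono prodb wb)
        show "integrable lborel (\<lambda>z. \<phi> z * (A z * Q z - B z * w2 z) + (N * (\<phi> z * \<bar>A z - w1 z\<bar>) + N * (\<phi> z * \<bar>B z - w2 z\<bar>)))"
          using iAB i3 by simp
        fix z
        \<comment> \<open>Only one factor of each product is replaced by its average, so that the
          other one needs no modulus and is simply bounded by \<open>N\<close>.\<close>
        have "w1 z * Q z - (w2 z)\<^sup>2 = (A z * Q z - B z * w2 z) + (w1 z - A z) * Q z + (B z - w2 z) * w2 z"
          by (simp add: power2_eq_square algebra_simps)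
        also have "\<dots> \<le> (A z * Q z - B z * w2 z) + \<bar>A z - w1 z\<bar> * N + \<bar>B z - w2 z\<bar> * N"
        proof (intro add_mono order_refl)
          show "(w1 z - A z) * Q z \<le> \<bar>A z - w1 z\<bar> * N"
            using mult_left_mono[OF wb(4)[of z], of "\<bar>A z - w1 z\<bar>"] abs_ge_self[of "(w1 z - A z) * Q z"]
            by (simp add: abs_mult abs_minus_commute)
          show "(B z - w2 z) * w2 z \<le> \<bar>B z - w2 z\<bar> * N"
            using mult_left_mono[OF wb(2)[of z], of "\<bar>B z - w2 z\<bar>"] abs_ge_self[of "(B z - w2 z) * w2 z"]
            by (simp add: abs_mult)
        qed
        finally have "w1 z * Q z - (w2 z)\<^sup>2 \<le> (A z * Q z - B z * w2 z) + \<bar>A z - w1 z\<bar> * N + \<bar>B z - w2 z\<bar> * N" .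
        from mult_left_mono[OF this \<phi>(2)[of z]]
        show "\<phi> z * (w1 z * Q z - (w2 z)\<^sup>2) \<le> \<phi> z * (A z * Q z - B z * w2 z) + (N * (\<phi> z * \<bar>A z - w1 z\<bar>) + N * (\<phi> z * \<bar>B z - w2 z\<bar>))"
          by (simp add: algebra_simps)
      qed
      also have "\<dots> = (LINT z|lborel. \<phi> z * (A z * Q z - B z * w2 z)) + (N * (LINT z|lborel. \<phi> z * \<bar>A z - w1 z\<bar>) + N * (LINT z|lborel. \<phi> z * \<bar>B z - w2 z\<bar>))"
        using iAB i3 by simp
      also have "\<dots> \<le> (LINT z|lborel. \<phi> z * (A z * Q z - B z * w2 z)) + (N * (c * (e + \<omega>)) + N * (c * (e + \<omega>)))"
        using c(1) N0
        by (intro add_mono order_refl mult_left_mono order_trans[OF c\<phi>[OF close1(2)]] order_trans[OF c\<phi>[OF close2(2)]] close1(1) close2(1)) auto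
      also have "\<dots> \<le> 4 * d * N * CT + (2 * d * N) * (NY * Pg) + P * (8 * N * N * (d / h)) + N * (S + 2 * c * e) + 2 * N * c * (e + \<omega>)"
        using E1 mult_left_mono[OF E2 N0] by (simp add: algebra_simps)
      also have "\<dots> = (4 * N * CT + 2 * N * NY * Pg) * d + 8 * N * N * P * (d / h) + 2 * N * c * \<omega> + N * S + (4 * N * c) * e"
        by (simp add: algebra_simps)
      also have "\<dots> \<le> C * d + C * (d / h) + C * \<omega> + C * S + e0"
      proof (intro add_mono mult_right_mono)
        have "0 \<le> N * CT" "0 \<le> N * NY * Pg" "0 \<le> N * N * P" "0 \<le> N * c" using N0 CT(1) NY P c(1) by simp_all
        then show "4 * N * CT + 2 * N * NY * Pg \<le> C" "8 * N * N * P \<le> C" "2 * N * c \<le> C" "N \<le> C"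
          unfolding C_def using N0 by simp_all
        have "0 \<le> (LINT z|lborel. \<bar>(U (z - 0 *\<^sub>R es) - V (z - 0 *\<^sub>R es)) - (U z - V z)\<bar>)" by (intro integral_nonneg_AE) auto
        also have "\<dots> \<le> \<omega>" using \<omega>1[of 0] h by simp
        finally show "0 \<le> \<omega>" .
        show "0 \<le> S" unfolding S_def using \<phi>(2) by (intro integral_nonneg_AE) auto
        have "(4 * N * c) * e \<le> (4 * N * c + 1) * e" using e by (intro mult_right_mono) auto
        also have "\<dots> = e0" using N0 c(1) unfolding e_def by (simp add: add_nonneg_eq_0_iff)
        finally show "(4 * N * c) * e \<le> e0" .
      qed (use d h in auto)
      finally show "(LINT z|lborel. \<phi> z * (w1 z * Q z - (w2 z)\<^sup>2)) \<le> C * (d + d / h + \<omega>) + C * S + e0"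
        by (simp add: algebra_simps)
    qed
    then show "(LINT z|lborel. \<phi> z * ((U z - V z) * (q (U z) - q (V z)) - (F (U z) - F (V z))\<^sup>2)) \<le>
      C * (d + d / h + \<omega>) + C * (LINT z|lborel. \<phi> z * (\<bar>box_mean d h et ey es (\<lambda>z. U z - V z) z\<bar> +
        \<bar>box_mean d h et ey es (\<lambda>z. F (U z) - F (V z)) z\<bar>))"
      by (simp add: S_def w1_def[abs_def] Q_def w2_def[abs_def])
  qed
qed

section \<open>Lipschitz bounds for box means\<close>

text \<open>A shift along the direction of averaging moves to the weight, which changes only near
  the two ends of its interval, on a set of length at most \<open>2 * \<bar>s\<bar>\<close> and by
  at most \<open>1 / d\<close>.\<close>

lemma weight_shift_bound:
  fixes f :: "'a::euclidean_space \<Rightarrow> real"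
  assumes d: "0 < d" and [measurable]: "f \<in> borel_measurable borel" and f: "\<And>z. \<bar>f z\<bar> \<le> C"
  shows "\<bar>av (box_weight d) e f (z + s *\<^sub>R e) - av (box_weight d) e f z\<bar> \<le> 2 * C / d * \<bar>s\<bar>"
proof -
  have C: "0 \<le> C" using f[of 0] by linarith
  have i: "integrable lborel (\<lambda>r. box_weight d r * f (z - r *\<^sub>R e))"
    using av_integrable[OF box_weight(1)[OF d], of f C z e] f by simp
  have eq: "av (box_weight d) e f (z + s *\<^sub>R e) = (LINT r|lborel. box_weight d (r + s) * f (z - r *\<^sub>R e))"
    unfolding av_def using lborel_integral_shift[of "\<lambda>r. box_weight d r *\<^sub>R f (z + s *\<^sub>R e - r *\<^sub>R e)" s] box_weight_measurable[of d]
    by (simp add: algebra_simps)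
  have iw: "integrable lborel (\<lambda>r. box_weight d (r + s))"
    using box_weight(1)[OF d] lborel_integrable_shift[OF box_weight_measurable[of d], of s] by simp
  have ish: "integrable lborel (\<lambda>r. box_weight d (r + s) * f (z - r *\<^sub>R e))"
    by (rule integrable_mult_bounded(1)[OF iw, of _ C]) (use f in auto)
  have ii: "integrable lborel (indicator ({-s..0} \<union> {0..-s} \<union> {d-s..d} \<union> {d..d-s}) :: real \<Rightarrow> real)"
    by (intro integrable_real_indicator) (auto intro!: order_le_less_trans[OF emeasure_subadditive] simp: emeasure_lborel_Icc_eq)
  have im: "measure lborel ({-s..0} \<union> {0..-s} \<union> {d-s..d} \<union> {d..d-s}) \<le> 2 * \<bar>s\<bar>"
  proof (cases "0 \<le> s")
    case True
    then have "{-s..0} \<union> {0..-s} \<union> {d-s..d} \<union> {d..d-s} = {-s..0} \<union> {d-s..d}" by auto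
    then show ?thesis using measure_Un_le[of "{-s..0}" lborel "{d-s..d}"] True by simp
  next
    case False
    then have "{-s..0} \<union> {0..-s} \<union> {d-s..d} \<union> {d..d-s} = {0..-s} \<union> {d..d-s}" by auto
    then show ?thesis using measure_Un_le[of "{0..-s}" lborel "{d..d-s}"] False by simp
  qed
  define S where "S = {-s..0} \<union> {0..-s} \<union> {d-s..d} \<union> {d..d-s}"
  have e1: "av (box_weight d) e f (z + s *\<^sub>R e) - av (box_weight d) e f z =
      (LINT r|lborel. box_weight d (r + s) * f (z - r *\<^sub>R e) - box_weight d r * f (z - r *\<^sub>R e))"
    unfolding eq using ish i by (simp add: av_def)
  have "norm (LINT r|lborel. box_weight d (r + s) * f (z - r *\<^sub>R e) - box_weight d r * f (z - r *\<^sub>R e))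
      \<le> (LINT r|lborel. indicator S r * (C / d))"
  proof (rule norm_integral_le)
    show "integrable lborel (\<lambda>r. indicator S r * (C / d))" using ii by (simp add: S_def)
    fix r
    have "\<bar>box_weight d (r + s) - box_weight d r\<bar> \<le> indicator S r * (1 / d)"
      using d by (auto simp: box_weight_def indicator_def S_def)
    then have "\<bar>box_weight d (r + s) - box_weight d r\<bar> * \<bar>f (z - r *\<^sub>R e)\<bar> \<le>
        (indicator S r * (1 / d)) * C"
      using f C d by (intro mult_mono) auto
    then show "norm (box_weight d (r + s) * f (z - r *\<^sub>R e) - box_weight d r * f (z - r *\<^sub>R e)) \<le>
        indicator S r * (C / d)"
      by (simp add: left_diff_distrib[symmetric] abs_mult)
  qed
  also have "\<dots> = measure lborel S * (C / d)" by simp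
  also have "\<dots> \<le> 2 * \<bar>s\<bar> * (C / d)" using im C d unfolding S_def by (intro mult_right_mono) auto
  finally show ?thesis unfolding e1 by (simp add: mult_ac)
qed

lemma av_shift: "av w e f (z + v) - av w e f z = av w e (\<lambda>x. f (x + v)) z - av w e f z"
  by (simp add: av_def algebra_simps)

text \<open>Each mean makes the function Lipschitz along its own direction, and the remaining means
  preserve such a bound. The constants depend on the bound of \<open>f\<close> and the two lengths
  alone, which gives equicontinuity along a sequence.\<close>

lemma box_mean_lipschitz:
  fixes f :: "'a::euclidean_space \<Rightarrow> real"
  assumes d: "0 < d" "0 < h" and fm: "f \<in> borel_measurable borel" and f: "\<And>z. \<bar>f z\<bar> \<le> C"
  shows "\<bar>box_mean d h et ey es f (z + (a *\<^sub>R et + b *\<^sub>R ey + c *\<^sub>R es)) - box_mean d h et ey es f z\<bar>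
    \<le> 2 * C / d * \<bar>a\<bar> + 2 * C / d * \<bar>b\<bar> + 2 * C / h * \<bar>c\<bar>"
proof -
  note bw = box_weight_measurable
  define A where "A = av (box_weight h) es f"
  define B where "B = av (box_weight d) ey A"
  define D where "D = av (box_weight d) et B"
  have Am: "A \<in> borel_measurable borel" and Ab: "\<bar>A z\<bar> \<le> C" for z
    unfolding A_def by (rule av_measurable[OF fm bw] av_box_bounded[OF d(2) f])+
  have Bm: "B \<in> borel_measurable borel" and Bb: "\<bar>B z\<bar> \<le> C" for z
    unfolding B_def by (rule av_measurable[OF Am bw] av_box_bounded[OF d(1) Ab])+
  have lift: "\<bar>av (box_weight k) e F (z + v) - av (box_weight k) e F z\<bar> \<le> m"
    if "\<And>z. \<bar>F (z + v) - F z\<bar> \<le> m" "0 < k" "F \<in> borel_measurable borel" "\<And>z. \<bar>F z\<bar> \<le> C" for k e F v z m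
  proof -
    have [measurable]: "F \<in> borel_measurable borel" by (rule that(3))
    have "av (box_weight k) e F (z + v) - av (box_weight k) e F z = av (box_weight k) e (\<lambda>x. F (x + v) - F x) z"
      unfolding av_shift using av_linear(2)[OF box_weight(1)[OF that(2)], of "\<lambda>x. F (x + v)" C F C] that(4) by simp
    then show ?thesis using av_box_bounded[OF that(2), of "\<lambda>x. F (x + v) - F x" m e z] that(1) by simp
  qed
  have es: "\<bar>D (z + c *\<^sub>R es) - D z\<bar> \<le> 2 * C / h * \<bar>c\<bar>" for z
    unfolding D_def
    by (rule lift[OF _ d(1) Bm Bb], unfold B_def, rule lift[OF _ d(1) Am Ab], unfold A_def,
      rule weight_shift_bound[OF d(2) fm f])
  have ey: "\<bar>D (z + b *\<^sub>R ey) - D z\<bar> \<le> 2 * C / d * \<bar>b\<bar>" for z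
    unfolding D_def by (rule lift[OF _ d(1) Bm Bb], unfold B_def, rule weight_shift_bound[OF d(1) Am Ab])
  have et: "\<bar>D (z + a *\<^sub>R et) - D z\<bar> \<le> 2 * C / d * \<bar>a\<bar>" for z
    unfolding D_def by (rule weight_shift_bound[OF d(1) Bm Bb])
  have "D (z + (a *\<^sub>R et + b *\<^sub>R ey + c *\<^sub>R es)) - D z = (D (z + a *\<^sub>R et) - D z) +
      (D ((z + a *\<^sub>R et) + b *\<^sub>R ey) - D (z + a *\<^sub>R et)) + (D ((z + a *\<^sub>R et + b *\<^sub>R ey) + c *\<^sub>R es) - D (z + a *\<^sub>R et + b *\<^sub>R ey))"
    by (simp add: algebra_simps)
  also have "\<bar>\<dots>\<bar> \<le> 2 * C / d * \<bar>a\<bar> + 2 * C / d * \<bar>b\<bar> + 2 * C / h * \<bar>c\<bar>"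
    by (intro order_trans[OF abs_triangle_ineq] add_mono et ey es)
  finally show ?thesis by (simp add: D_def B_def A_def box_mean_def)
qed

section \<open>The Burgers flux in the frame of \<xi>\<close>

text \<open>A quarter turn, which completes \<xi> to an orthonormal frame; \<open>rot \<xi>\<close>
  is the direction called \<open>n\<close> above.\<close>

definition rot :: "real ^ 2 \<Rightarrow> real ^ 2" where
  "rot \<xi> = vector [- (\<xi> $ 2), \<xi> $ 1]"

lemma frame_decomposition:
  fixes \<xi> x :: "real ^ 2"
  assumes "norm \<xi> = 1"
  shows "x = (x \<bullet> rot \<xi>) *\<^sub>R rot \<xi> + (x \<bullet> \<xi>) *\<^sub>R \<xi>" "norm (rot \<xi>) = 1"
proof -
  have 1: "\<xi> $ 1 * \<xi> $ 1 + \<xi> $ 2 * \<xi> $ 2 = 1"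
    using assms by (simp add: norm_eq_1 inner_vec_def sum_2)
  have "x $ 1 = x $ 1 * (\<xi> $ 1 * \<xi> $ 1 + \<xi> $ 2 * \<xi> $ 2)" "x $ 2 = x $ 2 * (\<xi> $ 1 * \<xi> $ 1 + \<xi> $ 2 * \<xi> $ 2)"
    by (simp_all only: 1 mult_1_right)
  then show "x = (x \<bullet> rot \<xi>) *\<^sub>R rot \<xi> + (x \<bullet> \<xi>) *\<^sub>R \<xi>"
    by (simp add: vec_eq_iff forall_2 rot_def inner_vec_def sum_2 algebra_simps)
  show "norm (rot \<xi>) = 1" using 1 by (simp add: norm_eq_1 inner_vec_def sum_2 rot_def add.commute)
qed

text \<open>The flux in direction \<open>n\<close> is \<open>F w = p w\<^sup>2 / 2 + r w\<^sup>3 / 3\<close> with \<open>(p, r) = n\<close>, and the polynomial of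
  degree five is a primitive of \<open>F'\<^sup>2\<close>.\<close>

lemma tartar_lower_bound:
  fixes p r M :: real
  assumes "p\<^sup>2 + r\<^sup>2 = 1" "0 < M"
  obtains c where "0 < c" "\<And>u v. \<bar>u\<bar> \<le> M \<Longrightarrow> \<bar>v\<bar> \<le> M \<Longrightarrow>
    c * \<bar>u - v\<bar> ^ 6 \<le> (u - v) * ((p\<^sup>2 * u ^ 3 / 3 + p * r * u ^ 4 / 2 + r\<^sup>2 * u ^ 5 / 5) - (p\<^sup>2 * v ^ 3 / 3 + p * r * v ^ 4 / 2 + r\<^sup>2 * v ^ 5 / 5))
       - ((p * u ^ 2 / 2 + r * u ^ 3 / 3) - (p * v ^ 2 / 2 + r * v ^ 3 / 3))\<^sup>2"
proof -
  \<comment> \<open>With the midpoint of \<open>u\<close> and \<open>v\<close> as origin,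
    \<open>F'\<close> is a constant plus \<open>(p + r * (u + v)) * s + r * s\<^sup>2\<close>. On an
    interval of length \<open>\<bar>u - v\<bar>\<close> the variances of these two orthogonal parts
    carry the factors 1/12 and 1/180.\<close>
  have id: "(u - v) * ((p\<^sup>2 * u ^ 3 / 3 + p * r * u ^ 4 / 2 + r\<^sup>2 * u ^ 5 / 5) - (p\<^sup>2 * v ^ 3 / 3 + p * r * v ^ 4 / 2 + r\<^sup>2 * v ^ 5 / 5))
       - ((p * u ^ 2 / 2 + r * u ^ 3 / 3) - (p * v ^ 2 / 2 + r * v ^ 3 / 3))\<^sup>2
     = (p + r * (u + v))\<^sup>2 * (u - v) ^ 4 / 12 + r\<^sup>2 * (u - v) ^ 6 / 180" for u v
    by (simp add: power2_eq_square power_numeral_reduce field_simps)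
  show ?thesis
  proof (cases "r = 0")
    case False
    show ?thesis
    proof (rule that[of "r\<^sup>2 / 180"])
      show "0 < r\<^sup>2 / 180" using False by simp
      fix u v :: real
      have "0 \<le> (p + r * (u + v))\<^sup>2 * (u - v) ^ 4 / 12" by simp
      then show "r\<^sup>2 / 180 * \<bar>u - v\<bar> ^ 6 \<le> (u - v) * ((p\<^sup>2 * u ^ 3 / 3 + p * r * u ^ 4 / 2 + r\<^sup>2 * u ^ 5 / 5) - (p\<^sup>2 * v ^ 3 / 3 + p * r * v ^ 4 / 2 + r\<^sup>2 * v ^ 5 / 5))
       - ((p * u ^ 2 / 2 + r * u ^ 3 / 3) - (p * v ^ 2 / 2 + r * v ^ 3 / 3))\<^sup>2"
        unfolding id by simp
    qed
  next
    case True
    then have p: "p\<^sup>2 = 1" using assms by simp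
    show ?thesis
    \<comment> \<open>For \<open>r = 0\<close> only the fourth power is available; two further
      powers are paid for by \<open>\<bar>u - v\<bar> \<le> 2 * M\<close>, so 48 is 4 times
      12.\<close>
    proof (rule that[of "1 / (48 * M\<^sup>2)"])
      show "0 < 1 / (48 * M\<^sup>2)" using assms by simp
      fix u v :: real assume "\<bar>u\<bar> \<le> M" "\<bar>v\<bar> \<le> M"
      then have "\<bar>u - v\<bar> \<le> 2 * M" using abs_triangle_ineq4[of u v] by linarith
      then have "\<bar>u - v\<bar>\<^sup>2 \<le> (2 * M)\<^sup>2" by (rule power_mono) simp
      then have "\<bar>u - v\<bar>\<^sup>2 * \<bar>u - v\<bar> ^ 4 \<le> (2 * M)\<^sup>2 * \<bar>u - v\<bar> ^ 4" by (rule mult_right_mono) simp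
      then have "\<bar>u - v\<bar> ^ 6 \<le> 4 * M\<^sup>2 * (u - v) ^ 4" by (simp add: power_mult_distrib flip: power_add)
      then have "1 / (48 * M\<^sup>2) * \<bar>u - v\<bar> ^ 6 \<le> (u - v) ^ 4 / 12" using assms(2) by (simp add: field_simps)
      then show "1 / (48 * M\<^sup>2) * \<bar>u - v\<bar> ^ 6 \<le> (u - v) * ((p\<^sup>2 * u ^ 3 / 3 + p * r * u ^ 4 / 2 + r\<^sup>2 * u ^ 5 / 5) - (p\<^sup>2 * v ^ 3 / 3 + p * r * v ^ 4 / 2 + r\<^sup>2 * v ^ 5 / 5))
       - ((p * u ^ 2 / 2 + r * u ^ 3 / 3) - (p * v ^ 2 / 2 + r * v ^ 3 / 3))\<^sup>2"
        unfolding id using p True by simp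
    qed
  qed
qed

text \<open>The indicator of the \<open>d / 2\<close>-neighbourhood of \<open>K\<close> is convolved
  with a mollifier of radius \<open>d / 2\<close>, so it stays 1 on \<open>K\<close> and vanishes
  beyond distance \<open>d\<close>.\<close>

lemma cutoff_exists:
  fixes K :: "'a::euclidean_space set"
  assumes K: "compact K" "K \<subseteq> \<Omega>" and \<Omega>: "open \<Omega>"
  obtains \<phi> g where "c1_test \<Omega> \<phi> g" "\<And>z. 0 \<le> \<phi> z" "\<And>z. z \<in> K \<Longrightarrow> \<phi> z = 1"
proof (cases "K = {}")
  case True
  show ?thesis by (rule that[of "\<lambda>_. 0" "\<lambda>_. 0"]) (use True in \<open>auto simp: c1_test_def is_grad_def\<close>)
next
  case ne: False
  obtain d where d: "0 < d" "{x. infdist x K \<le> d} \<subseteq> \<Omega>" using compact_in_open_separated[OF ne K(1) \<Omega> K(2)] by blast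
  define H where "H = {x. infdist x K \<le> d / 2}"
  have cH: "compact H" unfolding H_def by (rule compact_infdist_le[OF ne K(1)]) (use d in simp)
  have cd: "compact {x. infdist x K \<le> d}" by (rule compact_infdist_le[OF ne K(1) d(1)])
  have [measurable]: "H \<in> sets borel" using cH by (simp add: compact_imp_closed)
  obtain J :: "'a \<Rightarrow> real" and gJ where J: "\<And>n. C_k n J" "is_grad J gJ" "continuous_on UNIV gJ"
    "\<And>z. 0 \<le> J z" "\<And>z. d / 2 \<le> norm z \<Longrightarrow> J z = 0" "\<And>z. d / 2 < norm z \<Longrightarrow> gJ z = 0"
    "integrable lborel J" "(LINT z|lborel. J z) = 1" using mollifier_exists[of "d / 2"] d(1) by (metis half_gt_zero)
  have iH: "integrable lborel (indicator H :: 'a \<Rightarrow> real)"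
    using emeasure_bounded_finite[OF compact_imp_bounded[OF cH]] by (intro integrable_real_indicator) auto
  have [measurable]: "J \<in> borel_measurable borel" using C_k_continuous[OF J(1)] by (rule borel_measurable_continuous_onI)
  define \<phi> where "\<phi> x = (LINT y|lborel. indicator H y * J (x - y))" for x
  have Ck: "C_k m \<phi>" for m
    unfolding \<phi>_def[abs_def] by (rule C_k_average[OF J(1), of "cball 0 (d / 2)"]) (use J(5) iH in auto)
  define g where "g = (\<lambda>z. \<Sum>b\<in>Basis. frechet_derivative \<phi> (at z) b *\<^sub>R b)"
  show ?thesis
  proof (rule that[of \<phi> g])
    show "c1_test \<Omega> \<phi> g"
      unfolding c1_test_def
    proof (intro conjI exI[of _ "{x. infdist x K \<le> d}"] allI impI cd d(2))
      show "is_grad \<phi> g" "continuous_on UNIV g" unfolding g_def by (rule C_k_grad[OF Ck])+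
      fix x assume x: "x \<notin> {x. infdist x K \<le> d}"
      have "(\<lambda>y. indicator H y * J (x - y)) = (\<lambda>y. 0)"
      proof
        fix y
        show "indicator H y * J (x - y) = 0"
        proof (cases "y \<in> H")
          case True
          have "infdist x K \<le> infdist y K + dist x y" by (rule infdist_triangle)
          then have "d / 2 \<le> norm (x - y)" using x True by (simp add: H_def dist_norm)
          then show ?thesis using J(5) by simp
        qed simp
      qed
      then show "\<phi> x = 0" by (simp only: \<phi>_def) simp
    qed
    show "0 \<le> \<phi> z" for z unfolding \<phi>_def by (intro integral_nonneg_AE) (use J(4) in auto)
    show "\<phi> z = 1" if z: "z \<in> K" for z
    proof -
      have "(\<lambda>y. indicator H y * J (z - y)) = (\<lambda>y. J (z - y))"
      proof
        fix y
        show "indicator H y * J (z - y) = J (z - y)"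
        proof (cases "norm (z - y) < d / 2")
          case True
          then have "y \<in> H" using infdist_le[OF z, of y] by (simp add: H_def dist_norm norm_minus_commute)
          then show ?thesis by simp
        qed (use J(5) in simp)
      qed
      then have "\<phi> z = (LINT y|lborel. J (z - y))" by (simp only: \<phi>_def)
      then show ?thesis using lborel_integral_reflect[of J z] J(8) by simp
    qed
  qed
qed

definition slab :: "real \<Rightarrow> real \<Rightarrow> (real \<times> (real ^ 2)) set" where
  "slab \<tau> T = {z. \<tau> < fst z \<and> fst z < T}"

lemma open_slab: "open (slab \<tau> T)"
  unfolding slab_def by (intro open_Collect_conj open_Collect_less continuous_intros)

lemma bounded_on_interval:
  fixes h :: "real \<Rightarrow> real"
  assumes "continuous_on UNIV h"
  obtains B where "0 \<le> B" "\<And>w. \<bar>w\<bar> \<le> M \<Longrightarrow> \<bar>h w\<bar> \<le> B"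
proof -
  have "compact (h ` {-M..M})" by (intro compact_continuous_image continuous_on_subset[OF assms]) auto
  then obtain B where B: "\<forall>y\<in>h ` {-M..M}. norm y \<le> B" using compact_imp_bounded bounded_iff by metis
  show ?thesis
  proof (rule that[of "max B 0"])
    fix w assume "\<bar>w\<bar> \<le> M"
    then have "w \<in> {-M..M}" by (simp add: abs_le_iff minus_le_iff)
    then show "\<bar>h w\<bar> \<le> max B 0" using B by (force simp: le_max_iff_disj)
  qed simp
qed

lemma vector_combination_derivative:
  assumes "(a has_real_derivative a') (at w)" "(b has_real_derivative b') (at w)" "(c has_real_derivative c') (at w)"
  shows "((\<lambda>w. a w *\<^sub>R x + b w *\<^sub>R y + c w *\<^sub>R z) has_vector_derivative a' *\<^sub>R x + b' *\<^sub>R y + c' *\<^sub>R z) (at w)"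
proof -
  have s: "((\<lambda>w. a w *\<^sub>R x) has_vector_derivative a' *\<^sub>R x) (at w)"
    if "(a has_real_derivative a') (at w)" for a a' and x :: 'a
    using has_vector_derivative_scaleR[OF that has_vector_derivative_const[of x]] by simp
  show ?thesis by (intro has_vector_derivative_add s assms)
qed

text \<open>Split at \<open>\<bar>W z\<bar> = e\<close>: above it, five of the six powers are at
  least \<open>e ^ 5\<close>. Keeping \<open>e\<close> free lets the first term be made small before
  the sixth power is.\<close>

lemma L1_cauchy_of_sixth_power:
  fixes W :: "'a::euclidean_space \<Rightarrow> real"
  assumes \<phi>: "integrable lborel \<phi>" "\<And>z. 0 \<le> \<phi> z" and [measurable]: "W \<in> borel_measurable borel"
    and W: "\<And>z. \<bar>W z\<bar> \<le> B" and e: "0 < e"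
  shows "(LINT z|lborel. \<phi> z * \<bar>W z\<bar>) \<le> e * (LINT z|lborel. \<phi> z) + (LINT z|lborel. \<phi> z * \<bar>W z\<bar> ^ 6) / e ^ 5"
proof -
  have i: "integrable lborel (\<lambda>z. \<phi> z * \<bar>W z\<bar> ^ k)" for k
    by (rule integrable_mult_bounded(1)[OF \<phi>(1), of _ "B ^ k"]) (use W in \<open>auto intro!: power_mono\<close>)
  have "(LINT z|lborel. \<phi> z * \<bar>W z\<bar>) \<le> (LINT z|lborel. e * \<phi> z + \<phi> z * \<bar>W z\<bar> ^ 6 / e ^ 5)"
  proof (rule integral_mono)
    fix z
    have "\<bar>W z\<bar> \<le> e + \<bar>W z\<bar> ^ 6 / e ^ 5"
    proof (cases "\<bar>W z\<bar> \<le> e")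
      case False
      then have "e ^ 5 \<le> \<bar>W z\<bar> ^ 5" using e by (intro power_mono) auto
      then have "\<bar>W z\<bar> * e ^ 5 \<le> \<bar>W z\<bar> * \<bar>W z\<bar> ^ 5" by (rule mult_left_mono) simp
      then have "\<bar>W z\<bar> * e ^ 5 \<le> \<bar>W z\<bar> ^ 6" by (simp add: power_Suc[symmetric])
      then have "\<bar>W z\<bar> \<le> \<bar>W z\<bar> ^ 6 / e ^ 5" using e by (simp add: pos_le_divide_eq)
      then show ?thesis using e by simp
    qed (use e in \<open>auto intro: add_increasing2\<close>)
    from mult_left_mono[OF this \<phi>(2)[of z]]
    show "\<phi> z * \<bar>W z\<bar> \<le> e * \<phi> z + \<phi> z * \<bar>W z\<bar> ^ 6 / e ^ 5" by (simp add: algebra_simps)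
  qed (use i[of 1] i[of 6] \<phi>(1) in auto)
  then show ?thesis using i[of 6] \<phi>(1) by simp
qed

text \<open>Tartar's choice of entropy: the flux in the direction orthogonal to \<open>\<xi>\<close>.\<close>

lemma burgers_compensated_estimate:
  fixes \<xi> :: "real ^ 2"
  assumes \<xi>: "norm \<xi> = 1" and M: "0 < M" and \<phi>: "c1_test (slab \<tau> T) \<phi> g\<phi>" "\<And>z. 0 \<le> \<phi> z"
  defines "et \<equiv> (1, 0)" and "ey \<equiv> (0, rot \<xi>)" and "es \<equiv> (0, \<xi>)" and "F \<equiv> \<lambda>w. flux w \<bullet> rot \<xi>"
  obtains C c \<rho> where "0 \<le> C \<and> 0 < c \<and> 0 < \<rho>" "\<forall>U V d h \<omega>. bounded_sol spacetime_flux (slab \<tau> T) M U \<longrightarrow>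
    bounded_sol spacetime_flux (slab \<tau> T) M V \<longrightarrow> 0 < d \<longrightarrow> d \<le> \<rho> \<longrightarrow> 0 < h \<longrightarrow>
    (\<forall>r. 0 \<le> r \<longrightarrow> r \<le> h \<longrightarrow> (LINT z|lborel. \<bar>U (z - r *\<^sub>R es) - U z\<bar>) \<le> \<omega>) \<longrightarrow>
    (\<forall>r. 0 \<le> r \<longrightarrow> r \<le> h \<longrightarrow> (LINT z|lborel. \<bar>V (z - r *\<^sub>R es) - V z\<bar>) \<le> \<omega>) \<longrightarrow>
    c * (LINT z|lborel. \<phi> z * \<bar>U z - V z\<bar> ^ 6) \<le>
      C * (d + d / h + \<omega>) + C * (LINT z|lborel. \<phi> z * (\<bar>box_mean d h et ey es (\<lambda>z. U z - V z) z\<bar> +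
        \<bar>box_mean d h et ey es (\<lambda>z. F (U z) - F (V z)) z\<bar>))"
proof -
  define n where "n = rot \<xi>"
  define p where "p = n $ 1"
  define r where "r = n $ 2"
  define L where "L = 1 + M + M ^ 2"
  have L: "1 \<le> L" using M by (simp add: L_def)
  have n1: "norm n = 1" unfolding n_def by (rule frame_decomposition(2)[OF \<xi>])
  then have pr: "p\<^sup>2 + r\<^sup>2 = 1" by (simp add: p_def r_def norm_eq_1 inner_vec_def sum_2 power2_eq_square)
  have F: "F = (\<lambda>w. p * w ^ 2 / 2 + r * w ^ 3 / 3)"
    by (simp add: F_def n_def[symmetric] flux_eq p_def r_def fun_eq_iff inner_axis inner_add_left inner_axis' mult.commute)
  define G where "G w = \<xi> $ 1 * w ^ 2 / 2 + \<xi> $ 2 * w ^ 3 / 3" for w :: real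
  have G: "G w = flux w \<bullet> \<xi>" for w
    by (simp add: G_def flux_eq inner_add_left inner_axis' mult.commute)
  \<comment> \<open>The flux of the entropy \<open>F\<close> along the normal, a primitive of
    \<open>f w * f w\<close>; \<open>R\<close> below is its flux along \<xi>, a primitive of
    \<open>f w * g w\<close>, where \<open>g\<close> is the derivative of \<open>G\<close>.\<close>
  define q where "q w = p\<^sup>2 * w ^ 3 / 3 + p * r * w ^ 4 / 2 + r\<^sup>2 * w ^ 5 / 5" for w :: real
  define R where "R w = p * \<xi> $ 1 * w ^ 3 / 3 + (p * \<xi> $ 2 + r * \<xi> $ 1) * w ^ 4 / 4 + r * \<xi> $ 2 * w ^ 5 / 5" for w :: real
  define f where "f w = p * w + r * w\<^sup>2" for w :: real
  define g where "g w = \<xi> $ 1 * w + \<xi> $ 2 * w\<^sup>2" for w :: real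
  define f' where "f' w = p + r * (2 * w)" for w :: real
  define Y where "Y w = F w *\<^sub>R et + q w *\<^sub>R ey + R w *\<^sub>R es" for w
  define X' where "X' w = 1 *\<^sub>R et + f w *\<^sub>R ey + g w *\<^sub>R es" for w
  have X: "spacetime_flux w = w *\<^sub>R et + F w *\<^sub>R ey + G w *\<^sub>R es" for w
    using frame_decomposition(1)[OF \<xi>, of "flux w"] by (simp add: spacetime_flux_def et_def ey_def es_def F_def G)
  have dF: "(F has_real_derivative f w) (at w)" for w
    unfolding F f_def by (auto intro!: derivative_eq_intros simp: power2_eq_square)
  have dX: "(spacetime_flux has_vector_derivative X' w) (at w)" for w
    unfolding X[abs_def] X'_def
    by (intro vector_combination_derivative dF) (auto simp: G_def[abs_def] g_def intro!: derivative_eq_intros)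
  have df: "(f has_real_derivative f' w) (at w)" for w
    unfolding f_def[abs_def] f'_def by (auto intro!: derivative_eq_intros)
  have cf': "continuous_on UNIV f'" unfolding f'_def[abs_def] by (intro continuous_intros)
  have dY: "(Y has_vector_derivative f w *\<^sub>R X' w) (at w)" for w
  proof -
    have "(Y has_vector_derivative f w *\<^sub>R et + (f w * f w) *\<^sub>R ey + (f w * g w) *\<^sub>R es) (at w)"
      unfolding Y_def[abs_def]
      by (intro vector_combination_derivative dF)
        (auto simp: q_def[abs_def] R_def[abs_def] f_def g_def power2_eq_square power3_eq_cube power4_eq_xxxx algebra_simps intro!: derivative_eq_intros)
    then show ?thesis by (simp add: X'_def scaleR_add_right)
  qed
  have cont: "continuous_on UNIV F" "continuous_on UNIV G" "continuous_on UNIV q" "continuous_on UNIV R"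
    unfolding F G_def[abs_def] q_def[abs_def] R_def[abs_def] by (intro continuous_intros; simp)+
  note [measurable] = cont[THEN borel_measurable_continuous_onI]
  obtain B1 B2 B3 B4 where B: "0 \<le> B1" "0 \<le> B2" "0 \<le> B3" "0 \<le> B4" "\<And>w. \<bar>w\<bar> \<le> M \<Longrightarrow> \<bar>F w\<bar> \<le> B1" "\<And>w. \<bar>w\<bar> \<le> M \<Longrightarrow> \<bar>G w\<bar> \<le> B2"
    "\<And>w. \<bar>w\<bar> \<le> M \<Longrightarrow> \<bar>q w\<bar> \<le> B3" "\<And>w. \<bar>w\<bar> \<le> M \<Longrightarrow> \<bar>R w\<bar> \<le> B4"
    using bounded_on_interval[OF cont(1), of M] bounded_on_interval[OF cont(2), of M]
      bounded_on_interval[OF cont(3), of M] bounded_on_interval[OF cont(4), of M] by metis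
  define N where "N = 2 * (M + B1 + B2 + B3 + B4)"
  have N: "2 * \<bar>w\<bar> \<le> N \<and> 2 * \<bar>F w\<bar> \<le> N \<and> 2 * \<bar>G w\<bar> \<le> N \<and> 2 * \<bar>q w\<bar> \<le> N \<and> 2 * \<bar>R w\<bar> \<le> N" if "\<bar>w\<bar> \<le> M" for w
    using that B(1-4) B(5-8)[OF that] M unfolding N_def by simp
  have lip: "\<bar>F v - F w\<bar> \<le> L * \<bar>v - w\<bar>" "\<bar>G v - G w\<bar> \<le> L * \<bar>v - w\<bar>" if "\<bar>v\<bar> \<le> M" "\<bar>w\<bar> \<le> M" for v w
  proof -
    have "norm (flux v - flux w) \<le> norm (spacetime_flux v - spacetime_flux w)"
      using norm_snd_le[of "flux v - flux w" "v - w"] by (simp add: spacetime_flux_def)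
    also have "\<dots> \<le> L * \<bar>v - w\<bar>" unfolding L_def by (rule spacetime_flux_lipschitz[OF that])
    finally have *: "\<bar>(flux v - flux w) \<bullet> x\<bar> \<le> L * \<bar>v - w\<bar>" if "norm x = 1" for x
      using that Cauchy_Schwarz_ineq2[of "flux v - flux w" x] by simp
    show "\<bar>F v - F w\<bar> \<le> L * \<bar>v - w\<bar>" "\<bar>G v - G w\<bar> \<le> L * \<bar>v - w\<bar>"
      using *[OF n1] *[OF \<xi>] by (simp_all add: F_def G n_def inner_diff_left)
  qed
  have FL: "\<bar>F w\<bar> \<le> L * \<bar>w\<bar> \<and> \<bar>G w\<bar> \<le> L * \<bar>w\<bar>" if "\<bar>w\<bar> \<le> M" for w
    using lip[of w 0] that M by (simp add: F G_def)
  obtain c where c: "0 < c" "\<And>u v. \<bar>u\<bar> \<le> M \<Longrightarrow> \<bar>v\<bar> \<le> M \<Longrightarrow> c * \<bar>u - v\<bar> ^ 6 \<le> (u - v) * (q u - q v) - (F u - F v)\<^sup>2"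
    using tartar_lower_bound[OF pr M] unfolding q_def F by metis
  obtain K where K: "compact K" "K \<subseteq> slab \<tau> T" "\<And>z. z \<notin> K \<Longrightarrow> \<phi> z = 0" using \<phi>(1) unfolding c1_test_def by blast
  \<comment> \<open>Downwards the room is \<open>2 * \<rho>\<close>: one \<rho> for the displacement
    backwards in time and one for the ball around the displaced point. Displacements in space never
    leave the slab.\<close>
  have "\<exists>\<rho>>0. \<forall>z\<in>K. \<tau> + 2 * \<rho> < fst z \<and> fst z + \<rho> < T"
  proof (cases "K = {}")
    case True then show ?thesis by (intro exI[of _ 1]) auto
  next
    case False
    obtain e where e: "0 < e" "{x. infdist x K \<le> e} \<subseteq> slab \<tau> T"
      using compact_in_open_separated[OF False K(1) open_slab K(2)] by blast
    have "\<tau> + 2 * (e / 2) < fst z \<and> fst z + e / 2 < T" if z: "z \<in> K" for z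
    proof -
      have "z + s *\<^sub>R et \<in> slab \<tau> T" if "\<bar>s\<bar> \<le> e" for s
        using e(2) infdist_le[OF z, of "z + s *\<^sub>R et"] that by (force simp: et_def dist_norm norm_Pair)
      from this[of "- e"] this[of e] show ?thesis using e(1) by (auto simp: slab_def et_def)
    qed
    then show ?thesis using e(1) by (intro exI[of _ "e / 2"]) auto
  qed
  then obtain \<rho> where \<rho>: "0 < \<rho>" "\<And>z. z \<in> K \<Longrightarrow> \<tau> + 2 * \<rho> < fst z \<and> fst z + \<rho> < T" by blast
  have cb: "cball (z - s *\<^sub>R et - a *\<^sub>R ey - b *\<^sub>R es) \<rho> \<subseteq> slab \<tau> T" if "\<phi> z \<noteq> 0" "0 \<le> s" "s \<le> \<rho>" for z s a b
  proof
    fix y assume y: "y \<in> cball (z - s *\<^sub>R et - a *\<^sub>R ey - b *\<^sub>R es) \<rho>"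
    have "\<bar>fst (z - s *\<^sub>R et - a *\<^sub>R ey - b *\<^sub>R es) - fst y\<bar> \<le> \<rho>"
      using y dist_fst_le[of "z - s *\<^sub>R et - a *\<^sub>R ey - b *\<^sub>R es" y] by (simp add: dist_real_def)
    then have "\<bar>(fst z - s) - fst y\<bar> \<le> \<rho>" by (simp add: et_def ey_def es_def)
    moreover have "z \<in> K" using K(3)[of z] that(1) by blast
    ultimately show "y \<in> slab \<tau> T" using \<rho>(2)[of z] that(2,3) by (auto simp: slab_def abs_le_iff)
  qed
  obtain C where C: "0 \<le> C" "\<And>U V d h \<omega>. bounded_sol spacetime_flux (slab \<tau> T) M U \<Longrightarrow> bounded_sol spacetime_flux (slab \<tau> T) M V \<Longrightarrow> 0 < d \<Longrightarrow> d \<le> \<rho> \<Longrightarrow> 0 < h \<Longrightarrow>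
    (\<And>r. 0 \<le> r \<Longrightarrow> r \<le> h \<Longrightarrow> (LINT z|lborel. \<bar>(U (z - r *\<^sub>R es) - V (z - r *\<^sub>R es)) - (U z - V z)\<bar>) \<le> \<omega>) \<Longrightarrow>
    (\<And>r. 0 \<le> r \<Longrightarrow> r \<le> h \<Longrightarrow> (LINT z|lborel. \<bar>(F (U (z - r *\<^sub>R es)) - F (V (z - r *\<^sub>R es))) - (F (U z) - F (V z))\<bar>) \<le> \<omega>) \<Longrightarrow>
    (LINT z|lborel. \<phi> z * ((U z - V z) * (q (U z) - q (V z)) - (F (U z) - F (V z))\<^sup>2)) \<le>
      C * (d + d / h + \<omega>) + C * (LINT z|lborel. \<phi> z * (\<bar>box_mean d h et ey es (\<lambda>z. U z - V z) z\<bar> +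
        \<bar>box_mean d h et ey es (\<lambda>z. F (U z) - F (V z)) z\<bar>))"
    by (rule compensated_estimate[OF X Y_def dX df cf' dY _ _ _ _ N FL _ \<phi> \<rho>(1) cb]) (use M that in auto)
  have i\<phi>: "integrable lborel \<phi>"
    using \<phi>(1) by (rule c1_testE) (rule integrable_compact_support)
  show ?thesis
  \<comment> \<open>The moduli of the differences of \<open>U\<close> and of \<open>F U\<close> are
    both at most \<open>2 * L * \<omega>\<close>, with a Lipschitz constant \<open>L\<close> on
    [-M, M] that is at least 1.\<close>
  proof (rule that[of "2 * L * C" c \<rho>], use L C c \<rho> in simp, intro allI impI)
    fix U V d h \<omega>
    assume U: "bounded_sol spacetime_flux (slab \<tau> T) M U" and V: "bounded_sol spacetime_flux (slab \<tau> T) M V"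
      and d: "0 < d" "d \<le> \<rho>" and h: "0 < h"
      and \<omega>U: "\<forall>r. 0 \<le> r \<longrightarrow> r \<le> h \<longrightarrow> (LINT z|lborel. \<bar>U (z - r *\<^sub>R es) - U z\<bar>) \<le> \<omega>"
      and \<omega>V: "\<forall>r. 0 \<le> r \<longrightarrow> r \<le> h \<longrightarrow> (LINT z|lborel. \<bar>V (z - r *\<^sub>R es) - V z\<bar>) \<le> \<omega>"
    note \<omega>U = \<omega>U[rule_format] and \<omega>V = \<omega>V[rule_format]
    have Um[measurable]: "U \<in> borel_measurable borel" "V \<in> borel_measurable borel" and Ub: "\<And>z. \<bar>U z\<bar> \<le> M" "\<And>z. \<bar>V z\<bar> \<le> M"
      and iU: "integrable lborel U" "integrable lborel V" using U V by (auto simp: bounded_sol_def)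
    define S where "S = (LINT z|lborel. \<phi> z * (\<bar>box_mean d h et ey es (\<lambda>z. U z - V z) z\<bar> +
        \<bar>box_mean d h et ey es (\<lambda>z. F (U z) - F (V z)) z\<bar>))"
    have S0: "0 \<le> S" unfolding S_def using \<phi>(2) by (intro integral_nonneg_AE) auto
    have sh: "integrable lborel (\<lambda>z. U (z - v))" "integrable lborel (\<lambda>z. V (z - v))" for v
      using iU lborel_integrable_shift[of U "- v"] lborel_integrable_shift[of V "- v"] by auto
    have both: "(LINT z|lborel. L * (\<bar>U (z - r *\<^sub>R es) - U z\<bar> + \<bar>V (z - r *\<^sub>R es) - V z\<bar>)) \<le> 2 * L * \<omega>" if "0 \<le> r" "r \<le> h" for r
    proof -
      have "(LINT z|lborel. L * (\<bar>U (z - r *\<^sub>R es) - U z\<bar> + \<bar>V (z - r *\<^sub>R es) - V z\<bar>)) =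
        L * ((LINT z|lborel. \<bar>U (z - r *\<^sub>R es) - U z\<bar>) + (LINT z|lborel. \<bar>V (z - r *\<^sub>R es) - V z\<bar>))"
        using sh iU by simp
      also have "\<dots> \<le> L * (\<omega> + \<omega>)" using L by (intro mult_left_mono add_mono \<omega>U \<omega>V that) auto
      finally show ?thesis by simp
    qed
    have ib: "integrable lborel (\<lambda>z. L * (\<bar>U (z - v) - U z\<bar> + \<bar>V (z - v) - V z\<bar>))" for v using sh iU by simp
    have "(LINT z|lborel. \<phi> z * ((U z - V z) * (q (U z) - q (V z)) - (F (U z) - F (V z))\<^sup>2)) \<le> C * (d + d / h + 2 * L * \<omega>) + C * S"
      unfolding S_def
    proof (rule C(2)[OF U V d h])
      fix r assume r: "0 \<le> r" "r \<le> h"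
      have "norm (LINT z|lborel. \<bar>(U (z - r *\<^sub>R es) - V (z - r *\<^sub>R es)) - (U z - V z)\<bar>) \<le>
        (LINT z|lborel. L * (\<bar>U (z - r *\<^sub>R es) - U z\<bar> + \<bar>V (z - r *\<^sub>R es) - V z\<bar>))"
      proof (rule norm_integral_le[OF ib])
        fix z
        have "\<bar>(U (z - r *\<^sub>R es) - V (z - r *\<^sub>R es)) - (U z - V z)\<bar> \<le> 1 * (\<bar>U (z - r *\<^sub>R es) - U z\<bar> + \<bar>V (z - r *\<^sub>R es) - V z\<bar>)"
          using abs_triangle_ineq4[of "U (z - r *\<^sub>R es) - U z" "V (z - r *\<^sub>R es) - V z"] by (simp add: algebra_simps)
        also have "\<dots> \<le> L * (\<bar>U (z - r *\<^sub>R es) - U z\<bar> + \<bar>V (z - r *\<^sub>R es) - V z\<bar>)" using L by (intro mult_right_mono) auto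
        finally show "norm \<bar>(U (z - r *\<^sub>R es) - V (z - r *\<^sub>R es)) - (U z - V z)\<bar> \<le> L * (\<bar>U (z - r *\<^sub>R es) - U z\<bar> + \<bar>V (z - r *\<^sub>R es) - V z\<bar>)" by simp
      qed
      then show "(LINT z|lborel. \<bar>(U (z - r *\<^sub>R es) - V (z - r *\<^sub>R es)) - (U z - V z)\<bar>) \<le> 2 * L * \<omega>" using both[OF r] by simp
      have "norm (LINT z|lborel. \<bar>(F (U (z - r *\<^sub>R es)) - F (V (z - r *\<^sub>R es))) - (F (U z) - F (V z))\<bar>) \<le>
        (LINT z|lborel. L * (\<bar>U (z - r *\<^sub>R es) - U z\<bar> + \<bar>V (z - r *\<^sub>R es) - V z\<bar>))"
      proof (rule norm_integral_le[OF ib])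
        fix z
        have "\<bar>(F (U (z - r *\<^sub>R es)) - F (V (z - r *\<^sub>R es))) - (F (U z) - F (V z))\<bar> \<le>
          \<bar>F (U (z - r *\<^sub>R es)) - F (U z)\<bar> + \<bar>F (V (z - r *\<^sub>R es)) - F (V z)\<bar>"
          using abs_triangle_ineq4[of "F (U (z - r *\<^sub>R es)) - F (U z)" "F (V (z - r *\<^sub>R es)) - F (V z)"] by (simp add: algebra_simps)
        also have "\<dots> \<le> L * \<bar>U (z - r *\<^sub>R es) - U z\<bar> + L * \<bar>V (z - r *\<^sub>R es) - V z\<bar>"
          by (intro add_mono lip(1) Ub)
        finally show "norm \<bar>(F (U (z - r *\<^sub>R es)) - F (V (z - r *\<^sub>R es))) - (F (U z) - F (V z))\<bar> \<le> L * (\<bar>U (z - r *\<^sub>R es) - U z\<bar> + \<bar>V (z - r *\<^sub>R es) - V z\<bar>)"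
          by (simp add: distrib_left)
      qed
      then show "(LINT z|lborel. \<bar>(F (U (z - r *\<^sub>R es)) - F (V (z - r *\<^sub>R es))) - (F (U z) - F (V z))\<bar>) \<le> 2 * L * \<omega>" using both[OF r] by simp
    qed
    moreover have "c * (LINT z|lborel. \<phi> z * \<bar>U z - V z\<bar> ^ 6) \<le> (LINT z|lborel. \<phi> z * ((U z - V z) * (q (U z) - q (V z)) - (F (U z) - F (V z))\<^sup>2))"
    proof -
      have b2: "\<bar>U z - V z\<bar> \<le> 2 * M" for z using Ub[of z] abs_triangle_ineq4[of "U z" "V z"] by linarith
      have "(LINT z|lborel. c * (\<phi> z * \<bar>U z - V z\<bar> ^ 6)) \<le> (LINT z|lborel. \<phi> z * ((U z - V z) * (q (U z) - q (V z)) - (F (U z) - F (V z))\<^sup>2))"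
      proof (rule integral_mono)
        have b6: "norm (\<bar>U z - V z\<bar> ^ 6) \<le> (2 * M) ^ 6" for z
          using power_mono[OF b2[of z] abs_ge_zero, of 6] by simp
        show "integrable lborel (\<lambda>z. c * (\<phi> z * \<bar>U z - V z\<bar> ^ 6))"
          by (intro Bochner_Integration.integrable_mult_right integrable_mult_bounded(1)[OF i\<phi>, of _ "(2 * M) ^ 6"])
            (use b6 in auto)
        have "\<bar>(U z - V z) * (q (U z) - q (V z)) - (F (U z) - F (V z))\<^sup>2\<bar> \<le> N * N + N * N" for z
        proof -
          have tri: "\<bar>x - y\<bar> \<le> N" if "2 * \<bar>x\<bar> \<le> N" "2 * \<bar>y\<bar> \<le> N" for x y :: real
            using that abs_triangle_ineq4[of x y] by linarith
          have "\<bar>U z - V z\<bar> \<le> N" "\<bar>q (U z) - q (V z)\<bar> \<le> N" "\<bar>F (U z) - F (V z)\<bar> \<le> N"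
            using N[OF Ub(1), of z] N[OF Ub(2), of z] by (auto intro!: tri)
          moreover from this have "0 \<le> N" by linarith
          ultimately have "\<bar>(U z - V z) * (q (U z) - q (V z))\<bar> \<le> N * N" "\<bar>(F (U z) - F (V z))\<^sup>2\<bar> \<le> N * N"
            unfolding power2_eq_square abs_mult by (intro mult_mono; simp)+
          then show ?thesis using abs_triangle_ineq4 order_trans add_mono by meson
        qed
        then show "integrable lborel (\<lambda>z. \<phi> z * ((U z - V z) * (q (U z) - q (V z)) - (F (U z) - F (V z))\<^sup>2))"
          by (intro integrable_mult_bounded(1)[OF i\<phi>, of _ "N * N + N * N"]) auto
        show "c * (\<phi> z * \<bar>U z - V z\<bar> ^ 6) \<le> \<phi> z * ((U z - V z) * (q (U z) - q (V z)) - (F (U z) - F (V z))\<^sup>2)" for z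
          using mult_left_mono[OF c(2)[OF Ub(1) Ub(2)] \<phi>(2)[of z], of z z] by (simp add: mult_ac)
      qed
      then show ?thesis by simp
    qed
    moreover have "C * (d + d / h + 2 * L * \<omega>) \<le> 2 * L * C * (d + d / h + \<omega>)"
    proof -
      have "d + d / h + 2 * L * \<omega> \<le> 2 * L * (d + d / h) + 2 * L * \<omega>"
        using mult_right_mono[of 1 "2 * L" "d + d / h"] L d h by simp
      from mult_left_mono[OF this C(1)] show ?thesis by (simp add: algebra_simps)
    qed
    moreover have "C * S \<le> 2 * L * C * S"
      using mult_right_mono[of 1 "2 * L" "C * S"] L C(1) S0 by (simp add: mult_ac)
    ultimately show "c * (LINT z|lborel. \<phi> z * \<bar>U z - V z\<bar> ^ 6) \<le>
      2 * L * C * (d + d / h + \<omega>) + 2 * L * C * (LINT z|lborel. \<phi> z * (\<bar>box_mean d h et ey es (\<lambda>z. U z - V z) z\<bar> +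
        \<bar>box_mean d h et ey es (\<lambda>z. F (U z) - F (V z)) z\<bar>))"
      unfolding S_def[symmetric] by linarith
  qed
qed

section \<open>Extraction of convergent subsequences\<close>

text \<open>From each stage on, the diagonal sequence is a subsequence of the one chosen there.
  Inheritance by subsequences and insensitivity to finitely many terms therefore give every property
  to it.\<close>

lemma diagonal_subsequence:
  fixes P :: "nat \<Rightarrow> (nat \<Rightarrow> nat) \<Rightarrow> bool"
  assumes ex: "\<And>n s. strict_mono (s :: nat \<Rightarrow> nat) \<Longrightarrow> \<exists>r :: nat \<Rightarrow> nat. strict_mono r \<and> P n (s \<circ> r)"
    and sub: "\<And>n s r. strict_mono (r :: nat \<Rightarrow> nat) \<Longrightarrow> P n s \<Longrightarrow> P n (s \<circ> r)"
    and tail: "\<And>n s k. P n (s \<circ> (+) k) \<Longrightarrow> P n s"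
  obtains s :: "nat \<Rightarrow> nat" where "strict_mono s" "\<And>n. P n s"
proof -
  interpret subseqs P using ex by unfold_locales blast
  show ?thesis
    by (rule that[OF subseq_diagseq tail[OF diagseq_holds[OF sub]]])
qed

lemma eventually_pairs_subseq:
  assumes "strict_mono (r :: nat \<Rightarrow> nat)" "\<exists>N. \<forall>m\<ge>N. \<forall>n\<ge>N. P (s m) (s n)"
  shows "\<exists>N. \<forall>m\<ge>N. \<forall>n\<ge>N. P ((s \<circ> r) m) ((s \<circ> r) n)"
proof -
  obtain N where "\<forall>m\<ge>N. \<forall>n\<ge>N. P (s m) (s n)" using assms(2) by blast
  then show ?thesis using seq_suble[OF assms(1)] by (intro exI[of _ N]) (auto intro: order_trans)
qed

lemma eventually_pairs_tail:
  assumes "\<exists>N. \<forall>m\<ge>N. \<forall>n\<ge>N. P ((s \<circ> (+) (k :: nat)) m) ((s \<circ> (+) k) n)"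
  shows "\<exists>N. \<forall>m\<ge>N. \<forall>n\<ge>N. P (s m) (s n)"
proof -
  obtain N where N: "\<forall>m\<ge>N. \<forall>n\<ge>N. P ((s \<circ> (+) k) m) ((s \<circ> (+) k) n)" using assms by blast
  have "P (s m) (s n)" if "m \<ge> N + k" "n \<ge> N + k" for m n
    using N[rule_format, of "m - k" "n - k"] that by simp
  then show ?thesis by blast
qed

text \<open>For fixed lengths the means are uniformly bounded and uniformly Lipschitz, so
  Arzela-Ascoli applies on the ball. The conclusion is phrased as a Cauchy property, the form in
  which pairs of solutions enter.\<close>

lemma box_mean_cauchy_subseq:
  fixes W :: "nat \<Rightarrow> real \<times> (real ^ 2) \<Rightarrow> real"
  assumes \<xi>: "norm \<xi> = 1" and d: "0 < d" "0 < h" and W: "\<And>k. W k \<in> borel_measurable borel" "\<And>k z. \<bar>W k z\<bar> \<le> C"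
  obtains r :: "nat \<Rightarrow> nat" where "strict_mono r" "\<And>e. 0 < e \<Longrightarrow> \<exists>N. \<forall>m\<ge>N. \<forall>n\<ge>N. \<forall>z\<in>cball 0 R.
    \<bar>box_mean d h (1, 0) (0, rot \<xi>) (0, \<xi>) (W (r m)) z - box_mean d h (1, 0) (0, rot \<xi>) (0, \<xi>) (W (r n)) z\<bar> < e"
proof -
  define B where "B k = box_mean d h (1, 0) (0, rot \<xi>) (0, \<xi>) (W k)" for k
  have C: "0 \<le> C" using W(2)[of 0 0] by linarith
  have b: "\<bar>B k z\<bar> \<le> C" for k z
    unfolding B_def box_mean_def by (intro av_box_bounded d W)
  define L where "L = 2 * C / d + 2 * C / d + 2 * C / h + 1"
  have L: "0 < L" using C d by (simp add: L_def add_nonneg_pos)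
  have lip: "\<bar>B k x - B k y\<bar> \<le> L * norm (x - y)" for k x y
  proof -
    define v where "v = snd (x - y)"
    define \<alpha> where "\<alpha> = fst (x - y)"
    have xy: "x = y + (\<alpha> *\<^sub>R (1, 0) + (v \<bullet> rot \<xi>) *\<^sub>R (0, rot \<xi>) + (v \<bullet> \<xi>) *\<^sub>R (0, \<xi>))"
      using frame_decomposition(1)[OF \<xi>, of v] by (simp add: prod_eq_iff v_def \<alpha>_def)
    have n: "\<bar>\<alpha>\<bar> \<le> norm (x - y)" "norm v \<le> norm (x - y)"
      using norm_fst_le[of "fst (x - y)" "snd (x - y)"] norm_snd_le[of "snd (x - y)" "fst (x - y)"]
      unfolding \<alpha>_def v_def prod.collapse by simp_all
    have n2: "\<bar>v \<bullet> rot \<xi>\<bar> \<le> norm (x - y)" "\<bar>v \<bullet> \<xi>\<bar> \<le> norm (x - y)"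
      using Cauchy_Schwarz_ineq2[of v "rot \<xi>"] Cauchy_Schwarz_ineq2[of v \<xi>] n(2) \<xi> frame_decomposition(2)[OF \<xi>] by auto
    have "\<bar>B k x - B k y\<bar> \<le> 2 * C / d * \<bar>\<alpha>\<bar> + 2 * C / d * \<bar>v \<bullet> rot \<xi>\<bar> + 2 * C / h * \<bar>v \<bullet> \<xi>\<bar>"
      using box_mean_lipschitz[OF d W(1) W(2), of "(1, 0)" "(0, rot \<xi>)" "(0, \<xi>)" k y \<alpha> "v \<bullet> rot \<xi>" "v \<bullet> \<xi>"]
      unfolding xy[symmetric] B_def .
    also have "\<dots> \<le> 2 * C / d * norm (x - y) + 2 * C / d * norm (x - y) + 2 * C / h * norm (x - y)"
      using C d n n2 by (intro add_mono mult_left_mono) auto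
    also have "\<dots> \<le> L * norm (x - y)" unfolding L_def by (simp only: distrib_right) simp
    finally show ?thesis .
  qed
  obtain g k where gk: "strict_mono (k :: nat \<Rightarrow> nat)"
    "\<And>e. 0 < e \<Longrightarrow> \<exists>N. \<forall>n x. n \<ge> N \<and> x \<in> cball 0 R \<longrightarrow> norm (B (k n) x - g x) < e"
  proof (rule Arzela_Ascoli[of "cball 0 R" B C])
    fix x :: "real \<times> (real ^ 2)" and e :: real assume e: "0 < e"
    have "norm (B n x - B n y) < e" if "norm (x - y) < e / L" for n y
    proof -
      have "L * norm (x - y) < e" using that L by (simp add: pos_less_divide_eq mult.commute)
      then show ?thesis using lip[of n x y] by simp
    qed
    then show "\<exists>d>0. \<forall>n y. y \<in> cball 0 R \<and> norm (x - y) < d \<longrightarrow> norm (B n x - B n y) < e"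
      using L e by (intro exI[of _ "e / L"]) auto
  qed (use b in auto)
  show ?thesis
  proof (rule that[OF gk(1)])
    fix e :: real assume "0 < e"
    then obtain N where N: "\<And>n x. n \<ge> N \<Longrightarrow> x \<in> cball 0 R \<Longrightarrow> norm (B (k n) x - g x) < e / 2" using gk(2)[of "e / 2"] by auto
    have "\<bar>B (k m) z - B (k n) z\<bar> < e" if "m \<ge> N" "n \<ge> N" "z \<in> cball 0 R" for m n z
      using N[OF that(1,3)] N[OF that(2,3)] unfolding real_norm_def by linarith
    then show "\<exists>N. \<forall>m\<ge>N. \<forall>n\<ge>N. \<forall>z\<in>cball 0 R.
    \<bar>box_mean d h (1, 0) (0, rot \<xi>) (0, \<xi>) (W (k m)) z - box_mean d h (1, 0) (0, rot \<xi>) (0, \<xi>) (W (k n)) z\<bar> < e"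
      unfolding B_def by blast
  qed
qed

text \<open>A diagonal sequence is Cauchy in the means of every scale \<open>j\<close>. For given
  \<open>e\<close> a scale is fixed at which all errors but the means are small, and the means
  become small as both indices grow; the cut-off and \<open>e\<close> need not be known when the
  sequence is chosen.\<close>

lemma slab_cauchy_subseq:
  fixes \<xi> :: "real ^ 2" and U :: "nat \<Rightarrow> real \<times> (real ^ 2) \<Rightarrow> real"
  assumes \<xi>: "norm \<xi> = 1" and M: "0 < M" and U: "\<And>k. bounded_sol spacetime_flux (slab \<tau> T) M (U k)"
    and mod: "\<And>e. 0 < e \<Longrightarrow> \<exists>h0>0. \<forall>k r. 0 \<le> r \<longrightarrow> r \<le> h0 \<longrightarrow> (LINT z|lborel. \<bar>U k (z - r *\<^sub>R (0, \<xi>)) - U k z\<bar>) \<le> e"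
  shows "\<exists>s :: nat \<Rightarrow> nat. strict_mono s \<and> (\<forall>\<phi> g e. c1_test (slab \<tau> T) \<phi> g \<longrightarrow> (\<forall>z. 0 \<le> \<phi> z) \<longrightarrow> 0 < e \<longrightarrow>
    (\<exists>N. \<forall>m\<ge>N. \<forall>n\<ge>N. (LINT z|lborel. \<phi> z * \<bar>U (s m) z - U (s n) z\<bar>) < e))"
proof -
  define F where "F w = flux w \<bullet> rot \<xi>" for w
  have cF: "continuous_on UNIV F"
    unfolding F_def[abs_def] flux_eq by (intro continuous_intros) auto
  have [measurable]: "F \<in> borel_measurable borel" by (rule borel_measurable_continuous_onI[OF cF])
  obtain B where B: "0 \<le> B" "\<And>w. \<bar>w\<bar> \<le> M \<Longrightarrow> \<bar>F w\<bar> \<le> B" by (rule bounded_on_interval[OF cF, of M]) (rule that)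
  have Um[measurable]: "U k \<in> borel_measurable borel" and Ub: "\<bar>U k z\<bar> \<le> M" for k z
    using U[of k] unfolding bounded_sol_def by blast+
  have FUb: "\<bar>F (U k z)\<bar> \<le> B" for k z by (rule B(2)[OF Ub])
  \<comment> \<open>The length along \<xi> at scale \<open>j\<close>; the other two directions use
    its square, so that \<open>d / h\<close> is \<open>h j\<close> and tends to 0 as well.\<close>
  define h where "h j = 1 / (real j + 1)" for j
  have h: "0 < h j" "0 < (h j)\<^sup>2" for j by (simp_all add: h_def)
  define m where "m j f = box_mean ((h j)\<^sup>2) (h j) (1, 0) (0, rot \<xi>) (0, \<xi>) f" for j and f :: "real \<times> (real ^ 2) \<Rightarrow> real"
  define Q where "Q j e k l \<longleftrightarrow> (\<forall>z\<in>cball 0 (real j). \<bar>m j (U k) z - m j (U l) z\<bar> < e \<and>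
     \<bar>m j (\<lambda>z. F (U k z)) z - m j (\<lambda>z. F (U l z)) z\<bar> < e)" for j k l :: nat and e
  obtain s :: "nat \<Rightarrow> nat" where s: "strict_mono s" "\<And>j. \<forall>e>0. \<exists>N. \<forall>k\<ge>N. \<forall>l\<ge>N. Q j e (s k) (s l)"
  proof (rule diagonal_subsequence[of "\<lambda>j s. \<forall>e>0. \<exists>N. \<forall>k\<ge>N. \<forall>l\<ge>N. Q j e (s k) (s l)"])
    fix j s assume "strict_mono (s :: nat \<Rightarrow> nat)"
    obtain r1 :: "nat \<Rightarrow> nat" where r1: "strict_mono r1" "\<And>e. 0 < e \<Longrightarrow> \<exists>N. \<forall>k\<ge>N. \<forall>l\<ge>N. \<forall>z\<in>cball 0 (real j).
        \<bar>m j (U (s (r1 k))) z - m j (U (s (r1 l))) z\<bar> < e"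
      by (rule box_mean_cauchy_subseq[OF \<xi> h(2)[of j] h(1)[of j], where W = "\<lambda>k. U (s k)" and C = M and R = "real j",
          folded m_def], rule Um, rule Ub, rule that)
    obtain r2 :: "nat \<Rightarrow> nat" where r2: "strict_mono r2" "\<And>e. 0 < e \<Longrightarrow> \<exists>N. \<forall>k\<ge>N. \<forall>l\<ge>N. \<forall>z\<in>cball 0 (real j).
        \<bar>m j (\<lambda>z. F (U (s (r1 (r2 k))) z)) z - m j (\<lambda>z. F (U (s (r1 (r2 l))) z)) z\<bar> < e"
      by (rule box_mean_cauchy_subseq[OF \<xi> h(2)[of j] h(1)[of j], where W = "\<lambda>k z. F (U (s (r1 k)) z)" and C = B and R = "real j",
          folded m_def], simp, rule FUb, rule that)
    have QN: "\<exists>N. \<forall>k\<ge>N. \<forall>l\<ge>N. Q j e (s (r1 (r2 k))) (s (r1 (r2 l)))" if e: "0 < e" for e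
    proof -
      obtain N1 where N1: "\<And>k l z. k \<ge> N1 \<Longrightarrow> l \<ge> N1 \<Longrightarrow> z\<in>cball 0 (real j) \<Longrightarrow> \<bar>m j (U (s (r1 k))) z - m j (U (s (r1 l))) z\<bar> < e"
        using r1(2)[OF e] by blast
      obtain N2 where N2: "\<And>k l z. k \<ge> N2 \<Longrightarrow> l \<ge> N2 \<Longrightarrow> z\<in>cball 0 (real j) \<Longrightarrow>
          \<bar>m j (\<lambda>z. F (U (s (r1 (r2 k))) z)) z - m j (\<lambda>z. F (U (s (r1 (r2 l))) z)) z\<bar> < e"
        using r2(2)[OF e] by blast
      have "Q j e (s (r1 (r2 k))) (s (r1 (r2 l)))" if "k \<ge> max N1 N2" "l \<ge> max N1 N2" for k l
        unfolding Q_def using that seq_suble[OF r2(1), of k] seq_suble[OF r2(1), of l] by (intro ballI conjI N1 N2) auto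
      then show ?thesis by blast
    qed
    show "\<exists>r :: nat \<Rightarrow> nat. strict_mono r \<and> (\<forall>e>0. \<exists>N. \<forall>k\<ge>N. \<forall>l\<ge>N. Q j e ((s \<circ> r) k) ((s \<circ> r) l))"
    proof (intro exI[of _ "r1 \<circ> r2"] conjI allI impI)
      show "strict_mono (r1 \<circ> r2)" by (rule strict_mono_o[OF r1(1) r2(1)])
    qed (simp only: o_apply QN)
  qed (rule that eventually_pairs_subseq eventually_pairs_tail | blast intro: eventually_pairs_subseq eventually_pairs_tail)+
  show ?thesis
  proof (intro exI[of _ s] conjI allI impI s(1))
    fix \<phi> :: "real \<times> (real ^ 2) \<Rightarrow> real" and g e
    assume \<phi>1: "c1_test (slab \<tau> T) \<phi> g" "\<forall>z. 0 \<le> \<phi> z" and e: "0 < (e :: real)"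
    then have \<phi>: "c1_test (slab \<tau> T) \<phi> g" "\<And>z. 0 \<le> \<phi> z" by auto
    obtain K where K: "compact K" "\<And>z. z \<notin> K \<Longrightarrow> \<phi> z = 0" and c\<phi>: "continuous_on UNIV \<phi>"
      using \<phi>(1) by (rule c1_testE) (rule that)
    have i\<phi>: "integrable lborel \<phi>" by (rule integrable_compact_support[OF c\<phi> K])
    define I where "I = (LINT z|lborel. \<phi> z)"
    have I: "0 \<le> I" unfolding I_def using \<phi>(2) by (intro integral_nonneg_AE) auto
    obtain C c \<rho> where C0: "0 \<le> C \<and> 0 < c \<and> 0 < \<rho>" and est: "\<forall>U V d h \<omega>. bounded_sol spacetime_flux (slab \<tau> T) M U \<longrightarrow>
    bounded_sol spacetime_flux (slab \<tau> T) M V \<longrightarrow> 0 < d \<longrightarrow> d \<le> \<rho> \<longrightarrow> 0 < h \<longrightarrow>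
    (\<forall>r. 0 \<le> r \<longrightarrow> r \<le> h \<longrightarrow> (LINT z|lborel. \<bar>U (z - r *\<^sub>R (0, \<xi>)) - U z\<bar>) \<le> \<omega>) \<longrightarrow>
    (\<forall>r. 0 \<le> r \<longrightarrow> r \<le> h \<longrightarrow> (LINT z|lborel. \<bar>V (z - r *\<^sub>R (0, \<xi>)) - V z\<bar>) \<le> \<omega>) \<longrightarrow>
    c * (LINT z|lborel. \<phi> z * \<bar>U z - V z\<bar> ^ 6) \<le>
      C * (d + d / h + \<omega>) + C * (LINT z|lborel. \<phi> z * (\<bar>box_mean d h (1, 0) (0, rot \<xi>) (0, \<xi>) (\<lambda>z. U z - V z) z\<bar> +
        \<bar>box_mean d h (1, 0) (0, rot \<xi>) (0, \<xi>) (\<lambda>z. F (U z) - F (V z)) z\<bar>))"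
      by (rule burgers_compensated_estimate[OF \<xi> M \<phi>, folded F_def]) (rule that)
    then have C: "0 \<le> C" "0 < c" "0 < \<rho>" by auto
    \<comment> \<open>The threshold of the splitting of \<open>\<bar>W\<bar>\<close>, so that its
      part \<open>e1 * I\<close> stays below \<open>e / 2\<close>. The sixth power then has to be at
      most \<eta>, since it is divided by \<open>e1 ^ 5\<close>.\<close>
    define e1 where "e1 = e / (2 * (I + 1))"
    have e1: "0 < e1" using e I by (simp add: e1_def)
    have e1I: "e1 * I < e / 2"
    proof -
      have "e1 * I < e1 * (I + 1)" using e1 by simp
      also have "\<dots> = e / 2" using I by (simp add: e1_def field_simps)
      finally show ?thesis .
    qed
    define \<eta> where "\<eta> = e1 ^ 5 * (e / 2)"
    have \<eta>: "0 < \<eta>" using e e1 by (simp add: \<eta>_def)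
    \<comment> \<open>A budget for three contributions, each multiplied by \<open>C\<close>: the
      modulus along \<xi>, the sum of \<open>d\<close> and \<open>d / h\<close>, and the integral of
      the means. Their total must not exceed \<open>c * \<eta>\<close>.\<close>
    define \<kappa> where "\<kappa> = c * \<eta> / (3 * C + 1)"
    have \<kappa>: "0 < \<kappa>" using C \<eta> by (simp add: \<kappa>_def)
    have \<kappa>2: "C * (2 * \<kappa>) + C * \<kappa> \<le> c * \<eta>"
    proof -
      have "(3 * C + 1) * \<kappa> = c * \<eta>" using C(1) by (simp add: \<kappa>_def)
      then show ?thesis using \<kappa> by (simp add: algebra_simps)
    qed
    obtain h0 where h0: "0 < h0" "\<And>k r. 0 \<le> r \<Longrightarrow> r \<le> h0 \<Longrightarrow> (LINT z|lborel. \<bar>U k (z - r *\<^sub>R (0, \<xi>)) - U k z\<bar>) \<le> \<kappa>"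
      using mod[OF \<kappa>] by blast
    obtain R where R: "\<And>z. z \<in> K \<Longrightarrow> norm z \<le> R" using compact_imp_bounded[OF K(1)] bounded_iff by blast
    have hlim: "h \<longlonglongrightarrow> 0" unfolding h_def[abs_def] using LIMSEQ_inverse_real_of_nat by (simp add: inverse_eq_divide add.commute)
    have "eventually (\<lambda>j. h j < h0 \<and> h j < 1 \<and> h j < \<rho> \<and> h j < \<kappa> / 2 \<and> R \<le> real j) sequentially"
      using h0(1) C(3) \<kappa> by (intro eventually_conj order_tendstoD(2)[OF hlim] eventually_ge_at_top  filterlim_at_top[THEN iffD1, rule_format, OF filterlim_real_sequentially]) auto
    then obtain j where j: "h j < h0" "h j < 1" "h j < \<rho>" "h j < \<kappa> / 2" "R \<le> real j"
      unfolding eventually_sequentially by blast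
    define d where "d = (h j)\<^sup>2"
    have d: "0 < d" "d \<le> h j" "d / h j = h j" using h[of j] j(2) by (auto simp: d_def power2_eq_square mult_le_cancel_left1)
    define \<epsilon> where "\<epsilon> = \<kappa> / (2 * (I + 1))"
    have \<epsilon>: "0 < \<epsilon>" "I * (2 * \<epsilon>) \<le> \<kappa>"
    proof -
      show \<epsilon>0: "0 < \<epsilon>" using \<kappa> I by (simp add: \<epsilon>_def)
      have "I * (2 * \<epsilon>) \<le> (I + 1) * (2 * \<epsilon>)" using \<epsilon>0 by simp
      also have "\<dots> = \<kappa>" using I by (simp add: \<epsilon>_def field_simps)
      finally show "I * (2 * \<epsilon>) \<le> \<kappa>" .
    qed
    obtain N where N: "\<And>k l. k \<ge> N \<Longrightarrow> l \<ge> N \<Longrightarrow> Q j \<epsilon> (s k) (s l)" using s(2)[of j] \<epsilon>(1) by blast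
    have "(LINT z|lborel. \<phi> z * \<bar>U (s k) z - U (s l) z\<bar>) < e" if kl: "k \<ge> N" "l \<ge> N" for k l
    proof -
      define X where "X = (LINT z|lborel. \<phi> z * \<bar>U (s k) z - U (s l) z\<bar> ^ 6)"
      have "c * X \<le> C * (d + d / h j + \<kappa>) + C * (LINT z|lborel. \<phi> z * (\<bar>m j (\<lambda>z. U (s k) z - U (s l) z) z\<bar> +
          \<bar>m j (\<lambda>z. F (U (s k) z) - F (U (s l) z)) z\<bar>))"
        unfolding X_def m_def d_def[symmetric] using j d
        by (intro est[rule_format] U d(1) h(1) h0(2)) auto
      also have "(LINT z|lborel. \<phi> z * (\<bar>m j (\<lambda>z. U (s k) z - U (s l) z) z\<bar> + \<bar>m j (\<lambda>z. F (U (s k) z) - F (U (s l) z)) z\<bar>)) \<le> \<kappa>"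
      proof -
        have "norm (LINT z|lborel. \<phi> z * (\<bar>m j (\<lambda>z. U (s k) z - U (s l) z) z\<bar> + \<bar>m j (\<lambda>z. F (U (s k) z) - F (U (s l) z)) z\<bar>))
          \<le> (LINT z|lborel. \<phi> z * (2 * \<epsilon>))"
        proof (rule norm_integral_le)
          show "integrable lborel (\<lambda>z. \<phi> z * (2 * \<epsilon>))" using i\<phi> by simp
          fix z
          have md: "m j (\<lambda>z. U (s k) z - U (s l) z) z = m j (U (s k)) z - m j (U (s l)) z"
            "m j (\<lambda>z. F (U (s k) z) - F (U (s l) z)) z = m j (\<lambda>z. F (U (s k) z)) z - m j (\<lambda>z. F (U (s l) z)) z"
            unfolding m_def by (subst box_mean_diff[OF h(2,1) _ Ub _ Ub] box_mean_diff[OF h(2,1) _ FUb _ FUb]; simp)+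
          show "norm (\<phi> z * (\<bar>m j (\<lambda>z. U (s k) z - U (s l) z) z\<bar> + \<bar>m j (\<lambda>z. F (U (s k) z) - F (U (s l) z)) z\<bar>)) \<le> \<phi> z * (2 * \<epsilon>)"
          proof (cases "z \<in> K")
            case True
            then have "z \<in> cball 0 (real j)" using R[OF True] j(5) by simp
            then have "\<bar>m j (U (s k)) z - m j (U (s l)) z\<bar> + \<bar>m j (\<lambda>z. F (U (s k) z)) z - m j (\<lambda>z. F (U (s l) z)) z\<bar> \<le> 2 * \<epsilon>"
              using N[OF kl] unfolding Q_def by fastforce
            then show ?thesis unfolding md using \<phi>(2)[of z] by (simp add: abs_mult mult_left_mono)
          qed (use K(2) in simp)
        qed
        also have "\<dots> = I * (2 * \<epsilon>)" by (simp add: I_def)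
        finally show ?thesis using \<epsilon>(2) by simp
      qed
      also have "d + d / h j + \<kappa> \<le> 2 * \<kappa>" using d j(4) by simp
      finally have "c * X \<le> C * (2 * \<kappa>) + C * \<kappa>" using C(1) by (simp add: mult_left_mono)
      then have "c * X \<le> c * \<eta>" using \<kappa>2 by linarith
      then have "X \<le> \<eta>" using C(2) by simp
      then have X: "X / e1 ^ 5 \<le> e / 2" using e1 by (simp add: \<eta>_def pos_divide_le_eq mult.commute)
      have "(LINT z|lborel. \<phi> z * \<bar>U (s k) z - U (s l) z\<bar>) \<le> e1 * I + X / e1 ^ 5"
        unfolding I_def X_def
      proof (rule L1_cauchy_of_sixth_power[OF i\<phi> \<phi>(2) _ _ e1])
        show "\<bar>U (s k) z - U (s l) z\<bar> \<le> 2 * M" for z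
          using Ub[of "s k" z] Ub[of "s l" z] abs_triangle_ineq4[of "U (s k) z" "U (s l) z"] by linarith
      qed simp
      then show ?thesis using X e1I by linarith
    qed
    then show "\<exists>N. \<forall>m\<ge>N. \<forall>n\<ge>N. (LINT z|lborel. \<phi> z * \<bar>U (s m) z - U (s n) z\<bar>) < e" by blast
  qed
qed

text \<open>A Cauchy sequence in the mean has a subsequence that is Cauchy almost everywhere. This
  is applied with cut-offs equal to 1 on the members of a compact exhaustion of the slab.\<close>

lemma slab_compactness:
  fixes \<xi> :: "real ^ 2" and U :: "nat \<Rightarrow> real \<times> (real ^ 2) \<Rightarrow> real"
  assumes \<xi>: "norm \<xi> = 1" and M: "0 < M" and U: "\<And>k. bounded_sol spacetime_flux (slab \<tau> T) M (U k)"
    and mod: "\<And>e. 0 < e \<Longrightarrow> \<exists>h0>0. \<forall>k r. 0 \<le> r \<longrightarrow> r \<le> h0 \<longrightarrow> (LINT z|lborel. \<bar>U k (z - r *\<^sub>R (0, \<xi>)) - U k z\<bar>) \<le> e"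
  obtains s :: "nat \<Rightarrow> nat" where "strict_mono s" "AE z in lborel. z \<in> slab \<tau> T \<longrightarrow> convergent (\<lambda>k. U (s k) z)"
proof -
  obtain s :: "nat \<Rightarrow> nat" where s: "strict_mono s" "\<And>\<phi> g e. c1_test (slab \<tau> T) \<phi> g \<Longrightarrow> (\<And>z. 0 \<le> \<phi> z) \<Longrightarrow> 0 < e \<Longrightarrow>
    \<exists>N. \<forall>m\<ge>N. \<forall>n\<ge>N. (LINT z|lborel. \<phi> z * \<bar>U (s m) z - U (s n) z\<bar>) < e"
    using slab_cauchy_subseq[OF \<xi> M U mod] by blast
  \<comment> \<open>For small \<open>i\<close> the time interval may be empty, which is harmless:
    every point of the slab lies in \<open>K i\<close> for large \<open>i\<close>.\<close>
  define K where "K i = {\<tau> + 1 / (real i + 1)..T - 1 / (real i + 1)} \<times> cball (0 :: real ^ 2) (real i)" for i :: nat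
  obtain r :: "nat \<Rightarrow> nat" where r: "strict_mono r" "\<And>i. AE z in lborel. z \<in> K i \<longrightarrow> convergent (\<lambda>k. U (s (r k)) z)"
  proof (rule diagonal_subsequence[of "\<lambda>i (r :: nat \<Rightarrow> nat). AE z in lborel. z \<in> K i \<longrightarrow> convergent (\<lambda>k. U (s (r k)) z)"])
    fix i r assume r: "strict_mono (r :: nat \<Rightarrow> nat)"
    have "compact (K i)" unfolding K_def by (intro compact_Times) auto
    moreover have "K i \<subseteq> slab \<tau> T"
    proof -
      define q where "q = 1 / (real i + 1)"
      have "0 < q" by (simp add: q_def)
      then show ?thesis by (auto simp: K_def slab_def q_def[symmetric])
    qed
    ultimately obtain \<phi> g where \<phi>: "c1_test (slab \<tau> T) \<phi> g" "\<And>z. 0 \<le> \<phi> z" "\<And>z. z \<in> K i \<Longrightarrow> \<phi> z = 1"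
      by (rule cutoff_exists[OF _ _ open_slab]) (rule that)
    have i\<phi>: "integrable lborel \<phi>"
      using \<phi>(1) by (rule c1_testE) (rule integrable_compact_support)
    obtain r' :: "nat \<Rightarrow> nat" where r': "strict_mono r'" "AE z in lborel. Cauchy (\<lambda>k. \<phi> z * U (s (r (r' k))) z)"
    proof (rule cauchy_L1_AE_cauchy_subseq[of lborel "\<lambda>k z. \<phi> z * U (s (r k)) z"])
      show "integrable lborel (\<lambda>z. \<phi> z * U (s (r k)) z)" for k
        using U[of "s (r k)"] by (intro integrable_mult_bounded(1)[OF i\<phi>, of _ M]) (auto simp: bounded_sol_def)
      fix e :: real assume "0 < e"
      then obtain N where N: "\<And>m n. m\<ge>N \<Longrightarrow> n\<ge>N \<Longrightarrow> (LINT z|lborel. \<phi> z * \<bar>U (s m) z - U (s n) z\<bar>) < e"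
        using s(2)[OF \<phi>(1,2)] by blast
      have eq: "norm (\<phi> z * a - \<phi> z * b) = \<phi> z * \<bar>a - b\<bar>" for z a b
        using \<phi>(2)[of z] by (simp add: right_diff_distrib[symmetric] abs_mult)
      have "(LINT z|lborel. norm (\<phi> z * U (s (r m)) z - \<phi> z * U (s (r n)) z)) < e" if "m \<ge> N" "n \<ge> N" for m n
        unfolding eq using that seq_suble[OF r, of m] seq_suble[OF r, of n] by (intro N) auto
      then show "\<exists>N. \<forall>m\<ge>N. \<forall>n\<ge>N. (LINT z|lborel. norm (\<phi> z * U (s (r m)) z - \<phi> z * U (s (r n)) z)) < e" by blast
    qed (rule that)
    have "AE z in lborel. z \<in> K i \<longrightarrow> convergent (\<lambda>k. U (s ((r \<circ> r') k)) z)"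
      using r'(2) by eventually_elim (auto simp: \<phi>(3) Cauchy_convergent_iff)
    then show "\<exists>r'. strict_mono r' \<and> (AE z in lborel. z \<in> K i \<longrightarrow> convergent (\<lambda>k. U (s ((r \<circ> r') k)) z))"
      using r'(1) by blast
  next
    fix i q r assume q: "strict_mono (q :: nat \<Rightarrow> nat)" and r: "AE z in lborel. z \<in> K i \<longrightarrow> convergent (\<lambda>k. U (s (r k)) z)"
    from r show "AE z in lborel. z \<in> K i \<longrightarrow> convergent (\<lambda>k. U (s ((r \<circ> q) k)) z)"
      by eventually_elim (use convergent_subseq_convergent[OF _ q] in \<open>auto simp: o_def\<close>)
  next
    fix i r and k :: nat assume r: "AE z in lborel. z \<in> K i \<longrightarrow> convergent (\<lambda>n. U (s ((r \<circ> (+) k) n)) z)"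
    from r show "AE z in lborel. z \<in> K i \<longrightarrow> convergent (\<lambda>k. U (s (r k)) z)"
      by eventually_elim (auto simp: convergent_def add.commute[of k] dest: LIMSEQ_offset)
  qed (rule that)
  show ?thesis
  proof (rule that[OF strict_mono_o[OF s(1) r(1)]])
    have "AE z in lborel. \<forall>i. z \<in> K i \<longrightarrow> convergent (\<lambda>k. U (s (r k)) z)"
      unfolding AE_all_countable using r(2) by blast
    then show "AE z in lborel. z \<in> slab \<tau> T \<longrightarrow> convergent (\<lambda>k. U ((s \<circ> r) k) z)"
    proof eventually_elim
      case (elim z)
      show ?case
      proof
        assume z: "z \<in> slab \<tau> T"
        have hlim: "(\<lambda>i. 1 / (real i + 1)) \<longlonglongrightarrow> 0" using LIMSEQ_inverse_real_of_nat by (simp add: inverse_eq_divide add.commute)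
        have "eventually (\<lambda>i. 1 / (real i + 1) < fst z - \<tau> \<and> 1 / (real i + 1) < T - fst z \<and> norm (snd z) \<le> real i) sequentially"
          using z by (intro eventually_conj order_tendstoD(2)[OF hlim] filterlim_at_top[THEN iffD1, rule_format, OF filterlim_real_sequentially]) (auto simp: slab_def)
        then obtain i where "1 / (real i + 1) < fst z - \<tau>" "1 / (real i + 1) < T - fst z" "norm (snd z) \<le> real i"
          unfolding eventually_sequentially by blast
        then have "z \<in> K i" by (auto simp: K_def mem_Times_iff)
        then show "convergent (\<lambda>k. U ((s \<circ> r) k) z)" using elim by (auto simp: o_def)
      qed
    qed
  qed
qed

section \<open>Uniform bounds on time slabs and global extraction\<close>

text \<open>This direction of Fubini for null sets requires the set to be Borel in
  space-time.\<close>

lemma AE_lborel_slices: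
  fixes P :: "'a::euclidean_space \<times> 'b::euclidean_space \<Rightarrow> bool"
  assumes "{z. P z} \<in> sets borel" "AE t in lborel. AE x in lborel. P (t, x)"
  shows "AE z in lborel. P z"
  using lborel_pair.AE_pair_measure[of P] assms unfolding lborel_prod by simp

text \<open>The family \<open>f\<close> consists of slices without joint measurability, so Tonelli
  is applied to \<open>U\<close> and the comparison is made slice by slice.\<close>

lemma slab_integral_bound:
  fixes U :: "real \<times> (real ^ 2) \<Rightarrow> real"
  assumes [measurable]: "U \<in> borel_measurable borel" and z: "\<And>z. z \<notin> slab \<tau> T \<Longrightarrow> U z = 0"
    and le: "\<And>t x. \<tau> < t \<Longrightarrow> t < T \<Longrightarrow> \<bar>U (t, x)\<bar> \<le> \<bar>f t x\<bar>"
    and f: "\<And>t. \<tau> < t \<Longrightarrow> t < T \<Longrightarrow> integrable lborel (f t)" "\<And>t. \<tau> < t \<Longrightarrow> t < T \<Longrightarrow> L1_norm (f t) \<le> B"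
    and T: "\<tau> \<le> T" "0 \<le> B"
  shows "integrable lborel U" "(LINT z|lborel. \<bar>U z\<bar>) \<le> (T - \<tau>) * B"
proof -
  have [measurable]: "U \<in> borel_measurable (lborel \<Otimes>\<^sub>M lborel)" unfolding lborel_prod by simp
  have "(\<integral>\<^sup>+z. ennreal \<bar>U z\<bar> \<partial>lborel) = (\<integral>\<^sup>+t. \<integral>\<^sup>+x. ennreal \<bar>U (t, x)\<bar> \<partial>lborel \<partial>lborel)"
    unfolding lborel_prod[symmetric] by (rule lborel.nn_integral_fst[symmetric]) measurable
  also have "\<dots> \<le> (\<integral>\<^sup>+t. ennreal B * indicator {\<tau><..<T} t \<partial>lborel)"
  proof (rule nn_integral_mono)
    fix t
    show "(\<integral>\<^sup>+x. ennreal \<bar>U (t, x)\<bar> \<partial>lborel) \<le> ennreal B * indicator {\<tau><..<T} t"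
    proof (cases "\<tau> < t \<and> t < T")
      case True
      have "(\<integral>\<^sup>+x. ennreal \<bar>U (t, x)\<bar> \<partial>lborel) \<le> (\<integral>\<^sup>+x. ennreal \<bar>f t x\<bar> \<partial>lborel)"
        using le True by (intro nn_integral_mono ennreal_leI) auto
      also have "\<dots> = ennreal (L1_norm (f t))"
        unfolding L1_norm_def using f(1) True by (intro nn_integral_eq_integral) auto
      finally show ?thesis using f(2)[of t] True by (auto intro: order_trans ennreal_leI)
    next
      case False
      then have "U (t, x) = 0" for x by (intro z) (auto simp: slab_def)
      then show ?thesis by simp
    qed
  qed
  also have "\<dots> = ennreal B * emeasure lborel {\<tau><..<T}" by (rule nn_integral_cmult_indicator) simp
  also have "\<dots> = ennreal ((T - \<tau>) * B)" using T by (simp add: ennreal_mult' mult.commute)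
  finally have le: "(\<integral>\<^sup>+z. ennreal \<bar>U z\<bar> \<partial>lborel) \<le> ennreal ((T - \<tau>) * B)" .
  then have "(\<integral>\<^sup>+z. ennreal (norm (U z)) \<partial>lborel) < \<infinity>" by (simp add: order_le_less_trans)
  then show i: "integrable lborel U" by (intro integrableI_bounded) auto
  have "ennreal (LINT z|lborel. \<bar>U z\<bar>) = (\<integral>\<^sup>+z. ennreal \<bar>U z\<bar> \<partial>lborel)"
    using i by (intro nn_integral_eq_integral[symmetric]) auto
  then have "ennreal (LINT z|lborel. \<bar>U z\<bar>) \<le> ennreal ((T - \<tau>) * B)" using le by simp
  moreover have "0 \<le> (T - \<tau>) * B" using T by simp
  ultimately show "(LINT z|lborel. \<bar>U z\<bar>) \<le> (T - \<tau>) * B" by (simp add: ennreal_le_iff)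
qed

lemma abs_clamp_diff_le:
  fixes v w :: real
  shows "\<bar>max (- M) (min M v) - max (- M) (min M w)\<bar> \<le> \<bar>v - w\<bar>"
  by (auto simp: max_def min_def abs_if)

text \<open>Clamping is 1-Lipschitz and the shift is in space only, so it preserves the slab. The
  estimates at fixed times pass to the clamped function and are integrated over the time
  interval.\<close>

lemma kruzhkov_bounded_sol:
  assumes u: "kruzhkov_solution b u" and b[measurable]: "b \<in> borel_measurable borel" and \<tau>: "0 \<le> \<tau>" "\<tau> \<le> T" and M: "0 \<le> M"
    and bd: "AE z in lborel. \<tau> < fst z \<longrightarrow> \<bar>u (fst z) (snd z)\<bar> \<le> M"
  shows "bounded_sol spacetime_flux (slab \<tau> T) M (clamp_ext M (slab \<tau> T) u)"
    "(LINT z|lborel. \<bar>clamp_ext M (slab \<tau> T) u (z + (0, c)) - clamp_ext M (slab \<tau> T) u z\<bar>) \<le> (T - \<tau>) * L1_norm (\<lambda>x. b (x + c) - b x)"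
proof -
  define U where "U = clamp_ext M (slab \<tau> T) u"
  have e: "entropy_solution u" and iu: "\<And>t. 0 \<le> t \<Longrightarrow> integrable lborel (u t)" using u by (auto simp: kruzhkov_solution_def)
  have sub: "slab \<tau> T \<subseteq> half_space" using \<tau> by (auto simp: slab_def)
  have Um[measurable]: "U \<in> borel_measurable borel"
    unfolding U_def by (rule clamp_ext_measurable[OF e _ sub]) (use open_slab in auto)
  have Uz: "U z = 0" if "z \<notin> slab \<tau> T" for z using that by (simp add: U_def clamp_ext_def)
  have Ut: "U (t, x) = max (- M) (min M (u t x))" if "\<tau> < t" "t < T" for t x using that by (simp add: U_def clamp_ext_def slab_def)
  have L0: "0 \<le> L1_norm f" for f by (simp add: L1_norm_def)
  have "integrable lborel U"
  proof (rule slab_integral_bound(1)[OF Um Uz _ _ _ \<tau>(2) L0])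
    show "\<bar>U (t, x)\<bar> \<le> \<bar>u t x\<bar>" if "\<tau> < t" "t < T" for t x using that M by (auto simp: Ut)
    show "L1_norm (u t) \<le> L1_norm b" if "\<tau> < t" "t < T" for t
      using that \<tau> by (intro kruzhkov_L1_bound[OF u b]) auto
  qed (use iu \<tau> in auto)
  moreover have "AE z in lborel. z \<in> slab \<tau> T \<longrightarrow> \<bar>u (fst z) (snd z)\<bar> \<le> M"
    using bd by eventually_elim (auto simp: slab_def)
  note entropy_solution_clamp[OF e open_slab sub M this]
  ultimately show "bounded_sol spacetime_flux (slab \<tau> T) M (clamp_ext M (slab \<tau> T) u)"
    unfolding bounded_sol_def using Um clamp_ext_bound[OF M] by (simp add: U_def)
  show "(LINT z|lborel. \<bar>clamp_ext M (slab \<tau> T) u (z + (0, c)) - clamp_ext M (slab \<tau> T) u z\<bar>) \<le> (T - \<tau>) * L1_norm (\<lambda>x. b (x + c) - b x)"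
    unfolding U_def[symmetric]
  proof (rule slab_integral_bound(2)[OF _ _ _ _ _ \<tau>(2) L0])
    show "U (z + (0, c)) - U z = 0" if "z \<notin> slab \<tau> T" for z
      using that Uz[of z] Uz[of "z + (0, c)"] by (simp add: slab_def)
    fix t assume t: "\<tau> < t" "t < T"
    show "\<bar>U ((t, x) + (0, c)) - U (t, x)\<bar> \<le> \<bar>u t (x + c) - u t x\<bar>" for x
      using abs_clamp_diff_le by (simp add: Ut[OF t])
    show "integrable lborel (\<lambda>x. u t (x + c) - u t x)"
      using iu[of t] lborel_integrable_shift[of "u t" c] t \<tau> by auto
    show "L1_norm (\<lambda>x. u t (x + c) - u t x) \<le> L1_norm (\<lambda>x. b (x + c) - b x)"
      using t \<tau> by (intro kruzhkov_translation_estimate[OF u b]) auto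
  qed simp
qed

lemma kruzhkov_compactness:
  fixes \<xi> :: "real ^ 2" and u :: "nat \<Rightarrow> real \<Rightarrow> real ^ 2 \<Rightarrow> real"
  assumes \<xi>: "norm \<xi> = 1" and u: "\<And>k. kruzhkov_solution (b k) (u k)" "\<And>k. b k \<in> borel_measurable borel"
    and bd: "\<And>\<tau>. 0 < \<tau> \<Longrightarrow> \<exists>M. \<forall>k. AE z in lborel. \<tau> < fst z \<longrightarrow> \<bar>u k (fst z) (snd z)\<bar> \<le> M"
    and mod: "\<And>e. 0 < e \<Longrightarrow> \<exists>h0>0. \<forall>k r. 0 \<le> r \<longrightarrow> r \<le> h0 \<longrightarrow> L1_norm (\<lambda>x. b k (x + (- r) *\<^sub>R \<xi>) - b k x) \<le> e"
  obtains s :: "nat \<Rightarrow> nat" where "strict_mono s" "AE z in lborel. 0 < fst z \<longrightarrow> convergent (\<lambda>k. u (s k) (fst z) (snd z))"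
proof -
  \<comment> \<open>The slabs between these times exhaust the positive times; the summand 2 makes
    the lower end smaller than 1, which is at most the upper end.\<close>
  define \<tau> where "\<tau> i = 1 / (real i + 2)" for i
  define T where "T i = real i + 1" for i
  have \<tau>: "0 < \<tau> i" "\<tau> i < T i" for i
  proof -
    show "0 < \<tau> i" by (simp add: \<tau>_def)
    have "1 / (real i + 2) < 1" by (simp add: field_simps)
    also have "1 \<le> T i" by (simp add: T_def)
    finally show "\<tau> i < T i" by (simp add: \<tau>_def)
  qed
  obtain s :: "nat \<Rightarrow> nat" where s: "strict_mono s" "\<And>i. AE z in lborel. z \<in> slab (\<tau> i) (T i) \<longrightarrow> convergent (\<lambda>k. u (s k) (fst z) (snd z))"
  proof (rule diagonal_subsequence[of "\<lambda>i (s :: nat \<Rightarrow> nat). AE z in lborel. z \<in> slab (\<tau> i) (T i) \<longrightarrow> convergent (\<lambda>k. u (s k) (fst z) (snd z))"])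
    fix i s assume s: "strict_mono (s :: nat \<Rightarrow> nat)"
    obtain M0 where M0: "\<And>k. AE z in lborel. \<tau> i < fst z \<longrightarrow> \<bar>u k (fst z) (snd z)\<bar> \<le> M0" using bd[OF \<tau>(1)[of i]] by blast
    \<comment> \<open>The compactness on a slab asks for a positive bound.\<close>
    define M where "M = max M0 1"
    have M: "AE z in lborel. \<tau> i < fst z \<longrightarrow> \<bar>u k (fst z) (snd z)\<bar> \<le> M" for k
      using M0[of k] by eventually_elim (auto simp: M_def)
    have M1: "0 < M" "0 \<le> M" by (auto simp: M_def)
    note B = kruzhkov_bounded_sol[OF u(1) u(2) less_imp_le[OF \<tau>(1)] less_imp_le[OF \<tau>(2)] M1(2) M]
    obtain r :: "nat \<Rightarrow> nat" where r: "strict_mono r"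
      "AE z in lborel. z \<in> slab (\<tau> i) (T i) \<longrightarrow> convergent (\<lambda>k. clamp_ext M (slab (\<tau> i) (T i)) (u (s (r k))) z)"
    proof (rule slab_compactness[OF \<xi> M1(1), of "\<tau> i" "T i" "\<lambda>k. clamp_ext M (slab (\<tau> i) (T i)) (u (s k))"])
      show "bounded_sol spacetime_flux (slab (\<tau> i) (T i)) M (clamp_ext M (slab (\<tau> i) (T i)) (u (s k)))" for k by (rule B(1))
      fix e :: real assume e: "0 < e"
      define q where "q = T i - \<tau> i"
      have q: "0 < q" using \<tau>(2)[of i] by (simp add: q_def)
      obtain h0 where h0: "0 < h0" "\<And>k r. 0 \<le> r \<Longrightarrow> r \<le> h0 \<Longrightarrow> L1_norm (\<lambda>x. b k (x + (- r) *\<^sub>R \<xi>) - b k x) \<le> e / q"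
        using mod[of "e / q"] e q by auto
      have "(LINT z|lborel. \<bar>clamp_ext M (slab (\<tau> i) (T i)) (u (s k)) (z - r *\<^sub>R (0, \<xi>)) - clamp_ext M (slab (\<tau> i) (T i)) (u (s k)) z\<bar>) \<le> e"
        if "0 \<le> r" "r \<le> h0" for k r
      proof -
        have eq: "z - r *\<^sub>R (0, \<xi>) = z + (0, (- r) *\<^sub>R \<xi>)" for z :: "real \<times> (real ^ 2)" by (cases z) simp
        have "(LINT z|lborel. \<bar>clamp_ext M (slab (\<tau> i) (T i)) (u (s k)) (z + (0, (- r) *\<^sub>R \<xi>)) - clamp_ext M (slab (\<tau> i) (T i)) (u (s k)) z\<bar>)
          \<le> q * L1_norm (\<lambda>x. b (s k) (x + (- r) *\<^sub>R \<xi>) - b (s k) x)" unfolding q_def by (rule B(2))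
        also have "\<dots> \<le> q * (e / q)" using q by (intro mult_left_mono h0(2) that) auto
        finally show ?thesis using q unfolding eq by simp
      qed
      then show "\<exists>h0>0. \<forall>k r. 0 \<le> r \<longrightarrow> r \<le> h0 \<longrightarrow> (LINT z|lborel. \<bar>clamp_ext M (slab (\<tau> i) (T i)) (u (s k)) (z - r *\<^sub>R (0, \<xi>)) - clamp_ext M (slab (\<tau> i) (T i)) (u (s k)) z\<bar>) \<le> e"
        using h0(1) by blast
    qed (rule that)
    have "AE z in lborel. \<forall>k. \<tau> i < fst z \<longrightarrow> \<bar>u k (fst z) (snd z)\<bar> \<le> M" unfolding AE_all_countable using M by blast
    with r(2) have "AE z in lborel. z \<in> slab (\<tau> i) (T i) \<longrightarrow> convergent (\<lambda>k. u ((s \<circ> r) k) (fst z) (snd z))"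
    proof eventually_elim
      case (elim z)
      show ?case
      proof
        assume z: "z \<in> slab (\<tau> i) (T i)"
        then have "clamp_ext M (slab (\<tau> i) (T i)) (u k) z = u k (fst z) (snd z)" for k
          using elim(2)[rule_format, of k] by (auto simp: clamp_ext_def slab_def abs_le_iff)
        then show "convergent (\<lambda>k. u ((s \<circ> r) k) (fst z) (snd z))" using elim(1) z by simp
      qed
    qed
    then show "\<exists>r :: nat \<Rightarrow> nat. strict_mono r \<and> (AE z in lborel. z \<in> slab (\<tau> i) (T i) \<longrightarrow> convergent (\<lambda>k. u ((s \<circ> r) k) (fst z) (snd z)))"
      using r(1) by blast
  next
    fix i s r assume r: "strict_mono (r :: nat \<Rightarrow> nat)"
      and s: "AE z in lborel. z \<in> slab (\<tau> i) (T i) \<longrightarrow> convergent (\<lambda>k. u (s k) (fst z) (snd z))"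
    from s show "AE z in lborel. z \<in> slab (\<tau> i) (T i) \<longrightarrow> convergent (\<lambda>k. u ((s \<circ> r) k) (fst z) (snd z))"
      by eventually_elim (use convergent_subseq_convergent[OF _ r] in \<open>auto simp: o_def\<close>)
  next
    fix i s and k :: nat assume s: "AE z in lborel. z \<in> slab (\<tau> i) (T i) \<longrightarrow> convergent (\<lambda>n. u ((s \<circ> (+) k) n) (fst z) (snd z))"
    from s show "AE z in lborel. z \<in> slab (\<tau> i) (T i) \<longrightarrow> convergent (\<lambda>n. u (s n) (fst z) (snd z))"
      by eventually_elim (auto simp: convergent_def add.commute[of k] dest: LIMSEQ_offset)
  qed (rule that)
  show ?thesis
  proof (rule that[OF s(1)])
    have "AE z in lborel. \<forall>i. z \<in> slab (\<tau> i) (T i) \<longrightarrow> convergent (\<lambda>k. u (s k) (fst z) (snd z))"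
      unfolding AE_all_countable using s(2) by blast
    then show "AE z in lborel. 0 < fst z \<longrightarrow> convergent (\<lambda>k. u (s k) (fst z) (snd z))"
    proof eventually_elim
      case (elim z)
      show ?case
      proof
        assume z: "0 < fst z"
        \<comment> \<open>An index above both the time and its reciprocal puts the point between the
          two ends of the slab.\<close>
        obtain i :: nat where i: "fst z + 1 / fst z < real i" using reals_Archimedean2 by blast
        have "fst z < real i" using i z by (simp add: order_le_less_trans[of _ "fst z + 1 / fst z"])
        moreover have "1 / fst z < real i + 2" using i z by linarith
        then have "1 / (real i + 2) < fst z" using z by (simp add: field_simps)
        ultimately have "z \<in> slab (\<tau> i) (T i)" by (simp add: slab_def \<tau>_def T_def)
        then show "convergent (\<lambda>k. u (s k) (fst z) (snd z))" using elim by auto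
      qed
    qed
  qed
qed

section \<open>Stability of entropy solutions under bounded convergence\<close>

text \<open>The flux is polynomial, so its increment is divisible by \<open>w - c\<close>; the sign
  turns that factor into \<open>\<bar>w - c\<bar>\<close> and the discontinuity of
  \<open>sgn\<close> disappears.\<close>

lemma continuous_kflux_spacetime: "continuous_on UNIV (\<lambda>w. kflux spacetime_flux w c)"
proof -
  have "(\<lambda>w. kflux spacetime_flux w c) =
      (\<lambda>w. \<bar>w - c\<bar> *\<^sub>R (1, ((w + c) / 2) *\<^sub>R axis 1 1 + ((w\<^sup>2 + w * c + c\<^sup>2) / 3) *\<^sub>R axis 2 1))"
  proof
    fix w
    show "kflux spacetime_flux w c = \<bar>w - c\<bar> *\<^sub>R (1, ((w + c) / 2) *\<^sub>R axis 1 1 + ((w\<^sup>2 + w * c + c\<^sup>2) / 3) *\<^sub>R axis 2 1)"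
      by (cases w c rule: linorder_cases)
        (auto simp: kflux_def spacetime_flux_def flux_eq vec_eq_iff forall_2 axis_def power2_eq_square power3_eq_cube field_simps zero_prod_def)
  qed
  then show ?thesis by (simp only:) (intro continuous_intros; simp)
qed

lemma flux_integral_tendsto:
  fixes X :: "real \<Rightarrow> 'a::euclidean_space" and W :: "nat \<Rightarrow> 'a \<Rightarrow> real"
  assumes X: "continuous_on UNIV X" and [measurable]: "\<And>k. W k \<in> borel_measurable borel" "V \<in> borel_measurable borel" "g \<in> borel_measurable borel"
    and K: "compact K" "\<And>z. z \<notin> K \<Longrightarrow> g z = 0" and C: "\<And>z. norm (g z) \<le> C"
    and b: "\<And>k. AE z in lborel. z \<in> K \<longrightarrow> \<bar>W k z\<bar> \<le> M"
    and lim: "AE z in lborel. z \<in> K \<longrightarrow> (\<lambda>k. W k z) \<longlonglongrightarrow> V z"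
  shows "(\<lambda>k. LINT z|lborel. X (W k z) \<bullet> g z) \<longlonglongrightarrow> (LINT z|lborel. X (V z) \<bullet> g z)"
proof -
  have [measurable]: "X \<in> borel_measurable borel" using X by (rule borel_measurable_continuous_onI)
  have "compact (X ` {-M..M})" by (intro compact_continuous_image continuous_on_subset[OF X]) auto
  then obtain B where B: "\<And>w. w \<in> {-M..M} \<Longrightarrow> norm (X w) \<le> B" using compact_imp_bounded bounded_iff by (metis image_eqI)
  have iK: "integrable lborel (indicator K :: 'a \<Rightarrow> real)"
    using emeasure_bounded_finite[OF compact_imp_bounded[OF K(1)]] K(1) by (intro integrable_real_indicator) (auto simp: compact_imp_closed)
  show ?thesis
  proof (rule integral_dominated_convergence[where w = "\<lambda>z. indicator K z * (max B 0 * C)"])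
    show "AE z in lborel. (\<lambda>k. X (W k z) \<bullet> g z) \<longlonglongrightarrow> X (V z) \<bullet> g z"
      using lim
    proof eventually_elim
      case (elim z)
      show ?case
      proof (cases "z \<in> K")
        case True
        then have "(\<lambda>k. X (W k z)) \<longlonglongrightarrow> X (V z)"
          using elim X by (intro continuous_on_tendsto_compose[OF X]) auto
        then show ?thesis by (intro tendsto_intros)
      qed (simp add: K(2))
    qed
    show "AE z in lborel. norm (X (W k z) \<bullet> g z) \<le> indicator K z * (max B 0 * C)" for k
      using b[of k]
    proof eventually_elim
      case (elim z)
      show ?case
      proof (cases "z \<in> K")
        case True
        then have "W k z \<in> {-M..M}" using elim by (simp add: abs_le_iff minus_le_iff)
        then have "norm (X (W k z)) * norm (g z) \<le> max B 0 * C" using B C by (intro mult_mono) (auto simp: le_max_iff_disj)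
        then show ?thesis using True Cauchy_Schwarz_ineq2[of "X (W k z)" "g z"] by simp
      qed (simp add: K(2))
    qed
  qed (use iK in auto)
qed

lemma test_function_c1_test:
  assumes "test_function \<Omega> \<phi>"
  obtains g where "c1_test \<Omega> \<phi> g"
proof -
  have "C_k (Suc 0) \<phi>" using assms unfolding test_function_def by blast
  note G = C_k_grad[OF this]
  have "z \<notin> closure {z. \<phi> z \<noteq> 0} \<Longrightarrow> \<phi> z = 0" for z using closure_subset[of "{z. \<phi> z \<noteq> 0}"] by auto
  then show ?thesis using that G assms unfolding c1_test_def test_function_def by blast
qed

lemma compact_half_space_time:
  assumes "compact K" "K \<subseteq> half_space"
  obtains \<tau> where "0 < \<tau>" "\<And>z. z \<in> K \<Longrightarrow> \<tau> < fst z"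
proof (cases "K = {}")
  case True then show ?thesis using that[of 1] by simp
next
  case False
  obtain z0 where z0: "z0 \<in> K" "\<And>z. z \<in> K \<Longrightarrow> fst z0 \<le> fst z"
    using continuous_attains_inf[OF assms(1) False continuous_on_fst[OF continuous_on_id]] by auto
  have "0 < fst z0" using z0(1) assms(2) by auto
  then show ?thesis using that[of "fst z0 / 2"] z0(2) by fastforce
qed

text \<open>Both formulations integrate a continuous function of the solution against one gradient
  with compact support in positive times. There the sequence is uniformly bounded, so dominated
  convergence applies to every such function at once.\<close>

lemma entropy_solution_limit:
  fixes v :: "nat \<Rightarrow> real \<Rightarrow> real ^ 2 \<Rightarrow> real"
  assumes v: "\<And>k. entropy_solution (v k)"
    and bd: "\<And>\<tau>. 0 < \<tau> \<Longrightarrow> \<exists>M. \<forall>k. AE z in lborel. \<tau> < fst z \<longrightarrow> \<bar>v k (fst z) (snd z)\<bar> \<le> M"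
    and lim: "AE z in lborel. 0 < fst z \<longrightarrow> (\<lambda>k. v k (fst z) (snd z)) \<longlonglongrightarrow> u (fst z) (snd z)"
    and um[measurable]: "(\<lambda>z. u (fst z) (snd z)) \<in> borel_measurable borel"
  shows "entropy_solution u"
proof -
  define W where "W k z = indicator half_space z * v k (fst z) (snd z)" for k z
  define V where "V z = indicator half_space z * u (fst z) (snd z)" for z
  have [measurable]: "W k \<in> borel_measurable borel" for k unfolding W_def[abs_def] by (rule entropy_solution_measurable[OF v])
  have [measurable]: "V \<in> borel_measurable borel" unfolding V_def[abs_def] by measurable
  have key: "\<exists>g. is_grad \<phi> g \<and> (\<forall>X. continuous_on UNIV X \<longrightarrow>
      (\<lambda>k. LINT z|lborel. X (W k z) \<bullet> g z) \<longlonglongrightarrow> (LINT z|lborel. X (V z) \<bullet> g z))" if t: "test_function half_space \<phi>" for \<phi>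
  proof -
    obtain g where g: "c1_test half_space \<phi> g" using test_function_c1_test[OF t] by blast
    obtain K C where K: "compact K" "K \<subseteq> half_space" "\<And>z. z \<notin> K \<Longrightarrow> g z = 0"
      and C: "\<And>z. norm (g z) \<le> C" and g': "is_grad \<phi> g" "continuous_on UNIV g"
      using g by (rule c1_testE) blast
    obtain \<tau> where \<tau>: "0 < \<tau>" "\<And>z. z \<in> K \<Longrightarrow> \<tau> < fst z" using compact_half_space_time[OF K(1,2)] by blast
    obtain M where M: "\<And>k. AE z in lborel. \<tau> < fst z \<longrightarrow> \<bar>v k (fst z) (snd z)\<bar> \<le> M" using bd[OF \<tau>(1)] by blast
    have "(\<lambda>k. LINT z|lborel. X (W k z) \<bullet> g z) \<longlonglongrightarrow> (LINT z|lborel. X (V z) \<bullet> g z)" if X: "continuous_on UNIV X" for X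
    proof (rule flux_integral_tendsto[OF X _ _ _ K(1,3) C])
      show "g \<in> borel_measurable borel" using g'(2) by (rule borel_measurable_continuous_onI)
      show "AE z in lborel. z \<in> K \<longrightarrow> \<bar>W k z\<bar> \<le> M" for k
        using M[of k] by eventually_elim (use \<tau>(2) K(2) in \<open>auto simp: W_def\<close>)
      show "AE z in lborel. z \<in> K \<longrightarrow> (\<lambda>k. W k z) \<longlonglongrightarrow> V z"
        using lim
      proof eventually_elim
        case (elim z)
        show ?case
        proof
          assume "z \<in> K"
          then have "z \<in> half_space" using K(2) by blast
          then show "(\<lambda>k. W k z) \<longlonglongrightarrow> V z" using elim by (auto simp: W_def V_def)
        qed
      qed
    qed simp_all
    then show ?thesis using g'(1) by blast
  qed
  show ?thesis
    unfolding entropy_solution_def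
  proof (intro conjI allI impI)
    show "(\<lambda>(t, x). u t x) \<in> borel_measurable (restrict_space borel half_space)"
      using um by (simp add: split_beta measurable_restrict_space1)
    fix \<tau> :: real assume "0 < \<tau>"
    then obtain M where "\<And>k. AE z in lborel. \<tau> < fst z \<longrightarrow> \<bar>v k (fst z) (snd z)\<bar> \<le> M" using bd by blast
    then have "AE z in lborel. \<forall>k. \<tau> < fst z \<longrightarrow> \<bar>v k (fst z) (snd z)\<bar> \<le> M" unfolding AE_all_countable by blast
    with lim have "AE z in lborel. fst z > \<tau> \<longrightarrow> \<bar>u (fst z) (snd z)\<bar> \<le> M"
    proof eventually_elim
      case (elim z)
      show ?case
      proof
        assume z: "\<tau> < fst z"
        then have "(\<lambda>k. \<bar>v k (fst z) (snd z)\<bar>) \<longlonglongrightarrow> \<bar>u (fst z) (snd z)\<bar>" using elim(1) \<open>0 < \<tau>\<close> by (intro tendsto_rabs) auto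
        then show "\<bar>u (fst z) (snd z)\<bar> \<le> M" by (rule LIMSEQ_le_const2) (use elim(2) z in auto)
      qed
    qed
    then show "\<exists>C. AE (t, x) in lborel. \<tau> < t \<longrightarrow> \<bar>u t x\<bar> \<le> C" by (intro exI[of _ M]) (simp add: split_beta)
  next
    fix \<phi> :: "real \<times> (real ^ 2) \<Rightarrow> real" assume \<phi>: "test_function half_space \<phi>"
    obtain g where g: "is_grad \<phi> g" "\<And>X. continuous_on UNIV X \<Longrightarrow>
      (\<lambda>k. LINT z|lborel. X (W k z) \<bullet> g z) \<longlonglongrightarrow> (LINT z|lborel. X (V z) \<bullet> g z)" using key[OF \<phi>] by blast
    have "(LINT z|lborel. spacetime_flux (W k z) \<bullet> g z) = 0" for k
      unfolding W_def half_space_flux_integral(1)[OF \<phi> g(1), symmetric]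
      using v[of k] \<phi> unfolding entropy_solution_def by (elim conjE) blast
    then have "(LINT z|lborel. spacetime_flux (V z) \<bullet> g z) = 0"
      using g(2)[OF continuous_spacetime_flux] by (simp add: LIMSEQ_const_iff)
    then show "(LINT (t, x) : half_space | lborel. u t x * dt \<phi> (t, x) + flux (u t x) \<bullet> grad_x \<phi> (t, x)) = 0"
      unfolding half_space_flux_integral(1)[OF \<phi> g(1)] V_def .
  next
    fix k and \<phi> :: "real \<times> (real ^ 2) \<Rightarrow> real" assume \<phi>: "test_function half_space \<phi>" and pos: "\<forall>z. 0 \<le> \<phi> z"
    obtain g where g: "is_grad \<phi> g" "\<And>X. continuous_on UNIV X \<Longrightarrow>
      (\<lambda>k. LINT z|lborel. X (W k z) \<bullet> g z) \<longlonglongrightarrow> (LINT z|lborel. X (V z) \<bullet> g z)" using key[OF \<phi>] by blast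
    have "0 \<le> (LINT z|lborel. kflux spacetime_flux (W n z) k \<bullet> g z)" for n
      unfolding W_def half_space_flux_integral(2)[OF \<phi> g(1), symmetric]
      using v[of n] \<phi> pos unfolding entropy_solution_def by (elim conjE) blast
    then have "0 \<le> (LINT z|lborel. kflux spacetime_flux (V z) k \<bullet> g z)"
      by (intro LIMSEQ_le_const[OF g(2)[OF continuous_kflux_spacetime]]) auto
    then show "(LINT (t, x) : half_space | lborel. \<bar>u t x - k\<bar> * dt \<phi> (t, x) + sgn (u t x - k) * ((flux (u t x) - flux k) \<bullet> grad_x \<phi> (t, x))) \<ge> 0"
      unfolding half_space_flux_integral(2)[OF \<phi> g(1)] V_def .
  qed
qed

section \<open>Passage to the limit\<close>

lemma Linf_norm_AE:
  assumes "Linf_norm f \<le> ereal m"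
  shows "AE x in lborel. \<bar>f x\<bar> \<le> m"
  using esssup_AE[where M = lborel and f = "\<lambda>x. ereal \<bar>f x\<bar>"]
proof eventually_elim
  case (elim x)
  then have "ereal \<bar>f x\<bar> \<le> ereal m" using assms unfolding Linf_norm_def by (rule order_trans)
  then show ?case by simp
qed

lemma Linf_norm_le:
  assumes "f \<in> borel_measurable borel" "AE x in lborel. \<bar>f x\<bar> \<le> m"
  shows "Linf_norm f \<le> ereal m"
  unfolding Linf_norm_def using assms by (intro esssup_I) auto

lemma Linf_norm_nonneg:
  assumes "f \<in> borel_measurable borel"
  shows "0 \<le> Linf_norm f"
proof -
  have "0 = esssup lborel (\<lambda>x :: real ^ 2. 0 :: ereal)" by (rule esssup_const[symmetric]) simp
  also have "\<dots> \<le> Linf_norm f" unfolding Linf_norm_def by (rule esssup_mono) auto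
  finally show ?thesis .
qed

text \<open>Enlarging the mass and decreasing the time in the dispersive bound are monotone
  operations only for a constant that is not negative. The sign follows from one datum of positive
  mass, the indicator of the unit ball.\<close>

lemma dispersive_constant_nonneg:
  assumes S: "kruzhkov_semigroup S" and c: "dispersive_constant S c"
  shows "0 \<le> c"
proof -
  define f where "f = (indicator (cball 0 1) :: real ^ 2 \<Rightarrow> real)"
  have i: "integrable lborel f"
    unfolding f_def using emeasure_lborel_cball_finite[of "0 :: real ^ 2" 1] by (intro integrable_real_indicator) auto
  then have fm: "f \<in> borel_measurable borel" by auto
  have "Linf_norm f \<le> ereal 1" by (rule Linf_norm_le[OF fm]) (auto simp: f_def indicator_def)
  then have L: "L1_Linf f" using i by (auto simp: L1_Linf_def order_le_less_trans)
  have "L1_norm f = measure lborel (cball 0 1 :: (real ^ 2) set)"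
    by (simp add: L1_norm_def f_def)
  then have pos: "0 < L1_norm f" using content_cball_pos[of 1 "0 :: real ^ 2"] by simp
  have "kruzhkov_solution f (\<lambda>t. S t f)" using S L by (simp add: kruzhkov_semigroup_def)
  then have "integrable lborel (S 1 f)" by (simp add: kruzhkov_solution_def)
  then have "0 \<le> Linf_norm (S 1 f)" by (intro Linf_norm_nonneg) auto
  also have "\<dots> \<le> ereal (c * 1 powr (- 1 / 2) * L1_norm f powr (1 / 4))"
    using c L unfolding dispersive_constant_def by (metis zero_less_one)
  finally have "0 \<le> c * L1_norm f powr (1 / 4)" by simp
  then show ?thesis using pos by (simp add: zero_le_mult_iff)
qed

text \<open>The dispersive estimate holds at each time outside a null set of space that may depend
  on the time. Measurability in space-time of the solution and of the bound merges these into one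
  null set.\<close>

lemma entropy_solution_AE_bound:
  assumes u: "entropy_solution u" and [measurable]: "B \<in> borel_measurable borel"
    and b: "\<And>t. 0 < t \<Longrightarrow> AE x in lborel. \<bar>u t x\<bar> \<le> B t"
  shows "AE z in lborel. 0 < fst z \<longrightarrow> \<bar>u (fst z) (snd z)\<bar> \<le> B (fst z)"
proof -
  define W where "W z = indicator half_space z * u (fst z) (snd z)" for z
  have [measurable]: "W \<in> borel_measurable borel" unfolding W_def[abs_def] by (rule entropy_solution_measurable[OF u])
  have "AE z in lborel. 0 < fst z \<longrightarrow> \<bar>W z\<bar> \<le> B (fst z)"
  proof (rule AE_lborel_slices)
    have "{z \<in> space borel. 0 < fst z \<longrightarrow> \<bar>W z\<bar> \<le> B (fst z)} \<in> sets borel" by measurable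
    then show "{z. 0 < fst z \<longrightarrow> \<bar>W z\<bar> \<le> B (fst z)} \<in> sets borel" by simp
    show "AE t in lborel. AE x in lborel. 0 < fst (t, x) \<longrightarrow> \<bar>W (t, x)\<bar> \<le> B (fst (t, x))"
    proof (rule AE_I2)
      fix t :: real
      show "AE x in lborel. 0 < fst (t, x) \<longrightarrow> \<bar>W (t, x)\<bar> \<le> B (fst (t, x))"
        by (cases "0 < t") (use b[of t] in \<open>auto simp: W_def\<close>)
    qed
  qed
  then show ?thesis by eventually_elim (auto simp: W_def)
qed

lemma vague_limit_subseq:
  assumes "vague_limit b a" "strict_mono s"
  shows "vague_limit (\<lambda>k. b (s k)) a"
  using assms unfolding vague_limit_def by (auto intro: LIMSEQ_subseq_LIMSEQ[unfolded o_def])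

text \<open>The bounds are required at every positive time, but the limit is controlled only at almost every
  time. It is therefore set to zero at the times where one of the bounds fails; by Fatou these times
  form a null set.\<close>

lemma limit_representative:
  fixes v :: "nat \<Rightarrow> real \<Rightarrow> real ^ 2 \<Rightarrow> real"
  assumes v: "\<And>k. entropy_solution (v k)" and B[measurable]: "B \<in> borel_measurable borel"
    and i: "\<And>k t. 0 < t \<Longrightarrow> integrable lborel (v k t)" and L1: "\<And>k t. 0 < t \<Longrightarrow> L1_norm (v k t) \<le> m"
    and b: "\<And>k t. 0 < t \<Longrightarrow> AE x in lborel. \<bar>v k t x\<bar> \<le> B t"
    and conv: "AE z in lborel. 0 < fst z \<longrightarrow> convergent (\<lambda>k. v k (fst z) (snd z))"
    and pos: "0 \<le> m" "\<And>t. 0 < t \<Longrightarrow> 0 \<le> B t"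
  obtains u where "(\<lambda>z. u (fst z) (snd z)) \<in> borel_measurable borel"
    "AE z in lborel. 0 < fst z \<longrightarrow> (\<lambda>k. v k (fst z) (snd z)) \<longlonglongrightarrow> u (fst z) (snd z)"
    "\<And>t. 0 < t \<Longrightarrow> integrable lborel (u t)" "\<And>t. 0 < t \<Longrightarrow> L1_norm (u t) \<le> m"
    "\<And>t. 0 < t \<Longrightarrow> AE x in lborel. \<bar>u t x\<bar> \<le> B t"
proof -
  define W where "W k z = indicator half_space z * v k (fst z) (snd z)" for k z
  have Wm[measurable]: "W k \<in> borel_measurable borel" for k
    unfolding W_def[abs_def] by (rule entropy_solution_measurable[OF v])
  \<comment> \<open>Replacing sequences that are not Cauchy by 0 makes the limit exist at every
    point and keeps it Borel.\<close>
  define w where "w z = lim (\<lambda>k. if Cauchy (\<lambda>k. W k z) then W k z else 0)" for z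
  have wm[measurable]: "w \<in> borel_measurable borel" unfolding w_def[abs_def] by measurable
  have lim: "AE z in lborel. 0 < fst z \<longrightarrow> (\<lambda>k. v k (fst z) (snd z)) \<longlonglongrightarrow> w z"
    using conv
  proof eventually_elim
    case (elim z)
    show ?case
    proof
      assume z: "0 < fst z"
      then have W: "W k z = v k (fst z) (snd z)" for k by (auto simp: W_def mem_Times_iff)
      have c: "convergent (\<lambda>k. v k (fst z) (snd z))" using elim z by blast
      then show "(\<lambda>k. v k (fst z) (snd z)) \<longlonglongrightarrow> w z"
        unfolding w_def W using c by (simp add: Cauchy_convergent_iff convergent_LIMSEQ_iff)
    qed
  qed
  have [measurable]: "w \<in> borel_measurable (lborel \<Otimes>\<^sub>M lborel)" unfolding lborel_prod by simp
  have wt[measurable]: "(\<lambda>x. w (t, x)) \<in> borel_measurable borel" for t by measurable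
  define p where "p t = (\<integral>\<^sup>+x. ennreal \<bar>w (t, x)\<bar> \<partial>lborel)" for t
  define q where "q t = (\<integral>\<^sup>+x. indicator {z. B (fst z) < \<bar>w z\<bar>} (t, x) \<partial>lborel)" for t
  have [measurable]: "{z. B (fst z) < \<bar>w z\<bar>} \<in> sets (lborel \<Otimes>\<^sub>M lborel)"
  proof -
    have "{z \<in> space borel. B (fst z) < \<bar>w z\<bar>} \<in> sets borel" by measurable
    then show ?thesis unfolding lborel_prod by simp
  qed
  have pm: "p \<in> borel_measurable lborel" unfolding p_def[abs_def]
    by (rule lborel.borel_measurable_nn_integral_fst) measurable
  have qm: "q \<in> borel_measurable lborel" unfolding q_def[abs_def]
    by (rule lborel.borel_measurable_nn_integral_fst) measurable
  note [measurable] = pm[simplified] qm[simplified]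
  \<comment> \<open>The times at which both bounds hold for the slice of the limit;
    \<open>q t\<close> measures the part of the slice where the pointwise bound fails.\<close>
  define G where "G = {t. 0 < t \<and> p t \<le> ennreal m \<and> q t = 0}"
  have [measurable]: "G \<in> sets borel"
  proof -
    have "{t \<in> space borel. 0 < t \<and> p t \<le> ennreal m \<and> q t = 0} \<in> sets borel" by measurable
    then show ?thesis by (simp add: G_def)
  qed
  have "AE t in lborel. AE x in lborel. 0 < t \<longrightarrow> (\<lambda>k. v k t x) \<longlonglongrightarrow> w (t, x)"
    by (rule AE_lborel_pair) (use lim in simp)
  then have AG: "AE t in lborel. 0 < t \<longrightarrow> t \<in> G"
  proof eventually_elim
    case (elim t)
    show ?case
    proof
      assume t: "0 < t"
      have l: "AE x in lborel. (\<lambda>k. v k t x) \<longlonglongrightarrow> w (t, x)" using elim by eventually_elim (use t in auto)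
      have [measurable]: "v k t \<in> borel_measurable borel" for k using i[OF t, of k] by auto
      have "p t = (\<integral>\<^sup>+x. liminf (\<lambda>k. ennreal \<bar>v k t x\<bar>) \<partial>lborel)"
        unfolding p_def
      proof (rule nn_integral_cong_AE)
        show "AE x in lborel. ennreal \<bar>w (t, x)\<bar> = liminf (\<lambda>k. ennreal \<bar>v k t x\<bar>)"
          using l
        proof eventually_elim
          case (elim x)
          then have "(\<lambda>k. ennreal \<bar>v k t x\<bar>) \<longlonglongrightarrow> ennreal \<bar>w (t, x)\<bar>" by (intro tendsto_ennrealI tendsto_rabs)
          then show ?case using lim_imp_Liminf[OF sequentially_bot] by metis
        qed
      qed
      also have "\<dots> \<le> liminf (\<lambda>k. \<integral>\<^sup>+x. ennreal \<bar>v k t x\<bar> \<partial>lborel)" by (rule nn_integral_liminf) measurable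
      also have "\<dots> \<le> ennreal m"
      proof (rule Liminf_le)
        have "(\<integral>\<^sup>+x. ennreal \<bar>v k t x\<bar> \<partial>lborel) = ennreal (L1_norm (v k t))" for k
          unfolding L1_norm_def using i[OF t, of k] by (intro nn_integral_eq_integral) auto
        then show "\<forall>\<^sub>F k in sequentially. (\<integral>\<^sup>+x. ennreal \<bar>v k t x\<bar> \<partial>lborel) \<le> ennreal m"
          using L1[OF t] by (simp add: ennreal_leI)
      qed simp
      finally have "p t \<le> ennreal m" .
      moreover have "q t = 0"
      proof -
        have "AE x in lborel. \<forall>k. \<bar>v k t x\<bar> \<le> B t" unfolding AE_all_countable using b[OF t] by blast
        with l have "AE x in lborel. \<bar>w (t, x)\<bar> \<le> B t"
        proof eventually_elim
          case (elim x)
          show ?case by (rule LIMSEQ_le_const2[OF tendsto_rabs[OF elim(1)]]) (use elim(2) in auto)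
        qed
        then have "AE x in lborel. indicator {z. B (fst z) < \<bar>w z\<bar>} (t, x) = (0 :: ennreal)"
          by eventually_elim simp
        then show ?thesis unfolding q_def by (subst nn_integral_0_iff_AE) auto
      qed
      ultimately show "t \<in> G" using t by (simp add: G_def)
    qed
  qed
  define u where "u t x = indicator G t * w (t, x)" for t x
  have uw: "u t x = w (t, x)" if "t \<in> G" for t x using that by (simp add: u_def)
  have uG: "u t x = 0" if "t \<notin> G" for t x using that by (simp add: u_def)
  have iG: "integrable lborel (\<lambda>x. w (t, x))" "L1_norm (\<lambda>x. w (t, x)) \<le> m" if "t \<in> G" for t
  proof -
    have p: "(\<integral>\<^sup>+x. ennreal \<bar>w (t, x)\<bar> \<partial>lborel) \<le> ennreal m" using that by (simp add: G_def p_def)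
    then have "(\<integral>\<^sup>+x. ennreal (norm (w (t, x))) \<partial>lborel) < \<infinity>" by (simp add: order_le_less_trans)
    then show i: "integrable lborel (\<lambda>x. w (t, x))" by (intro integrableI_bounded) auto
    have "ennreal (L1_norm (\<lambda>x. w (t, x))) = (\<integral>\<^sup>+x. ennreal \<bar>w (t, x)\<bar> \<partial>lborel)"
      unfolding L1_norm_def using i by (intro nn_integral_eq_integral[symmetric]) auto
    then have "ennreal (L1_norm (\<lambda>x. w (t, x))) \<le> ennreal m" using p by simp
    then show "L1_norm (\<lambda>x. w (t, x)) \<le> m" using pos(1) by (simp add: ennreal_le_iff)
  qed
  show ?thesis
  proof (rule that[of u])
    show "(\<lambda>z. u (fst z) (snd z)) \<in> borel_measurable borel" unfolding u_def by simp
    have "AE z in (lborel :: (real \<times> (real ^ 2)) measure). 0 < fst z \<longrightarrow> fst z \<in> G"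
    proof (rule AE_lborel_slices)
      have "{z \<in> space borel. 0 < fst z \<longrightarrow> fst z \<in> G} \<in> sets (borel :: (real \<times> (real ^ 2)) measure)" by measurable
      then show "{z :: real \<times> (real ^ 2). 0 < fst z \<longrightarrow> fst z \<in> G} \<in> sets borel" by simp
      show "AE t in lborel. AE x in (lborel :: (real ^ 2) measure). 0 < fst (t, x) \<longrightarrow> fst (t, x) \<in> G"
        using AG by eventually_elim simp
    qed
    with lim show "AE z in lborel. 0 < fst z \<longrightarrow> (\<lambda>k. v k (fst z) (snd z)) \<longlonglongrightarrow> u (fst z) (snd z)"
      by eventually_elim (simp add: uw)
    fix t :: real assume t: "0 < t"
    show "integrable lborel (u t)" "L1_norm (u t) \<le> m"
      using iG[of t] pos(1) by (cases "t \<in> G"; simp add: uw uG L1_norm_def cong: Bochner_Integration.integrable_cong; fail)+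
    show "AE x in lborel. \<bar>u t x\<bar> \<le> B t"
    proof (cases "t \<in> G")
      case True
      then have "AE x in lborel. indicator {z. B (fst z) < \<bar>w z\<bar>} (t, x) = (0 :: ennreal)"
        unfolding G_def q_def by (subst (asm) nn_integral_0_iff_AE) auto
      then show ?thesis by eventually_elim (auto simp: uw[OF True] indicator_def split: if_splits)
    qed (use pos(2)[OF t] in \<open>simp add: uG\<close>)
  qed
qed

theorem theorem7p1:
  fixes \<xi> :: "real ^ 2"
    and a :: smeasure
    and S :: "real \<Rightarrow> (real ^ 2 \<Rightarrow> real) \<Rightarrow> real ^ 2 \<Rightarrow> real"
    and c_inf :: real
  assumes "kruzhkov_semigroup S"
    and "dispersive_constant S c_inf"
    and "norm \<xi> = 1"
    and "signed_measure a"
    and "((\<lambda>h::real. tv_norm (\<lambda>E. translate (h *\<^sub>R \<xi>) a E - a E)) \<longlongrightarrow> 0) (at 0)"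
  shows "\<exists>(b :: nat \<Rightarrow> real ^ 2 \<Rightarrow> real) (u :: real \<Rightarrow> real ^ 2 \<Rightarrow> real).
    (\<forall>k. L1_Linf (b k)) \<and>
    vague_limit b a \<and>
    (\<forall>K. compact K \<longrightarrow> K \<subseteq> {0<..} \<times> UNIV \<longrightarrow> boundedly_ae_on K (\<lambda>k t. S t (b k)) u) \<and>
    entropy_solution u \<and>
    (\<forall>t>0. integrable lborel (u t) \<and> L1_norm (u t) \<le> tv_norm a \<and>
       Linf_norm (u t) \<le> ereal (c_inf * t powr (- 1 / 2) * tv_norm a powr (1 / 4)))"
proof -
  \<comment> \<open>The shift by 1 keeps the radius finite at \<open>k = 0\<close>. Balls of
    positive measure give bounded averages, and shrinking radii give vague convergence.\<close>
  define Q where "Q k = cball (0 :: real ^ 2) (1 / (real k + 1))" for k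
  have Q: "Q k \<in> sets borel" "emeasure lborel (Q k) < \<infinity>" "0 < measure lborel (Q k)" for k
    using emeasure_lborel_cball_finite[of "0 :: real ^ 2" "1 / (real k + 1)"] content_cball_pos[of "1 / (real k + 1)" "0 :: real ^ 2"]
    by (auto simp: Q_def)
  define b where "b k = set_average a (Q k)" for k
  note bL = set_average_L1[OF assms(4) Q, folded b_def]
  have vague: "vague_limit b a"
    unfolding b_def[abs_def]
  proof (rule set_average_vague[OF assms(4) Q])
    fix d :: real assume d: "0 < d"
    have "(\<lambda>k. 1 / (real k + 1)) \<longlonglongrightarrow> 0" using LIMSEQ_inverse_real_of_nat by (simp add: inverse_eq_divide add.commute)
    from order_tendstoD(2)[OF this d] show "eventually (\<lambda>k. Q k \<subseteq> ball 0 d) sequentially"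
      by eventually_elim (auto simp: Q_def)
  qed
  define m where "m = tv_norm a"
  have "0 \<le> L1_norm (b 0)" by (simp add: L1_norm_def)
  then have m: "0 \<le> m" unfolding m_def using bL(3)[of 0] by linarith
  have LL: "L1_Linf (b k)" for k
  proof -
    have "Linf_norm (b k) \<le> ereal (tv_norm a / measure lborel (Q k))" using bL(1,4) by (intro Linf_norm_le) auto
    then show ?thesis using bL(2) by (auto simp: L1_Linf_def order_le_less_trans)
  qed
  have ks: "kruzhkov_solution (b k) (\<lambda>t. S t (b k))" for k using assms(1) LL by (simp add: kruzhkov_semigroup_def)
  then have es: "entropy_solution (\<lambda>t. S t (b k))" and int: "0 < t \<Longrightarrow> integrable lborel (S t (b k))" for k t
    by (auto simp: kruzhkov_solution_def)
  \<comment> \<open>The dispersive bound with the total variation of \<open>a\<close> in place of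
    the mass of the data, which it dominates; hence one bound for all \<open>k\<close>.\<close>
  define B where "B t = c_inf * t powr (- 1 / 2) * m powr (1 / 4)" for t
  have Bm[measurable]: "B \<in> borel_measurable borel" unfolding B_def[abs_def] by measurable
  have c: "0 \<le> c_inf" by (rule dispersive_constant_nonneg[OF assms(1,2)])
  have B0: "0 \<le> B t" for t using c by (simp add: B_def)
  have Bmono: "B t \<le> B \<tau>" if "0 < \<tau>" "\<tau> < t" for \<tau> t
    unfolding B_def using that c by (intro mult_right_mono mult_left_mono powr_mono2') auto
  have bound: "AE x in lborel. \<bar>S t (b k) x\<bar> \<le> B t" if t: "0 < t" for k t
  proof (rule Linf_norm_AE)
    have "Linf_norm (S t (b k)) \<le> ereal (c_inf * t powr (- 1 / 2) * L1_norm (b k) powr (1 / 4))"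
      using assms(2) LL t unfolding dispersive_constant_def by blast
    also have "\<dots> \<le> ereal (B t)"
      unfolding ereal_less_eq(3) B_def using c bL(3) by (intro mult_left_mono powr_mono2) (auto simp: m_def L1_norm_def)
    finally show "Linf_norm (S t (b k)) \<le> ereal (B t)" .
  qed
  \<comment> \<open>The bound decreases in time, so its value at \<tau> serves all later times; this
    is why uniform boundedness is available away from time 0 only.\<close>
  have bd: "\<exists>M. \<forall>k. AE z in lborel. \<tau> < fst z \<longrightarrow> \<bar>S (fst z) (b k) (snd z)\<bar> \<le> M" if \<tau>: "0 < \<tau>" for \<tau>
  proof (intro exI[of _ "B \<tau>"] allI)
    fix k
    have "AE z in lborel. 0 < fst z \<longrightarrow> \<bar>S (fst z) (b k) (snd z)\<bar> \<le> B (fst z)"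
      by (rule entropy_solution_AE_bound[OF es Bm]) (rule bound)
    then show "AE z in lborel. \<tau> < fst z \<longrightarrow> \<bar>S (fst z) (b k) (snd z)\<bar> \<le> B \<tau>"
      by eventually_elim (use \<tau> Bmono[OF \<tau>] in \<open>fastforce intro: order_trans\<close>)
  qed
  have mod: "\<exists>h0>0. \<forall>k r. 0 \<le> r \<longrightarrow> r \<le> h0 \<longrightarrow> L1_norm (\<lambda>x. b k (x + (- r) *\<^sub>R \<xi>) - b k x) \<le> e" if e: "0 < e" for e
  proof -
    obtain d where d: "0 < d" "\<And>h. h \<noteq> 0 \<Longrightarrow> \<bar>h\<bar> < d \<Longrightarrow> \<bar>tv_norm (\<lambda>E. translate (h *\<^sub>R \<xi>) a E - a E)\<bar> < e"
      using assms(5) e unfolding LIM_eq by auto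
    have "L1_norm (\<lambda>x. b k (x + (- r) *\<^sub>R \<xi>) - b k x) \<le> e" if r: "0 \<le> r" "r \<le> d / 2" for k r
    \<comment> \<open>The limit in the hypothesis excludes the increment 0, for which the difference
      vanishes.\<close>
    proof (cases "r = 0")
      case False
      have "L1_norm (\<lambda>x. b k (x + (- r) *\<^sub>R \<xi>) - b k x) \<le> tv_norm (\<lambda>E. translate ((- r) *\<^sub>R \<xi>) a E - a E)"
        unfolding b_def by (rule set_average_shift_L1[OF assms(4) Q])
      also have "\<dots> \<le> e" using d(2)[of "- r"] False r d(1) by simp
      finally show ?thesis .
    qed (use e in \<open>simp add: L1_norm_def\<close>)
    then show ?thesis using d(1) by (intro exI[of _ "d / 2"]) auto
  qed
  obtain s :: "nat \<Rightarrow> nat" where s: "strict_mono s" "AE z in lborel. 0 < fst z \<longrightarrow> convergent (\<lambda>k. S (fst z) (b (s k)) (snd z))"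
    by (rule kruzhkov_compactness[OF assms(3) ks bL(1) bd mod]) (auto intro: that)
  have L1: "L1_norm (S t (b (s k))) \<le> m" if "0 < t" for k t
    using kruzhkov_L1_bound[OF ks bL(1), of t "s k"] bL(3)[of "s k"] that by (simp add: m_def)
  obtain u where u: "(\<lambda>z. u (fst z) (snd z)) \<in> borel_measurable borel"
    "AE z in lborel. 0 < fst z \<longrightarrow> (\<lambda>k. S (fst z) (b (s k)) (snd z)) \<longlonglongrightarrow> u (fst z) (snd z)"
    "\<And>t. 0 < t \<Longrightarrow> integrable lborel (u t)" "\<And>t. 0 < t \<Longrightarrow> L1_norm (u t) \<le> m"
    "\<And>t. 0 < t \<Longrightarrow> AE x in lborel. \<bar>u t x\<bar> \<le> B t"
    by (rule limit_representative[of "\<lambda>k t. S t (b (s k))" B m]) (use es Bm int L1 bound s(2) m B0 that in auto)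
  have bds: "\<exists>M. \<forall>k. AE z in lborel. \<tau> < fst z \<longrightarrow> \<bar>S (fst z) (b (s k)) (snd z)\<bar> \<le> M" if "0 < \<tau>" for \<tau>
    using bd[OF that] by blast
  show ?thesis
  proof (intro exI[of _ "\<lambda>k. b (s k)"] exI[of _ u] conjI allI impI)
    show "L1_Linf (b (s k))" for k by (rule LL)
    show "vague_limit (\<lambda>k. b (s k)) a" by (rule vague_limit_subseq[OF vague s(1)])
    show "entropy_solution u"
      by (rule entropy_solution_limit[of "\<lambda>k t. S t (b (s k))"]) (use es bds u(1,2) in auto)
    fix K :: "(real \<times> (real ^ 2)) set" assume K: "compact K" "K \<subseteq> half_space"
    obtain \<tau> where \<tau>: "0 < \<tau>" "\<And>z. z \<in> K \<Longrightarrow> \<tau> < fst z" using compact_half_space_time[OF K] by blast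
    obtain M where M: "\<And>k. AE z in lborel. \<tau> < fst z \<longrightarrow> \<bar>S (fst z) (b (s k)) (snd z)\<bar> \<le> M" using bds[OF \<tau>(1)] by blast
    have "AE z in lborel. z \<in> K \<longrightarrow> (\<lambda>k. S (fst z) (b (s k)) (snd z)) \<longlonglongrightarrow> u (fst z) (snd z)"
      using u(2) by eventually_elim (use \<tau> in \<open>fastforce intro: order_less_trans\<close>)
    moreover have "AE z in lborel. z \<in> K \<longrightarrow> \<bar>S (fst z) (b (s k)) (snd z)\<bar> \<le> M" for k
      using M[of k] by eventually_elim (use \<tau>(2) in auto)
    ultimately show "boundedly_ae_on K (\<lambda>k t. S t (b (s k))) u"
      unfolding boundedly_ae_on_def by (auto simp: split_beta)
  next
    fix t :: real assume t: "0 < t"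
    show "integrable lborel (u t)" by (rule u(3)[OF t])
    then show "Linf_norm (u t) \<le> ereal (c_inf * t powr (- 1 / 2) * tv_norm a powr (1 / 4))"
      using Linf_norm_le[OF _ u(5)[OF t]] by (auto simp: B_def m_def)
    show "L1_norm (u t) \<le> tv_norm a" using u(4)[OF t] by (simp add: m_def)
  qed
qed

end
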